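(* Let $M$ be a manifold. There is an $L_\infty[1]$-algebra structure on $\mathfrak{L}:=\Omega^{\bullet\ge1}(M)[3]\oplus\chi^\bullet(M)[2]$ whose only non-vanishing multibrackets (up to permutation of the entries) are: a) minus the de Rham differential on differential forms; b) $\{\pi_1,\pi_2\}=(-1)^{a_1+1}[\pi_1,\pi_2]$, where $\pi_i\in\chi^{a_i}(M)$; c) $\{H,\pi_1,\dots,\pi_n\}=(-1)^{\sum_{i=1}^na_i(n-i)}(\pi_1^\sharp\wedge\dots\wedge\pi_n^\sharp)H$ for all $n\ge1$, where $H\in\Omega^n(M)$ and $\pi_1\in\chi^{a_1}(M),\dots,\pi_n\in\chi^{a_n}(M)$ with all $a_i\ge1$. Its Maurer-Cartan elements are exactly the pairs $(H[3],\pi[2])$ where $H\in\Omega^3(M)$ and $\pi\in\chi^2(M)$ are such that $dH=0$ and $\pi$ is an $H$-twisted Poisson structure.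
   Context: An $L_\infty[1]$-algebra is a $\mathbb{Z}$-graded vector space $W$ with graded symmetric degree $1$ multilinear maps $m_k=\{\cdots\}$, $k\ge1$, satisfying $\sum_{i+j=n+1,\,i,j\ge1}\sum_{\sigma\in S_{(i,n-i)}}\epsilon(\sigma)m_j(m_i(v_{\sigma(1)},\dots,v_{\sigma(i)}),v_{\sigma(i+1)},\dots,v_{\sigma(n)})=0$ for all $n\ge1$ ($\epsilon$ Koszul sign, $S_{(i,n-i)}$ unshuffles). A Maurer-Cartan element is a degree $0$ element $\alpha$ with $\sum_{n\ge1}\frac1{n!}\{\alpha,\dots,\alpha\}=0$. $V[n]_i=V_{i+n}$, so the degree $i$ component of $\mathfrak{L}$ is $\Omega^{i+3}(M)\oplus\chi^{i+2}(M)$ (with only forms of degree $\ge1$). $\chi^a(M)$ denotes $a$-vector fields, $[\cdot,\cdot]$ the Schouten bracket ($[X,\cdot]=\mathcal{L}_X$ for a vector field $X$). For $\pi\in\wedge^aTM$ with $a\ge1$, $\pi^\sharp:T^*M\to\wedge^{a-1}TM$, $\xi\mapsto\iota_\xi\pi$ (and $\pi^\sharp=0$ if $a=0$). For $\pi_i\in\wedge^{a_i}TM$, $a_i\ge1$, $$\pi_1^\sharp\wedge\dots\wedge\pi_n^\sharp:\wedge^nT^*M\to\wedge^{a_1+\dots+a_n-n}TM,\quad \xi_1\wedge\dots\wedge\xi_n\mapsto\sum_{\sigma\in S_n}(-1)^\sigma\pi_1^\sharp(\xi_{\sigma(1)})\wedge\dots\wedge\pi_n^\sharp(\xi_{\sigma(n)}).$$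 For a closed 3-form $H$, a bivector field $\pi$ is an $H$-twisted Poisson structure if $[\pi,\pi]=2\wedge^3\tilde\pi(H)$, where $\wedge^3\tilde\pi:=\frac16(\pi^\sharp\wedge\pi^\sharp\wedge\pi^\sharp)$. *)

theory Defs
  imports
    "HOL-Analysis.Analysis"
    "HOL-Library.Function_Algebras"
    "HOL-Library.Multiset"
    "HOL-Combinatorics.Permutations"
begin

section \<open>Preliminaries\<close>

instantiation "fun" :: (type, real_vector) real_vector
begin

definition scaleR_fun :: "real \<Rightarrow> ('a \<Rightarrow> 'b) \<Rightarrow> 'a \<Rightarrow> 'b"
  where "scaleR_fun c f = (\<lambda>x. c *\<^sub>R f x)"

instance
  by standard (auto simp: scaleR_fun_def scaleR_add_right scaleR_add_left)

end

definition lin_on :: "'v::real_vector set \<Rightarrow> ('v \<Rightarrow> 'w::real_vector) \<Rightarrow> bool" where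
  "lin_on V f \<longleftrightarrow>
     (\<forall>x\<in>V. \<forall>y\<in>V. f (x + y) = f x + f y) \<and> (\<forall>c. \<forall>x\<in>V. f (c *\<^sub>R x) = c *\<^sub>R f x)"

text \<open>Maps of several arguments are functions on lists.\<close>

definition multilin_on :: "'v::real_vector set \<Rightarrow> ('v list \<Rightarrow> 'w::real_vector) \<Rightarrow> bool" where
  "multilin_on V F \<longleftrightarrow>
     (\<forall>xs ys. set xs \<subseteq> V \<and> set ys \<subseteq> V \<longrightarrow> lin_on V (\<lambda>x. F (xs @ x # ys)))"

definition unshuffles :: "nat \<Rightarrow> nat \<Rightarrow> (nat \<Rightarrow> nat) set" where
  "unshuffles i n =
     {\<sigma>. \<sigma> permutes {..<n} \<and> strict_mono_on {..<i} \<sigma> \<and> strict_mono_on {i..<n} \<sigma>}"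

section \<open>\<open>L\<^sub>\<infinity>[1]\<close>-algebras\<close>

text \<open>A graded vector space is given by its homogeneous components, which are independent
  subspaces of an ambient real vector space; the whole space is their (direct) sum.\<close>

definition graded_space :: "(int \<Rightarrow> 'v::real_vector set) \<Rightarrow> bool" where
  "graded_space W \<longleftrightarrow>
     (\<forall>i. subspace (W i)) \<and>
     (\<forall>I w. finite I \<and> (\<forall>i\<in>I. w i \<in> W i) \<and> (\<Sum>i\<in>I. w i) = 0 \<longrightarrow> (\<forall>i\<in>I. w i = 0))"

definition total_space :: "(int \<Rightarrow> 'v::real_vector set) \<Rightarrow> 'v set" where
  "total_space W = span (\<Union>i. W i)"

text \<open>The Koszul sign of
  \<open>v\<^sub>0 \<dots> v\<^bsub>n-1\<^esub> = \<epsilon>(\<sigma>) v\<^bsub>\<sigma> 0\<^esub> \<dots> v\<^bsub>\<sigma> (n-1)\<^esub>\<close>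
  in the graded symmetric algebra, where \<open>v\<^sub>i\<close> has degree \<open>d i\<close>.\<close>

definition koszul_sign :: "(nat \<Rightarrow> int) \<Rightarrow> (nat \<Rightarrow> nat) \<Rightarrow> nat \<Rightarrow> real" where
  "koszul_sign d \<sigma> n =
     (\<Prod>(i, j) \<in> {(i, j). i < j \<and> j < n \<and> \<sigma> j < \<sigma> i}. (-1) powi (d (\<sigma> i) * d (\<sigma> j)))"

text \<open>The \<open>k\<close>-th multibracket \<open>m\<^sub>k\<close> is the restriction of \<open>m\<close> to lists of length \<open>k \<ge> 1\<close>;
  the value of \<open>m\<close> on the empty list is irrelevant.\<close>

definition Linf1_algebra ::
    "(int \<Rightarrow> 'v::real_vector set) \<Rightarrow> ('v list \<Rightarrow> 'v) \<Rightarrow> bool" where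
  "Linf1_algebra W m \<longleftrightarrow>
     graded_space W \<and>
     multilin_on (total_space W) m \<and>
     (\<forall>n\<ge>1. \<forall>d v. (\<forall>i<n. v i \<in> W (d i)) \<longrightarrow>
        m (map v [0..<n]) \<in> W ((\<Sum>i<n. d i) + 1) \<and>
        (\<forall>\<sigma>. \<sigma> permutes {..<n} \<longrightarrow>
           m (map v [0..<n]) = koszul_sign d \<sigma> n *\<^sub>R m (map (\<lambda>i. v (\<sigma> i)) [0..<n])) \<and>
        (\<Sum>i=1..n. \<Sum>\<sigma>\<in>unshuffles i n.
           koszul_sign d \<sigma> n *\<^sub>R
             m (m (map (\<lambda>k. v (\<sigma> k)) [0..<i]) # map (\<lambda>k. v (\<sigma> k)) [i..<n])) = 0)"

text \<open>The Maurer-Cartan series is required to have only finitely many nonzero terms.\<close>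

definition maurer_cartan ::
    "(int \<Rightarrow> 'v::real_vector set) \<Rightarrow> ('v list \<Rightarrow> 'v) \<Rightarrow> 'v \<Rightarrow> bool" where
  "maurer_cartan W m \<alpha> \<longleftrightarrow>
     \<alpha> \<in> W 0 \<and>
     finite {n. 1 \<le> n \<and> m (replicate n \<alpha>) \<noteq> 0} \<and>
     (\<Sum>n \<in> {n. 1 \<le> n \<and> m (replicate n \<alpha>) \<noteq> 0}. (1 / fact n) *\<^sub>R m (replicate n \<alpha>)) = 0"

section \<open>Smooth manifolds\<close>

text \<open>The model space \<open>\<real>\<^sup>n\<close> is \<^const>\<open>Euclidean_space\<close> \<open>n\<close>, i.e. the sequences supported
  on \<open>{..<n}\<close>, so that \<open>n = 0\<close> is allowed.\<close>

definition pderiv_at :: "nat \<Rightarrow> ((nat \<Rightarrow> real) \<Rightarrow> real) \<Rightarrow> (nat \<Rightarrow> real) \<Rightarrow> real" where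
  "pderiv_at i f x = deriv (\<lambda>t. f (x(i := t))) (x i)"

primrec Ck_on :: "nat \<Rightarrow> nat \<Rightarrow> (nat \<Rightarrow> real) set \<Rightarrow> ((nat \<Rightarrow> real) \<Rightarrow> real) \<Rightarrow> bool" where
  "Ck_on 0 n V f \<longleftrightarrow> continuous_map (subtopology (Euclidean_space n) V) euclideanreal f"
| "Ck_on (Suc k) n V f \<longleftrightarrow>
     continuous_map (subtopology (Euclidean_space n) V) euclideanreal f \<and>
     (\<forall>i<n. (\<forall>x\<in>V. (\<lambda>t. f (x(i := t))) field_differentiable (at (x i))) \<and>
             Ck_on k n V (pderiv_at i f))"

definition smooth_on :: "nat \<Rightarrow> (nat \<Rightarrow> real) set \<Rightarrow> ((nat \<Rightarrow> real) \<Rightarrow> real) \<Rightarrow> bool" where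
  "smooth_on n V f \<longleftrightarrow> (\<forall>k. Ck_on k n V f)"

record 'a mfd =
  mtop :: "'a topology"
  mdim :: nat
  matlas :: "('a set \<times> ('a \<Rightarrow> nat \<Rightarrow> real)) set"

abbreviation pts :: "'a mfd \<Rightarrow> 'a set" where
  "pts M \<equiv> topspace (mtop M)"

definition smooth_manifold :: "'a mfd \<Rightarrow> bool" where
  "smooth_manifold M \<longleftrightarrow>
     Hausdorff_space (mtop M) \<and> second_countable (mtop M) \<and>
     (\<Union>(U, \<phi>) \<in> matlas M. U) = pts M \<and>
     (\<forall>(U, \<phi>) \<in> matlas M.
        openin (mtop M) U \<and> openin (Euclidean_space (mdim M)) (\<phi> ` U) \<and>
        homeomorphic_map (subtopology (mtop M) U)
          (subtopology (Euclidean_space (mdim M)) (\<phi> ` U)) \<phi>) \<and>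
     (\<forall>(U, \<phi>) \<in> matlas M. \<forall>(W, \<psi>) \<in> matlas M. \<forall>i < mdim M.
        smooth_on (mdim M) (\<phi> ` (U \<inter> W)) (\<lambda>x. \<psi> (inv_into U \<phi> x) i))"

text \<open>Functions, forms and multivector fields on \<open>M\<close> are set to \<open>0\<close> outside their domain; this
  makes them subsets of function spaces.\<close>

definition smooth_functions :: "'a mfd \<Rightarrow> ('a \<Rightarrow> real) set" where
  "smooth_functions M =
     {f. (\<forall>(U, \<phi>) \<in> matlas M. smooth_on (mdim M) (\<phi> ` U) (\<lambda>x. f (inv_into U \<phi> x))) \<and>
         (\<forall>p. p \<notin> pts M \<longrightarrow> f p = 0)}"

section \<open>Tangent and cotangent spaces\<close>

type_synonym 'a tan = "('a \<Rightarrow> real) \<Rightarrow> real"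
type_synonym 'a cotan = "'a tan \<Rightarrow> real"

text \<open>Tangent vectors at \<open>p\<close> are the derivations at \<open>p\<close> of the algebra of smooth functions.\<close>

definition tangent :: "'a mfd \<Rightarrow> 'a \<Rightarrow> 'a tan set" where
  "tangent M p =
     {v. lin_on (smooth_functions M) v \<and>
         (\<forall>f \<in> smooth_functions M. \<forall>g \<in> smooth_functions M.
            v (\<lambda>q. f q * g q) = v f * g p + f p * v g) \<and>
         (\<forall>f. f \<notin> smooth_functions M \<longrightarrow> v f = 0)}"

definition cotangent :: "'a mfd \<Rightarrow> 'a \<Rightarrow> 'a cotan set" where
  "cotangent M p = {\<xi>. lin_on (tangent M p) \<xi> \<and> (\<forall>v. v \<notin> tangent M p \<longrightarrow> \<xi> v = 0)}"

definition diff_at :: "'a mfd \<Rightarrow> 'a \<Rightarrow> ('a \<Rightarrow> real) \<Rightarrow> 'a cotan" where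
  "diff_at M p f = (\<lambda>v. if v \<in> tangent M p then v f else 0)"

section \<open>Exterior powers\<close>

text \<open>\<open>alt_maps V k\<close> consists of the alternating \<open>k\<close>-linear forms on \<open>V\<close>, extended by zero to
  lists of other lengths.  It is \<open>\<And>\<^sup>k V\<^sup>*\<close>, with
  \<open>(\<xi>\<^sub>1 \<and> \<dots> \<and> \<xi>\<^sub>k)(v\<^sub>1, \<dots>, v\<^sub>k) = det (\<xi>\<^sub>i v\<^sub>j)\<close>.  Taking for \<open>V\<close> the cotangent space, whose dual
  is the (finite-dimensional) tangent space, it is \<open>\<And>\<^sup>k T\<^sub>pM\<close>, with
  \<open>(v\<^sub>1 \<and> \<dots> \<and> v\<^sub>k)(\<xi>\<^sub>1, \<dots>, \<xi>\<^sub>k) = det (\<xi>\<^sub>i v\<^sub>j)\<close>.\<close>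

definition alt_maps :: "'v::real_vector set \<Rightarrow> nat \<Rightarrow> ('v list \<Rightarrow> real) set" where
  "alt_maps V k =
     {A. multilin_on V A \<and>
         (\<forall>xs. set xs \<subseteq> V \<and> \<not> distinct xs \<longrightarrow> A xs = 0) \<and>
         (\<forall>xs. \<not> (set xs \<subseteq> V \<and> length xs = k) \<longrightarrow> A xs = 0)}"

text \<open>Since homogeneous elements vanish on lists of the wrong length, at most one value of \<open>r\<close>
  contributes to the product of homogeneous elements.\<close>

definition wedge :: "('v list \<Rightarrow> real) \<Rightarrow> ('v list \<Rightarrow> real) \<Rightarrow> 'v list \<Rightarrow> real" where
  "wedge A B xs =
     (\<Sum>r\<le>length xs. \<Sum>\<sigma>\<in>unshuffles r (length xs).
        of_int (sign \<sigma>) * A (map (\<lambda>i. xs ! \<sigma> i) [0..<r])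
          * B (map (\<lambda>i. xs ! \<sigma> i) [r..<length xs]))"

definition wedge_list :: "('v list \<Rightarrow> real) list \<Rightarrow> 'v list \<Rightarrow> real" where
  "wedge_list As = foldr wedge As (\<lambda>xs. if xs = [] then 1 else 0)"

definition alt1 :: "('v \<Rightarrow> real) \<Rightarrow> 'v list \<Rightarrow> real" where
  "alt1 \<xi> xs = (case xs of [x] \<Rightarrow> \<xi> x | _ \<Rightarrow> 0)"

section \<open>Vector fields, differential forms, multivector fields\<close>

definition vector_fields :: "'a mfd \<Rightarrow> ('a \<Rightarrow> 'a tan) set" where
  "vector_fields M =
     {X. (\<forall>p \<in> pts M. X p \<in> tangent M p) \<and> (\<forall>p. p \<notin> pts M \<longrightarrow> X p = 0) \<and>
         (\<forall>f \<in> smooth_functions M. (\<lambda>p. X p f) \<in> smooth_functions M)}"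

definition lie_bracket :: "('a \<Rightarrow> 'a tan) \<Rightarrow> ('a \<Rightarrow> 'a tan) \<Rightarrow> 'a \<Rightarrow> 'a tan" where
  "lie_bracket X Y = (\<lambda>p f. X p (\<lambda>q. Y q f) - Y p (\<lambda>q. X q f))"

type_synonym 'a form = "'a \<Rightarrow> 'a tan list \<Rightarrow> real"
type_synonym 'a mvf = "'a \<Rightarrow> 'a cotan list \<Rightarrow> real"

text \<open>Sections of \<open>\<And>\<^sup>k T\<^sup>*M\<close> and \<open>\<And>\<^sup>a TM\<close>; smoothness is tested on smooth vector fields and on
  differentials of smooth functions, respectively.\<close>

definition forms :: "'a mfd \<Rightarrow> nat \<Rightarrow> 'a form set" where
  "forms M k =
     {\<omega>. (\<forall>p \<in> pts M. \<omega> p \<in> alt_maps (tangent M p) k) \<and> (\<forall>p. p \<notin> pts M \<longrightarrow> \<omega> p = 0) \<and>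
         (\<forall>Xs. length Xs = k \<and> set Xs \<subseteq> vector_fields M \<longrightarrow>
            (\<lambda>p. \<omega> p (map (\<lambda>X. X p) Xs)) \<in> smooth_functions M)}"

definition multivector_fields :: "'a mfd \<Rightarrow> nat \<Rightarrow> 'a mvf set" where
  "multivector_fields M a =
     {P. (\<forall>p \<in> pts M. P p \<in> alt_maps (cotangent M p) a) \<and> (\<forall>p. p \<notin> pts M \<longrightarrow> P p = 0) \<and>
         (\<forall>fs. length fs = a \<and> set fs \<subseteq> smooth_functions M \<longrightarrow>
            (\<lambda>p. P p (map (diff_at M p) fs)) \<in> smooth_functions M)}"

text \<open>The de Rham differential of a \<open>k\<close>-form, given by the invariant formula
  \<open>d\<omega>(X\<^sub>0, \<dots>, X\<^sub>k) = \<Sum>\<^sub>i (-1)\<^sup>i X\<^sub>i(\<omega>(\<dots> omit i \<dots>))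
    + \<Sum>\<^bsub>i<j\<^esub> (-1)\<^bsup>i+j\<^esup> \<omega>([X\<^sub>i, X\<^sub>j], \<dots> omit i, j \<dots>)\<close>.\<close>

definition ext_deriv :: "'a mfd \<Rightarrow> nat \<Rightarrow> 'a form \<Rightarrow> 'a form" where
  "ext_deriv M k \<omega> = (THE \<eta>. \<eta> \<in> forms M (Suc k) \<and>
     (\<forall>Xs. length Xs = Suc k \<and> set Xs \<subseteq> vector_fields M \<longrightarrow> (\<forall>p \<in> pts M.
        \<eta> p (map (\<lambda>X. X p) Xs) =
          (\<Sum>i\<le>k. (-1) ^ i * (Xs ! i) p (\<lambda>q. \<omega> q (map (\<lambda>X. X q) (nths Xs (- {i}))))) +
          (\<Sum>(i, j) \<in> {(i, j). i < j \<and> j \<le> k}.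
             (-1) ^ (i + j) *
               \<omega> p (lie_bracket (Xs ! i) (Xs ! j) p # map (\<lambda>X. X p) (nths Xs (- {i, j})))))))"

text \<open>For \<open>P \<in> \<chi>\<^sup>a(M)\<close>, \<open>Q \<in> \<chi>\<^sup>b(M)\<close>, the value of
  \<open>\<Sum>\<^bsub>\<sigma> \<in> S(b, a-1)\<^esub> (-1)\<^sup>\<sigma> P(Q(f\<^bsub>\<sigma> 1\<^esub>, \<dots>, f\<^bsub>\<sigma> b\<^esub>), f\<^bsub>\<sigma> (b+1)\<^esub>, \<dots>, f\<^bsub>\<sigma> (a+b-1)\<^esub>)\<close> at \<open>p\<close>, where
  multivector fields act on functions through differentials.  It vanishes for \<open>a = 0\<close> since then
  \<open>P\<close> vanishes on nonempty lists.\<close>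

definition mvf_comp ::
    "'a mfd \<Rightarrow> nat \<Rightarrow> nat \<Rightarrow> 'a mvf \<Rightarrow> 'a mvf \<Rightarrow> ('a \<Rightarrow> real) list \<Rightarrow> 'a \<Rightarrow> real" where
  "mvf_comp M a b P Q fs p =
     (\<Sum>\<sigma>\<in>unshuffles b (a + b - 1). of_int (sign \<sigma>) *
        P p (diff_at M p (\<lambda>q. Q q (map (\<lambda>i. diff_at M q (fs ! \<sigma> i)) [0..<b]))
              # map (\<lambda>i. diff_at M p (fs ! \<sigma> i)) [b..<a + b - 1]))"

text \<open>The Schouten bracket \<open>[P, Q] = (-1)\<^bsup>(a-1)(b-1)\<^esup> P \<circ> Q - Q \<circ> P\<close> of \<open>P \<in> \<chi>\<^sup>a(M)\<close> and
  \<open>Q \<in> \<chi>\<^sup>b(M)\<close>, evaluated on functions.  The signs are those of the bracket with \<open>[X, \<cdot>] = L\<^sub>X\<close>,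
  \<open>[P, Q] = - (-1)\<^bsup>(a-1)(b-1)\<^esup> [Q, P]\<close> and
  \<open>[P, Q \<and> R] = [P, Q] \<and> R + (-1)\<^bsup>(a-1)b\<^esup> Q \<and> [P, R]\<close>.  For \<open>a = b = 0\<close> the truncated degree
  \<open>a + b - 1\<close> is \<open>0\<close> and the bracket is the zero function.\<close>

definition schouten :: "'a mfd \<Rightarrow> nat \<Rightarrow> nat \<Rightarrow> 'a mvf \<Rightarrow> 'a mvf \<Rightarrow> 'a mvf" where
  "schouten M a b P Q = (THE R. R \<in> multivector_fields M (a + b - 1) \<and>
     (\<forall>fs. length fs = a + b - 1 \<and> set fs \<subseteq> smooth_functions M \<longrightarrow> (\<forall>p \<in> pts M.
        R p (map (diff_at M p) fs) =
          (-1) ^ ((a + 1) * (b + 1)) * mvf_comp M a b P Q fs p - mvf_comp M b a Q P fs p)))"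

text \<open>The contraction \<open>\<xi> \<mapsto> \<iota>\<^sub>\<xi> \<pi>\<close>, inserting \<open>\<xi>\<close> into the first slot; it is zero in degree
  \<open>a = 0\<close>.\<close>

definition sharp :: "('a cotan list \<Rightarrow> real) \<Rightarrow> 'a cotan \<Rightarrow> 'a cotan list \<Rightarrow> real" where
  "sharp P \<xi> = (\<lambda>\<eta>s. P (\<xi> # \<eta>s))"

text \<open>\<open>sharp_wedge M [\<pi>\<^sub>1, \<dots>, \<pi>\<^sub>n] H\<close> is \<open>(\<pi>\<^sub>1\<^sup>\<sharp> \<and> \<dots> \<and> \<pi>\<^sub>n\<^sup>\<sharp>) H\<close>: at each point, the linear map on
  \<open>\<And>\<^sup>n T\<^sub>p\<^sup>*M\<close> with the prescribed values on decomposable elements, applied to \<open>H\<^sub>p\<close>.\<close>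

definition sharp_wedge :: "'a mfd \<Rightarrow> 'a mvf list \<Rightarrow> 'a form \<Rightarrow> 'a mvf" where
  "sharp_wedge M Ps H = (\<lambda>p. if p \<in> pts M then
     (THE \<Phi>.
        lin_on (alt_maps (tangent M p) (length Ps)) \<Phi> \<and>
        (\<forall>A. A \<notin> alt_maps (tangent M p) (length Ps) \<longrightarrow> \<Phi> A = 0) \<and>
        (\<forall>\<xi>s. length \<xi>s = length Ps \<and> set \<xi>s \<subseteq> cotangent M p \<longrightarrow>
           \<Phi> (wedge_list (map alt1 \<xi>s)) =
             (\<Sum>\<sigma> | \<sigma> permutes {..<length Ps}. of_int (sign \<sigma>) *\<^sub>R
                wedge_list (map (\<lambda>i. sharp ((Ps ! i) p) (\<xi>s ! \<sigma> i)) [0..<length Ps])))) (H p)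
     else 0)"

definition wedge3_tilde :: "'a mfd \<Rightarrow> 'a mvf \<Rightarrow> 'a form \<Rightarrow> 'a mvf" where
  "wedge3_tilde M \<pi> H = (1/6) *\<^sub>R sharp_wedge M [\<pi>, \<pi>, \<pi>] H"

definition twisted_poisson :: "'a mfd \<Rightarrow> 'a form \<Rightarrow> 'a mvf \<Rightarrow> bool" where
  "twisted_poisson M H \<pi> \<longleftrightarrow>
     \<pi> \<in> multivector_fields M 2 \<and> schouten M 2 2 \<pi> \<pi> = 2 *\<^sub>R wedge3_tilde M \<pi> H"

section \<open>The graded vector space \<open>\<Omega>\<^bsup>\<bullet>\<ge>1\<^esup>(M)[3] \<oplus> \<chi>\<^sup>\<bullet>(M)[2]\<close>\<close>

definition Lspace :: "'a mfd \<Rightarrow> int \<Rightarrow> ('a form \<times> 'a mvf) set" where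
  "Lspace M i =
     (if i + 3 \<ge> 1 then forms M (nat (i + 3)) else {0}) \<times>
     (if i + 2 \<ge> 0 then multivector_fields M (nat (i + 2)) else {0})"

text \<open>Lists of forms and multivector fields of the shapes occurring in the three families of
  multibrackets.\<close>

definition bracket_input :: "'a mfd \<Rightarrow> ('a form \<times> 'a mvf) list \<Rightarrow> bool" where
  "bracket_input M zs \<longleftrightarrow>
     (\<exists>k\<ge>1. \<exists>\<omega> \<in> forms M k. zs = [(\<omega>, 0)]) \<or>
     (\<exists>a b. \<exists>P \<in> multivector_fields M a. \<exists>Q \<in> multivector_fields M b. zs = [(0, P), (0, Q)]) \<or>
     (\<exists>n\<ge>1. \<exists>H \<in> forms M n. \<exists>a P.
        (\<forall>i<n. 1 \<le> a i \<and> P i \<in> multivector_fields M (a i)) \<and>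
        zs = (H, 0) # map (\<lambda>i. (0, P i)) [0..<n])"

definition pure :: "'a mfd \<Rightarrow> 'a form \<times> 'a mvf \<Rightarrow> bool" where
  "pure M z \<longleftrightarrow>
     (\<exists>k\<ge>1. \<exists>\<omega> \<in> forms M k. z = (\<omega>, 0)) \<or> (\<exists>a. \<exists>P \<in> multivector_fields M a. z = (0, P))"

end

theory Submission
  imports Defs "Jordan_Normal_Form.Determinant"
begin

text \<open>Work with forms and multivector fields of mixed degree. Writing \<open>\<delta>\<^sub>f\<close> for the insertion of \<open>df\<close> into
  the first slot, a multivector field is determined by its degree zero part and by all its images
  under \<open>\<delta>\<^sub>f\<close>, and both the Schouten bracket and the contraction of a form with multivector fields
  are, up to signs, derivations for \<open>\<delta>\<^sub>f\<close>. Hence the Jacobiator satisfies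
  \<open>\<delta>\<^sub>f Jac(\<dots>, z, \<dots>) = \<Sum> \<plusminus> Jac(\<dots>, \<delta>\<^sub>f z, \<dots>)\<close>, and by induction on the total degree it suffices that its
  degree zero part vanishes. There only two cases are not trivial for degree reasons: one form and
  vector fields, which is the invariant formula for the de Rham differential, and two forms, one
  bivector and vector fields, which is the antisymmetry of the bivector. The wedge product of the
  sharp maps is compared with the contraction on decomposable covectors, which span thanks to a local
  frame. In the Maurer-Cartan equation only the brackets with one, two and four entries contribute:
  it reads \<open>- dH = 0\<close> together with \<open>- [\<pi>, \<pi>] / 2 + \<and>\<^sup>3\<pi>(H) = 0\<close>.\<close>

subsection \<open>Calculus on open subsets of Euclidean space\<close>

text \<open>The obstacle that shapes the proof is that \<open>ext_deriv\<close>,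
  \<open>schouten\<close> and \<open>sharp_wedge\<close> are definite descriptions, so that each
  value must first be shown to exist. Since tangent vectors are derivations of the algebra of global
  functions, everything rests on a local frame made of global functions and global vector fields. It
  shows that every covector is the differential of a function and that every tangent vector extends
  to a vector field, so that a tensor may be built from its values on functions or on vector fields.
  Mixed degree keeps degrees out of the recursions: the sign (-1)^deg becomes the operator
  \<open>parity\<close>, and the rules for \<open>\<delta>\<^sub>f\<close> hold without side
  conditions. With the signs of b), the bracket of a function g with P is exactly the insertion of
  dg into P. The Jacobi identity with a function among the entries is therefore nothing but the
  derivation rule of the brackets, so that in output degree zero only forms and multivector fields
  of degree at least 1 remain to be considered.\<close>

abbreviation eucl :: "nat => (nat => real) set" where
 "eucl n \<equiv> {x. \<forall>i\<ge>n. x i = 0}"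

abbreviation eopen :: "nat => (nat => real) set => bool" where
 "eopen n V \<equiv> openin (Euclidean_space n) V"

lemma eopen_iff: "eopen n V \<longleftrightarrow> (\<exists>T. open T & V = eucl n \<inter> T)"
 unfolding Euclidean_space_def euclidean_product_topology openin_subtopology by (auto simp: Int_commute)

lemma eopen_subset: "eopen n V ==> V <= eucl n" by (auto simp: eopen_iff)

lemma continuous_map_eucl:
 assumes "V <= eucl n"
 shows "continuous_map (subtopology (Euclidean_space n) V) euclideanreal f \<longleftrightarrow> continuous_on V f"
by (simp add: Euclidean_space_def euclidean_product_topology subtopology_subtopology assms Int_absorb1)

text \<open>A basic open set of the product topology gives a radius for every coordinate, but from
  the n-th on all coordinates vanish on \<open>eucl n\<close>, so the minimum over i < n
  suffices.\<close>

lemma eopen_box: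
 assumes "eopen n V" "x \<in> V"
 shows "\<exists>\<delta>>0. \<forall>y\<in>eucl n. (\<forall>i<n. \<bar>y i - x i\<bar> < \<delta>) --> y \<in> V"
proof -
 obtain T where T: "open T" "V = eucl n \<inter> T" using assms(1) by (auto simp: eopen_iff)
 have "openin (product_topology (%i. euclidean) UNIV) T" unfolding euclidean_product_topology using T by simp
 then obtain X where X: "x \<in> (\<Pi>\<^sub>E i\<in>UNIV. X i)" "!!i. open (X i)" "finite {i. X i ~= UNIV}"
   "(\<Pi>\<^sub>E i\<in>UNIV. X i) <= T" using product_topology_open_contains_basis[of "%i. euclidean" UNIV T x] assms(2) T(2) by auto
 have "\<forall>i. \<exists>d>0. \<forall>y. \<bar>y - x i\<bar> < d --> y \<in> X i"
 proof
  fix i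
  have "x i \<in> X i" using X(1) by auto
  then show "\<exists>d>0. \<forall>y. \<bar>y - x i\<bar> < d --> y \<in> X i" using X(2)[of i] unfolding open_real by blast
 qed
 then obtain d where d: "!!i. d i > 0" "!!i y. \<bar>y - x i\<bar> < d i ==> y \<in> X i" by metis
 \<comment> \<open>The element 1 keeps the set non-empty when n = 0.\<close>
 define \<delta> where "\<delta> = Min (insert 1 (d ` {..<n}))"
 have "\<delta> > 0" unfolding \<delta>_def using d(1) by simp
 moreover have "y \<in> V" if y: "y \<in> eucl n" "\<forall>i<n. \<bar>y i - x i\<bar> < \<delta>" for y
 proof -
  have "y i \<in> X i" for i
  proof (cases "i < n")
   case True
   then have "\<delta> \<le> d i" unfolding \<delta>_def by simp
   then show ?thesis using d(2) y(2) True by auto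
  next
   case False
   then have "x i = 0" "y i = 0" using y(1) assms(2) T(2) by auto
   then show ?thesis using d by simp
  qed
  then show ?thesis using X(4) y(1) T(2) by auto
 qed
 ultimately show ?thesis by blast
qed

lemma eopen_boxI:
 assumes "V <= eucl n"
  and "!!x. x \<in> V ==> \<exists>\<delta>>0. \<forall>y\<in>eucl n. (\<forall>i<n. \<bar>y i - x i\<bar> < \<delta>) --> y \<in> V"
 shows "eopen n V"
proof (subst openin_subopen, intro ballI)
 fix x assume x: "x \<in> V"
 then obtain \<delta> where \<delta>: "\<delta> > 0" "\<forall>y\<in>eucl n. (\<forall>i<n. \<bar>y i - x i\<bar> < \<delta>) --> y \<in> V"
  using assms(2) by blast
 let ?T = "\<Inter>i<n. {y::nat=>real. \<bar>y i - x i\<bar> < \<delta>}"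
 have c: "continuous_on UNIV (%y::nat=>real. y i)" for i by simp
 have "open ?T" by (intro open_INT finite_lessThan ballI open_Collect_less continuous_intros c)
 then have "eopen n (eucl n \<inter> ?T)" by (auto simp: eopen_iff)
 moreover have "x \<in> eucl n \<inter> ?T" using x assms(1) \<delta>(1) by auto
 moreover have "eucl n \<inter> ?T <= V" using \<delta>(2) by auto
 ultimately show "\<exists>T. eopen n T & x \<in> T & T <= V" by blast
qed

lemma continuous_box:
 assumes V: "eopen n V" and f: "continuous_on V f" and x: "x \<in> V" and e: "(e::real) > 0"
 shows "\<exists>\<delta>>0. \<forall>y\<in>eucl n. (\<forall>i<n. \<bar>y i - x i\<bar> < \<delta>) --> y \<in> V & \<bar>f y - f x\<bar> < e"
proof -
 let ?W = "V \<inter> f -` {t. \<bar>t - f x\<bar> < e}"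
 have "open {t. \<bar>t - f x\<bar> < e}" by (intro open_Collect_less continuous_intros)
 then obtain T where T: "open T" "?W = V \<inter> T" using f unfolding continuous_on_open_invariant by (metis Int_commute)
 then have "eopen n ?W" using V by (auto simp: eopen_iff)
 from eopen_box[OF this, of x] x e show ?thesis by auto
qed

lemma eventually_upd:
 assumes "eopen n V" "x \<in> V" "i < n"
 shows "\<forall>\<^sub>F t in nhds (x i). x(i := t) \<in> V"
proof -
 obtain \<delta> where \<delta>: "\<delta> > 0" "\<forall>y\<in>eucl n. (\<forall>i<n. \<bar>y i - x i\<bar> < \<delta>) --> y \<in> V"
  using eopen_box[OF assms(1,2)] by blast
 have "x(i := t) \<in> V" if "dist t (x i) < \<delta>" for t
 proof -
  have "x(i := t) \<in> eucl n" using eopen_subset[OF assms(1)] assms by auto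
  moreover have "\<forall>j<n. \<bar>(x(i := t)) j - x j\<bar> < \<delta>" using that \<delta>(1) by (auto simp: dist_real_def)
  ultimately show ?thesis using \<delta>(2) by blast
 qed
 then show ?thesis using \<delta>(1) by (auto simp: eventually_nhds_metric)
qed

declare Ck_on.simps [simp del]

lemma Ck_on_0: "eopen n V ==> Ck_on 0 n V f \<longleftrightarrow> continuous_on V f" by (simp add: Ck_on.simps continuous_map_eucl eopen_subset)

lemma Ck_on_continuous: "eopen n V ==> Ck_on k n V f ==> continuous_on V f" by (cases k) (auto simp: Ck_on.simps continuous_map_eucl eopen_subset)

lemma Ck_on_SucD:
 assumes "eopen n V" "Ck_on (Suc k) n V f" "i < n"
 shows "!!x. x \<in> V ==> ((%t. f (x(i := t))) has_real_derivative pderiv_at i f x) (at (x i))"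
  and "Ck_on k n V (pderiv_at i f)" using assms by (auto simp: Ck_on.simps pderiv_at_def DERIV_deriv_iff_field_differentiable)

lemma pderiv_at_cong:
 assumes "eopen n V" "x \<in> V" "i < n" "!!x. x \<in> V ==> f x = g x"
 shows "pderiv_at i f x = pderiv_at i g x"
  and "(%t. f (x(i := t))) field_differentiable at (x i) \<longleftrightarrow>
     (%t. g (x(i := t))) field_differentiable at (x i)"
proof -
 have ev: "\<forall>\<^sub>F t in nhds (x i). f (x(i := t)) = g (x(i := t))"
  using eventually_upd[OF assms(1-3)] by eventually_elim (use assms(4) in auto)
 show "pderiv_at i f x = pderiv_at i g x" unfolding pderiv_at_def by (rule deriv_cong_ev[OF ev refl])
 show "(%t. f (x(i := t))) field_differentiable at (x i) \<longleftrightarrow>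
     (%t. g (x(i := t))) field_differentiable at (x i)" unfolding field_differentiable_def using DERIV_cong_ev[OF refl ev refl] by blast
qed

lemma Ck_on_cong:
 assumes "eopen n V" "!!x. x \<in> V ==> f x = g x"
 shows "Ck_on k n V f \<longleftrightarrow> Ck_on k n V g" using assms
proof (induction k arbitrary: f g)
 case 0
 show ?case unfolding Ck_on_0[OF 0(1)] by (rule continuous_on_cong[OF refl 0(2)])
next
 case (Suc k)
 have c: "continuous_on V f \<longleftrightarrow> continuous_on V g" by (rule continuous_on_cong[OF refl Suc.prems(2)])
 have "Ck_on k n V (pderiv_at i f) \<longleftrightarrow> Ck_on k n V (pderiv_at i g)" if "i < n" for i
  by (rule Suc.IH[OF Suc.prems(1)]) (rule pderiv_at_cong(1)[OF Suc.prems(1) _ that Suc.prems(2)])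
 moreover have "(%t. f (x(i := t))) field_differentiable at (x i) \<longleftrightarrow>
     (%t. g (x(i := t))) field_differentiable at (x i)" if "i < n" "x \<in> V" for i x
  using pderiv_at_cong(2)[OF Suc.prems(1) that(2,1) Suc.prems(2)] .
 ultimately show ?case using c unfolding Ck_on.simps continuous_map_eucl[OF eopen_subset[OF Suc.prems(1)]] by blast
qed

lemma Ck_on_SucI:
 assumes "eopen n V" "continuous_on V f"
  and "!!i x. i < n ==> x \<in> V ==> ((%t. f (x(i := t))) has_real_derivative f' i x) (at (x i))"
  and "!!i. i < n ==> Ck_on k n V (f' i)"
 shows "Ck_on (Suc k) n V f"
proof -
 have "Ck_on k n V (pderiv_at i f)" if "i < n" for i by (metis pderiv_at_def assms that DERIV_imp_deriv Ck_on_cong)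
 then show ?thesis using assms(2,3) unfolding Ck_on.simps continuous_map_eucl[OF eopen_subset[OF assms(1)]] field_differentiable_def by blast
qed

lemma Ck_on_Suc_imp: "eopen n V ==> Ck_on (Suc k) n V f ==> Ck_on k n V f"
proof (induction k arbitrary: f)
 case 0
 then show ?case by (auto simp: Ck_on.simps)
next
 case (Suc k)
 from Suc.prems(2) show ?case using Suc.IH[OF Suc.prems(1)] unfolding Ck_on.simps(2) by blast
qed

lemma Ck_on_mono:
 assumes "eopen n V" "eopen n W" "W <= V" "Ck_on k n V f"
 shows "Ck_on k n W f" using assms(4)
proof (induction k arbitrary: f)
 case 0
 then show ?case unfolding Ck_on_0[OF assms(1)] Ck_on_0[OF assms(2)] using assms(3) by (rule continuous_on_subset)
next
 case (Suc k)
 have c: "continuous_on V f" using Ck_on_continuous[OF assms(1) Suc.prems] .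
 show ?case using Suc continuous_on_subset[OF c assms(3)] assms(3) unfolding Ck_on.simps(2) continuous_map_eucl[OF eopen_subset[OF assms(2)]] by blast
qed

lemma Ck_on_local:
 assumes "eopen n V" "!!x. x \<in> V ==> \<exists>W. eopen n W & x \<in> W & Ck_on k n W f"
 shows "Ck_on k n V f" using assms(2)
proof (induction k arbitrary: f)
 case 0
 show ?case unfolding Ck_on_0[OF assms(1)]
 proof (subst continuous_on_eq_continuous_within, intro ballI)
  fix x assume x: "x \<in> V"
  obtain W where W: "eopen n W" "x \<in> W" "continuous_on W f" using 0[OF x] by (auto simp: Ck_on_0)
  obtain T where T: "open T" "W = eucl n \<inter> T" using W(1) by (auto simp: eopen_iff)
  have "continuous (at x within V \<inter> T) f" using W T x eopen_subset[OF assms(1)]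
   by (intro continuous_within_subset[of x W f "V \<inter> T"]) (auto simp: continuous_on_eq_continuous_within)
  then show "continuous (at x within V) f" using at_within_nhd[of x T "V \<inter> T" V] W T x by simp
 qed
next
 case (Suc k)
 have "Ck_on k n V f" by (metis Suc.IH Suc.prems Ck_on_Suc_imp exI conjI)
 then have "continuous_on V f" by (rule Ck_on_continuous[OF assms(1)])
 moreover have "(%t. f (x(i := t))) field_differentiable at (x i)" if "i < n" "x \<in> V" for i x
  using Suc.prems[OF that(2)] that(1) unfolding Ck_on.simps(2) by blast
 moreover have "Ck_on k n V (pderiv_at i f)" if "i < n" for i by (metis Suc.IH Suc.prems that Ck_on.simps)
 ultimately show ?case unfolding Ck_on.simps continuous_map_eucl[OF eopen_subset[OF assms(1)]] by blast
qed

lemma continuous_on_coord: "continuous_on V (%x::nat=>real. x i)" by (rule continuous_on_subset[OF continuous_on_product_coordinates subset_UNIV])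

lemma Ck_on_const:
 assumes "eopen n V"
 shows "Ck_on k n V (%x. c)"
proof (induction k arbitrary: c)
 case (Suc k)
 show ?case by (rule Ck_on_SucI[OF assms, where f'="%_ _. 0"]) (rule continuous_on_const DERIV_const Suc)+
qed (simp add: Ck_on_0[OF assms])

lemma Ck_on_coord:
 assumes "eopen n V"
 shows "Ck_on k n V (%x. x j)"
proof (cases k)
 case (Suc k')
 have "((%t. (x(i := t)) j) has_real_derivative (if i = j then 1 else 0)) (at (x i))" for i and x :: "nat => real" by (cases "i = j") auto
 then show ?thesis unfolding Suc by (intro Ck_on_SucI[where f'="%i _. if i = j then 1 else 0"] assms continuous_on_coord Ck_on_const)
qed (simp add: Ck_on_0[OF assms] continuous_on_coord)

lemma Ck_on_add:
 "eopen n V ==> Ck_on k n V f ==> Ck_on k n V g ==> Ck_on k n V (%x. f x + g x)"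
proof (induction k arbitrary: f g)
 case (Suc k)
 show ?case by (fastforce intro: Ck_on_SucI Suc.prems Ck_on_continuous continuous_intros Ck_on_SucD Suc.IH DERIV_add)
qed (simp_all add: Ck_on_0 continuous_on_add continuous_on_mult)

lemma Ck_on_mult:
 "eopen n V ==> Ck_on k n V f ==> Ck_on k n V g ==> Ck_on k n V (%x. f x * g x)"
proof (induction k arbitrary: f g)
 case (Suc k)
 show ?case
 proof (rule Ck_on_SucI[OF Suc.prems(1), where f'="%i x. pderiv_at i f x * g x + f x * pderiv_at i g x"])
  show "continuous_on V (%x. f x * g x)" using Ck_on_continuous[OF Suc.prems(1,2)] Ck_on_continuous[OF Suc.prems(1,3)] by (intro continuous_intros)
  show "Ck_on k n V (%x. pderiv_at i f x * g x + f x * pderiv_at i g x)" if "i < n" for i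
   using Ck_on_SucD(2)[OF Suc.prems(1) Suc.prems(2) that] Ck_on_SucD(2)[OF Suc.prems(1) Suc.prems(3) that]
    Ck_on_Suc_imp[OF Suc.prems(1,2)] Ck_on_Suc_imp[OF Suc.prems(1,3)] by (intro Ck_on_add Suc.IH Suc.prems(1))
  show "((%t. f (x(i := t)) * g (x(i := t))) has_real_derivative
       pderiv_at i f x * g x + f x * pderiv_at i g x) (at (x i))" if "i < n" "x \<in> V" for i x
   by (rule DERIV_cong[OF DERIV_mult[OF Ck_on_SucD(1)[OF Suc.prems(1,2) that] Ck_on_SucD(1)[OF Suc.prems(1,3) that]]])
    (simp add: algebra_simps)
 qed
qed (simp_all add: Ck_on_0 continuous_on_add continuous_on_mult)

lemma Ck_on_cmult: "eopen n V ==> Ck_on k n V f ==> Ck_on k n V (%x. c * f x)" by (intro Ck_on_mult Ck_on_const)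

lemma Ck_on_sum:
 assumes "eopen n V" "!!j. j \<in> J ==> Ck_on k n V (f j)"
 shows "Ck_on k n V (%x. \<Sum>j\<in>J. f j x)" using assms(2)
proof (induction J rule: infinite_finite_induct)
 case (insert j J)
 then show ?case using Ck_on_add[OF assms(1), of k "f j" "%x. \<Sum>j\<in>J. f j x"] by simp
qed (simp_all add: Ck_on_const[OF assms(1)])

lemma Ck_on_prod:
 assumes "eopen n V" "!!j. j \<in> J ==> Ck_on k n V (f j)"
 shows "Ck_on k n V (%x. \<Prod>j\<in>J. f j x)" using assms(2)
proof (induction J rule: infinite_finite_induct)
 case (insert j J)
 then show ?case using Ck_on_mult[OF assms(1), of k "f j" "%x. \<Prod>j\<in>J. f j x"] by simp
qed (simp_all add: Ck_on_const[OF assms(1)])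

text \<open>The increment of f is split into m increments, in each of which one coordinate moves
  from \<gamma> t0 to \<gamma> t. By the mean value theorem each is a partial derivative at a nearby
  point times the increment of that coordinate, and continuity of the partial derivatives gives the
  limit.\<close>

lemma chain_rule_curve:
 fixes \<gamma> :: "real => nat => real"
 assumes V: "eopen m V" and f: "Ck_on (Suc 0) m V f"
  and ev: "\<forall>\<^sub>F t in nhds t0. \<gamma> t \<in> V"
  and \<gamma>': "!!j. j < m ==> ((%t. \<gamma> t j) has_real_derivative \<gamma>' j) (at t0)"
 shows "((%t. f (\<gamma> t)) has_real_derivative (\<Sum>j<m. pderiv_at j f (\<gamma> t0) * \<gamma>' j)) (at t0)"
proof -
 have x0: "\<gamma> t0 \<in> V" using eventually_nhds_x_imp_x[OF ev] .
 define hyb where "hyb k t = (%i. if i < k then \<gamma> t i else \<gamma> t0 i)" for k t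
 have "((%t. f (hyb k t)) has_real_derivative (\<Sum>j<k. pderiv_at j f (\<gamma> t0) * \<gamma>' j)) (at t0)"
  if "k \<le> m" for k using that
 proof (induction k)
  case 0
  then show ?case by (simp add: hyb_def)
 next
  case (Suc k)
  then have k: "k < m" by simp
  let ?L = "pderiv_at k f (\<gamma> t0)"
  define D where "D t = f (hyb (Suc k) t) - f (hyb k t)" for t
  \<comment> \<open>The slope in direction k; where the coordinate does not move, the limit value is
    prescribed, so that only continuity of q at t0 has to be proved and Caratheodory's form of the
    derivative applies.\<close>
  define q where "q t = (if \<gamma> t k = \<gamma> t0 k then ?L else D t / (\<gamma> t k - \<gamma> t0 k))" for t
  have hs: "hyb (Suc k) t = (hyb k t)(k := \<gamma> t k)" for t by (auto simp: hyb_def fun_eq_iff)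
  have hk: "hyb k t k = \<gamma> t0 k" for t by (simp add: hyb_def)
  have Dq: "D t = q t * (\<gamma> t k - \<gamma> t0 k)" for t
  proof (cases "\<gamma> t k = \<gamma> t0 k")
   case True
   then have "hyb (Suc k) t = hyb k t" using hk[of t] by (simp add: hs fun_upd_idem)
   then show ?thesis using True by (simp add: D_def)
  qed (simp add: q_def)
  have "isCont q t0" unfolding continuous_at_eps_delta
  proof -
   have "\<forall>\<^sub>F t in nhds t0. \<bar>q t - q t0\<bar> < e" if e: "e > 0" for e
   proof -
    obtain \<delta> where \<delta>: "\<delta> > 0"
     "\<forall>y\<in>eucl m. (\<forall>i<m. \<bar>y i - \<gamma> t0 i\<bar> < \<delta>) --> y \<in> V & \<bar>pderiv_at k f y - ?L\<bar> < e"
     using continuous_box[OF V _ x0 e, of "pderiv_at k f"] Ck_on_SucD(2)[OF V f k] Ck_on_0[OF V] by blast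
    have "\<forall>\<^sub>F t in nhds t0. \<bar>\<gamma> t i - \<gamma> t0 i\<bar> < \<delta>" if "i < m" for i
    proof -
     have "isCont (%t. \<gamma> t i) t0" using \<gamma>'[OF that] by (rule DERIV_isCont)
     then have "((%t. \<gamma> t i) \<longlongrightarrow> \<gamma> t0 i) (nhds t0)" by (simp add: isCont_def tendsto_nhds_iff)
     from tendstoD[OF this \<delta>(1)] show ?thesis by (simp add: dist_real_def)
    qed
    then have "\<forall>\<^sub>F t in nhds t0. \<forall>i\<in>{..<m}. \<bar>\<gamma> t i - \<gamma> t0 i\<bar> < \<delta>"
     by (intro eventually_ball_finite) auto
    with ev show ?thesis
    proof eventually_elim
     case (elim t)
     have box: "(hyb k t)(k := s) \<in> V & \<bar>pderiv_at k f ((hyb k t)(k := s)) - ?L\<bar> < e"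
      if "\<bar>s - \<gamma> t0 k\<bar> < \<delta>" for s
     proof (intro \<delta>(2)[rule_format])
      show "(hyb k t)(k := s) \<in> eucl m" using eopen_subset[OF V] x0 elim(1) k by (auto simp: hyb_def)
      show "\<bar>((hyb k t)(k := s)) i - \<gamma> t0 i\<bar> < \<delta>" if "i < m" for i
       using elim(2) that \<open>\<bar>s - \<gamma> t0 k\<bar> < \<delta>\<close> \<delta>(1) by (auto simp: hyb_def)
     qed
     have der: "((%s. f ((hyb k t)(k := s))) has_real_derivative
       pderiv_at k f ((hyb k t)(k := s))) (at s)" if "\<bar>s - \<gamma> t0 k\<bar> < \<delta>" for s
      using Ck_on_SucD(1)[OF V f k, of "(hyb k t)(k := s)"] box[OF that] by simp
     have bk: "\<bar>\<gamma> t k - \<gamma> t0 k\<bar> < \<delta>" using elim(2) k by auto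
     have D': "D t = f ((hyb k t)(k := \<gamma> t k)) - f ((hyb k t)(k := \<gamma> t0 k))" using hk[of t] by (simp add: D_def hs fun_upd_idem)
     have "\<exists>z. \<bar>z - \<gamma> t0 k\<bar> < \<delta> & D t = (\<gamma> t k - \<gamma> t0 k) * pderiv_at k f ((hyb k t)(k := z))"
      if "\<gamma> t k ~= \<gamma> t0 k"
     proof (cases "\<gamma> t k < \<gamma> t0 k")
      case True
      obtain z where "\<gamma> t k < z" "z < \<gamma> t0 k"
       "f ((hyb k t)(k := \<gamma> t0 k)) - f ((hyb k t)(k := \<gamma> t k)) =
         (\<gamma> t0 k - \<gamma> t k) * pderiv_at k f ((hyb k t)(k := z))"
       using MVT2[OF True, of "%s. f ((hyb k t)(k := s))" "%s. pderiv_at k f ((hyb k t)(k := s))"]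
        der bk by auto
      then show ?thesis using bk unfolding D' by (intro exI[of _ z]) (auto simp: algebra_simps)
     next
      case False
      with that have "\<gamma> t0 k < \<gamma> t k" by simp
      from MVT2[OF this, of "%s. f ((hyb k t)(k := s))" "%s. pderiv_at k f ((hyb k t)(k := s))"]
      obtain z where "\<gamma> t0 k < z" "z < \<gamma> t k"
       "f ((hyb k t)(k := \<gamma> t k)) - f ((hyb k t)(k := \<gamma> t0 k)) =
         (\<gamma> t k - \<gamma> t0 k) * pderiv_at k f ((hyb k t)(k := z))" using der bk by auto
      then show ?thesis using bk unfolding D' by (intro exI[of _ z]) auto
     qed
     then show ?case using box e by (auto simp: q_def)
    qed
   qed
   then show "\<forall>e>0. \<exists>d>0. \<forall>x'. dist x' t0 < d --> dist (q x') (q t0) < e" by (auto simp: eventually_nhds_metric dist_real_def)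
  qed
  moreover obtain g where g: "!!z. \<gamma> z k - \<gamma> t0 k = g z * (z - t0)" "isCont g t0" "g t0 = \<gamma>' k"
   using \<gamma>'[OF k] unfolding CARAT_DERIV by blast
  ultimately have "isCont (%z. q z * g z) t0" by simp
  moreover have "D t0 = 0" by (simp add: D_def hyb_def)
  ultimately have "(D has_real_derivative ?L * \<gamma>' k) (at t0)" unfolding CARAT_DERIV
   by (intro exI[of _ "%z. q z * g z"]) (auto simp: Dq g q_def)
  from DERIV_add[OF Suc.IH this] k show ?case by (simp add: D_def)
 qed
 from this[OF order_refl]
 have "((%t. f (hyb m t)) has_real_derivative (\<Sum>j<m. pderiv_at j f (\<gamma> t0) * \<gamma>' j)) (at t0)" .
 moreover have "\<forall>\<^sub>F t in nhds t0. f (\<gamma> t) = f (hyb m t)" using ev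
 proof eventually_elim
  case (elim t)
  have "\<gamma> t i = hyb m t i" for i
  proof (cases "i < m")
   case False
   then have "\<gamma> t i = 0" "\<gamma> t0 i = 0" using elim x0 eopen_subset[OF V] by fastforce+
   then show ?thesis by (simp add: hyb_def)
  qed (simp add: hyb_def)
  then show ?case by presburger
 qed
 ultimately show ?thesis using DERIV_cong_ev[OF refl _ refl, of "%t. f (\<gamma> t)" "%t. f (hyb m t)" t0] by blast
qed

lemma Ck_on_compose:
 assumes V: "eopen n V" and W: "eopen m W" and GW: "!!x. x \<in> V ==> G x \<in> W"
  and G: "!!j. j < m ==> Ck_on k n V (%x. G x j)" and f: "Ck_on k m W f"
 shows "Ck_on k n V (%x. f (G x))" using f G
proof (induction k arbitrary: f)
 case 0
 show ?case unfolding Ck_on_0[OF V]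
 proof (rule continuous_on_compose2[of W f])
  show "continuous_on W f" using 0(1) Ck_on_0[OF W] by simp
  show "continuous_on V G"
  proof (rule continuous_on_coordinatewise_then_product)
   fix i show "continuous_on V (%x. G x i)"
   proof (cases "i < m")
    case True
    then show ?thesis using 0(2) Ck_on_0[OF V] by simp
   next
    case False
    then have "!!x. x \<in> V ==> G x i = 0" using GW eopen_subset[OF W] by fastforce
    then show ?thesis using continuous_on_cong[OF refl, of V "%x. G x i" "%x. 0"] by simp
   qed
  qed
 qed (use GW in auto)
next
 case (Suc k)
 have G': "Ck_on k n V (%x. G x j)" if "j < m" for j using Ck_on_Suc_imp[OF V Suc.prems(2)[OF that]] .
 have c: "continuous_on V (%x. f (G x))" using Ck_on_continuous[OF V Suc.IH[OF Ck_on_Suc_imp[OF W Suc.prems(1)] G']] .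
 have one: "Ck_on (Suc 0) m W f" using Suc.prems(1)
 proof (induction k)
  case (Suc k)
  then show ?case using Ck_on_Suc_imp[OF W Suc.prems] by blast
 qed
 show ?case
 proof (rule Ck_on_SucI[OF V c,
   where f'="%i x. \<Sum>j<m. pderiv_at j f (G x) * pderiv_at i (%x. G x j) x"])
  fix i x assume i: "i < n" "x \<in> V"
  have "((%t. f (G (x(i := t)))) has_real_derivative
    (\<Sum>j<m. pderiv_at j f (G (x(i := x i))) * pderiv_at i (%x. G x j) x)) (at (x i))"
  proof (rule chain_rule_curve[OF W one])
   show "\<forall>\<^sub>F t in nhds (x i). G (x(i := t)) \<in> W" using eventually_upd[OF V i(2,1)] by eventually_elim (rule GW)
   show "((%t. G (x(i := t)) j) has_real_derivative pderiv_at i (%x. G x j) x) (at (x i))"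
    if "j < m" for j by (rule Ck_on_SucD(1)[OF V Suc.prems(2)[OF that] i])
  qed
  then show "((%t. f (G (x(i := t)))) has_real_derivative
    (\<Sum>j<m. pderiv_at j f (G x) * pderiv_at i (%x. G x j) x)) (at (x i))" by simp
 next
  fix i assume i: "i < n"
  show "Ck_on k n V (%x. \<Sum>j<m. pderiv_at j f (G x) * pderiv_at i (%x. G x j) x)"
  proof (intro Ck_on_sum Ck_on_mult V)
   fix j assume "j \<in> {..<m}"
   then have j: "j < m" by simp
   show "Ck_on k n V (%x. pderiv_at j f (G x))" by (rule Suc.IH[OF Ck_on_SucD(2)[OF W Suc.prems(1) j] G'])
   show "Ck_on k n V (pderiv_at i (%x. G x j))" by (rule Ck_on_SucD(2)[OF V Suc.prems(2)[OF j] i])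
  qed
 qed
qed

subsection \<open>Hadamard's lemma\<close>

definition segm :: "(nat => real) => real => (nat => real) => nat => real" where
 "segm q t x = (%i. q i + t * (x i - q i))"

lemma continuous_on_segm: "continuous_on S (%(x, t). segm q t x)" unfolding segm_def split_def
 by (intro continuous_on_coordinatewise_then_product continuous_intros
   continuous_on_compose2[OF continuous_on_coord[of UNIV] continuous_on_fst[OF continuous_on_id]])
  auto

lemma continuous_on_segm_comp:
 assumes "continuous_on Q F" "!!x t. x \<in> Q ==> t \<in> {0..1} ==> segm q t x \<in> Q"
 shows "continuous_on (Q \<times> {0..1}) (%(x, t). t ^ m * F (segm q t x))"
proof -
 have "continuous_on (Q \<times> {0..1}) (%z. F (case z of (x, t) => segm q t x))"
  by (rule continuous_on_compose2[OF assms(1) continuous_on_segm]) (use assms(2) in auto)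
 then have "continuous_on (Q \<times> {0..1}) (%z. snd z ^ m * F (case z of (x, t) => segm q t x))" by (intro continuous_intros)
 then show ?thesis by (simp add: split_def)
qed

text \<open>Differentiation under the integral sign. Each derivative in x contributes a factor t
  from the inner derivative of \<open>segm\<close>, so the power of t has to be carried through the
  induction.\<close>

lemma Ck_on_segm_integral:
 assumes Q: "eopen n Q" and star: "!!x t. x \<in> Q ==> t \<in> {0..1} ==> segm q t x \<in> Q"
  and F: "Ck_on k n Q F"
 shows "Ck_on k n Q (%x. integral {0..1} (%t. t ^ m * F (segm q t x)))" using F
proof (induction k arbitrary: F m)
 case 0
 have "continuous_on (Q \<times> cbox 0 1) (%(x, t). t ^ m * F (segm q t x))" using continuous_on_segm_comp[OF _ star] 0 Ck_on_0[OF Q] by simp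
 from integral_continuous_on_param[OF this] show ?case unfolding Ck_on_0[OF Q] by simp
next
 case (Suc k)
 have cF: "continuous_on (Q \<times> cbox 0 1) (%(x, t). t ^ m * F (segm q t x))" for m
  using continuous_on_segm_comp[OF _ star] Ck_on_continuous[OF Q Suc.prems] by simp
 show ?case
 proof (rule Ck_on_SucI[OF Q, where f'="%i x. integral {0..1} (%t. t ^ Suc m * pderiv_at i F (segm q t x))"])
  show "continuous_on Q (%x. integral {0..1} (%t. t ^ m * F (segm q t x)))" using integral_continuous_on_param[OF cF] by simp
  show "Ck_on k n Q (%x. integral {0..1} (%t. t ^ Suc m * pderiv_at i F (segm q t x)))" if "i < n" for i
   by (rule Suc.IH[OF Ck_on_SucD(2)[OF Q Suc.prems that]])
  fix i x assume i: "i < n" and x: "x \<in> Q"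
  obtain \<delta> where \<delta>: "\<delta> > 0" "!!s. \<bar>s - x i\<bar> < \<delta> ==> x(i := s) \<in> Q"
   using eventually_upd[OF Q x i] by (auto simp: eventually_nhds_metric dist_real_def)
  define U where "U = ball (x i) \<delta>"
  have U: "open U" "convex U" "x i \<in> U" "!!s. s \<in> U ==> x(i := s) \<in> Q"
   using \<delta> by (auto simp: U_def dist_real_def abs_minus_commute)
  have cx: "continuous_on U (%s. x(i := s))"
  proof (rule continuous_on_coordinatewise_then_product)
   show "continuous_on U (%s. (x(i := s)) j)" for j by (cases "j = i") auto
  qed
  have cP: "continuous_on (Q \<times> {0..1}) (%(x, t). t ^ Suc m * pderiv_at i F (segm q t x))"
   by (rule continuous_on_segm_comp[OF Ck_on_continuous[OF Q Ck_on_SucD(2)[OF Q Suc.prems i]] star])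
  have cU: "continuous_on (U \<times> {0..1}) (%(s, t). t ^ Suc m * pderiv_at i F (segm q t (x(i := s))))"
  proof -
   have "continuous_on (U \<times> {0..1::real}) (%z. (x(i := fst z), snd z))" by (intro continuous_intros continuous_on_compose2[OF cx]) auto
   moreover have "(%z. (x(i := fst z), snd z)) ` (U \<times> {0..1}) <= Q \<times> {0..1}" using U(4) by auto
   ultimately have "continuous_on (U \<times> {0..1}) (%z. case (x(i := fst z), snd z) of
     (x, t) => t ^ Suc m * pderiv_at i F (segm q t x))" by (rule continuous_on_compose2[OF cP])
   then show ?thesis by (simp add: split_def)
  qed
  have "((%s. integral (cbox 0 1) (%t. t ^ m * F (segm q t (x(i := s))))) has_field_derivative
    integral (cbox 0 1) (%t. t ^ Suc m * pderiv_at i F (segm q t (x(i := x i))))) (at (x i) within U)"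
  proof (rule leibniz_rule_field_derivative)
   fix s and t :: real assume s: "s \<in> U" and t: "t \<in> cbox 0 1"
   let ?z = "segm q t (x(i := s))"
   have z: "?z \<in> Q" using star U(4)[OF s] t by auto
   have e: "segm q t (x(i := s')) = ?z(i := q i + t * (s' - q i))" for s' by (auto simp: segm_def)
   have zi: "?z i = q i + t * (s - q i)" by (simp add: segm_def)
   have d1: "((%r. F (?z(i := r))) has_real_derivative pderiv_at i F ?z) (at (q i + t * (s - q i)))"
    using Ck_on_SucD(1)[OF Q Suc.prems i z] unfolding zi .
   have d2: "((%s'. q i + t * (s' - q i)) has_real_derivative t) (at s)" by (auto intro!: derivative_eq_intros)
   have "((%s'. F (?z(i := q i + t * (s' - q i)))) has_real_derivative pderiv_at i F ?z * t) (at s)" by (rule DERIV_chain2[OF d1 d2])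
   then have "((%s'. F (segm q t (x(i := s')))) has_real_derivative pderiv_at i F ?z * t) (at s)" unfolding e[symmetric] .
   from DERIV_cmult[OF this, of "t ^ m"]
   have "((%s'. t ^ m * F (segm q t (x(i := s')))) has_real_derivative t ^ Suc m * pderiv_at i F ?z) (at s)" by (simp add: mult_ac)
   then show "((%s'. t ^ m * F (segm q t (x(i := s')))) has_real_derivative t ^ Suc m * pderiv_at i F ?z) (at s within U)"
    by (rule has_field_derivative_at_within)
  next
   fix s assume s: "s \<in> U"
   have "continuous_on {0..1} (%t. t ^ m * F (segm q t (x(i := s))))"
   proof -
    have "continuous_on {0..1::real} (%t. (x(i := s), t))" by (intro continuous_intros)
    from continuous_on_compose2[OF cF[of m] this] U(4)[OF s] show ?thesis by auto
   qed
   then show "(%t. t ^ m * F (segm q t (x(i := s)))) integrable_on cbox 0 1" by (simp add: integrable_continuous_interval)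
  next
   show "continuous_on (U \<times> cbox 0 1) (%(s, t). t ^ Suc m * pderiv_at i F (segm q t (x(i := s))))" using cU by simp
   show "x i \<in> U" "convex U" by (fact U)+
  qed
  then show "((%s. integral {0..1} (%t. t ^ m * F (segm q t (x(i := s))))) has_real_derivative
    integral {0..1} (%t. t ^ Suc m * pderiv_at i F (segm q t x))) (at (x i))" using at_within_open[OF U(3,1)] by simp
 qed
qed

text \<open>The fundamental theorem of calculus is applied to f along the segment from q to x; the
  j-th factor is the mean of the j-th partial derivative over this segment.\<close>

lemma Hadamard:
 assumes Q: "eopen n Q" and star: "!!x t. x \<in> Q ==> t \<in> {0..1} ==> segm q t x \<in> Q" and q: "q \<in> Q"
  and f: "smooth_on n Q f"
 shows "\<exists>g. (\<forall>j<n. smooth_on n Q (g j) & g j q = pderiv_at j f q) &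
   (\<forall>x\<in>Q. f x = f q + (\<Sum>j<n. (x j - q j) * g j x))"
proof (intro exI conjI allI impI ballI)
 \<comment> \<open>The factor \<open>t ^ 0\<close> brings the integrand into the form of
   \<open>Ck_on_segm_integral\<close>.\<close>
 let ?g = "%j x. integral {0..1} (%t. t ^ 0 * pderiv_at j f (segm q t x))"
 fix j assume j: "j < n"
 have "Ck_on k n Q (pderiv_at j f)" for k using f j Ck_on_SucD(2)[OF Q] unfolding smooth_on_def by blast
 then show "smooth_on n Q (?g j)" unfolding smooth_on_def using Ck_on_segm_integral[OF Q star] by blast
 show "?g j q = pderiv_at j f q" by (simp add: segm_def)
next
 let ?g = "%j x. integral {0..1} (%t. t ^ 0 * pderiv_at j f (segm q t x))"
 fix x assume x: "x \<in> Q"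
 have f1: "Ck_on (Suc k) n Q f" for k using f by (simp add: smooth_on_def)
 have d: "((%t. f (segm q t x)) has_real_derivative
   (\<Sum>j<n. pderiv_at j f (segm q t0 x) * (x j - q j))) (at t0)" if t0: "t0 \<in> {0..1}" for t0
 proof (rule chain_rule_curve[OF Q f1])
  obtain \<delta> where \<delta>: "\<delta> > 0" "\<forall>y\<in>eucl n. (\<forall>i<n. \<bar>y i - segm q t0 x i\<bar> < \<delta>) --> y \<in> Q"
   using eopen_box[OF Q star[OF x t0]] by blast
  have "\<forall>\<^sub>F t in nhds t0. \<bar>segm q t x i - segm q t0 x i\<bar> < \<delta>" for i
  proof -
   have "((%t. segm q t x i) \<longlongrightarrow> segm q t0 x i) (nhds t0)" unfolding segm_def by (intro tendsto_intros filterlim_ident)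
   from tendstoD[OF this \<delta>(1)] show ?thesis by (simp add: dist_real_def)
  qed
  then have "\<forall>\<^sub>F t in nhds t0. \<forall>i\<in>{..<n}. \<bar>segm q t x i - segm q t0 x i\<bar> < \<delta>"
   by (intro eventually_ball_finite) auto
  then show "\<forall>\<^sub>F t in nhds t0. segm q t x \<in> Q"
  proof eventually_elim
   case (elim t)
   have "segm q t x \<in> eucl n" using subsetD[OF eopen_subset[OF Q] x] subsetD[OF eopen_subset[OF Q] q] by (simp add: segm_def)
   then show ?case using \<delta>(2) elim by auto
  qed
  show "((%t. segm q t x j) has_real_derivative x j - q j) (at t0)" for j unfolding segm_def by (auto intro!: derivative_eq_intros)
 qed
 have "((%t. \<Sum>j<n. pderiv_at j f (segm q t x) * (x j - q j)) has_integral
   f (segm q 1 x) - f (segm q 0 x)) {0..1}" by (rule fundamental_theorem_of_calculus)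
   (use d in \<open>auto simp flip: has_real_derivative_iff_has_vector_derivative intro: has_field_derivative_at_within\<close>)
 then have "integral {0..1} (%t. \<Sum>j<n. pderiv_at j f (segm q t x) * (x j - q j)) = f x - f q" by (simp add: segm_def integral_unique)
 moreover have "integral {0..1} (%t. \<Sum>j<n. pderiv_at j f (segm q t x) * (x j - q j)) =
   (\<Sum>j<n. integral {0..1} (%t. pderiv_at j f (segm q t x) * (x j - q j)))"
 proof (rule integral_sum)
  fix j assume "j \<in> {..<n}"
  then have j: "j < n" by simp
  have "continuous_on {0..1} (%t. t ^ 0 * pderiv_at j f (segm q t x))"
  proof -
   have c1: "continuous_on {0..1::real} (%t. (x, t))" by (intro continuous_intros)
   have c2: "continuous_on (Q \<times> {0..1}) (%(x, t). t ^ 0 * pderiv_at j f (segm q t x))"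
    by (rule continuous_on_segm_comp[OF Ck_on_continuous[OF Q Ck_on_SucD(2)[OF Q f1 j]] star])
   have "continuous_on {0..1} (%t. case (x, t) of (x, t) => t ^ 0 * pderiv_at j f (segm q t x))"
    by (rule continuous_on_compose2[OF c2 c1]) (use x in auto)
   then show ?thesis by simp
  qed
  then show "(%t. pderiv_at j f (segm q t x) * (x j - q j)) integrable_on {0..1}" by (intro integrable_continuous_interval continuous_intros) simp
 qed simp
 ultimately show "f x = f q + (\<Sum>j<n. (x j - q j) * ?g j x)" by (simp add: mult.commute)
qed

subsection \<open>Bump functions\<close>

text \<open>The bump functions only use m = 0. The powers make the family closed under
  differentiation up to linear combinations, with indices m + 1 and m + 2, so that smoothness
  follows by one induction for all m.\<close>

definition flat_exp :: "nat => real => real" where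
 "flat_exp m t = (if t > 0 then inverse t ^ m * exp (- inverse t) else 0)"

lemma flat_exp_right_limit: "((%t. inverse t ^ m * exp (- inverse t)) \<longlongrightarrow> (0::real)) (at_right 0)"
proof -
 have "((%t. inverse t ^ m / exp (inverse t)) \<longlongrightarrow> (0::real)) (at_right 0)"
  by (rule filterlim_compose[OF tendsto_power_div_exp_0 filterlim_inverse_at_top_right])
 then show ?thesis by (simp add: exp_minus divide_inverse)
qed

lemma flat_exp_DERIV:
 "(flat_exp m has_real_derivative - real m * flat_exp (Suc m) t + flat_exp (Suc (Suc m)) t) (at t)"
proof -
 consider "t > 0" | "t < 0" | "t = 0" by linarith
 then show ?thesis
 proof cases
  case 1
  have d1: "(inverse has_real_derivative - (inverse t ^ 2)) (at t)" using DERIV_inverse[of t] 1 by (simp add: numeral_2_eq_2)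
  have d2: "((%t. exp (- inverse t)) has_real_derivative exp (- inverse t) * inverse t ^ 2) (at t)"
   using DERIV_chain2[OF DERIV_exp DERIV_minus[OF d1]] by simp
  have "real m * (inverse t ^ (m - Suc 0) * inverse t ^ 2) = real m * inverse t ^ Suc m" by (cases m) (simp_all add: power2_eq_square)
  then have "- (inverse t ^ 2) * (real m * inverse t ^ (m - Suc 0)) * exp (- inverse t)
    + (exp (- inverse t) * inverse t ^ 2) * inverse t ^ m =
    - real m * flat_exp (Suc m) t + flat_exp (Suc (Suc m)) t" using 1 by (simp add: flat_exp_def power2_eq_square mult_ac)
  then have "((%t. inverse t ^ m * exp (- inverse t)) has_real_derivative
    - real m * flat_exp (Suc m) t + flat_exp (Suc (Suc m)) t) (at t)" using DERIV_mult[OF DERIV_power[OF d1, of m] d2] by (simp add: mult_ac)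
  moreover have "\<forall>\<^sub>F s in nhds t. flat_exp m s = inverse s ^ m * exp (- inverse s)"
   using eventually_nhds_in_open[of "{0<..}" t] 1 by (auto elim!: eventually_mono simp: flat_exp_def)
  ultimately show ?thesis using DERIV_cong_ev[OF refl _ refl, of "flat_exp m" "%t. inverse t ^ m * exp (- inverse t)" t] by blast
 next
  case 2
  have "\<forall>\<^sub>F s in nhds t. flat_exp m s = 0"
   using eventually_nhds_in_open[of "{..<0}" t] 2 by (auto elim!: eventually_mono simp: flat_exp_def)
  then have "(flat_exp m has_real_derivative 0) (at t)" using DERIV_cong_ev[OF refl _ refl, of "flat_exp m" "%_. 0" t 0] by simp
  then show ?thesis using 2 by (simp add: flat_exp_def)
 next
  case 3
  \<comment> \<open>At 0 the difference quotient from the right is itself the next function of the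
    family.\<close>
  have "((%s. flat_exp m s / s) \<longlongrightarrow> 0) (at_right 0)" using flat_exp_right_limit[of "Suc m"] by (rule Lim_transform_eventually)
    (auto simp: flat_exp_def eventually_at_right_less field_simps intro!: eventually_at_rightI[of 0 1])
  moreover have "((%s. flat_exp m s / s) \<longlongrightarrow> 0) (at_left 0)" by (rule Lim_transform_eventually[OF tendsto_const])
    (auto simp: flat_exp_def intro!: eventually_at_leftI[of "-1"])
  ultimately have "((%s. flat_exp m s / s) \<longlongrightarrow> 0) (at 0)" by (simp add: filterlim_split_at)
  then show ?thesis using 3 by (simp add: has_field_derivative_iff flat_exp_def)
 qed
qed

lemma flat_exp_eq_0_iff: "flat_exp m t = 0 \<longleftrightarrow> t \<le> 0" by (auto simp: flat_exp_def)

lemma Ck_on_flat_exp: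
 assumes V: "eopen n V"
 shows "Ck_on k n V (%x. flat_exp m (a + c * x j))"
proof (induction k arbitrary: m)
 case 0
 have "continuous_on UNIV (flat_exp m)" by (rule DERIV_continuous_on[OF has_field_derivative_at_within[OF flat_exp_DERIV]])
 then show ?case unfolding Ck_on_0[OF V] by (rule continuous_on_compose2) (auto intro!: continuous_intros continuous_on_coord)
next
 case (Suc k)
 show ?case
 proof (rule Ck_on_SucI[OF V, where f'="%i x. if i = j then
    c * (- real m * flat_exp (Suc m) (a + c * x j) + flat_exp (Suc (Suc m)) (a + c * x j)) else 0"])
  show "continuous_on V (%x. flat_exp m (a + c * x j))" by (rule Ck_on_continuous[OF V Suc.IH])
  show "Ck_on k n V (%x. if i = j then
    c * (- real m * flat_exp (Suc m) (a + c * x j) + flat_exp (Suc (Suc m)) (a + c * x j)) else 0)" for i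
   by (cases "i = j") (simp_all only: if_True if_False refl Ck_on_const[OF V] Ck_on_cmult[OF V] Ck_on_add[OF V] Suc.IH)
  show "((%t. flat_exp m (a + c * (x(i := t)) j)) has_real_derivative (if i = j then
    c * (- real m * flat_exp (Suc m) (a + c * x j) + flat_exp (Suc (Suc m)) (a + c * x j)) else 0)) (at (x i))"
   for i and x :: "nat => real"
  proof (cases "i = j")
   case True
   have "((%t. a + c * t) has_real_derivative c) (at (x j))" by (auto intro!: derivative_eq_intros)
   from DERIV_chain2[OF flat_exp_DERIV this] show ?thesis using True by (simp add: mult.commute)
  qed simp
 qed
qed

section \<open>Smooth functions on open subsets of Euclidean space\<close>

lemma smooth_onD: "smooth_on n V f ==> Ck_on k n V f" by (simp add: smooth_on_def)

lemma smooth_on_const: "eopen n V ==> smooth_on n V (%x. c)" by (simp add: smooth_on_def Ck_on_const)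

lemma smooth_on_coord: "eopen n V ==> smooth_on n V (%x. x j)" by (simp add: smooth_on_def Ck_on_coord)

lemma smooth_on_add:
 "eopen n V ==> smooth_on n V f ==> smooth_on n V g ==> smooth_on n V (%x. f x + g x)" by (simp add: smooth_on_def Ck_on_add)

lemma smooth_on_mult:
 "eopen n V ==> smooth_on n V f ==> smooth_on n V g ==> smooth_on n V (%x. f x * g x)" by (simp add: smooth_on_def Ck_on_mult)

lemma smooth_on_sum:
 "eopen n V ==> (!!j. j \<in> J ==> smooth_on n V (f j)) ==> smooth_on n V (%x. \<Sum>j\<in>J. f j x)" by (simp add: smooth_on_def Ck_on_sum)

lemma smooth_on_mono:
 "eopen n V ==> eopen n W ==> W <= V ==> smooth_on n V f ==> smooth_on n W f" unfolding smooth_on_def by (intro allI, rule Ck_on_mono) auto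

lemma smooth_on_cong:
 assumes "eopen n V" "!!x. x \<in> V ==> f x = g x"
 shows "smooth_on n V f \<longleftrightarrow> smooth_on n V g" unfolding smooth_on_def by (simp only: Ck_on_cong[of n V f g, OF assms])

lemma smooth_on_local:
 assumes "eopen n V" "!!x. x \<in> V ==> \<exists>W. eopen n W & x \<in> W & smooth_on n W f"
 shows "smooth_on n V f" unfolding smooth_on_def by (metis Ck_on_local assms exI smooth_on_def)

lemma smooth_on_pderiv: "eopen n V ==> i < n ==> smooth_on n V f ==> smooth_on n V (pderiv_at i f)" unfolding smooth_on_def by (metis Ck_on_SucD(2))

lemma smooth_on_compose:
 assumes "eopen n V" "eopen m W" "!!x. x \<in> V ==> G x \<in> W"
  and "!!j. j < m ==> smooth_on n V (%x. G x j)" "smooth_on m W f"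
 shows "smooth_on n V (%x. f (G x))" unfolding smooth_on_def
 by (rule allI, rule Ck_on_compose[OF assms(1-3) smooth_onD[OF assms(4)] smooth_onD[OF assms(5)]])

lemma smooth_on_DERIV:
 "eopen n V ==> smooth_on n V f ==> i < n ==> x \<in> V ==>
  ((%t. f (x(i := t))) has_real_derivative pderiv_at i f x) (at (x i))" using Ck_on_SucD(1)[of n V 0 f i x] by (simp add: smooth_on_def)

section \<open>Charts of a smooth manifold\<close>

locale smooth_mfd =
 fixes M :: "'a mfd"
 assumes smooth: "smooth_manifold M"
begin

abbreviation "A \<equiv> smooth_functions M"
abbreviation "n \<equiv> mdim M"

context
 fixes U \<phi> assumes chart: "(U, \<phi>) \<in> matlas M"
begin

lemma chart_open: "openin (mtop M) U" and chart_image_open: "eopen n (\<phi> ` U)"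
 and chart_homeo: "homeomorphic_map (subtopology (mtop M) U) (subtopology (Euclidean_space n) (\<phi> ` U)) \<phi>"
 using smooth chart unfolding smooth_manifold_def by auto

lemma chart_subset: "U <= pts M" using chart_open openin_subset by blast

lemma chart_inj: "inj_on \<phi> U" using homeomorphic_imp_injective_map[OF chart_homeo] chart_subset by (simp add: Int_absorb1)

lemma chart_inv [simp]: "q \<in> U ==> inv_into U \<phi> (\<phi> q) = q" using chart_inj by simp

lemma chart_inv_in: "x \<in> \<phi> ` U ==> inv_into U \<phi> x \<in> U & \<phi> (inv_into U \<phi> x) = x" by (simp add: inv_into_into f_inv_into_f)

lemma chart_open_image:
 assumes "openin (mtop M) S" "S <= U" shows "eopen n (\<phi> ` S)"
by (metis assms chart_open openin_open_subtopology homeomorphic_imp_open_map chart_homeo open_map_def chart_image_open openin_trans_full)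

lemma chart_preimage_open:
 assumes "eopen n C" "C <= \<phi> ` U" shows "openin (mtop M) {q\<in>U. \<phi> q \<in> C}"
proof -
 have "openin (subtopology (Euclidean_space n) (\<phi> ` U)) C" using assms chart_image_open by (simp add: openin_open_subtopology)
 then have "openin (subtopology (mtop M) U) {q \<in> topspace (subtopology (mtop M) U). \<phi> q \<in> C}"
  using openin_continuous_map_preimage[OF homeomorphic_imp_continuous_map[OF chart_homeo]] by blast
 then show ?thesis using chart_open openin_trans_full chart_subset by (simp add: Int_absorb1)
qed

text \<open>The inverse chart carries compactness to M, and there the Hausdorff property turns it
  into closedness. Without it an extension by zero could fail to be smooth at the boundary of the
  chart.\<close>

lemma chart_preimage_closed:
 assumes "compactin (Euclidean_space n) K" "K <= \<phi> ` U" shows "closedin (mtop M) {q\<in>U. \<phi> q \<in> K}"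
proof -
 obtain g where g: "homeomorphic_maps (subtopology (mtop M) U) (subtopology (Euclidean_space n) (\<phi> ` U)) \<phi> g"
  using chart_homeo homeomorphic_map_maps by blast
 then have gc: "continuous_map (subtopology (Euclidean_space n) (\<phi> ` U)) (subtopology (mtop M) U) g"
  and gi: "!!q. q \<in> U ==> g (\<phi> q) = q" using chart_subset by (auto simp: homeomorphic_maps_def Int_absorb1)
 have "compactin (subtopology (Euclidean_space n) (\<phi> ` U)) K" using assms by (simp add: compactin_subtopology)
 then have "compactin (subtopology (mtop M) U) (g ` K)" using gc by (rule image_compactin)
 then have "compactin (mtop M) (g ` K)" by (simp add: compactin_subtopology)
 moreover have "g ` K = {q\<in>U. \<phi> q \<in> K}"
 proof safe
  fix x assume x: "x \<in> K"
  then obtain q where "q \<in> U" "x = \<phi> q" using assms(2) by auto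
  then show "g x \<in> U" "\<phi> (g x) \<in> K" using gi x by auto
 next
  fix q assume "q \<in> U" "\<phi> q \<in> K" then show "q \<in> g ` K" using gi by (metis imageI)
 qed
 ultimately show ?thesis using smooth compactin_imp_closedin unfolding smooth_manifold_def by auto
qed

lemma smooth_function_chart: "f \<in> A ==> smooth_on n (\<phi> ` U) (%x. f (inv_into U \<phi> x))" using chart unfolding smooth_functions_def by auto

text \<open>Smoothness is local, and two open sets cover M: the preimage of C, where the function is
  u in the chart, and the complement of the preimage of K, where it is 0.\<close>

lemma smooth_function_extension:
 assumes C: "eopen n C" "C <= \<phi> ` U" and K: "compactin (Euclidean_space n) K" "K <= C"
  and u: "smooth_on n C u" "!!x. x \<in> C ==> x ~: K ==> u x = 0"
 shows "(%q. if q \<in> U & \<phi> q \<in> C then u (\<phi> q) else 0) \<in> A" (is "?f \<in> A")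
proof -
 have "smooth_on n (\<psi> ` W) (%x. ?f (inv_into W \<psi> x))" if W: "(W, \<psi>) \<in> matlas M" for W \<psi>
 proof (rule smooth_on_local)
  note W' = smooth_mfd.chart_open[OF smooth_mfd_axioms W] smooth_mfd.chart_image_open[OF smooth_mfd_axioms W]
   smooth_mfd.chart_open_image[OF smooth_mfd_axioms W] smooth_mfd.chart_inv[OF smooth_mfd_axioms W]
  show "eopen n (\<psi> ` W)" by (rule W')
  fix x assume "x \<in> \<psi> ` W"
  then obtain p where p: "p \<in> W" "x = \<psi> p" by auto
  show "\<exists>V. eopen n V & x \<in> V & smooth_on n V (%x. ?f (inv_into W \<psi> x))"
  proof (cases "p \<in> U & \<phi> p \<in> C")
   case True
   let ?S = "W \<inter> {q\<in>U. \<phi> q \<in> C}"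
   have o: "eopen n (\<psi> ` ?S)" using W'(1) chart_preimage_open[OF C] by (intro W'(3) openin_Int) auto
   have o2: "eopen n (\<psi> ` (W \<inter> U))" using W'(1) chart_open by (intro W'(3) openin_Int) auto
   have "smooth_on n (\<psi> ` ?S) (%x. u (\<phi> (inv_into W \<psi> x)))"
   proof (rule smooth_on_compose[OF o C(1) _ _ u(1)])
    show "\<phi> (inv_into W \<psi> x) \<in> C" if "x \<in> \<psi> ` ?S" for x using that W'(4) by auto
    show "smooth_on n (\<psi> ` ?S) (%x. \<phi> (inv_into W \<psi> x) j)" if "j < n" for j
    proof (rule smooth_on_mono[OF o2 o])
     show "smooth_on n (\<psi> ` (W \<inter> U)) (%x. \<phi> (inv_into W \<psi> x) j)"
      using smooth chart W that unfolding smooth_manifold_def by blast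
    qed auto
   qed
   then have "smooth_on n (\<psi> ` ?S) (%x. ?f (inv_into W \<psi> x))" by (subst smooth_on_cong[OF o]) (use W'(4) in auto)
   moreover have "x \<in> \<psi> ` ?S" using True p by auto
   ultimately show ?thesis using o by blast
  next
   case False
   let ?S = "W - {q\<in>U. \<phi> q \<in> K}"
   have o: "eopen n (\<psi> ` ?S)" using W'(1) chart_preimage_closed[OF K(1)] K(2) C(2) by (intro W'(3) openin_diff) auto
   have "smooth_on n (\<psi> ` ?S) (%x. ?f (inv_into W \<psi> x))"
   proof (subst smooth_on_cong[OF o, of _ "%_. 0"])
    fix x assume "x \<in> \<psi> ` ?S"
    then obtain q where "q \<in> W" "x = \<psi> q" "\<not> (q \<in> U & \<phi> q \<in> K)" by blast
    then show "(if inv_into W \<psi> x \<in> U & \<phi> (inv_into W \<psi> x) \<in> C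
      then u (\<phi> (inv_into W \<psi> x)) else 0) = 0" using W'(4) u(2) by simp
   qed (rule smooth_on_const[OF o])
   moreover have "x \<in> \<psi> ` ?S" using False p K(2) by auto
   ultimately show ?thesis using o by blast
  qed
 qed
 moreover have "?f p = 0" if "p ~: pts M" for p using that chart_subset by auto
 ultimately show ?thesis unfolding smooth_functions_def by auto
qed

end

section \<open>The algebra of smooth functions and its derivations\<close>

lemma A_add: "f \<in> A ==> g \<in> A ==> (%q. f q + g q) \<in> A" using chart_image_open by (auto simp: smooth_functions_def intro!: smooth_on_add)

lemma A_mult: "f \<in> A ==> g \<in> A ==> (%q. f q * g q) \<in> A" using chart_image_open by (auto simp: smooth_functions_def intro!: smooth_on_mult)

lemma A_cmult: "f \<in> A ==> (%q. c * f q) \<in> A"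
 using chart_image_open by (auto simp: smooth_functions_def intro!: smooth_on_mult smooth_on_const)

lemma A_const: "(%q. if q \<in> pts M then c else 0) \<in> A"
proof -
 have "smooth_on n (\<phi> ` U) (%x. if inv_into U \<phi> x \<in> pts M then c else 0)" if "(U, \<phi>) \<in> matlas M" for U \<phi>
  using chart_image_open[OF that] chart_inv_in[OF that] chart_subset[OF that]
  by (subst smooth_on_cong[where g="%_. c"]) (auto intro!: smooth_on_const)
 then show ?thesis by (auto simp: smooth_functions_def)
qed

lemma A_zero: "(%q. 0) \<in> A" using A_const[of 0] by simp

lemma A_minus: "f \<in> A ==> (%q. - f q) \<in> A" using A_cmult[of f "-1"] by simp

lemma A_diff: "f \<in> A ==> g \<in> A ==> (%q. f q - g q) \<in> A" using A_add[OF _ A_minus, of f g] by simp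

lemma A_sum: "(!!j. j \<in> J ==> F j \<in> A) ==> (%q. \<Sum>j\<in>J. F j q) \<in> A"
 by (induction J rule: infinite_finite_induct) (auto simp: A_zero intro!: A_add)

lemma A_outside: "f \<in> A ==> p ~: pts M ==> f p = 0" by (simp add: smooth_functions_def)

lemma tangent_add: "v \<in> tangent M p ==> f \<in> A ==> g \<in> A ==> v (%q. f q + g q) = v f + v g"
 by (simp add: tangent_def lin_on_def plus_fun_def)

lemma tangent_cmult: "v \<in> tangent M p ==> f \<in> A ==> v (%q. c * f q) = c * v f" by (simp add: tangent_def lin_on_def scaleR_fun_def)

lemma tangent_mult:
 "v \<in> tangent M p ==> f \<in> A ==> g \<in> A ==> v (%q. f q * g q) = v f * g p + f p * v g" by (simp add: tangent_def)

lemma tangent_outside: "v \<in> tangent M p ==> f ~: A ==> v f = 0" by (simp add: tangent_def)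

lemma tangent_zero: "v \<in> tangent M p ==> v (%q. 0) = 0" using tangent_cmult[of v p "%q. 0" 0] A_zero by simp

lemma tangent_minus: "v \<in> tangent M p ==> f \<in> A ==> v (%q. - f q) = - v f" using tangent_cmult[of v p f "-1"] by simp

lemma tangent_sum:
 assumes v: "v \<in> tangent M p"
 shows "(!!j. j \<in> J ==> F j \<in> A) ==> v (%q. \<Sum>j\<in>J. F j q) = (\<Sum>j\<in>J. v (F j))"
proof (induction J rule: infinite_finite_induct)
 case (insert j J)
 then show ?case using tangent_add[OF v, of "F j" "%q. \<Sum>j\<in>J. F j q"] A_sum[of J F] by simp
qed (simp_all add: tangent_zero[OF v])

lemma tangentI:
 assumes "!!f g. f \<in> A ==> g \<in> A ==> v (%q. f q + g q) = v f + v g"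
  and "!!c f. f \<in> A ==> v (%q. c * f q) = c * v f"
  and "!!f g. f \<in> A ==> g \<in> A ==> v (%q. f q * g q) = v f * g p + f p * v g"
  and "!!f. f ~: A ==> v f = 0"
 shows "v \<in> tangent M p" using assms by (simp add: tangent_def lin_on_def plus_fun_def scaleR_fun_def)

text \<open>With a bump function \<open>\<rho>\<close> supported in a chart with coordinates \<open>x\<^sub>j\<close>, Hadamard's lemma gives
  \<open>\<rho>\<^sup>2 df = \<Sum>\<^sub>j \<rho> (\<partial>\<^sub>j f) (d(\<rho> x\<^sub>j) - x\<^sub>j d\<rho>)\<close>; the functions \<open>\<rho> x\<^sub>j\<close> and \<open>\<rho>\<close> thus serve as the \<open>x\<^sub>i\<close> below.\<close>

lemma local_frame:
 assumes p: "p \<in> pts M"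
 shows "\<exists>(N::nat) \<kappa> x E. \<kappa> \<in> A & \<kappa> p ~= 0 & (\<forall>i<N. x i \<in> A & E i \<in> vector_fields M) &
   (\<forall>q\<in>pts M. \<forall>v\<in>tangent M q. \<forall>f\<in>A. \<kappa> q * v f = (\<Sum>i<N. v (x i) * E i q f))"
proof -
 obtain U \<phi> where ch: "(U, \<phi>) \<in> matlas M" and pU: "p \<in> U" using smooth p unfolding smooth_manifold_def by blast
 note [simp] = chart_inv[OF ch]
 define c where "c = \<phi> p"
 obtain \<delta> where \<delta>: "\<delta> > 0" "\<forall>y\<in>eucl n. (\<forall>i<n. \<bar>y i - c i\<bar> < \<delta>) --> y \<in> \<phi> ` U"
  using eopen_box[OF chart_image_open[OF ch], of c] pU by (auto simp: c_def)
 define r where "r = \<delta> / 2"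
 have r: "r > 0" "r < \<delta>" using \<delta>(1) by (auto simp: r_def)
 define C where "C = {x\<in>eucl n. \<forall>i<n. \<bar>x i - c i\<bar> < \<delta>}"
 define K where "K = {x\<in>eucl n. \<forall>i<n. \<bar>x i - c i\<bar> \<le> r}"
 have cE: "c \<in> eucl n" using pU eopen_subset[OF chart_image_open[OF ch]] by (auto simp: c_def)
 have C: "eopen n C"
 proof (rule eopen_boxI)
  fix x assume x: "x \<in> C"
  define e where "e = Min (insert 1 ((%i. \<delta> - \<bar>x i - c i\<bar>) ` {..<n}))"
  have e: "e > 0" unfolding e_def using x by (subst Min_gr_iff) (auto simp: C_def)
  have "\<bar>y i - c i\<bar> < \<delta>" if "\<bar>y i - x i\<bar> < e" "i < n" for y i
  proof -
   have "e \<le> \<delta> - \<bar>x i - c i\<bar>" unfolding e_def using that by simp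
   then show ?thesis using that by simp
  qed
  then show "\<exists>\<delta>>0. \<forall>y\<in>eucl n. (\<forall>i<n. \<bar>y i - x i\<bar> < \<delta>) --> y \<in> C"
   using e by (intro exI[of _ e]) (auto simp: C_def)
 qed (auto simp: C_def)
 have CU: "C <= \<phi> ` U" using \<delta>(2) by (auto simp: C_def)
 have KC: "K <= C" using r by (force simp: K_def C_def)
 have K: "compactin (Euclidean_space n) K"
 proof -
  have "K = (\<Pi>\<^sub>E i\<in>UNIV. if i < n then {c i - r..c i + r} else {0})"
   by (auto simp: K_def PiE_UNIV_domain Pi_iff abs_diff_le_iff algebra_simps split: if_splits)
  then have "compactin (powertop_real UNIV) K" by (auto simp: compactin_PiE)
  then show ?thesis unfolding Euclidean_space_def by (auto simp: compactin_subtopology K_def)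
 qed
 \<comment> \<open>Each pair of factors is nonzero exactly for c i - r < x i < c i + r, so b is
   supported in the box K.\<close>
 define b where "b x = (\<Prod>i<n. flat_exp 0 ((r - c i) + 1 * x i) * flat_exp 0 ((r + c i) + (-1) * x i))" for x
 have bsm: "smooth_on n V b" if "eopen n V" for V unfolding smooth_on_def b_def using that by (intro allI Ck_on_prod Ck_on_mult Ck_on_flat_exp)
 have b0: "b x = 0" if "x \<in> C" "x ~: K" for x
 proof -
  obtain i where i: "i < n" "\<bar>x i - c i\<bar> > r" using \<open>x \<in> C\<close> \<open>x ~: K\<close> by (auto simp: C_def K_def not_le)
  then have "flat_exp 0 ((r - c i) + 1 * x i) * flat_exp 0 ((r + c i) + (-1) * x i) = 0" by (auto simp: flat_exp_eq_0_iff)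
  then show ?thesis unfolding b_def using i(1) by auto
 qed
 have bc: "b c ~= 0" unfolding b_def using r by (subst prod_zero_iff) (auto simp: flat_exp_eq_0_iff)
 \<comment> \<open>All functions that exist only in the chart enter through \<open>cut\<close>:
   after multiplication with b they extend by zero to elements of \<open>A\<close>.\<close>
 define cut where "cut u q = (if q \<in> U & \<phi> q \<in> C then b (\<phi> q) * u (\<phi> q) else 0)" for u q
 have cutA: "cut u \<in> A" if "smooth_on n C u" for u
 proof -
  have e: "cut u = (%q. if q \<in> U & \<phi> q \<in> C then b (\<phi> q) * u (\<phi> q) else 0)" by (rule ext) (simp only: cut_def)
  have bu: "smooth_on n C (%x. b x * u x)" by (rule smooth_on_mult[OF C bsm[OF C] that])
  show ?thesis unfolding e by (rule smooth_function_extension[OF ch C CU K KC bu]) (simp add: b0)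
 qed
 have cutU: "cut u q = b (\<phi> q) * u (\<phi> q)" if "q \<in> U" "\<phi> q \<in> C" for u q using that by (simp add: cut_def)
 define loc where "loc f x = f (inv_into U \<phi> x)" for f :: "'a => real" and x
 have loc: "smooth_on n C (loc f)" if "f \<in> A" for f
 proof -
  have "loc f = (%x. f (inv_into U \<phi> x))" by (simp add: loc_def fun_eq_iff)
  then show ?thesis using smooth_on_mono[OF chart_image_open[OF ch] C CU smooth_function_chart[OF ch that]] by simp
 qed
 have loc_DERIV: "((%t. loc f (x(j := t))) has_real_derivative pderiv_at j (loc f) x) (at (x j))"
  if "f \<in> A" "j < n" "x \<in> C" for f j x by (rule smooth_on_DERIV[OF C loc[OF that(1)] that(2,3)])
 define \<rho> where "\<rho> = cut (%x. 1)"
 have \<rho>A: "\<rho> \<in> A" unfolding \<rho>_def by (intro cutA smooth_on_const C)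
 define y where "y j = cut (%x. x j)" for j
 have yA: "y j \<in> A" for j unfolding y_def by (intro cutA smooth_on_coord C)
 define T where "T w q f = (if f \<in> A then cut (%x. \<Sum>j<n. w j x * pderiv_at j (loc f) x) q else 0)"
  for w :: "nat => (nat => real) => real" and q f
 have T: "T w \<in> vector_fields M" if w: "!!j. j < n ==> smooth_on n C (w j)" for w
 proof -
  have t1: "T w q \<in> tangent M q" if "q \<in> pts M" for q
  proof (cases "q \<in> U & \<phi> q \<in> C")
   case True
   let ?x = "\<phi> q"
   have TU: "T w q f = b ?x * (\<Sum>j<n. w j ?x * pderiv_at j (loc f) ?x)" if "f \<in> A" for f using True that by (simp add: T_def cut_def)
   have qC: "?x \<in> C" using True by simp
   have lq: "loc f (?x(j := ?x j)) = f q" for f j using True by (simp add: loc_def)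
   show ?thesis
   proof (rule tangentI)
    fix f g assume f: "f \<in> A" and g: "g \<in> A"
    have "pderiv_at j (loc (%q. f q + g q)) ?x = pderiv_at j (loc f) ?x + pderiv_at j (loc g) ?x"
     if "j < n" for j using DERIV_add[OF loc_DERIV[OF f that qC] loc_DERIV[OF g that qC]] True
     unfolding pderiv_at_def by (intro DERIV_imp_deriv) (simp add: loc_def)
    then show "T w q (%q. f q + g q) = T w q f + T w q g" by (simp add: TU f g A_add sum.distrib algebra_simps)
    have "pderiv_at j (loc (%q. f q * g q)) ?x =
      pderiv_at j (loc f) ?x * g q + f q * pderiv_at j (loc g) ?x"
     if "j < n" for j using DERIV_mult[OF loc_DERIV[OF f that qC] loc_DERIV[OF g that qC]] True
     unfolding pderiv_at_def lq by (intro DERIV_imp_deriv) (simp add: loc_def mult.commute)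
    then show "T w q (%q. f q * g q) = T w q f * g q + f q * T w q g" by (simp add: TU f g A_mult sum.distrib algebra_simps sum_distrib_left)
   next
    fix a f assume f: "f \<in> A"
    have "pderiv_at j (loc (%q. a * f q)) ?x = a * pderiv_at j (loc f) ?x" if "j < n" for j using DERIV_cmult[OF loc_DERIV[OF f that qC], of a] True
     unfolding pderiv_at_def by (intro DERIV_imp_deriv) (simp add: loc_def)
    then show "T w q (%q. a * f q) = a * T w q f" by (simp add: TU f A_cmult algebra_simps sum_distrib_left)
   qed (simp add: T_def)
  next
   case False
   then have "T w q f = 0" for f by (auto simp: T_def cut_def)
   then show ?thesis by (intro tangentI) auto
  qed
  have t2: "T w q = 0" if "q ~: pts M" for q using that chart_subset[OF ch] by (auto simp: T_def cut_def fun_eq_iff)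
  have t3: "(%q. T w q f) \<in> A" if "f \<in> A" for f
  proof -
   have "smooth_on n C (%x. \<Sum>j<n. w j x * pderiv_at j (loc f) x)"
   proof (rule smooth_on_sum[OF C])
    fix j assume "j \<in> {..<n}"
    then have j: "j < n" by simp
    show "smooth_on n C (%x. w j x * pderiv_at j (loc f) x)" by (rule smooth_on_mult[OF C w[OF j] smooth_on_pderiv[OF C j loc[OF that]]])
   qed
   from cutA[OF this] show ?thesis by (simp only: T_def that if_True)
  qed
  have "(\<forall>q\<in>pts M. T w q \<in> tangent M q) & (\<forall>q. q ~: pts M --> T w q = 0) & (\<forall>f\<in>A. (%q. T w q f) \<in> A)"
   using t1 t2 t3 by blast
  then show ?thesis by (simp only: vector_fields_def mem_Collect_eq)
 qed
 define x where "x i = (if i < n then y i else \<rho>)" for i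
 \<comment> \<open>The last field has the coefficients - x j: it gathers the corrections - x j
   d\<rho> of all j at once, so that n + 1 pairs suffice.\<close>
 define E where "E i = (if i < n then T (%j x. if i = j then 1 else 0) else T (%j x. - x j))" for i :: nat
 have "x i \<in> A & E i \<in> vector_fields M" for i
 proof
  show "x i \<in> A" using yA \<rho>A by (simp add: x_def)
  have "smooth_on n C (%x. - x j)" for j using smooth_on_mult[OF C smooth_on_const[OF C, of "-1"] smooth_on_coord[OF C, of j]] by simp
  then have "T (%j x. - x j) \<in> vector_fields M" by (intro T)
  moreover have "T (%j x. if i = j then 1 else 0) \<in> vector_fields M" by (intro T smooth_on_const[OF C])
  ultimately show "E i \<in> vector_fields M" by (simp add: E_def)
 qed
 moreover have "\<rho> q * \<rho> q * v f = (\<Sum>i<Suc n. v (x i) * E i q f)"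
  if q: "q \<in> pts M" and v: "v \<in> tangent M q" and f: "f \<in> A" for q v f
 proof (cases "\<rho> q = 0")
  case True
  then have "cut u q = 0" for u by (auto simp: cut_def \<rho>_def)
  then have "E i q f = 0" for i by (simp add: E_def T_def)
  then show ?thesis using True by simp
 next
  case False
  then have qU: "q \<in> U" "\<phi> q \<in> C" by (auto simp: \<rho>_def cut_def split: if_splits)
  define z where "z = \<phi> q"
  have z: "z \<in> C" using qU by (simp add: z_def)
  have star: "segm z t x \<in> C" if x: "x \<in> C" and t: "t \<in> {0..1}" for x t
  proof -
   have "\<bar>z i + t * (x i - z i) - c i\<bar> < \<delta>" if "i < n" for i
   proof -
    have zx: "z i - c i \<in> {-\<delta><..<\<delta>}" "x i - c i \<in> {-\<delta><..<\<delta>}" using z x that by (auto simp: C_def abs_less_iff)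
    have "convex {-\<delta><..<\<delta>}" by (rule convex_real_interval)
    from convexD[OF this zx, of "1 - t" t] t
    have "(1 - t) * (z i - c i) + t * (x i - c i) \<in> {-\<delta><..<\<delta>}" by simp
    moreover have "(1 - t) * (z i - c i) + t * (x i - c i) = z i + t * (x i - z i) - c i" by (simp add: algebra_simps)
    ultimately show ?thesis by auto
   qed
   then show ?thesis using z x by (simp add: C_def segm_def)
  qed
  obtain g where g': "(\<forall>j<n. smooth_on n C (g j) & g j z = pderiv_at j (loc f) z) &
    (\<forall>x\<in>C. loc f x = loc f z + (\<Sum>j<n. (x j - z j) * g j x))" using Hadamard[OF C star z loc[OF f]] by auto
  then have g: "!!j. j < n ==> smooth_on n C (g j)" "!!j. j < n ==> g j z = pderiv_at j (loc f) z"
    "!!x. x \<in> C ==> loc f x = loc f z + (\<Sum>j<n. (x j - z j) * g j x)" by blast+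
  have lz: "loc f z = f q" using qU by (simp add: loc_def z_def)
  define w where "w j q' = y j q' + (- z j) * \<rho> q'" for j q'
  have wA: "w j \<in> A" for j unfolding w_def by (intro A_add A_cmult yA \<rho>A)
  have gA: "j < n ==> cut (g j) \<in> A" for j by (intro cutA g)
  \<comment> \<open>Hadamard's expansion of f at q holds in the box only. Two factors \<rho> make it
    global: one for the coordinate differences, one for the functions g j.\<close>
  have "\<rho> q' * (\<rho> q' * f q') = f q * (\<rho> q' * \<rho> q') + (\<Sum>j<n. w j q' * cut (g j) q')" for q'
  proof (cases "q' \<in> U & \<phi> q' \<in> C")
   case True
   then have "f q' = f q + (\<Sum>j<n. (\<phi> q' j - z j) * g j (\<phi> q'))" using g(3)[of "\<phi> q'"] lz by (simp add: loc_def)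
   moreover have "(\<Sum>j<n. w j q' * cut (g j) q') =
     b (\<phi> q') * b (\<phi> q') * (\<Sum>j<n. (\<phi> q' j - z j) * g j (\<phi> q'))" unfolding sum_distrib_left using True
    by (intro sum.cong) (simp_all add: w_def y_def \<rho>_def cut_def algebra_simps)
   moreover have "\<rho> q' = b (\<phi> q')" using True by (simp add: \<rho>_def cut_def)
   ultimately show ?thesis by (simp add: algebra_simps)
  qed (auto simp: \<rho>_def w_def y_def cut_def)
  then have eq: "(%q'. \<rho> q' * (\<rho> q' * f q')) = (%q'. f q * (\<rho> q' * \<rho> q') + (\<Sum>j<n. w j q' * cut (g j) q'))" by simp
  have "v (%q'. \<rho> q' * (\<rho> q' * f q')) = v (%q'. f q * (\<rho> q' * \<rho> q') + (\<Sum>j<n. w j q' * cut (g j) q'))" by (simp only: eq)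
  moreover have "v (%q'. \<Sum>j<n. w j q' * cut (g j) q') = (\<Sum>j<n. v (w j) * cut (g j) q + w j q * v (cut (g j)))"
   using gA by (subst tangent_sum[OF v])
    (auto intro!: sum.cong A_mult wA simp: tangent_mult[OF v wA gA])
  moreover have "(%q'. \<Sum>j<n. w j q' * cut (g j) q') \<in> A" by (intro A_sum A_mult wA gA) simp
  ultimately have "v \<rho> * (\<rho> q * f q) + \<rho> q * (v \<rho> * f q + \<rho> q * v f) =
    f q * (v \<rho> * \<rho> q + \<rho> q * v \<rho>) + (\<Sum>j<n. v (w j) * cut (g j) q + w j q * v (cut (g j)))"
   by (simp add: tangent_mult[OF v] tangent_add[OF v] tangent_cmult[OF v] f \<rho>A
     A_mult A_cmult)
  \<comment> \<open>After applying v with the Leibniz rule the derivatives of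
    \<open>cut (g j)\<close> disappear, and only the values of g j at q are left; these are the
    partial derivatives of f.\<close>
  moreover have "w j q = 0" for j using qU by (simp add: w_def y_def \<rho>_def cut_def z_def)
  moreover have "v (w j) = v (y j) - z j * v \<rho>" for j
  proof -
   have "w j = (%q'. y j q' + (- z j) * \<rho> q')" by (rule ext) (simp only: w_def)
   then show ?thesis by (simp only: tangent_add[OF v yA A_cmult[OF \<rho>A]] tangent_cmult[OF v \<rho>A]
       mult_minus_left[of "z j" "v \<rho>"] diff_conv_add_uminus)
  qed
  ultimately have "\<rho> q * \<rho> q * v f = (\<Sum>j<n. (v (y j) - z j * v \<rho>) * cut (g j) q)" by (simp add: algebra_simps)
  also have "\<dots> = (\<Sum>j<n. (v (y j) - z j * v \<rho>) * (b z * pderiv_at j (loc f) z))"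
   using g(2) qU by (intro sum.cong) (simp_all add: cut_def flip: z_def)
  also have "\<dots> = (\<Sum>i<n. v (y i) * (b z * pderiv_at i (loc f) z)) + v \<rho> * (b z * (\<Sum>j<n. - z j * pderiv_at j (loc f) z))"
   unfolding sum_distrib_left sum.distrib[symmetric] by (intro sum.cong) (simp_all add: algebra_simps)
  also have "\<dots> = (\<Sum>i<Suc n. v (x i) * E i q f)"
  proof -
   have "E i q f = b z * pderiv_at i (loc f) z" if "i < n" for i
   proof -
    have "(\<Sum>j<n. (if i = j then 1 else 0) * pderiv_at j (loc f) z) =
      (\<Sum>j<n. if i = j then pderiv_at j (loc f) z else 0)" by (rule sum.cong) simp_all
    also have "\<dots> = pderiv_at i (loc f) z" using that by simp
    finally have "(\<Sum>j<n. (if i = j then 1 else 0) * pderiv_at j (loc f) z) = pderiv_at i (loc f) z" .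
    then show ?thesis by (simp only: E_def that if_True T_def f cutU[OF qU] z_def)
   qed
   moreover have "E n q f = b z * (\<Sum>j<n. - z j * pderiv_at j (loc f) z)"
    by (simp only: E_def less_irrefl if_False if_True T_def f cutU[OF qU] z_def)
   ultimately show ?thesis unfolding sum.lessThan_Suc x_def by simp_all
  qed
  finally show ?thesis .
 qed
 moreover have "(%q. \<rho> q * \<rho> q) \<in> A" using \<rho>A by (intro A_mult)
 moreover have "\<rho> p * \<rho> p ~= 0" using pU bc cE \<delta>(1) by (simp add: \<rho>_def cut_def C_def flip: c_def)
 ultimately show ?thesis by blast
qed

end

subsection \<open>Shuffle sums\<close>

abbreviation wprod :: "('b => 'b => real) => 'b => 'b list => real" where
 "wprod w x ys \<equiv> \<Prod>y\<leftarrow>ys. w x y"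

text \<open>The sum over all unshuffles of a list into two blocks, of any length, in recursive form:
  the first entry goes to the left block, or it goes to the right block and pays w for every later
  entry that has to pass it on the way to the left. With w = -1 this is the signature, with w =
  (-1)^(product of degrees) the Koszul sign.\<close>

primrec shuf ::
  "('b => 'b => real) => ('b list => 'b list => 'c::real_vector) => 'b list => 'c" where
 "shuf w G [] = G [] []"
| "shuf w G (x # xs) = shuf w (%ys zs. G (x # ys) zs) xs
   + shuf w (%ys zs. wprod w x ys *\<^sub>R G ys (x # zs)) xs"

lemma shuf_cong:
 assumes "!!ys zs. mset ys + mset zs = mset xs ==> G ys zs = H ys zs"
 shows "shuf w G xs = shuf w H xs" using assms
proof (induction xs arbitrary: G H)
 case (Cons x xs)
 have "shuf w (%ys zs. G (x # ys) zs) xs = shuf w (%ys zs. H (x # ys) zs) xs" by (rule Cons.IH) (rule Cons.prems, simp)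
 moreover have "shuf w (%ys zs. wprod w x ys *\<^sub>R G ys (x # zs)) xs =
   shuf w (%ys zs. wprod w x ys *\<^sub>R H ys (x # zs)) xs" by (rule Cons.IH) (subst Cons.prems, simp_all)
 ultimately show ?case by simp
qed simp

lemma shuf_add:
 "shuf w (%ys zs. G ys zs + H ys zs) xs = shuf w G xs + shuf w H xs" by (induction xs arbitrary: G H) (simp_all add: scaleR_add_right)

lemma shuf_scaleR:
 "shuf w (%ys zs. c *\<^sub>R G ys zs) xs = c *\<^sub>R shuf w G xs"
proof (induction xs arbitrary: G)
 case (Cons x xs)
 show ?case by (simp add: scaleR_add_right Cons.IH[symmetric] mult.commute)
qed simp

lemma shuf_zero: "shuf w (%ys zs. 0) xs = 0" by (induction xs) simp_all

lemma shuf_minus: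
 "shuf w (%ys zs. - G ys zs) xs = - shuf w G xs" using shuf_scaleR[of w "-1" G xs] by simp

lemma shuf_eq_zero:
 "(!!ys zs. mset ys + mset zs = mset xs ==> G ys zs = 0) ==> shuf w G xs = 0" using shuf_cong[of xs G "%_ _. 0"] shuf_zero by metis

lemma shuf_map:
 "shuf w G (map v xs) = shuf (%i j. w (v i) (v j)) (%ys zs. G (map v ys) (map v zs)) xs" by (induction xs arbitrary: G) (simp_all add: comp_def)

primrec split_weight :: "('b => 'b => real) => 'b set => 'b list => real" where
 "split_weight w S [] = 1"
| "split_weight w S (x # xs) =
   (if x \<in> S then 1 else \<Prod>y\<leftarrow>filter (%y. y \<in> S) xs. w x y) * split_weight w S xs"

text \<open>The link from the recursion to sums over permutations: a splitting is the set of entries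
  that go to the left.\<close>

lemma shuf_subsets:
 "distinct xs ==> shuf w G xs =
  (\<Sum>S\<in>Pow (set xs). split_weight w S xs *\<^sub>R G (filter (%x. x \<in> S) xs) (filter (%x. x ~: S) xs))"
proof (induction xs arbitrary: G)
 case (Cons x xs)
 let ?F = "%S. split_weight w S (x # xs) *\<^sub>R
   G (filter (%y. y \<in> S) (x # xs)) (filter (%y. y ~: S) (x # xs))"
 have x: "x ~: set xs" and d: "distinct xs" using Cons.prems by auto
 have inj: "inj_on (insert x) (Pow (set xs))" using x by (auto simp: inj_on_def)
 have w: "split_weight w (insert x S) ys = split_weight w S ys" if "x ~: set ys" for S ys using that
 proof (induction ys)
  case (Cons y ys)
  then have "filter (%z. z \<in> insert x S) ys = filter (%z. z \<in> S) ys" by (auto intro: filter_cong)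
  then show ?case using Cons by auto
 qed simp
 have f: "filter (%y. y = x \<or> y \<in> S) xs = filter (%y. y \<in> S) xs"
  "filter (%y. y ~= x & y ~: S) xs = filter (%y. y ~: S) xs" for S using x by (auto intro: filter_cong)
 have "(\<Sum>S\<in>Pow (set (x # xs)). ?F S) = (\<Sum>S\<in>Pow (set xs). ?F S) + (\<Sum>S\<in>insert x ` Pow (set xs). ?F S)"
  unfolding list.set(2) Pow_insert using x by (intro sum.union_disjoint) auto
 also have "(\<Sum>S\<in>insert x ` Pow (set xs). ?F S) = (\<Sum>S\<in>Pow (set xs). ?F (insert x S))" by (subst sum.reindex[OF inj]) simp
 also have "\<dots> = shuf w (%ys zs. G (x # ys) zs) xs" unfolding Cons.IH[OF d] by (intro sum.cong) (simp_all add: w x f)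
 also have "(\<Sum>S\<in>Pow (set xs). ?F S) = shuf w (%ys zs. wprod w x ys *\<^sub>R G ys (x # zs)) xs" unfolding Cons.IH[OF d]
 proof (intro sum.cong refl)
  fix S assume "S \<in> Pow (set xs)"
  then have "x ~: S" using x by auto
  then show "?F S = split_weight w S xs *\<^sub>R (\<Prod>y\<leftarrow>filter (%y. y \<in> S) xs. w x y) *\<^sub>R
    G (filter (%y. y \<in> S) xs) (x # filter (%y. y ~: S) xs)" by (simp add: mult.commute)
 qed
 finally show ?case by simp
qed simp

text \<open>With suitable w this is the signature or the Koszul sign of the permutation listed by
  its values.\<close>

primrec inversion_weight :: "('b::linorder => 'b => real) => 'b list => real" where
 "inversion_weight w [] = 1"
| "inversion_weight w (x # xs) = (\<Prod>y\<leftarrow>filter (%y. y < x) xs. w x y) * inversion_weight w xs"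

lemma prod_list_filter_nth:
 fixes f :: "'b => 'c::comm_monoid_mult"
 shows "(\<Prod>y\<leftarrow>filter P xs. f y) = (\<Prod>j | j < length xs & P (xs ! j). f (xs ! j))"
proof -
 have "(\<Prod>y\<leftarrow>filter P xs. f y) = (\<Prod>j<length xs. if P (xs ! j) then f (xs ! j) else 1)"
 proof (induction xs)
  case (Cons x xs)
  show ?case unfolding list.size add_0_right add_Suc_right prod.lessThan_Suc_shift nth_Cons_0 nth_Cons_Suc using Cons by simp
 qed simp
 also have "\<dots> = (\<Prod>j\<in>{j\<in>{..<length xs}. P (xs ! j)}. f (xs ! j))" by (rule prod.inter_filter[symmetric]) simp
 finally show ?thesis by simp
qed

lemma prod_inversions:
 "(\<Prod>(i, j) \<in> {(i, j). i < j & j < length L & L ! j < L ! i}. w (L ! i) (L ! j)) = inversion_weight w L"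
proof (induction L)
 case (Cons x L)
 let ?A = "(%j. (0::nat, Suc j)) ` {j. j < length L & L ! j < x}"
 let ?I = "{(i, j). i < j & j < length L & L ! j < L ! i}"
 let ?B = "(%(i, j). (Suc i, Suc j)) ` ?I"
 let ?f = "%(i, j). w ((x # L) ! i) ((x # L) ! j)"
 have fin: "finite ?I" by (rule finite_subset[of _ "{..<length L} \<times> {..<length L}"]) auto
 have "{(i, j). i < j & j < length (x # L) & (x # L) ! j < (x # L) ! i} = ?A \<union> ?B"
 proof (rule Set.set_eqI)
  fix z :: "nat \<times> nat"
  obtain i j where z: "z = (i, j)" by force
  show "z \<in> {(i, j). i < j & j < length (x # L) & (x # L) ! j < (x # L) ! i} \<longleftrightarrow> z \<in> ?A \<union> ?B"
   unfolding z by (cases i; cases j) (auto simp: image_iff)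
 qed
 then have "prod ?f {(i, j). i < j & j < length (x # L) & (x # L) ! j < (x # L) ! i} = prod ?f ?A * prod ?f ?B"
  using fin by (simp only:) (intro prod.union_disjoint, auto)
 also have "prod ?f ?A = (\<Prod>j | j < length L & L ! j < x. w x (L ! j))" by (subst prod.reindex) (auto simp: inj_on_def)
 also have "prod ?f ?B = (\<Prod>(i, j)\<in>?I. w (L ! i) (L ! j))" by (subst prod.reindex) (auto simp: inj_on_def split_def)
 finally show ?case using Cons by (simp add: prod_list_filter_nth)
qed simp

lemma prod_list_map_mset:
 fixes f :: "'b => 'c::comm_monoid_mult"
 shows "mset xs = mset ys ==> (\<Prod>x\<leftarrow>xs. f x) = (\<Prod>x\<leftarrow>ys. f x)" by (metis mset_map prod_mset_prod_list)

lemma inversion_weight_insort: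
 fixes G :: "'b::linorder list => 'c::real_vector"
 assumes "!!pre x y post. set (pre @ x # y # post) <= S ==> y < x ==>
   G (pre @ x # y # post) = w x y *\<^sub>R G (pre @ y # x # post)"
  and "sorted T" "x ~: set T" "insert x (set T) <= S"
 shows "G (x # T) = (\<Prod>y\<leftarrow>filter (%y. y < x) T. w x y) *\<^sub>R G (insort x T)" using assms
proof (induction T arbitrary: G)
 case (Cons y T)
 show ?case
 proof (cases "x \<le> y")
  case True
  then have "filter (%z. z < x) (y # T) = []" using Cons.prems(2) by (auto simp: filter_empty_conv)
  then show ?thesis using True by simp
 next
  case False
  then have yx: "y < x" by simp
  have "G (x # y # T) = w x y *\<^sub>R G (y # x # T)" using Cons.prems(1)[of "[]" x y T] Cons.prems(4) yx by simp
  also have "G (y # x # T) = (\<Prod>y\<leftarrow>filter (%y. y < x) T. w x y) *\<^sub>R G (y # insort x T)"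
  proof (rule Cons.IH)
   fix pre x' y' post assume "set (pre @ x' # y' # post) <= S" "y' < x'"
   then show "G (y # pre @ x' # y' # post) = w x' y' *\<^sub>R G (y # pre @ y' # x' # post)"
    using Cons.prems(1)[of "y # pre" x' y' post] Cons.prems(4) by simp
  qed (use Cons.prems in auto)
  finally show ?thesis using False yx by simp
 qed
qed simp

text \<open>Insertion sort uses adjacent exchanges only and undoes every inversion exactly once. So
  a sign rule for neighbours implies the rule for arbitrary permutations; this serves for the
  signature and for the symmetry of the multibrackets.\<close>

lemma inversion_weight_sort:
 fixes G :: "'b::linorder list => 'c::real_vector"
 assumes "!!pre x y post. set (pre @ x # y # post) <= S ==> y < x ==>
   G (pre @ x # y # post) = w x y *\<^sub>R G (pre @ y # x # post)"
  and "distinct L" "set L <= S"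
 shows "G L = inversion_weight w L *\<^sub>R G (sort L)" using assms
proof (induction L arbitrary: G)
 case (Cons x L)
 have "G (x # L) = inversion_weight w L *\<^sub>R G (x # sort L)"
 proof (rule Cons.IH)
  fix pre x' y' post assume "set (pre @ x' # y' # post) <= S" "y' < x'"
  then show "G (x # pre @ x' # y' # post) = w x' y' *\<^sub>R G (x # pre @ y' # x' # post)"
   using Cons.prems(1)[of "x # pre" x' y' post] Cons.prems(3) by simp
 qed (use Cons.prems in auto)
 also have "G (x # sort L) = (\<Prod>y\<leftarrow>filter (%y. y < x) (sort L). w x y) *\<^sub>R G (insort x (sort L))"
  by (rule inversion_weight_insort[where S=S]) (use Cons.prems in auto)
 also have "(\<Prod>y\<leftarrow>filter (%y. y < x) (sort L). w x y) = (\<Prod>y\<leftarrow>filter (%y. y < x) L. w x y)"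
  by (rule prod_list_map_mset) (simp add: mset_filter)
 finally show ?case by (simp add: mult.commute)
qed simp

lemma inversion_weight_append:
 assumes "\<forall>a\<in>set A. x < a" "\<forall>b\<in>set B. x < b"
 shows "inversion_weight w (A @ x # B) = (\<Prod>a\<leftarrow>A. w a x) * inversion_weight w (A @ B)" using assms(1)
proof (induction A)
 case Nil
 have "filter (%y. y < x) B = []" using assms(2) by (auto simp: filter_empty_conv)
 then show ?case by simp
qed simp

text \<open>In a sorted list the inversions created by moving S to the front are the pairs of an
  entry outside S and a later entry in S. The two products list such a pair in opposite orders,
  whence the symmetry of w.\<close>

lemma inversion_weight_split:
 assumes "sorted_wrt (<) xs" and w: "!!x y. w x y = w y x"
 shows "inversion_weight w (filter (%x. x \<in> S) xs @ filter (%x. x ~: S) xs) = split_weight w S xs" using assms(1)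
proof (induction xs)
 case (Cons x xs)
 show ?case
 proof (cases "x \<in> S")
  case True
  have "filter (%y. y < x) (filter (%x. x \<in> S) xs @ filter (%x. x ~: S) xs) = []" using Cons.prems by (auto simp: filter_empty_conv)
  then show ?thesis using True Cons by simp
 next
  case False
  have "inversion_weight w (filter (%x. x \<in> S) xs @ x # filter (%x. x ~: S) xs) =
    (\<Prod>a\<leftarrow>filter (%x. x \<in> S) xs. w a x) * inversion_weight w (filter (%x. x \<in> S) xs @ filter (%x. x ~: S) xs)"
   using Cons.prems by (intro inversion_weight_append) auto
  then show ?thesis using False Cons w[of _ x] by simp
 qed
qed simp

definition list_perm :: "nat list => nat => nat" where
 "list_perm L = (%i. if i < length L then L ! i else i)"

lemma list_perm_permutes:
 assumes "distinct L" "set L = {..<length L}"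
 shows "list_perm L permutes {..<length L}"
proof -
 have "bij_betw (%i. L ! i) {..<length L} {..<length L}" using bij_betw_nth[OF assms(1) refl] assms(2) by simp
 then have "bij_betw (list_perm L) {..<length L} {..<length L}" by (subst bij_betw_cong[of _ _ "%i. L ! i"]) (auto simp: list_perm_def)
 then show ?thesis by (intro bij_imp_permutes) (auto simp: list_perm_def)
qed

lemma list_perm_map:
 assumes "\<sigma> permutes {..<n}" shows "list_perm (map \<sigma> [0..<n]) = \<sigma>"
 using permutes_not_in[OF assms] by (auto simp: list_perm_def fun_eq_iff)

lemma sort_map_permutes:
 assumes "\<sigma> permutes {..<n}" shows "sort (map \<sigma> [0..<n]) = [0..<n]"
proof (rule sorted_distinct_set_unique)
 have "set (map \<sigma> [0..<n]) = {..<n}" using permutes_image[OF assms] by (simp add: atLeast0LessThan)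
 then show "set (sort (map \<sigma> [0..<n])) = set [0..<n]" by (simp add: atLeast0LessThan)
 show "distinct (sort (map \<sigma> [0..<n]))" using permutes_inj_on[OF assms] by (simp add: distinct_map)
qed auto

lemma prod_inversions_permutes:
 "(\<Prod>(i, j) \<in> {(i, j). i < j & j < n & \<sigma> j < \<sigma> i}. w (\<sigma> i) (\<sigma> j)) =
   inversion_weight w (map \<sigma> [0..<n])"
proof -
 have "(\<Prod>(i, j) \<in> {(i, j). i < j & j < n & \<sigma> j < \<sigma> i}. w (\<sigma> i) (\<sigma> j)) =
  (\<Prod>(i, j) \<in> {(i, j). i < j & j < length (map \<sigma> [0..<n]) & map \<sigma> [0..<n] ! j < map \<sigma> [0..<n] ! i}.
   w (map \<sigma> [0..<n] ! i) (map \<sigma> [0..<n] ! j))"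
 proof (rule prod.cong)
  show "{(i, j). i < j & j < n & \<sigma> j < \<sigma> i} = {(i, j). i < j & j < length (map \<sigma> [0..<n]) &
   map \<sigma> [0..<n] ! j < map \<sigma> [0..<n] ! i}" by (rule Set.set_eqI, rule prod.induct) auto
 qed (auto simp: split_def)
 then show ?thesis unfolding prod_inversions .
qed

lemma koszul_sign_inversion_weight:
 "koszul_sign d \<sigma> n = inversion_weight (%i j. (-1) powi (d i * d j)) (map \<sigma> [0..<n])"
 unfolding koszul_sign_def prod_inversions_permutes[symmetric] ..

lemma sign_inversion_weight:
 assumes "\<sigma> permutes {..<n}"
 shows "of_int (sign \<sigma>) = inversion_weight (%_ _. -1) (map \<sigma> [0..<n])"
proof -
 \<comment> \<open>The signature as a function of the list of values; it changes sign under adjacent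
   exchanges, so that sorting computes it.\<close>
 define G :: "nat list => real" where
  "G L = (if distinct L & length L = n then of_int (sign (list_perm L)) else 0)" for L
 have "G (map \<sigma> [0..<n]) = inversion_weight (%_ _. -1) (map \<sigma> [0..<n]) *\<^sub>R G (sort (map \<sigma> [0..<n]))"
 proof (rule inversion_weight_sort)
  fix pre post and x y :: nat assume S: "set (pre @ x # y # post) <= {..<n}"
  let ?L = "pre @ x # y # post" and ?L' = "pre @ y # x # post"
  show "G ?L = -1 *\<^sub>R G ?L'"
  proof (cases "distinct ?L & length ?L = n")
   case True
   have c: "set ?L = {..<length ?L}" using S True distinct_card[of ?L] by (intro card_subset_eq) auto
   have p: "list_perm ?L permutes {..<length ?L}" using True c by (intro list_perm_permutes) auto
   have t: "list_perm ?L' = list_perm ?L \<circ> Transposition.transpose (length pre) (Suc (length pre))"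
    by (rule ext) (auto simp: list_perm_def Transposition.transpose_def nth_append nth_Cons')
   have "sign (list_perm ?L') = - sign (list_perm ?L)" unfolding t using permutes_imp_permutation[OF _ p]
    by (subst sign_compose) (auto simp: sign_swap_id permutation_swap_id)
   then show ?thesis using True by (auto simp: G_def)
  qed (auto simp: G_def)
 next
  show "distinct (map \<sigma> [0..<n])" using permutes_inj_on[OF assms] by (simp add: distinct_map)
  show "set (map \<sigma> [0..<n]) <= {..<n}" using permutes_image[OF assms] by (simp add: atLeast0LessThan)
 qed
 moreover have "G [0..<n] = 1"
 proof -
  have "list_perm [0..<n] = id" by (auto simp: list_perm_def fun_eq_iff)
  then show ?thesis by (simp add: G_def)
 qed
 moreover have "G (map \<sigma> [0..<n]) = of_int (sign \<sigma>)"
  using permutes_inj_on[OF assms] by (simp add: G_def list_perm_map[OF assms] distinct_map)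
 ultimately show ?thesis by (simp add: sort_map_permutes[OF assms])
qed

text \<open>Both sides are increasing lists with the same entries. Hence an unshuffle is determined
  by the set of its first r values.\<close>

lemma unshuffle_blocks:
 assumes \<sigma>: "\<sigma> \<in> unshuffles r n" and r: "r \<le> n"
 shows "map \<sigma> [0..<r] = filter (%x. x \<in> \<sigma> ` {..<r}) [0..<n]"
  and "map \<sigma> [r..<n] = filter (%x. x ~: \<sigma> ` {..<r}) [0..<n]"
proof -
 have p: "\<sigma> permutes {..<n}" and m: "strict_mono_on {..<r} \<sigma>" "strict_mono_on {r..<n} \<sigma>"
  using \<sigma> by (auto simp: unshuffles_def)
 have inj: "inj \<sigma>" using permutes_inj[OF p] .
 have im: "\<sigma> ` {..<n} = {..<n}" using permutes_image[OF p] .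
 show "map \<sigma> [0..<r] = filter (%x. x \<in> \<sigma> ` {..<r}) [0..<n]"
 proof (rule sorted_distinct_set_unique)
  show "sorted (map \<sigma> [0..<r])" unfolding sorted_map using m(1)
   by (intro sorted_wrt_mono_rel[OF _ sorted_wrt_upt]) (auto simp: strict_mono_on_def le_less)
  show "distinct (map \<sigma> [0..<r])" using inj by (simp add: distinct_map inj_on_def)
  have "\<sigma> ` {..<r} <= \<sigma> ` {..<n}" using r by (intro image_mono) auto
  then show "set (map \<sigma> [0..<r]) = set (filter (%x. x \<in> \<sigma> ` {..<r}) [0..<n])" unfolding im by (auto simp: image_subset_iff)
 qed (auto simp: sorted_wrt_filter)
 show "map \<sigma> [r..<n] = filter (%x. x ~: \<sigma> ` {..<r}) [0..<n]"
 proof (rule sorted_distinct_set_unique)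
  show "sorted (map \<sigma> [r..<n])" unfolding sorted_map using m(2)
   by (intro sorted_wrt_mono_rel[OF _ sorted_wrt_upt]) (auto simp: strict_mono_on_def le_less)
  show "distinct (map \<sigma> [r..<n])" using inj by (simp add: distinct_map inj_on_def)
  have "\<sigma> ` {r..<n} = \<sigma> ` ({..<n} - {..<r})" by (rule arg_cong[where f="image \<sigma>"]) auto
  also have "\<dots> = {..<n} - \<sigma> ` {..<r}" by (simp only: image_set_diff[OF inj] im)
  finally show "set (map \<sigma> [r..<n]) = set (filter (%x. x ~: \<sigma> ` {..<r}) [0..<n])" by auto
 qed (auto simp: sorted_wrt_filter)
qed

lemma unshuffle_of_subset:
 assumes S: "S <= {..<n}"
 defines "L \<equiv> filter (%x. x \<in> S) [0..<n] @ filter (%x. x ~: S) [0..<n]"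
 shows "list_perm L \<in> unshuffles (card S) n" "list_perm L ` {..<card S} = S"
proof -
 have sf: "set (filter (%x. x \<in> S) [0..<n]) = S" using S by auto
 have d: "distinct L" unfolding L_def by auto
 have l1: "length (filter (%x. x \<in> S) [0..<n]) = card S" using distinct_card[of "filter (%x. x \<in> S) [0..<n]"] sf by simp
 have sL: "set L = {..<n}" unfolding L_def by auto
 have lL: "length L = n" using distinct_card[OF d] sL by simp
 have cS: "card S \<le> n" using card_mono[OF _ S] by simp
 have n1: "list_perm L i = filter (%x. x \<in> S) [0..<n] ! i" if "i < card S" for i
  using that cS l1 lL by (simp add: list_perm_def) (simp add: L_def nth_append)
 have n2: "list_perm L i = filter (%x. x ~: S) [0..<n] ! (i - card S)" if "card S \<le> i" "i < n" for i
  using that l1 lL by (simp add: list_perm_def) (simp add: L_def nth_append)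
 have l2: "length (filter (%x. x ~: S) [0..<n]) = n - card S" using lL l1 unfolding L_def by simp
 have s1: "sorted_wrt (<) (filter (%x. x \<in> S) [0..<n])" "sorted_wrt (<) (filter (%x. x ~: S) [0..<n])" by (auto intro: sorted_wrt_filter)
 have "strict_mono_on {..<card S} (list_perm L)" using s1(1) l1 by (auto simp: strict_mono_on_def n1 sorted_wrt_iff_nth_less)
 moreover have "strict_mono_on {card S..<n} (list_perm L)" using s1(2) l2 by (auto simp: strict_mono_on_def n2 sorted_wrt_iff_nth_less)
 moreover have "list_perm L permutes {..<n}" using list_perm_permutes[OF d] sL lL by simp
 ultimately show "list_perm L \<in> unshuffles (card S) n" by (simp add: unshuffles_def)
 have "list_perm L ` {..<card S} = (%i. filter (%x. x \<in> S) [0..<n] ! i) ` {..<card S}" using n1 by (intro image_cong) auto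
 also have "\<dots> = set (filter (%x. x \<in> S) [0..<n])" unfolding set_conv_nth l1 by auto
 finally show "list_perm L ` {..<card S} = S" using sf by simp
qed

text \<open>Reindexing by the set of the first r values turns the sum over permutations into the
  subset form of \<open>shuf\<close>.\<close>

lemma sum_unshuffles:
 assumes r: "r \<le> n" and w: "!!x y. w x y = w y x"
 shows "(\<Sum>\<sigma>\<in>unshuffles r n. inversion_weight w (map \<sigma> [0..<n]) *\<^sub>R G (map \<sigma> [0..<r]) (map \<sigma> [r..<n])) =
  shuf w (%ys zs. if length ys = r then G ys zs else 0) [0..<n]"
proof -
 let ?f = "%S. filter (%x. x \<in> S) [0..<n]" and ?g = "%S. filter (%x. x ~: S) [0..<n]"
 have l: "length (?f S) = card S" if "S <= {..<n}" for S
 proof -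
  have "set (?f S) = S" using that by auto
  then show ?thesis using distinct_card[of "?f S"] by simp
 qed
 have split: "map \<sigma> [0..<n] = map \<sigma> [0..<r] @ map \<sigma> [r..<n]" for \<sigma> :: "nat => nat"
  using upt_add_eq_append[of 0 r "n - r"] r by simp
 have "shuf w (%ys zs. if length ys = r then G ys zs else 0) [0..<n] =
  (\<Sum>S\<in>Pow {..<n}. split_weight w S [0..<n] *\<^sub>R (if length (?f S) = r then G (?f S) (?g S) else 0))"
  by (subst shuf_subsets) (simp_all add: atLeast0LessThan)
 also have "\<dots> = (\<Sum>S | S <= {..<n} & card S = r. split_weight w S [0..<n] *\<^sub>R G (?f S) (?g S))"
  by (intro sum.mono_neutral_cong_right) (auto simp: l)
 also have "\<dots> = (\<Sum>\<sigma>\<in>unshuffles r n. inversion_weight w (map \<sigma> [0..<n]) *\<^sub>R G (map \<sigma> [0..<r]) (map \<sigma> [r..<n]))"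
 proof (rule sum.reindex_bij_witness[where j="%S. list_perm (?f S @ ?g S)" and i="%\<sigma>. \<sigma> ` {..<r}"])
  fix S assume "S \<in> {S. S <= {..<n} & card S = r}"
  then have S: "S <= {..<n}" "card S = r" by auto
  note u = unshuffle_of_subset[OF S(1), unfolded S(2)]
  show "list_perm (?f S @ ?g S) ` {..<r} = S" "list_perm (?f S @ ?g S) \<in> unshuffles r n" by (fact u)+
  show "inversion_weight w (map (list_perm (?f S @ ?g S)) [0..<n]) *\<^sub>R
    G (map (list_perm (?f S @ ?g S)) [0..<r]) (map (list_perm (?f S @ ?g S)) [r..<n]) =
    split_weight w S [0..<n] *\<^sub>R G (?f S) (?g S)" unfolding split unshuffle_blocks[OF u(1) r] u(2)
   by (subst inversion_weight_split) (use w in \<open>auto simp: sorted_wrt_upt\<close>)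
 next
  fix \<sigma> assume \<sigma>: "\<sigma> \<in> unshuffles r n"
  then have p: "\<sigma> permutes {..<n}" by (simp add: unshuffles_def)
  show "list_perm (?f (\<sigma> ` {..<r}) @ ?g (\<sigma> ` {..<r})) = \<sigma>"
   unfolding unshuffle_blocks[OF \<sigma> r, symmetric] split[symmetric] by (rule list_perm_map[OF p])
  have "\<sigma> ` {..<r} <= \<sigma> ` {..<n}" using r by (intro image_mono) auto
  moreover have "card (\<sigma> ` {..<r}) = r" using permutes_inj_on[OF p, of "{..<r}"] by (simp add: card_image)
  ultimately show "\<sigma> ` {..<r} \<in> {S. S <= {..<n} & card S = r}" using permutes_image[OF p] by auto
 qed
 finally show ?thesis by simp
qed

lemma sum_unshuffles_sign:
 fixes G :: "'b list => 'b list => real"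
 assumes r: "r \<le> length xs"
 shows "(\<Sum>\<sigma>\<in>unshuffles r (length xs). of_int (sign \<sigma>) *
   G (map (%i. xs ! \<sigma> i) [0..<r]) (map (%i. xs ! \<sigma> i) [r..<length xs])) =
  shuf (%_ _. -1) (%ys zs. if length ys = r then G ys zs else 0) xs"
proof -
 have "(\<Sum>\<sigma>\<in>unshuffles r (length xs). of_int (sign \<sigma>) *
   G (map (%i. xs ! \<sigma> i) [0..<r]) (map (%i. xs ! \<sigma> i) [r..<length xs])) =
  (\<Sum>\<sigma>\<in>unshuffles r (length xs). inversion_weight (%_ _. -1) (map \<sigma> [0..<length xs]) *\<^sub>R
   G (map (nth xs) (map \<sigma> [0..<r])) (map (nth xs) (map \<sigma> [r..<length xs])))"
  by (intro sum.cong refl) (simp add: unshuffles_def sign_inversion_weight comp_def)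
 also have "\<dots> = shuf (%_ _. -1)
   (%ys zs. if length ys = r then G (map (nth xs) ys) (map (nth xs) zs) else 0) [0..<length xs]" by (rule sum_unshuffles[OF r]) simp
 also have "\<dots> = shuf (%_ _. -1) (%ys zs. if length ys = r then G ys zs else 0) (map (nth xs) [0..<length xs])" unfolding shuf_map by simp
 finally show ?thesis by (simp add: map_nth)
qed

lemma shuf_lengths:
 assumes "length xs \<le> N"
 shows "(\<Sum>r\<le>N. shuf w (%ys zs. if length ys = r then G ys zs else 0) xs) = shuf w G xs" using assms
proof -
 have s: "(\<Sum>r\<le>N. shuf w (%ys zs. H r ys zs) xs) = shuf w (%ys zs. \<Sum>r\<le>N. H r ys zs) xs" for H
  by (induction N) (simp_all add: shuf_add)
 show ?thesis unfolding s
 proof (rule shuf_cong)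
  fix ys zs assume "mset ys + mset zs = mset xs"
  then have "length ys \<le> length xs" by (metis le_add1 size_mset size_union)
  then show "(\<Sum>r\<le>N. if length ys = r then G ys zs else 0) = G ys zs" using assms by simp
 qed
qed

lemma wedge_shuf: "wedge A B xs = shuf (%_ _. -1) (%ys zs. A ys * B zs) xs" unfolding wedge_def
 using sum_unshuffles_sign[of _ xs "%ys zs. A ys * B zs"] shuf_lengths[OF order_refl, of "%_ _. -1" "%ys zs. A ys * B zs"] by (simp add: mult.assoc)

subsection \<open>Alternating maps of mixed degree\<close>

definition alt_all :: "'v::real_vector set => ('v list => real) set" where
 "alt_all V = {A. multilin_on V A &
   (\<forall>xs. set xs <= V & \<not> distinct xs --> A xs = 0) & (\<forall>xs. \<not> set xs <= V --> A xs = 0)}"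

lemma alt_maps_iff:
 "A \<in> alt_maps V k \<longleftrightarrow> A \<in> alt_all V & (\<forall>xs. length xs ~= k --> A xs = 0)"
 unfolding alt_maps_def alt_all_def by blast

lemma alt_allD:
 assumes "A \<in> alt_all V"
 shows alt_all_outside: "\<not> set xs <= V ==> A xs = 0"
  and alt_all_nondistinct: "\<not> distinct xs ==> A xs = 0"
  and alt_all_add: "set pre <= V ==> set post <= V ==> x \<in> V ==> y \<in> V ==>
   A (pre @ (x + y) # post) = A (pre @ x # post) + A (pre @ y # post)"
  and alt_all_scaleR: "set pre <= V ==> set post <= V ==> x \<in> V ==>
   A (pre @ (c *\<^sub>R x) # post) = c * A (pre @ x # post)"
proof -
 show o: "\<not> set xs <= V ==> A xs = 0" using assms by (simp add: alt_all_def)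
 show "\<not> distinct xs ==> A xs = 0" using assms o by (cases "set xs <= V") (simp_all add: alt_all_def)
qed (use assms in \<open>simp_all add: alt_all_def multilin_on_def lin_on_def\<close>)

lemma alt_all_zero: "A \<in> alt_all V ==> 0 \<in> V ==> A (pre @ 0 # post) = 0"
 using alt_all_scaleR[of A V pre post 0 0] alt_all_outside[of A V "pre @ 0 # post"] by (cases "set pre <= V & set post <= V") auto

context
 fixes V :: "'v::real_vector set" and A :: "'v list => real"
 assumes ml: "multilin_on V A" and V: "subspace V"
  and adj: "!!pre x post. set pre <= V ==> x \<in> V ==> set post <= V ==> A (pre @ x # x # post) = 0"
begin

lemma adjacent_swap:
 assumes "set pre <= V" "x \<in> V" "y \<in> V" "set post <= V"
 shows "A (pre @ x # y # post) = - A (pre @ y # x # post)"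
proof -
 have add: "A (pre @ (u + v) # post) = A (pre @ u # post) + A (pre @ v # post)"
  if "set pre <= V" "set post <= V" "u \<in> V" "v \<in> V" for pre post u v using ml that by (simp add: multilin_on_def lin_on_def)
 have "0 = A (pre @ (x + y) # (x + y) # post)" using adj[OF assms(1) subspace_add[OF V assms(2,3)] assms(4)] by simp
 also have "\<dots> = A (pre @ x # (x + y) # post) + A (pre @ y # (x + y) # post)" using assms subspace_add[OF V assms(2,3)] by (intro add) auto
 also have "A (pre @ x # (x + y) # post) = A (pre @ x # x # post) + A (pre @ x # y # post)" using add[of "pre @ [x]" post x y] assms by simp
 also have "A (pre @ y # (x + y) # post) = A (pre @ y # x # post) + A (pre @ y # y # post)" using add[of "pre @ [y]" post x y] assms by simp
 finally show ?thesis using adj assms by simp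
qed

lemma adjacent_nondistinct:
 assumes "set xs <= V" "\<not> distinct xs" shows "A xs = 0"
proof -
 obtain p x q r where xs: "xs = p @ [x] @ q @ [x] @ r" using not_distinct_decomp[OF assms(2)] by blast
 have "A (p @ x # q @ x # r) = 0" if "set (p @ x # q @ x # r) <= V" for p using that
 proof (induction q arbitrary: p)
  case Nil then show ?case using adj by simp
 next
  case (Cons y q)
  have "A (p @ x # (y # q) @ x # r) = - A ((p @ [y]) @ x # q @ x # r)" using adjacent_swap[of p x y "q @ x # r"] Cons.prems by simp
  also have "A ((p @ [y]) @ x # q @ x # r) = 0" using Cons.prems by (intro Cons.IH) auto
  finally show ?case by simp
 qed
 then show ?thesis using assms(1) xs by simp
qed

text \<open>Equal entries at a distance are brought together by adjacent exchanges, so it suffices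
  to check equal neighbours; this is what recursions over the argument list can verify.\<close>

lemma alt_allI_adjacent:
 assumes "!!xs. \<not> set xs <= V ==> A xs = 0" shows "A \<in> alt_all V" using ml adjacent_nondistinct assms by (auto simp: alt_all_def)

end

lemma alt_all_swap:
 assumes "A \<in> alt_all V" "subspace V"
 shows "A (pre @ x # y # post) = - A (pre @ y # x # post)"
proof (cases "set (pre @ x # y # post) <= V")
 case True
 show ?thesis by (rule adjacent_swap[of V]) (use assms True alt_all_nondistinct[OF assms(1)] in \<open>auto simp: alt_all_def\<close>)
next
 case False
 then show ?thesis using alt_all_outside[OF assms(1), of "pre @ x # y # post"] alt_all_outside[OF assms(1), of "pre @ y # x # post"] by auto
qed

definition contract :: "'v => ('v list => real) => 'v list => real" where
 "contract x A ys = A (x # ys)"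

text \<open>Stands in for the factor (-1)^deg, which makes no sense for an element of mixed
  degree.\<close>

definition parity :: "('v list => real) => 'v list => real" where
 "parity A xs = (-1) ^ length xs * A xs"

lemma alt_all_contract:
 assumes "A \<in> alt_all V" "x \<in> V" shows "contract x A \<in> alt_all V"
proof -
 have "multilin_on V (contract x A)" using assms alt_all_add[OF assms(1), of "x # _"] alt_all_scaleR[OF assms(1), of "x # _"]
  by (auto simp: multilin_on_def lin_on_def contract_def)
 then show ?thesis using assms alt_all_nondistinct[OF assms(1)] alt_all_outside[OF assms(1)] by (simp add: alt_all_def contract_def)
qed

lemma alt_all_parity:
 assumes "A \<in> alt_all V" shows "parity A \<in> alt_all V"
proof -
 have "multilin_on V (parity A)" using alt_all_add[OF assms] alt_all_scaleR[OF assms]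
  by (auto simp: multilin_on_def lin_on_def parity_def algebra_simps)
 then show ?thesis using alt_all_nondistinct[OF assms] alt_all_outside[OF assms] by (simp add: alt_all_def parity_def)
qed

lemma parity_parity [simp]: "parity (parity A) = A" by (rule ext) (simp add: parity_def flip: power_add)

lemma contract_parity: "contract x (parity A) = - parity (contract x A)" by (rule ext) (simp add: parity_def contract_def fun_Compl_def)

lemma contract_contract:
 assumes "A \<in> alt_all V" shows "contract x (contract x A) = 0" by (rule ext) (simp add: contract_def alt_all_nondistinct[OF assms] zero_fun_def)

lemma subspace_alt_all: "subspace (alt_all V)" unfolding subspace_def
 by (auto simp: alt_all_def multilin_on_def lin_on_def plus_fun_def zero_fun_def scaleR_fun_def algebra_simps)

subsection \<open>Tangent vectors, covectors and vector fields\<close>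

context smooth_mfd
begin

abbreviation "T p \<equiv> tangent M p"
abbreviation "C p \<equiv> cotangent M p"
abbreviation "VF \<equiv> vector_fields M"
abbreviation "dif p \<equiv> diff_at M p"

lemma subspace_tangent: "subspace (T p)" unfolding subspace_def
 by (auto intro!: tangentI simp: tangent_add tangent_cmult tangent_mult tangent_outside algebra_simps
   plus_fun_def zero_fun_def scaleR_fun_def)

lemma subspace_cotangent: "subspace (C p)" using subspace_tangent[of p]
 by (auto simp: subspace_def cotangent_def lin_on_def plus_fun_def zero_fun_def scaleR_fun_def algebra_simps)

lemma dif_cotangent: "dif p f \<in> C p" using subspace_tangent[of p]
 by (auto simp: cotangent_def lin_on_def diff_at_def subspace_def plus_fun_def scaleR_fun_def)

lemma dif_add: "f \<in> A ==> g \<in> A ==> dif p (%q. f q + g q) = dif p f + dif p g" by (auto simp: diff_at_def tangent_add fun_eq_iff)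

lemma dif_cmult: "f \<in> A ==> dif p (%q. c * f q) = c *\<^sub>R dif p f" by (auto simp: diff_at_def tangent_cmult fun_eq_iff scaleR_fun_def)

lemma dif_mult: "f \<in> A ==> g \<in> A ==> dif p (%q. f q * g q) = g p *\<^sub>R dif p f + f p *\<^sub>R dif p g"
 by (auto simp: diff_at_def tangent_mult fun_eq_iff scaleR_fun_def)

lemma tan_zero: "0 \<in> T p" by (rule subspace_0[OF subspace_tangent])

lemma VF_tangent: "X \<in> VF ==> p \<in> pts M ==> X p \<in> T p"
 and VF_outside: "X \<in> VF ==> p ~: pts M ==> X p = 0"
 and VF_smooth: "X \<in> VF ==> f \<in> A ==> (%p. X p f) \<in> A" by (simp_all add: vector_fields_def)

lemma VFI: "(!!p. p \<in> pts M ==> X p \<in> T p) ==> (!!p. p ~: pts M ==> X p = 0) ==>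
  (!!f. f \<in> A ==> (%p. X p f) \<in> A) ==> X \<in> VF" by (simp add: vector_fields_def)

lemma VF_tangent': "X \<in> VF ==> X p \<in> T p" using VF_tangent VF_outside tan_zero by metis

lemma subspace_VF: "subspace VF"
proof -
 have "0 \<in> VF" by (rule VFI) (simp_all add: tan_zero A_zero)
 moreover have "X + Y \<in> VF" if "X \<in> VF" "Y \<in> VF" for X Y using that subspace_tangent
  by (intro VFI) (simp_all add: VF_tangent VF_outside VF_smooth subspace_add A_add zero_fun_def)
 moreover have "c *\<^sub>R X \<in> VF" if "X \<in> VF" for X c
 proof (rule VFI)
  fix p
  have e: "(c *\<^sub>R X) p = c *\<^sub>R X p" by (simp add: scaleR_fun_def)
  show "(c *\<^sub>R X) p \<in> T p" if "p \<in> pts M"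
   unfolding e using VF_tangent[OF \<open>X \<in> VF\<close> that] by (rule subspace_scale[OF subspace_tangent])
  show "(c *\<^sub>R X) p = 0" if "p ~: pts M" unfolding e VF_outside[OF \<open>X \<in> VF\<close> that] by (rule scaleR_zero_right)
  show "(%p. (c *\<^sub>R X) p f) \<in> A" if "f \<in> A" for f
   using A_cmult[OF VF_smooth[OF \<open>X \<in> VF\<close> that]] by (simp add: scaleR_fun_def)
 qed
 ultimately show ?thesis by (simp add: subspace_def)
qed

definition vmul :: "('a => real) => ('a => 'a tan) => 'a => 'a tan" where
 "vmul g X p = g p *\<^sub>R X p"

lemma vmul_VF:
 assumes g: "g \<in> A" and X: "X \<in> VF" shows "vmul g X \<in> VF"
proof (rule VFI)
 fix p
 show "vmul g X p \<in> T p" if "p \<in> pts M" unfolding vmul_def using VF_tangent[OF X that] by (rule subspace_scale[OF subspace_tangent])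
 show "vmul g X p = 0" if "p ~: pts M" unfolding vmul_def VF_outside[OF X that] by (rule scaleR_zero_right)
 show "(%p. vmul g X p f) \<in> A" if "f \<in> A" for f using A_mult[OF g VF_smooth[OF X that]] by (simp add: vmul_def scaleR_fun_def)
qed

definition at_frame where
 "at_frame p N \<kappa> x E \<longleftrightarrow> \<kappa> \<in> A & \<kappa> p ~= 0 & (\<forall>i<N::nat. x i \<in> A & E i \<in> VF) &
   (\<forall>q\<in>pts M. \<forall>v\<in>T q. \<forall>f\<in>A. \<kappa> q * v f = (\<Sum>i<N. v (x i) * E i q f))"

lemma ex_frame: "p \<in> pts M ==> \<exists>N \<kappa> x E. at_frame p N \<kappa> x E" using local_frame unfolding at_frame_def by blast

lemma frame_tangent:
 assumes F: "at_frame p N \<kappa> x E" and p: "p \<in> pts M" and v: "v \<in> T p"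
 shows "v = (\<Sum>i<N. (v (x i) / \<kappa> p) *\<^sub>R E i p)"
proof
 fix f
 have s: "(\<Sum>i<N. (v (x i) / \<kappa> p) *\<^sub>R E i p) f = (\<Sum>i<N. v (x i) / \<kappa> p * E i p f)"
  by (induction N) (simp_all add: zero_fun_def plus_fun_def scaleR_fun_def)
 show "v f = (\<Sum>i<N. (v (x i) / \<kappa> p) *\<^sub>R E i p) f"
 proof (cases "f \<in> A")
  case True
  have "\<kappa> p * v f = (\<Sum>i<N. v (x i) * E i p f)" using F p v True by (simp add: at_frame_def)
  moreover have "\<kappa> p ~= 0" using F by (simp add: at_frame_def)
  ultimately have "v f = (\<Sum>i<N. v (x i) * E i p f) / \<kappa> p" by (simp add: field_simps)
  then show ?thesis unfolding s by (simp add: sum_divide_distrib)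
 next
  case False
  have "E i p f = 0" if "i < N" for i using F that p False by (auto simp: at_frame_def intro: tangent_outside[OF VF_tangent])
  then show ?thesis unfolding s using tangent_outside[OF v False] by simp
 qed
qed

lemma cotangent_sum:
 assumes "\<xi> \<in> C p" "!!i. i \<in> I ==> w i \<in> T p"
 shows "\<xi> (\<Sum>i\<in>I. c i *\<^sub>R w i) = (\<Sum>i\<in>I. c i * \<xi> (w i))" using assms(2)
proof (induction I rule: infinite_finite_induct)
 case (insert i I)
 have "(\<Sum>i\<in>I. c i *\<^sub>R w i) \<in> T p"
  using insert.prems by (intro subspace_sum[OF subspace_tangent] subspace_scale[OF subspace_tangent]) auto
 moreover have "c i *\<^sub>R w i \<in> T p" "w i \<in> T p" using insert.prems by (auto intro: subspace_scale[OF subspace_tangent])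
 ultimately have "\<xi> (c i *\<^sub>R w i + (\<Sum>i\<in>I. c i *\<^sub>R w i)) = c i * \<xi> (w i) + \<xi> (\<Sum>i\<in>I. c i *\<^sub>R w i)"
  using assms(1) by (simp add: cotangent_def lin_on_def)
 moreover have "\<xi> (\<Sum>i\<in>I. c i *\<^sub>R w i) = (\<Sum>i\<in>I. c i * \<xi> (w i))" using insert by simp
 ultimately show ?case by (simp only: sum.insert[OF insert(1,2)])
next
 case empty
 have "lin_on (T p) \<xi>" using assms(1) by (simp add: cotangent_def)
 then have "\<xi> (0 *\<^sub>R 0) = 0 *\<^sub>R \<xi> 0" using tan_zero unfolding lin_on_def by blast
 then show ?case by (simp only: sum.empty scaleR_zero_left)
next
 case (infinite I)
 have "lin_on (T p) \<xi>" using assms(1) by (simp add: cotangent_def)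
 then have "\<xi> (0 *\<^sub>R 0) = 0 *\<^sub>R \<xi> 0" using tan_zero unfolding lin_on_def by blast
 then show ?case by (simp only: sum.infinite[OF infinite(1)] scaleR_zero_left)
qed

text \<open>Applying \<xi> to the frame expansion of v shows that \<xi> agrees with the differential
  of a linear combination of the x i with constant coefficients. This allows multivector fields to
  be evaluated on functions only.\<close>

lemma cotangent_dif:
 assumes p: "p \<in> pts M" and \<xi>: "\<xi> \<in> C p"
 shows "\<exists>f\<in>A. dif p f = \<xi>"
proof -
 obtain N \<kappa> x E where F: "at_frame p N \<kappa> x E" using ex_frame[OF p] by blast
 then have x: "x i \<in> A" and E: "E i p \<in> T p" if "i < N" for i using that p VF_tangent by (auto simp: at_frame_def)
 define f where "f q = (\<Sum>i<N. \<xi> (E i p) / \<kappa> p * x i q)" for q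
 have "f = (%q. \<Sum>i<N. \<xi> (E i p) / \<kappa> p * x i q)" by (rule ext) (simp only: f_def)
 moreover have s: "(%q. \<xi> (E i p) / \<kappa> p * x i q) \<in> A" if "i \<in> {..<N}" for i using that x by (intro A_cmult) simp
 ultimately have f: "f \<in> A" by (simp only: A_sum)
 have vf: "v f = (\<Sum>i<N. \<xi> (E i p) / \<kappa> p * v (x i))" if v: "v \<in> T p" for v
 proof -
  have "v f = (\<Sum>i<N. v (%q. \<xi> (E i p) / \<kappa> p * x i q))" unfolding \<open>f = _\<close> by (rule tangent_sum[OF v s])
  also have "\<dots> = (\<Sum>i<N. \<xi> (E i p) / \<kappa> p * v (x i))" using x by (intro sum.cong refl tangent_cmult[OF v]) simp
  finally show ?thesis .
 qed
 have "dif p f v = \<xi> v" for v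
 proof (cases "v \<in> T p")
  case True
  have "\<xi> v = \<xi> (\<Sum>i<N. (v (x i) / \<kappa> p) *\<^sub>R E i p)" using frame_tangent[OF F p True] by (rule arg_cong)
  also have "\<dots> = (\<Sum>i<N. v (x i) / \<kappa> p * \<xi> (E i p))" using E by (intro cotangent_sum[OF \<xi>]) simp
  finally show ?thesis using vf[OF True] True by (simp add: diff_at_def mult.commute)
 next
  case False then show ?thesis using \<xi> by (simp add: cotangent_def diff_at_def)
 qed
 then show ?thesis using f by blast
qed

lemma tangent_extends:
 assumes p: "p \<in> pts M" and v: "v \<in> T p"
 shows "\<exists>X\<in>VF. X p = v"
proof -
 obtain N \<kappa> x E where F: "at_frame p N \<kappa> x E" using ex_frame[OF p] by blast
 let ?X = "\<Sum>i<N. (v (x i) / \<kappa> p) *\<^sub>R E i"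
 have "?X \<in> VF" using F by (intro subspace_sum[OF subspace_VF] subspace_scale[OF subspace_VF]) (auto simp: at_frame_def)
 moreover have "?X p = (\<Sum>i<N. (v (x i) / \<kappa> p) *\<^sub>R E i p)" by (induction N) (simp_all add: zero_fun_def plus_fun_def scaleR_fun_def)
 ultimately show ?thesis using frame_tangent[OF F p v] by auto
qed

text \<open>The difference Z of X and Y vanishes at p, and \<kappa> Z is the combination of the E i
  with coefficients Z (x i), which are smooth functions vanishing at p; function linearity then
  gives \<kappa> p * F Z = 0.\<close>

lemma tensorial:
 fixes F :: "('a => 'a tan) => real"
 assumes p: "p \<in> pts M"
  and add: "!!X Y. X \<in> VF ==> Y \<in> VF ==> F (X + Y) = F X + F Y"
  and mul: "!!g X. g \<in> A ==> X \<in> VF ==> F (vmul g X) = g p * F X"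
  and XY: "X \<in> VF" "Y \<in> VF" "X p = Y p"
 shows "F X = F Y"
proof -
 obtain N \<kappa> x E where F: "at_frame p N \<kappa> x E" using ex_frame[OF p] by blast
 have F0: "F 0 = 0" using add[of 0 0] subspace_0[OF subspace_VF] by simp
 let ?Z = "X + (-1) *\<^sub>R Y"
 have mY: "(-1) *\<^sub>R Y \<in> VF" using XY by (intro subspace_scale[OF subspace_VF])
 have Z: "?Z \<in> VF" using mY XY subspace_add[OF subspace_VF] by blast
 have Zp: "?Z p = 0" using XY by (simp add: plus_fun_def scaleR_fun_def fun_eq_iff)
 have FS: "F (\<Sum>i\<in>I. vmul (g i) (E i)) = (\<Sum>i\<in>I. g i p * F (E i))"
  if "!!i. i \<in> I ==> g i \<in> A & E i \<in> VF" for g and I :: "nat set" using that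
 proof (induction I rule: infinite_finite_induct)
  case (insert i I)
  have "(\<Sum>i\<in>I. vmul (g i) (E i)) \<in> VF" using insert.prems vmul_VF by (intro subspace_sum[OF subspace_VF]) auto
  then have "F (vmul (g i) (E i) + (\<Sum>i\<in>I. vmul (g i) (E i))) = g i p * F (E i) + (\<Sum>i\<in>I. g i p * F (E i))"
   using insert vmul_VF by (simp only: add mul insert_iff simp_thms)
  then show ?case unfolding sum.insert[OF insert(1,2)] .
 qed (simp_all only: sum.empty sum.infinite not_False_eq_True F0)
 have "vmul \<kappa> ?Z = (\<Sum>i<N. vmul (%q. ?Z q (x i)) (E i))"
 proof (rule ext, rule ext)
  fix q f
  have s: "(\<Sum>i<N. vmul (%q. ?Z q (x i)) (E i)) q f = (\<Sum>i<N. ?Z q (x i) * E i q f)"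
   by (induction N) (simp_all add: vmul_def zero_fun_def plus_fun_def scaleR_fun_def)
  show "vmul \<kappa> ?Z q f = (\<Sum>i<N. vmul (%q. ?Z q (x i)) (E i)) q f"
  proof (cases "q \<in> pts M & f \<in> A")
   case True
   then have "\<kappa> q * ?Z q f = (\<Sum>i<N. ?Z q (x i) * E i q f)" using F VF_tangent[OF Z] unfolding at_frame_def by blast
   then show ?thesis unfolding s by (simp add: vmul_def scaleR_fun_def)
  next
   case False
   have 0: "W q f = 0" if "W \<in> VF" for W using False VF_outside[OF that, of q] tangent_outside[OF VF_tangent'[OF that, of q], of f]
    by (cases "q \<in> pts M") (simp_all only: simp_thms zero_fun_apply)
   have "?Z q f = 0" "!!i. i < N ==> E i q f = 0" using F by (auto simp only: at_frame_def intro: 0[OF Z] 0)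
   then show ?thesis unfolding s by (simp add: vmul_def scaleR_fun_def)
  qed
 qed
 then have "\<kappa> p * F ?Z = F (\<Sum>i<N. vmul (%q. ?Z q (x i)) (E i))" using mul[OF _ Z, of \<kappa>] F by (simp add: at_frame_def)
 also have "\<dots> = (\<Sum>i<N. ?Z p (x i) * F (E i))" using F VF_smooth[OF Z] by (intro FS) (auto simp: at_frame_def)
 also have "\<dots> = 0" unfolding Zp by simp
 finally have "F ?Z = 0" using F by (simp add: at_frame_def)
 moreover have "X = ?Z + Y" by simp
 then have "F X = F ?Z + F Y" using add[OF Z XY(2)] by metis
 ultimately show ?thesis by simp
qed

lemma subst_slots:
 assumes F: "!!pre x y post. set pre <= S ==> x \<in> S ==> y \<in> S ==> set post <= S ==> val x = val y ==>
   F (pre @ x # post) = F (pre @ y # post)"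
  and xs: "set xs <= S" "set ys <= S" "map val xs = map val ys"
 shows "F xs = F ys"
proof -
 have "F (pre @ xs) = F (pre @ ys)" if "set pre <= S" for pre using xs that
 proof (induction xs arbitrary: ys pre)
  case (Cons x xs)
  then obtain y ys' where ys: "ys = y # ys'" "val x = val y" "map val xs = map val ys'" by (cases ys) auto
  have "F (pre @ x # xs) = F (pre @ y # xs)" using Cons.prems ys by (intro F) auto
  also have "\<dots> = F ((pre @ [y]) @ xs)" by simp
  also have "\<dots> = F ((pre @ [y]) @ ys')" using Cons.prems ys by (intro Cons.IH) auto
  finally show ?case using ys by simp
 qed simp
 from this[of "[]"] show ?thesis by simp
qed

end

subsection \<open>Forms and multivector fields of mixed degree\<close>

context smooth_mfd
begin

text \<open>A common frame for forms and multivector fields: S is the space of arguments at a point,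
  G consists of the global objects on which smoothness is tested (vector fields or functions), and
  \<open>val\<close> takes such an object to an argument at a point.\<close>

definition smooth_alt :: "('a => 'v::real_vector set) => 'g set => ('a => 'g => 'v) => ('a => 'v list => real) set" where
 "smooth_alt S G val = {P. (\<forall>p\<in>pts M. P p \<in> alt_all (S p)) & (\<forall>p. p ~: pts M --> P p = 0) &
   (\<forall>gs. set gs <= G --> (%p. P p (map (val p) gs)) \<in> A)}"

lemma subspace_smooth_alt: "subspace (smooth_alt S G val)"
proof -
 have sc: "(c *\<^sub>R P) p = c *\<^sub>R P p" "(c *\<^sub>R P p) xs = c * P p xs" for c p xs and P :: "'a => 'b list => real"
  by (simp_all add: scaleR_fun_def)
 show ?thesis unfolding subspace_def smooth_alt_def
  by (auto simp: sc subspace_0[OF subspace_alt_all] subspace_add[OF subspace_alt_all] subspace_scale[OF subspace_alt_all]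
   A_zero A_add A_cmult)
qed

lemma smooth_alt_homogeneous_iff:
 "(\<forall>p\<in>pts M. P p \<in> alt_maps (S p) k) & (\<forall>p. p ~: pts M --> P p = 0) &
   (\<forall>gs. length gs = k & set gs <= G --> (%p. P p (map (val p) gs)) \<in> A) \<longleftrightarrow>
  P \<in> smooth_alt S G val & (\<forall>p xs. length xs ~= k --> P p xs = 0)" (is "?L \<longleftrightarrow> ?R")
proof
 assume L: ?L
 have len: "P p xs = 0" if "length xs ~= k" for p xs using L that by (cases "p \<in> pts M") (auto simp: alt_maps_iff)
 have "(%p. P p (map (val p) gs)) \<in> A" if "set gs <= G" for gs using L that by (cases "length gs = k") (auto simp: len A_zero)
 then show ?R using L len by (auto simp: smooth_alt_def alt_maps_iff)
qed (auto simp: smooth_alt_def alt_maps_iff)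

definition MV :: "'a mvf set" where
 "MV = {P. (\<forall>p\<in>pts M. P p \<in> alt_all (C p)) & (\<forall>p. p ~: pts M --> P p = 0) &
   (\<forall>fs. set fs <= A --> (%p. P p (map (dif p) fs)) \<in> A)}"

definition FM :: "'a form set" where
 "FM = {om. (\<forall>p\<in>pts M. om p \<in> alt_all (T p)) & (\<forall>p. p ~: pts M --> om p = 0) &
   (\<forall>Xs. set Xs <= VF --> (%p. om p (map (%X. X p) Xs)) \<in> A)}"

lemma MV_smooth_alt: "MV = smooth_alt C A dif" and FM_smooth_alt: "FM = smooth_alt T VF (%p X. X p)" by (simp_all add: MV_def FM_def smooth_alt_def)

lemma multivector_fields_iff:
 "P \<in> multivector_fields M a \<longleftrightarrow> P \<in> MV & (\<forall>p xs. length xs ~= a --> P p xs = 0)"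
 unfolding MV_smooth_alt smooth_alt_homogeneous_iff[symmetric] by (auto simp: multivector_fields_def)

lemma forms_iff:
 "om \<in> forms M k \<longleftrightarrow> om \<in> FM & (\<forall>p xs. length xs ~= k --> om p xs = 0)"
 unfolding FM_smooth_alt smooth_alt_homogeneous_iff[symmetric] by (auto simp: forms_def)

lemma MV_alt: "P \<in> MV ==> P p \<in> alt_all (C p)" using subspace_0[OF subspace_alt_all] by (cases "p \<in> pts M") (simp_all add: MV_def)

lemma FM_alt: "om \<in> FM ==> om p \<in> alt_all (T p)" using subspace_0[OF subspace_alt_all] by (cases "p \<in> pts M") (simp_all add: FM_def)

lemma MV_outside: "P \<in> MV ==> p ~: pts M ==> P p xs = 0" by (simp add: MV_def)

lemma FM_outside: "om \<in> FM ==> p ~: pts M ==> om p xs = 0" by (simp add: FM_def)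

definition ev :: "'a mvf => ('a => real) list => 'a => real" where
 "ev P fs = (%p. P p (map (dif p) fs))"

definition evf :: "'a form => ('a => 'a tan) list => 'a => real" where
 "evf om Xs = (%p. om p (map (%X. X p) Xs))"

lemma ev_smooth: "P \<in> MV ==> set fs <= A ==> ev P fs \<in> A" by (simp add: MV_def ev_def)

lemma evf_smooth: "om \<in> FM ==> set Xs <= VF ==> evf om Xs \<in> A" by (simp add: FM_def evf_def)

text \<open>The differential obeys the Leibniz rule, so a multivector field is a tangent vector in
  each slot, and the rules for tangent vectors apply slotwise.\<close>

lemma MV_derivation:
 assumes "P \<in> MV"
 shows "(%f. if f \<in> A then P p (pre @ dif p f # post) else 0) \<in> T p"
proof (cases "set pre <= C p & set post <= C p")
 case True
 note a = alt_all_add[OF MV_alt[OF assms, of p]] and s = alt_all_scaleR[OF MV_alt[OF assms, of p]]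
 have sc: "c *\<^sub>R dif p f \<in> C p" for c f using dif_cotangent by (rule subspace_scale[OF subspace_cotangent])
 show ?thesis using True by (intro tangentI)
   (simp_all add: A_add A_cmult A_mult
    dif_add dif_cmult dif_mult a s sc dif_cotangent)
next
 case False
 then have "P p (pre @ dif p f # post) = 0" for f by (intro alt_all_outside[OF MV_alt[OF assms]]) auto
 then show ?thesis by (intro tangentI) simp_all
qed

definition delta :: "('a => real) => 'a mvf => 'a mvf" where
 "delta f P p = contract (dif p f) (P p)"

definition par :: "('a => 'v list => real) => 'a => 'v list => real" where
 "par P p = parity (P p)"

definition iprod :: "('a => 'a tan) => 'a form => 'a form" where
 "iprod X om p = contract (X p) (om p)"

lemma ev_delta: "ev (delta f P) fs = ev P (f # fs)" by (simp add: ev_def delta_def contract_def)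

lemma evf_iprod: "evf (iprod X om) Xs = evf om (X # Xs)" by (simp add: evf_def iprod_def contract_def)

lemma ev_par: "ev (par P) fs = (%p. (-1) ^ length fs * ev P fs p)" by (simp add: ev_def par_def parity_def)

lemma delta_MV: "f \<in> A ==> P \<in> MV ==> delta f P \<in> MV" using ev_smooth[of P "f # _"]
 by (auto simp: MV_def delta_def ev_def intro: alt_all_contract[OF _ dif_cotangent])
  (simp_all add: contract_def fun_eq_iff)

lemma iprod_FM: "X \<in> VF ==> om \<in> FM ==> iprod X om \<in> FM" using evf_smooth[of om "X # _"]
 by (auto simp: FM_def iprod_def evf_def intro: alt_all_contract[OF _ VF_tangent'])
  (simp_all add: contract_def fun_eq_iff)

lemma par_MV: "P \<in> MV ==> par P \<in> MV" by (auto simp: MV_def par_def intro: alt_all_parity)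
  (simp_all add: parity_def fun_eq_iff A_cmult)

lemma par_FM: "om \<in> FM ==> par om \<in> FM" by (auto simp: FM_def par_def intro: alt_all_parity)
  (simp_all add: parity_def fun_eq_iff A_cmult)

lemma par_par [simp]: "par (par P) = P" by (rule ext) (simp add: par_def)

lemma delta_par: "delta f (par P) = - par (delta f P)" by (intro ext) (simp add: delta_def par_def contract_parity)

lemma delta_linear:
 "delta f (P + Q) = delta f P + delta f Q" "delta f (c *\<^sub>R P) = c *\<^sub>R delta f P"
 "delta f (- P) = - delta f P" "delta f 0 = 0" by (intro ext; simp add: delta_def contract_def scaleR_fun_def)+

lemma par_linear:
 "par (P + Q) = par P + par Q" "par (c *\<^sub>R P) = c *\<^sub>R par P" "par (- P) = - par P" "par 0 = 0"
 by (intro ext; simp add: par_def parity_def scaleR_fun_def algebra_simps)+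

lemma subspace_MV: "subspace MV" and subspace_FM: "subspace FM" unfolding MV_smooth_alt FM_smooth_alt by (rule subspace_smooth_alt)+

section \<open>Tensors from their values on functions or vector fields\<close>

definition cofun :: "'a => 'a cotan => 'a => real" where
 "cofun p \<xi> = (SOME f. f \<in> A & dif p f = \<xi>)"

definition vfext :: "'a => 'a tan => 'a => 'a tan" where
 "vfext p v = (SOME X. X \<in> VF & X p = v)"

lemma cofun: "p \<in> pts M ==> \<xi> \<in> C p ==> cofun p \<xi> \<in> A & dif p (cofun p \<xi>) = \<xi>"
 unfolding cofun_def using cotangent_dif[of p \<xi>] by (intro someI_ex[of "%f. f \<in> A & dif p f = \<xi>"]) blast

lemma vfext: "p \<in> pts M ==> v \<in> T p ==> vfext p v \<in> VF & vfext p v p = v"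
 unfolding vfext_def using tangent_extends[of p v] by (intro someI_ex[of "%X. X \<in> VF & X p = v"]) blast

text \<open>Pointwise arguments are replaced by chosen global representatives. This yields the
  existence half of the definite descriptions.\<close>

definition mk_alt :: "('a => 'v set) => ('a => 'v => 'g) => ('g list => 'a => real) => 'a => 'v list => real" where
 "mk_alt S r F p xs = (if p \<in> pts M & set xs <= S p then F (map (r p) xs) p else 0)"

context
 fixes S :: "'a => 'v::real_vector set" and G :: "'g set" and val :: "'a => 'g => 'v" and r :: "'a => 'v => 'g"
 assumes S: "!!p. subspace (S p)" and val: "!!p g. g \<in> G ==> val p g \<in> S p"
  and r: "!!p x. p \<in> pts M ==> x \<in> S p ==> r p x \<in> G & val p (r p x) = x"
begin

lemma smooth_alt_repr:
 assumes "p \<in> pts M" "set xs <= S p" shows "set (map (r p) xs) <= G" "map (val p) (map (r p) xs) = xs"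
 using assms r by (auto simp: subset_iff map_idI)

lemma smooth_alt_eqI:
 assumes P: "P \<in> smooth_alt S G val" "Q \<in> smooth_alt S G val"
  and e: "!!p gs. set gs <= G ==> P p (map (val p) gs) = Q p (map (val p) gs)"
 shows "P = Q"
proof (intro ext)
 fix p xs
 show "P p xs = Q p xs"
 proof (cases "p \<in> pts M & set xs <= S p")
  case True
  then show ?thesis using e[of "map (r p) xs" p] smooth_alt_repr[of p xs] by simp
 next
  case False
  then show ?thesis using P alt_all_outside[of "P p" "S p" xs] alt_all_outside[of "Q p" "S p" xs]
   by (cases "p \<in> pts M") (auto simp: smooth_alt_def)
 qed
qed

text \<open>By \<open>slot\<close> the chosen representatives do not matter. The type of G carries
  no linear structure here, so \<open>add\<close> and \<open>scale\<close> ask only for some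
  representative of the sum and of the multiple.\<close>

lemma mk_alt:
 assumes smooth: "!!gs. set gs <= G ==> F gs \<in> A"
  and slot: "!!p pre x y post. p \<in> pts M ==> set pre <= G ==> set post <= G ==> x \<in> G ==> y \<in> G ==> val p x = val p y ==>
   F (pre @ x # post) p = F (pre @ y # post) p"
  and add: "!!p pre x y post. p \<in> pts M ==> set pre <= G ==> set post <= G ==> x \<in> G ==> y \<in> G ==>
   \<exists>z\<in>G. val p z = val p x + val p y & F (pre @ z # post) p = F (pre @ x # post) p + F (pre @ y # post) p"
  and scale: "!!p pre x c post. p \<in> pts M ==> set pre <= G ==> set post <= G ==> x \<in> G ==>
   \<exists>z\<in>G. val p z = c *\<^sub>R val p x & F (pre @ z # post) p = c * F (pre @ x # post) p"
  and adj: "!!p pre x post. set pre <= G ==> x \<in> G ==> set post <= G ==> F (pre @ x # x # post) p = 0"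
 shows "mk_alt S r F \<in> smooth_alt S G val" and "set gs <= G ==> mk_alt S r F p (map (val p) gs) = F gs p"
proof -
 show ev: "mk_alt S r F p (map (val p) gs) = F gs p" if gs: "set gs <= G" for p gs
 proof (cases "p \<in> pts M")
  case True
  have m: "set (map (val p) gs) <= S p" using val gs by auto
  have "F (map (r p) (map (val p) gs)) p = F gs p" by (rule subst_slots[where S=G and val="val p" and F="%gs. F gs p"])
    (use slot[OF True] smooth_alt_repr[OF True m] gs in blast)+
  then show ?thesis using True m by (simp add: mk_alt_def)
 qed (use A_outside[OF smooth[OF gs]] in \<open>simp add: mk_alt_def\<close>)
 show "mk_alt S r F \<in> smooth_alt S G val" unfolding smooth_alt_def
 proof (intro CollectI conjI ballI allI impI)
  fix p assume p: "p \<in> pts M"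
  note repr = smooth_alt_repr[OF p]
  show "mk_alt S r F p \<in> alt_all (S p)"
  proof (rule alt_allI_adjacent[OF _ S])
   show "multilin_on (S p) (mk_alt S r F p)" unfolding multilin_on_def lin_on_def
   proof (intro allI impI conjI ballI)
    fix xs ys assume xy: "set xs <= S p & set ys <= S p"
    note xs = repr[OF conjunct1[OF xy]] and ys = repr[OF conjunct2[OF xy]]
    have e: "mk_alt S r F p (xs @ val p g # ys) = F (map (r p) xs @ g # map (r p) ys) p" if "g \<in> G" for g
     using ev[of "map (r p) xs @ g # map (r p) ys" p] that xs ys by simp
    fix x assume "x \<in> S p"
    then have x: "r p x \<in> G" "val p (r p x) = x" using r[OF p] by blast+
    show "mk_alt S r F p (xs @ (c *\<^sub>R x) # ys) = c *\<^sub>R mk_alt S r F p (xs @ x # ys)" for c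
     using scale[OF p xs(1) ys(1) x(1), of c] e x by (metis real_scaleR_def)
    fix y assume "y \<in> S p"
    then have y: "r p y \<in> G" "val p (r p y) = y" using r[OF p] by blast+
    show "mk_alt S r F p (xs @ (x + y) # ys) = mk_alt S r F p (xs @ x # ys) + mk_alt S r F p (xs @ y # ys)"
     using add[OF p xs(1) ys(1) x(1) y(1)] e x y by metis
   qed
   fix pre x post assume s: "set pre <= S p" "x \<in> S p" "set post <= S p"
   then show "mk_alt S r F p (pre @ x # x # post) = 0" using adj[OF repr(1) _ repr(1), of pre "r p x" post p] r[OF p s(2)] by (simp add: mk_alt_def)
  qed (simp add: mk_alt_def)
 qed (use ev smooth in \<open>simp_all add: mk_alt_def fun_eq_iff\<close>)
qed

end

lemmas MV_0 = subspace_0[OF subspace_MV] and FM_0 = subspace_0[OF subspace_FM]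

lemma MV_eqI:
 assumes "P \<in> MV" "Q \<in> MV" and "!!fs. set fs <= A ==> ev P fs = ev Q fs"
 shows "P = Q" by (rule smooth_alt_eqI[OF subspace_cotangent dif_cotangent cofun])
  (use assms in \<open>auto simp: ev_def fun_eq_iff MV_smooth_alt\<close>)

lemma FM_eqI:
 assumes "P \<in> FM" "Q \<in> FM" and "!!Xs. set Xs <= VF ==> evf P Xs = evf Q Xs"
 shows "P = Q" by (rule smooth_alt_eqI[OF subspace_tangent VF_tangent' vfext])
  (use assms in \<open>auto simp: evf_def fun_eq_iff FM_smooth_alt\<close>)

lemma MV_eqI_delta:
 assumes P: "P \<in> MV" "Q \<in> MV" and "!!p. P p [] = Q p []" and "!!f. f \<in> A ==> delta f P = delta f Q"
 shows "P = Q"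
proof (rule MV_eqI[OF P])
 fix fs assume fs: "set fs <= A"
 show "ev P fs = ev Q fs"
 proof (cases fs)
  case Nil then show ?thesis using assms(3) by (simp add: ev_def)
 next
  case (Cons f gs)
  then have "delta f P = delta f Q" using fs by (intro assms(4)) simp
  then show ?thesis unfolding Cons ev_delta[symmetric] by simp
 qed
qed

abbreviation "mk_mv \<equiv> mk_alt C cofun"
abbreviation "mk_fm \<equiv> mk_alt T vfext"

text \<open>A map that is a derivation at p in a slot is evaluated there by a tangent vector, and
  \<open>dif p f\<close> records the values of all tangent vectors on f; hence the slot depends on f
  through its differential only.\<close>

lemma mk_mv:
 assumes smooth: "!!fs. set fs <= A ==> F fs \<in> A"
  and der: "!!p pre post. set pre <= A ==> set post <= A ==>
    (%f. if f \<in> A then F (pre @ f # post) p else 0) \<in> T p"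
  and adj: "!!p pre f post. set pre <= A ==> f \<in> A ==> set post <= A ==> F (pre @ f # f # post) p = 0"
 shows "mk_mv F \<in> MV" and "set fs <= A ==> ev (mk_mv F) fs = F fs"
proof -
 have slot: "F (pre @ f # post) p = F (pre @ g # post) p"
  if "set pre <= A" "set post <= A" "f \<in> A" "g \<in> A" "dif p f = dif p g" for p pre post f g
  using fun_cong[OF that(5), of "%f. if f \<in> A then F (pre @ f # post) p else 0"] der[OF that(1,2), of p] that(3,4) by (simp add: diff_at_def)
 have add: "\<exists>h\<in>A. dif p h = dif p f + dif p g & F (pre @ h # post) p = F (pre @ f # post) p + F (pre @ g # post) p"
  if "set pre <= A" "set post <= A" and f: "f \<in> A" "g \<in> A" for p pre post f g using tangent_add[OF der[OF that(1,2), of p] f] f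
  by (intro bexI[OF _ A_add[OF f]]) (simp add: dif_add A_add)
 have scale: "\<exists>h\<in>A. dif p h = c *\<^sub>R dif p f & F (pre @ h # post) p = c * F (pre @ f # post) p"
  if "set pre <= A" "set post <= A" and f: "f \<in> A" for p pre post f c using tangent_cmult[OF der[OF that(1,2), of p] f, of c] f
  by (intro bexI[OF _ A_cmult[OF f, of c]]) (simp add: dif_cmult A_cmult)
 note m = mk_alt[where S=C and G=A and val=dif and r=cofun and F=F, OF subspace_cotangent dif_cotangent cofun smooth slot add scale adj]
 show "mk_mv F \<in> MV" unfolding MV_smooth_alt by (rule m(1))
 show "set fs <= A ==> ev (mk_mv F) fs = F fs" unfolding ev_def by (rule ext) (rule m(2))
qed

lemma mk_fm:
 assumes smooth: "!!Xs. set Xs <= VF ==> F Xs \<in> A"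
  and lin: "!!p pre g X Y post. set pre <= VF ==> g \<in> A ==> X \<in> VF ==> Y \<in> VF ==> set post <= VF ==>
   F (pre @ (vmul g X + Y) # post) p = g p * F (pre @ X # post) p + F (pre @ Y # post) p"
  and adj: "!!p pre X post. set pre <= VF ==> X \<in> VF ==> set post <= VF ==> F (pre @ X # X # post) p = 0"
 shows "mk_fm F \<in> FM" and "set Xs <= VF ==> evf (mk_fm F) Xs = F Xs"
proof -
 have add: "F (pre @ (X + Y) # post) p = F (pre @ X # post) p + F (pre @ Y # post) p"
  and mul: "F (pre @ vmul g X # post) p = g p * F (pre @ X # post) p"
  if p: "p \<in> pts M" and s: "set pre <= VF" "set post <= VF" "X \<in> VF" "Y \<in> VF" "g \<in> A" for p pre post X Y g
 proof -
  \<comment> \<open>The constant function 1 has to vanish off M; as vector fields vanish there too,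
    it still acts as the identity.\<close>
  have v: "vmul (%q. if q \<in> pts M then 1 else 0) Z = Z" if "Z \<in> VF" for Z
   using VF_outside[OF that] by (intro ext) (simp add: vmul_def scaleR_fun_def)
  have z: "0 \<in> VF" by (rule subspace_0[OF subspace_VF])
  have "F (pre @ 0 # post) p = 0" using lin[OF s(1) A_const[of 1] z z s(2), of p] p by (simp add: v[OF z])
  then show "F (pre @ vmul g X # post) p = g p * F (pre @ X # post) p" using lin[OF s(1,5,3) z s(2), of p] by simp
  show "F (pre @ (X + Y) # post) p = F (pre @ X # post) p + F (pre @ Y # post) p"
   using lin[OF s(1) A_const[of 1] s(3,4,2), of p] p by (simp only: v[OF s(3)] if_True mult_1)
 qed
 have slot: "F (pre @ X # post) p = F (pre @ Y # post) p"
  if p: "p \<in> pts M" and s: "set pre <= VF" "set post <= VF" and X: "X \<in> VF" "Y \<in> VF" "X p = Y p" for p pre post X Y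
  by (rule tensorial[OF p, where F="%X. F (pre @ X # post) p"])
   (rule add[OF p s _ _ A_zero] mul[OF p s _ X(1)] X; assumption)+
 have add': "\<exists>Z\<in>VF. Z p = X p + Y p & F (pre @ Z # post) p = F (pre @ X # post) p + F (pre @ Y # post) p"
  if p: "p \<in> pts M" and s: "set pre <= VF" "set post <= VF" and X: "X \<in> VF" "Y \<in> VF" for p pre post X Y
  by (rule bexI[OF _ subspace_add[OF subspace_VF X]]) (simp only: plus_fun_apply add[OF p s X A_zero])
 have scale: "\<exists>Z\<in>VF. Z p = c *\<^sub>R X p & F (pre @ Z # post) p = c * F (pre @ X # post) p"
  if p: "p \<in> pts M" and s: "set pre <= VF" "set post <= VF" and X: "X \<in> VF" for p pre post X c using mul[OF p s X X A_const[of c]] p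
  by (intro bexI[OF _ vmul_VF[OF A_const[of c] X]]) (simp add: vmul_def)
 note m = mk_alt[where S=T and G=VF and val="%p X. X p" and r=vfext and F=F, OF subspace_tangent _ vfext smooth slot add' scale adj]
 show "mk_fm F \<in> FM" unfolding FM_smooth_alt by (rule m(1)) (rule VF_tangent')
 show "set Xs <= VF ==> evf (mk_fm F) Xs = F Xs" unfolding evf_def by (rule ext, rule m(2)) (rule VF_tangent')
qed

text \<open>The degree one part of Q is a linear form on covectors; this is the corresponding
  element of the tangent space.\<close>

definition vec :: "'a => ('a cotan list => real) => 'a tan" where
 "vec p Q f = (if f \<in> A then Q [dif p f] else 0)"

definition vecf :: "'a mvf => 'a => 'a tan" where
 "vecf P p = vec p (P p)"

lemma vec_tangent:
 assumes "Q \<in> alt_all (C p)" shows "vec p Q \<in> T p"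
proof -
 note a = alt_all_add[OF assms, of "[]" "[]"] and s = alt_all_scaleR[OF assms, of "[]" "[]"]
 have sc: "c *\<^sub>R dif p f \<in> C p" for c f using dif_cotangent by (rule subspace_scale[OF subspace_cotangent])
 show ?thesis by (intro tangentI)
   (use a s in \<open>simp_all add: vec_def A_add A_cmult A_mult
    dif_add dif_cmult dif_mult sc dif_cotangent\<close>)
qed

lemma cotangent_vec:
 assumes "p \<in> pts M" "Q \<in> alt_all (C p)" "\<xi> \<in> C p" shows "\<xi> (vec p Q) = Q [\<xi>]"
proof -
 obtain f where "f \<in> A" "dif p f = \<xi>" using cotangent_dif[OF assms(1,3)] by blast
 then show ?thesis using vec_tangent[OF assms(2)] by (auto simp: diff_at_def vec_def)
qed

lemma vecf_VF: "P \<in> MV ==> vecf P \<in> VF"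
proof (rule VFI)
 assume P: "P \<in> MV"
 show "vecf P p \<in> T p" for p unfolding vecf_def by (rule vec_tangent[OF MV_alt[OF P]])
 show "vecf P p = 0" if "p ~: pts M" for p using MV_outside[OF P that] by (intro ext) (simp add: vecf_def vec_def)
 show "(%p. vecf P p f) \<in> A" if "f \<in> A" for f using ev_smooth[OF P, of "[f]"] that by (simp add: vecf_def vec_def ev_def)
qed

end

subsection \<open>Integer degrees and signs\<close>

definition sg :: "int => real" where "sg e = (if even e then 1 else -1)"

lemma sg_diff: "sg (a - b) = sg a * sg b" by (simp add: sg_def)
lemma sg_simps [simp]: "sg 0 = 1" "sg 1 = -1" "sg 2 = 1" "sg 3 = -1" "sg (-1) = -1" "sg a * sg a = 1" by (simp_all add: sg_def)
lemma sg_of_nat: "sg (int k) = (-1) ^ k" by (simp add: sg_def)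
lemma sg_power: "(-1) powi e = sg e" by (simp add: sg_def power_int_minus_left)
lemma sg_mult_left_cancel [simp]: "sg a * (sg a * x) = x" by (simp add: sg_def)

text \<open>Degrees are integers, so that an insertion lowers the degree by one without exception
  and a negative degree simply means 0.\<close>

definition hdeg :: "int => ('a => 'v list => real) => bool" where
 "hdeg a P \<longleftrightarrow> (\<forall>p xs. int (length xs) ~= a --> P p xs = 0)"

lemma hdegD: "hdeg a P ==> int (length xs) ~= a ==> P p xs = 0" by (simp add: hdeg_def)

lemma hdeg_neg: "hdeg a P ==> a < 0 ==> P = 0" by (intro ext) (simp add: hdegD)

lemma hdeg_zero: "hdeg a 0" by (simp add: hdeg_def)

lemma hdeg_linear:
 "hdeg a P ==> hdeg a Q ==> hdeg a (P + Q)" "hdeg a P ==> hdeg a (c *\<^sub>R P)"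
 "hdeg a P ==> hdeg a (- P)" by (simp_all add: hdeg_def scaleR_fun_def)

context smooth_mfd
begin

lemma hdeg_delta: "hdeg a P ==> hdeg (a - 1) (delta f P)" by (auto simp: hdeg_def delta_def contract_def)

lemma hdeg_par: "hdeg a P ==> par P = sg a *\<^sub>R P"
proof (intro ext)
 fix p xs assume "hdeg a P"
 then show "par P p xs = (sg a *\<^sub>R P) p xs" by (cases "int (length xs) = a")
   (auto simp: par_def parity_def scaleR_fun_def hdegD simp flip: sg_of_nat)
qed

lemma multivector_fields_hom: "P \<in> multivector_fields M a \<longleftrightarrow> P \<in> MV & hdeg (int a) P"
 by (simp add: multivector_fields_iff hdeg_def)

lemma forms_hom: "om \<in> forms M a \<longleftrightarrow> om \<in> FM & hdeg (int a) om" by (simp add: forms_iff hdeg_def)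

subsection \<open>The Schouten bracket\<close>

lemma lie_bracket_VF:
 assumes X: "X \<in> VF" and Y: "Y \<in> VF" shows "lie_bracket X Y \<in> VF"
proof (rule VFI)
 fix p
 have Xp: "X p \<in> T p" and Yp: "Y p \<in> T p" using X Y VF_tangent' by auto
 have s: "(%q. X q f) \<in> A" "(%q. Y q f) \<in> A" if "f \<in> A" for f using X Y that VF_smooth by auto
 show "lie_bracket X Y p \<in> T p"
 proof (rule tangentI)
  fix f g assume f: "f \<in> A" and g: "g \<in> A"
  have "(%q. Y q (%q. f q + g q)) = (%q. Y q f + Y q g)" "(%q. X q (%q. f q + g q)) = (%q. X q f + X q g)"
   using tangent_add[OF VF_tangent'[OF X] f g] tangent_add[OF VF_tangent'[OF Y] f g] by auto
  then show "lie_bracket X Y p (%q. f q + g q) = lie_bracket X Y p f + lie_bracket X Y p g"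
   by (simp add: lie_bracket_def tangent_add[OF Xp s(2)[OF f] s(2)[OF g]] tangent_add[OF Yp s(1)[OF f] s(1)[OF g]])
  have "(%q. Y q (%q. f q * g q)) = (%q. Y q f * g q + f q * Y q g)"
   "(%q. X q (%q. f q * g q)) = (%q. X q f * g q + f q * X q g)"
   using tangent_mult[OF VF_tangent'[OF X] f g] tangent_mult[OF VF_tangent'[OF Y] f g] by auto
  then show "lie_bracket X Y p (%q. f q * g q) = lie_bracket X Y p f * g p + f p * lie_bracket X Y p g"
   by (simp add: lie_bracket_def tangent_add[OF Xp] tangent_add[OF Yp] tangent_mult[OF Xp] tangent_mult[OF Yp]
     s f g A_mult algebra_simps)
 next
  fix c f assume f: "f \<in> A"
  have "(%q. Y q (%q. c * f q)) = (%q. c * Y q f)" "(%q. X q (%q. c * f q)) = (%q. c * X q f)"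
   using tangent_cmult[OF VF_tangent'[OF X] f] tangent_cmult[OF VF_tangent'[OF Y] f] by auto
  then show "lie_bracket X Y p (%q. c * f q) = c * lie_bracket X Y p f"
   by (simp add: lie_bracket_def tangent_cmult[OF Xp s(2)[OF f]] tangent_cmult[OF Yp s(1)[OF f]] algebra_simps)
 next
  fix f assume f: "f ~: A"
  have "(%q. Y q f) = (%q. 0)" "(%q. X q f) = (%q. 0)" using tangent_outside[OF VF_tangent'[OF X] f] tangent_outside[OF VF_tangent'[OF Y] f] by auto
  then show "lie_bracket X Y p f = 0" by (simp add: lie_bracket_def tangent_zero[OF Xp] tangent_zero[OF Yp])
 qed
 show "lie_bracket X Y p = 0" if "p ~: pts M" using VF_outside[OF X that] VF_outside[OF Y that] by (intro ext) (simp add: lie_bracket_def)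
 show "(%p. lie_bracket X Y p f) \<in> A" if "f \<in> A" for f unfolding lie_bracket_def
  by (rule A_diff[OF VF_smooth[OF X VF_smooth[OF Y that]] VF_smooth[OF Y VF_smooth[OF X that]]])
qed

lemma ev_linear:
 "ev (P + Q) fs = (%p. ev P fs p + ev Q fs p)" "ev (c *\<^sub>R P) fs = (%p. c * ev P fs p)"
 "ev (- P) fs = (%p. - ev P fs p)" "ev 0 fs = (%p. 0)" by (simp_all add: ev_def scaleR_fun_def)

context
 fixes P pre post p and v :: "('a => real) => real"
 assumes P: "P \<in> MV"
 defines "v \<equiv> %f. if f \<in> A then P p (map (dif p) pre @ dif p f # map (dif p) post) else 0"
begin

lemma ev_slot_derivation: "v \<in> T p" unfolding v_def by (rule MV_derivation[OF P])

lemma ev_slot_eq: "f \<in> A ==> ev P (pre @ f # post) p = v f" by (simp add: ev_def v_def)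

lemma ev_slot_add:
 "f \<in> A ==> g \<in> A ==>
  ev P (pre @ (%q. f q + g q) # post) p = ev P (pre @ f # post) p + ev P (pre @ g # post) p"
 by (simp add: ev_slot_eq tangent_add[OF ev_slot_derivation] A_add)

lemma ev_slot_cmult:
 "f \<in> A ==> ev P (pre @ (%q. c * f q) # post) p = c * ev P (pre @ f # post) p"
 by (simp add: ev_slot_eq tangent_cmult[OF ev_slot_derivation] A_cmult)

lemma ev_slot_minus:
 "f \<in> A ==> ev P (pre @ (%q. - f q) # post) p = - ev P (pre @ f # post) p" by (simp add: ev_slot_eq tangent_minus[OF ev_slot_derivation] A_minus)

lemma ev_slot_zero: "ev P (pre @ (%q. 0) # post) p = 0" by (simp add: ev_slot_eq tangent_zero[OF ev_slot_derivation] A_zero)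

end

lemmas ev_slot1 = ev_slot_add[where pre="[]", simplified] ev_slot_cmult[where pre="[]", simplified]
 ev_slot_minus[where pre="[]", simplified] ev_slot_zero[where pre="[]", simplified]

text \<open>The bracket b), sign included, on functions. Its degree zero part lets the vector field
  part of each argument act on the function part of the other; the remaining values are dictated by
  the derivation rule for the insertion of df, where \<open>par\<close> supplies the sign for
  passing P.\<close>

primrec brev :: "('a => real) list => 'a mvf => 'a mvf => 'a => real" where
 "brev [] = (%P Q p. ev P [ev Q []] p + ev Q [ev P []] p)"
| "brev (f # fs) =
   (%P Q p. - brev fs (delta f P) Q p - brev fs (par P) (delta f Q) p)"

lemma brev_add_left:
 "P \<in> MV ==> P' \<in> MV ==> Q \<in> MV ==> set fs <= A ==>
  brev fs (P + P') Q p = brev fs P Q p + brev fs P' Q p" by (induction fs arbitrary: P P' Q)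
  (simp_all add: ev_linear ev_slot1 ev_smooth delta_linear par_linear delta_MV par_MV)

lemma brev_add_right:
 "P \<in> MV ==> Q \<in> MV ==> Q' \<in> MV ==> set fs <= A ==>
  brev fs P (Q + Q') p = brev fs P Q p + brev fs P Q' p" by (induction fs arbitrary: P Q Q')
  (simp_all add: ev_linear ev_slot1 ev_smooth delta_linear par_linear delta_MV par_MV)

lemma brev_scaleR_left:
 "P \<in> MV ==> Q \<in> MV ==> set fs <= A ==> brev fs (c *\<^sub>R P) Q p = c * brev fs P Q p" by (induction fs arbitrary: P Q)
  (simp_all add: ev_linear ev_slot1 ev_smooth delta_linear par_linear delta_MV par_MV algebra_simps)

lemma brev_scaleR_right:
 "P \<in> MV ==> Q \<in> MV ==> set fs <= A ==> brev fs P (c *\<^sub>R Q) p = c * brev fs P Q p" by (induction fs arbitrary: P Q)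
  (simp_all add: ev_linear ev_slot1 ev_smooth delta_linear par_linear delta_MV par_MV algebra_simps)

lemma brev_minus:
 assumes "P \<in> MV" "Q \<in> MV" "set fs <= A"
 shows "brev fs (- P) Q p = - brev fs P Q p" "brev fs P (- Q) p = - brev fs P Q p"
 using brev_scaleR_left[OF assms, of "-1" p] brev_scaleR_right[OF assms, of "-1" p] by simp_all

lemma brev_smooth:
 "P \<in> MV ==> Q \<in> MV ==> set fs <= A ==> brev fs P Q \<in> A"
proof (induction fs arbitrary: P Q)
 case Nil
 then show ?case unfolding brev.simps by (intro A_add ev_smooth) (simp_all add: ev_smooth)
next
 case (Cons f fs)
 then have "brev fs (delta f P) Q \<in> A" "brev fs (par P) (delta f Q) \<in> A" by (simp_all add: delta_MV par_MV)
 then show ?case unfolding brev.simps by (intro A_diff A_minus)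
qed

lemma delta_swap: "P \<in> MV ==> delta g (delta f P) = - delta f (delta g P)"
proof (intro ext)
 fix p xs assume "P \<in> MV"
 then show "delta g (delta f P) p xs = (- delta f (delta g P)) p xs"
  using alt_all_swap[OF MV_alt[of P p] subspace_cotangent, of "[]" "dif p f" "dif p g" xs] by (simp add: delta_def contract_def)
qed

text \<open>Unfolding twice gives four terms. The two in which both insertions hit the same argument
  change sign because insertions anticommute; the two mixed ones are exchanged with a minus sign
  because \<open>par\<close> anticommutes with \<open>delta\<close>.\<close>

lemma brev_swap:
 assumes "P \<in> MV" "Q \<in> MV" "f \<in> A" "g \<in> A" "set fs <= A"
 shows "brev (f # g # fs) P Q p = - brev (g # f # fs) P Q p" using assms by (simp add: delta_par brev_minus delta_MV par_MV)
  (simp add: delta_swap[of _ g f] brev_minus delta_MV par_MV)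

lemma brev_adjacent:
 "P \<in> MV ==> Q \<in> MV ==> f \<in> A ==> set pre <= A ==> set post <= A ==>
  brev (pre @ f # f # post) P Q p = 0"
proof (induction pre arbitrary: P Q)
 case Nil
 then show ?case using brev_swap[of P Q f f post p] by simp
next
 case (Cons g pre)
 then show ?case using delta_MV par_MV by simp
qed

text \<open>The value on f is the Lie bracket of the vector field parts applied to f, minus two
  terms in which the bivector part of one argument meets df and the differential of the function
  part of the other. Second derivatives occur in the Lie bracket only, where they cancel.\<close>

lemma brev_derivation_single:
 assumes P: "P \<in> MV" and Q: "Q \<in> MV"
 shows "(%f. if f \<in> A then brev [f] P Q p else 0) \<in> T p"
proof -
 let ?u1 = "%f. if f \<in> A then P p ([] @ dif p f # [dif p (ev Q [])]) else 0"
 let ?u2 = "%f. if f \<in> A then Q p ([] @ dif p f # [dif p (ev P [])]) else 0"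
 have L: "lie_bracket (vecf P) (vecf Q) p \<in> T p" by (rule VF_tangent'[OF lie_bracket_VF[OF vecf_VF[OF P] vecf_VF[OF Q]]])
 moreover have "?u1 \<in> T p" "?u2 \<in> T p" using MV_derivation[OF P] MV_derivation[OF Q] by blast+
 ultimately have "lie_bracket (vecf P) (vecf Q) p + ((-1) *\<^sub>R ?u1 + (-1) *\<^sub>R ?u2) \<in> T p"
  by (intro subspace_add[OF subspace_tangent] subspace_scale[OF subspace_tangent])
 also have "lie_bracket (vecf P) (vecf Q) p + ((-1) *\<^sub>R ?u1 + (-1) *\<^sub>R ?u2) =
  (%f. if f \<in> A then brev [f] P Q p else 0)"
 proof (rule ext)
  fix f
  show "(lie_bracket (vecf P) (vecf Q) p + ((-1) *\<^sub>R ?u1 + (-1) *\<^sub>R ?u2)) f =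
   (if f \<in> A then brev [f] P Q p else 0)"
  proof (cases "f \<in> A")
   case True
   have 1: "(%q. vecf R q f) = ev R [f]" for R using True by (simp add: vecf_def vec_def ev_def)
   have 2: "vecf R p (ev S [f]) = ev R [ev S [f]] p" if "S \<in> MV" for R S
    using ev_smooth[OF that, of "[f]"] True by (simp add: vecf_def vec_def ev_def)
   have "ev (par P) [g] p = - ev P [g] p" "ev (par P) [] = ev P []" for g by (simp_all add: ev_par)
   then show ?thesis using True by (simp add: lie_bracket_def scaleR_fun_def 1 2 P Q ev_delta) (simp add: ev_def)
  next
   case False
   then show ?thesis using tangent_outside[OF L False] by (simp add: scaleR_fun_def)
  qed
 qed
 finally show ?thesis .
qed

lemma brev_derivation:
 "P \<in> MV ==> Q \<in> MV ==> set pre <= A ==> set post <= A ==>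
  (%f. if f \<in> A then brev (pre @ f # post) P Q p else 0) \<in> T p"
proof (induction pre arbitrary: P Q)
 case (Cons g pre)
 let ?u = "%f. if f \<in> A then brev (pre @ f # post) (delta g P) Q p else 0"
 let ?w = "%f. if f \<in> A then brev (pre @ f # post) (par P) (delta g Q) p else 0"
 have "?u \<in> T p" "?w \<in> T p" using Cons delta_MV par_MV by auto
 then have "(-1) *\<^sub>R ?u + (-1) *\<^sub>R ?w \<in> T p" by (intro subspace_add[OF subspace_tangent] subspace_scale[OF subspace_tangent])
 also have "(-1) *\<^sub>R ?u + (-1) *\<^sub>R ?w =
   (%f. if f \<in> A then brev ((g # pre) @ f # post) P Q p else 0)" by (rule ext) (simp add: scaleR_fun_def)
 finally show ?case .
next
 case Nil
 then show ?case
 proof (induction post arbitrary: P Q)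
  case Nil
  then show ?case unfolding append_Nil using brev_derivation_single by blast
 next
  case (Cons g post)
  let ?u = "%f. if f \<in> A then brev ([] @ f # post) (delta g P) Q p else 0"
  let ?w = "%f. if f \<in> A then brev ([] @ f # post) (par P) (delta g Q) p else 0"
  have "?u \<in> T p" "?w \<in> T p" using Cons delta_MV par_MV by auto
  then have "?u + ?w \<in> T p" by (rule subspace_add[OF subspace_tangent])
  \<comment> \<open>Exchanging f and g makes the recursion treat g first; the sign of the exchange
    cancels the minus signs of the recursion.\<close>
  also have "?u + ?w = (%f. if f \<in> A then brev ([] @ f # g # post) P Q p else 0)"
  proof (rule ext)
   fix f
   show "(?u + ?w) f = (if f \<in> A then brev ([] @ f # g # post) P Q p else 0)" using brev_swap[of P Q f g post p] Cons.prems
    by (cases "f \<in> A") (simp_all del: brev.simps(2), simp)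
  qed
  finally show ?case .
 qed
qed

definition bracket :: "'a mvf => 'a mvf => 'a mvf" where
 "bracket P Q = mk_mv (%fs. brev fs P Q)"

lemma bracket_MV: "P \<in> MV ==> Q \<in> MV ==> bracket P Q \<in> MV"
 and ev_bracket: "P \<in> MV ==> Q \<in> MV ==> set fs <= A ==> ev (bracket P Q) fs = brev fs P Q" unfolding bracket_def
 by (rule mk_mv[where F="%fs. brev fs P Q"];
   simp add: brev_smooth brev_derivation brev_adjacent)+

lemma delta_bracket:
 assumes P: "P \<in> MV" and Q: "Q \<in> MV" and f: "f \<in> A"
 shows "delta f (bracket P Q) = - bracket (delta f P) Q - bracket (par P) (delta f Q)"
proof (rule MV_eqI)
 note m = delta_MV[OF f] par_MV bracket_MV P Q
 have "(-1) *\<^sub>R bracket (delta f P) Q + (-1) *\<^sub>R bracket (par P) (delta f Q) \<in> MV"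
  by (intro subspace_add[OF subspace_MV] subspace_scale[OF subspace_MV] m)
 then show "- bracket (delta f P) Q - bracket (par P) (delta f Q) \<in> MV" by simp
 show "delta f (bracket P Q) \<in> MV" by (intro m)
 fix fs assume "set fs <= A"
 then show "ev (delta f (bracket P Q)) fs = ev (- bracket (delta f P) Q - bracket (par P) (delta f Q)) fs"
  using ev_linear(1)[of "- bracket (delta f P) Q" "- bracket (par P) (delta f Q)"] by (simp add: ev_delta ev_bracket m f ev_linear)
qed

lemma bracket_linear:
 assumes "P \<in> MV" "P' \<in> MV" "Q \<in> MV"
 shows "bracket (P + P') Q = bracket P Q + bracket P' Q" "bracket Q (P + P') = bracket Q P + bracket Q P'"
  and "bracket (c *\<^sub>R P) Q = c *\<^sub>R bracket P Q" "bracket Q (c *\<^sub>R P) = c *\<^sub>R bracket Q P"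
 by (rule MV_eqI; simp add: assms bracket_MV subspace_add[OF subspace_MV] subspace_scale[OF subspace_MV]
   ev_bracket ev_linear brev_add_left brev_add_right brev_scaleR_left brev_scaleR_right
   fun_eq_iff)+

lemma brev_hom:
 "hdeg a P ==> hdeg b Q ==> int (length fs) ~= a + b - 1 ==> P \<in> MV ==> Q \<in> MV ==>
  set fs <= A ==> brev fs P Q p = 0"
proof (induction fs arbitrary: P Q a b)
 case Nil
 have 0: "ev P [ev Q []] p = 0" if "hdeg a P" "hdeg b Q" "a + b ~= 1" "P \<in> MV" for a b P Q
 proof (cases "a = 1")
  case True
  then have "ev Q [] = (%p. 0)" using that(2,3) by (intro ext) (simp add: ev_def hdegD)
  then show ?thesis using ev_slot1(4)[OF that(4)] by simp
 qed (use that(1) in \<open>simp add: ev_def hdegD\<close>)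
 show ?case using 0[of a P b Q] 0[of b Q a P] Nil by simp
next
 case (Cons f fs)
 have "par P = sg a *\<^sub>R P" by (rule hdeg_par[OF Cons.prems(1)])
 then have "hdeg a (par P)" using hdeg_linear(2)[OF Cons.prems(1)] by simp
 then show ?case using Cons.IH[OF hdeg_delta[OF Cons.prems(1), of f] Cons.prems(2)]
   Cons.IH[OF _ hdeg_delta[OF Cons.prems(2), of f]] Cons.prems(3-6) by (simp add: delta_MV par_MV)
qed

lemma hdeg_bracket:
 assumes P: "P \<in> MV" "hdeg a P" and Q: "Q \<in> MV" "hdeg b Q"
 shows "hdeg (a + b - 1) (bracket P Q)" unfolding hdeg_def
proof (intro allI impI)
 fix p and \<xi>s :: "'a cotan list" assume l: "int (length \<xi>s) ~= a + b - 1"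
 show "bracket P Q p \<xi>s = 0"
 proof (cases "p \<in> pts M & set \<xi>s <= C p")
  case True
  then have "set (map (cofun p) \<xi>s) <= A" using cofun by auto
  then show ?thesis using brev_hom[OF P(2) Q(2) _ P(1) Q(1), of "map (cofun p) \<xi>s"] l True by (simp add: bracket_def mk_alt_def)
 qed (auto simp: bracket_def mk_alt_def)
qed

lemma brev_commute:
 "hdeg a P ==> hdeg b Q ==> P \<in> MV ==> Q \<in> MV ==> set fs <= A ==>
  brev fs P Q p = sg (a * b) * brev fs Q P p"
proof (induction fs arbitrary: P Q a b)
 case Nil
 show ?case
 proof (cases "a + b = 1")
  case True
  then have "even a \<or> even b" by presburger
  then have "even (a * b)" by simp
  then have "sg (a * b) = 1" by (simp add: sg_def)
  then show ?thesis by simp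
 next
  case False
  then have "brev [] P Q p = 0" "brev [] Q P p = 0" using brev_hom[of a P b Q "[]"] brev_hom[of b Q a P "[]"] Nil by auto
  then show ?thesis by simp
 qed
next
 case (Cons f fs)
 have f: "f \<in> A" and fs: "set fs <= A" using Cons.prems by auto
 note pq = Cons.prems(3,4) delta_MV[OF f Cons.prems(3)] delta_MV[OF f Cons.prems(4)]
 have 1: "brev fs (delta f P) Q p = sg ((a - 1) * b) * brev fs Q (delta f P) p"
  by (rule Cons.IH[OF hdeg_delta[OF Cons.prems(1)] Cons.prems(2) pq(3,2) fs])
 have 2: "brev fs P (delta f Q) p = sg (a * (b - 1)) * brev fs (delta f Q) P p"
  by (rule Cons.IH[OF Cons.prems(1) hdeg_delta[OF Cons.prems(2)] pq(1,4) fs])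
 have s: "sg ((a - 1) * b) = sg (a * b) * sg b" "sg (a * (b - 1)) = sg (a * b) * sg a" by (simp_all add: sg_diff algebra_simps)
 show ?case by (simp add: hdeg_par[OF Cons.prems(1)] hdeg_par[OF Cons.prems(2)] brev_scaleR_left pq fs
    1[unfolded s] 2[unfolded s]) (simp add: algebra_simps)
qed

lemma bracket_commute:
 assumes P: "P \<in> MV" "hdeg a P" and Q: "Q \<in> MV" "hdeg b Q"
 shows "bracket P Q = sg (a * b) *\<^sub>R bracket Q P" by (rule MV_eqI)
  (simp_all add: assms bracket_MV subspace_scale[OF subspace_MV] ev_bracket ev_linear fun_eq_iff
   brev_commute[OF P(2) Q(2) P(1) Q(1)])

text \<open>The recursion unrolled into the shuffle sums of \<open>mvf_comp\<close>. As P and Q have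
  mixed degree, the signs can only be expressed by the lengths of the blocks.\<close>

lemma brev_shuf:
 "P \<in> MV ==> Q \<in> MV ==> set fs <= A ==>
  brev fs P Q p = shuf (%_ _. -1) (%ys zs.
   (-1) ^ (length ys * length zs) * ev P (ev Q ys # zs) p + (-1) ^ length ys * ev Q (ev P ys # zs) p) fs"
proof (induction fs arbitrary: P Q)
 case (Cons f fs)
 define G where "G P Q ys zs = (-1) ^ (length ys * length zs) * ev P (ev Q ys # zs) p
   + (-1) ^ length ys * ev Q (ev P ys # zs) p" for P Q ys zs
 have f: "f \<in> A" and fs: "set fs <= A" using Cons.prems by auto
 note pq = Cons.prems(1,2) delta_MV[OF f Cons.prems(1)] delta_MV[OF f Cons.prems(2)] par_MV[OF Cons.prems(1)]
 have minus: "ev R (g # f # zs) p = - ev R (f # g # zs) p" if "R \<in> MV" for R g zs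
  using alt_all_swap[OF MV_alt[OF that, of p] subspace_cotangent, of "[]" "dif p g" "dif p f"] by (simp add: ev_def)
 have pm: "(\<Prod>y\<leftarrow>ys. -1) = (-1::real) ^ length ys" for ys :: "('a => real) list" by (induction ys) simp_all
 have "brev (f # fs) P Q p =
  shuf (%_ _. -1) (%ys zs. (-1) *\<^sub>R G (delta f P) Q ys zs + (-1) *\<^sub>R G (par P) (delta f Q) ys zs) fs"
  using Cons.IH[OF pq(3,2) fs] Cons.IH[OF pq(5,4) fs] by (simp only: shuf_add shuf_scaleR brev.simps(2) G_def[symmetric]) simp
 also have "\<dots> = shuf (%_ _. -1) (%ys zs. G P Q (f # ys) zs + (-1) ^ length ys * G P Q ys (f # zs)) fs"
 proof (rule shuf_cong)
  fix ys zs assume m: "mset ys + mset zs = mset fs"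
  have ys: "set ys <= A" using fs m by (metis set_mset_mset set_mset_union Un_subset_iff)
  define s t u where "s = (-1::real) ^ length ys" and "t = (-1::real) ^ length zs"
   and "u = (-1::real) ^ (length ys * length zs)"
  have "s * s = 1" by (simp add: s_def flip: power_add)
  then have ss: "s * (s * x) = x" for x by (simp flip: mult.assoc)
  have "ev (par P) ys = (%p. s * ev P ys p)" by (simp add: ev_par s_def)
  then have a: "ev (delta f Q) (ev (par P) ys # zs) p = s * ev (delta f Q) (ev P ys # zs) p"
   using ev_slot1(2)[OF pq(4) ev_smooth[OF pq(1) ys], of s zs p] by simp
  have b: "ev (par P) (g # zs) p = - t * ev P (g # zs) p" for g by (simp add: ev_par t_def)
  have c: "(-1) ^ (length (f # ys) * length zs) = t * u" "(-1) ^ (length ys * length (f # zs)) = s * u"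
   "(-1) ^ length (f # ys) = - s" by (simp_all add: s_def t_def u_def power_add)
  show "(-1) *\<^sub>R G (delta f P) Q ys zs + (-1) *\<^sub>R G (par P) (delta f Q) ys zs =
    G P Q (f # ys) zs + (-1) ^ length ys * G P Q ys (f # zs)"
   unfolding G_def a[unfolded ev_delta] b c s_def[symmetric] u_def[symmetric] minus[OF pq(1)] minus[OF pq(2)] ev_delta
    real_scaleR_def a[unfolded ev_delta] by (simp add: algebra_simps ss)
 qed
 also have "\<dots> = shuf (%_ _. -1) (G P Q) (f # fs)" by (simp only: shuf.simps(2) pm shuf_add real_scaleR_def)
 moreover have "G P Q = (%ys zs. (-1) ^ (length ys * length zs) * ev P (ev Q ys # zs) p
   + (-1) ^ length ys * ev Q (ev P ys # zs) p)" by (intro ext) (simp only: G_def)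
 ultimately show ?case by simp
qed simp

section \<open>Comparison with the Schouten bracket\<close>

lemma ev_hom: "hdeg a P ==> int (length fs) ~= a ==> ev P fs = (%p. 0)" by (intro ext) (simp add: ev_def hdegD)

lemma mvf_comp_shuf:
 assumes P: "P \<in> multivector_fields M a" and Q: "Q \<in> multivector_fields M b"
  and fs: "length fs = a + b - 1"
 shows "mvf_comp M a b P Q fs p = shuf (%_ _. -1) (%ys zs. ev P (ev Q ys # zs) p) fs"
proof (cases "a = 0")
 case True
 then have "P p (x # xs) = 0" for x xs using P by (simp add: multivector_fields_iff)
 then show ?thesis by (simp add: mvf_comp_def ev_def shuf_zero)
next
 case False
 have "mvf_comp M a b P Q fs p =
   (\<Sum>\<sigma>\<in>unshuffles b (length fs). of_int (sign \<sigma>) *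
    ev P (ev Q (map (%i. fs ! \<sigma> i) [0..<b]) # map (%i. fs ! \<sigma> i) [b..<length fs]) p)" by (simp add: mvf_comp_def ev_def fs comp_def)
 also have "\<dots> = shuf (%_ _. -1) (%ys zs. if length ys = b then ev P (ev Q ys # zs) p else 0) fs"
  by (rule sum_unshuffles_sign) (use False fs in simp)
 also have "\<dots> = shuf (%_ _. -1) (%ys zs. ev P (ev Q ys # zs) p) fs"
 proof (rule shuf_cong)
  fix ys zs
  have "ev P ((%q. 0) # zs) p = 0" using ev_slot1(4) P by (simp add: multivector_fields_iff)
  moreover have "ev Q ys = (%q. 0)" if "length ys ~= b" using ev_hom[of "int b" Q ys] that Q by (simp add: multivector_fields_hom)
  ultimately show "(if length ys = b then ev P (ev Q ys # zs) p else 0) = ev P (ev Q ys # zs) p" by auto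
 qed
 finally show ?thesis .
qed

text \<open>The factor is the sign in b), so \<open>bracket\<close> is the binary multibracket
  itself. The description of \<open>schouten\<close> is met by the multiple of
  \<open>bracket\<close>, and it determines its solution because covectors are
  differentials.\<close>

lemma schouten_bracket:
 assumes P: "P \<in> multivector_fields M a" and Q: "Q \<in> multivector_fields M b"
 shows "(-1) ^ (a + 1) *\<^sub>R schouten M a b P Q = bracket P Q"
proof -
 have PM: "P \<in> MV" "hdeg (int a) P" and QM: "Q \<in> MV" "hdeg (int b) Q" using P Q by (simp_all add: multivector_fields_hom)
 let ?S = "(-1) ^ (a + 1) *\<^sub>R bracket P Q"
 have hd: "hdeg (int (a + b - 1)) (bracket P Q)"
 \<comment> \<open>For two functions the truncated degree is 0 instead of -1; the bracket is then 0,
   which has every degree.\<close>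
 proof (cases "a + b = 0")
  case True
  then have "bracket P Q = 0" using hdeg_bracket[OF PM QM] hdeg_neg by fastforce
  then show ?thesis by (simp add: hdeg_zero)
 next
  case False
  then have "int (a + b - 1) = int a + int b - 1" by arith
  then show ?thesis using hdeg_bracket[OF PM QM] by simp
 qed
 have S: "?S \<in> multivector_fields M (a + b - 1)" using hd bracket_MV[OF PM(1) QM(1)]
  by (simp only: multivector_fields_hom hdeg_linear subspace_scale[OF subspace_MV] simp_thms)
 have z: "ev R (ev R' ys # zs) p = 0" if "R \<in> MV" "hdeg (int c) R" "hdeg (int d) R'"
  "length ys ~= d \<or> Suc (length zs) ~= c" for R R' c d ys zs p
  using that ev_hom[of "int d" R' ys] ev_slot1(4)[OF that(1)] by (auto simp: ev_def hdegD)
 have ev: "?S p (map (dif p) fs) =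
   (-1) ^ ((a + 1) * (b + 1)) * mvf_comp M a b P Q fs p - mvf_comp M b a Q P fs p"
  if fs: "length fs = a + b - 1" "set fs <= A" for fs p
 proof -
  have fs': "length fs = b + a - 1" using fs by simp
  have "brev fs P Q p = shuf (%_ _. -1) (%ys zs.
    ((-1) ^ (a + 1) * (-1) ^ ((a + 1) * (b + 1))) *\<^sub>R ev P (ev Q ys # zs) p
     + ((-1) ^ a) *\<^sub>R ev Q (ev P ys # zs) p) fs" unfolding brev_shuf[OF PM(1) QM(1) fs(2)]
  proof (rule shuf_cong)
   fix ys zs
   have "(-1) ^ (length ys * length zs) * ev P (ev Q ys # zs) p =
     ((-1) ^ (a + 1) * (-1) ^ ((a + 1) * (b + 1))) * ev P (ev Q ys # zs) p"
   proof (cases "length ys ~= b \<or> Suc (length zs) ~= a")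
    case True then show ?thesis using z[OF PM QM(2)] by simp
   next
    case False
    \<comment> \<open>Only blocks of lengths b and a - 1 contribute, and there b (a - 1) and (a + 1)
      + (a + 1)(b + 1) have the same parity.\<close>
    then have "even (length ys * length zs) \<longleftrightarrow> even (a + 1 + (a + 1) * (b + 1))" by auto
    then have "(-1::real) ^ (length ys * length zs) = (-1) ^ (a + 1 + (a + 1) * (b + 1))" by (simp only: minus_one_power_iff)
    then show ?thesis by (simp only: power_add)
   qed
   moreover have "(-1) ^ length ys * ev Q (ev P ys # zs) p = (-1) ^ a * ev Q (ev P ys # zs) p"
    using z[OF QM PM(2), of ys zs p] by (cases "length ys = a") auto
   ultimately show "(-1) ^ (length ys * length zs) * ev P (ev Q ys # zs) p
     + (-1) ^ length ys * ev Q (ev P ys # zs) p =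
    ((-1) ^ (a + 1) * (-1) ^ ((a + 1) * (b + 1))) *\<^sub>R ev P (ev Q ys # zs) p
     + ((-1) ^ a) *\<^sub>R ev Q (ev P ys # zs) p" unfolding real_scaleR_def by (rule arg_cong2)
  qed
  also have "\<dots> = ((-1) ^ (a + 1) * (-1) ^ ((a + 1) * (b + 1))) * mvf_comp M a b P Q fs p
    + (-1) ^ a * mvf_comp M b a Q P fs p" unfolding mvf_comp_shuf[OF P Q fs(1)] mvf_comp_shuf[OF Q P fs']
   by (simp only: shuf_add shuf_scaleR) (simp only: real_scaleR_def)
  finally have e: "brev fs P Q p = \<dots>" .
  define s where "s = (-1::real) ^ a"
  have s: "(-1::real) ^ (a + 1) = - s" "s * s = 1" by (simp_all add: s_def flip: power_add)
  have "?S p (map (dif p) fs) = (-1) ^ (a + 1) * brev fs P Q p"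
   using fun_cong[OF ev_bracket[OF PM(1) QM(1) fs(2)], of p] by (simp add: ev_def scaleR_fun_def)
  also have "\<dots> = (s * s) * ((-1) ^ ((a + 1) * (b + 1)) * mvf_comp M a b P Q fs p)
    - (s * s) * mvf_comp M b a Q P fs p" unfolding e s(1) s_def[symmetric] by (simp only: algebra_simps)
  finally show ?thesis unfolding s(2) by (simp only: mult_1_left)
 qed
 have "schouten M a b P Q = ?S" unfolding schouten_def
 proof (rule the_equality)
  show "?S \<in> multivector_fields M (a + b - 1) &
   (\<forall>fs. length fs = a + b - 1 & set fs <= A --> (\<forall>p\<in>pts M. ?S p (map (dif p) fs) =
    (-1) ^ ((a + 1) * (b + 1)) * mvf_comp M a b P Q fs p - mvf_comp M b a Q P fs p))" using S ev by blast
  fix R assume R: "R \<in> multivector_fields M (a + b - 1) &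
   (\<forall>fs. length fs = a + b - 1 & set fs <= A --> (\<forall>p\<in>pts M. R p (map (dif p) fs) =
    (-1) ^ ((a + 1) * (b + 1)) * mvf_comp M a b P Q fs p - mvf_comp M b a Q P fs p))"
  show "R = ?S"
  proof (rule MV_eqI)
   show RM: "R \<in> MV" and SM: "?S \<in> MV" using R S by (simp_all only: multivector_fields_hom simp_thms)
   fix fs assume fs: "set fs <= A"
   show "ev R fs = ev ?S fs"
   proof
    fix p
    consider "p ~: pts M" | "length fs ~= a + b - 1" | "p \<in> pts M" "length fs = a + b - 1" by blast
    then show "ev R fs p = ev ?S fs p"
    proof cases
     case 1 show ?thesis unfolding ev_def by (simp only: MV_outside[OF RM 1] MV_outside[OF SM 1])
    next
     case 2
     have X: "X p (map (dif p) fs) = 0" if "X \<in> multivector_fields M (a + b - 1)" for X using that 2 by (simp add: multivector_fields_iff)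
     show ?thesis unfolding ev_def by (simp only: X[OF conjunct1[OF R]] X[OF S])
    next
     case 3
     then have "R p (map (dif p) fs) = ?S p (map (dif p) fs)" using R fs ev[OF 3(2) fs] by (simp only:)
     then show ?thesis by (simp only: ev_def)
    qed
   qed
  qed
 qed
 moreover have "(-1) ^ (a + 1) *\<^sub>R ((-1) ^ (a + 1) *\<^sub>R bracket P Q) = bracket P Q" by (simp flip: power_add)
 ultimately show ?thesis by simp
qed

end

subsection \<open>The exterior derivative\<close>

primrec pick1 :: "('b => 'b list => real) => 'b list => real" where
 "pick1 F [] = 0"
| "pick1 F (x # xs) = F x xs - pick1 (%y ys. F y (x # ys)) xs"

primrec pick2 :: "('b => 'b => 'b list => real) => 'b list => real" where
 "pick2 F [] = 0"
| "pick2 F (x # xs) = pick2 (%y z zs. F y z (x # zs)) xs - pick1 (F x) xs"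

lemma nths_omit: "nths (x # xs) (- {0}) = xs" "nths (x # xs) (- {Suc i}) = x # nths xs (- {i})"
 "nths (x # xs) (- {0, Suc i}) = nths xs (- {i})"
 "nths (x # xs) (- {Suc i, Suc j}) = x # nths xs (- {i, j})"
proof -
 have "{j. Suc j \<in> - {0}} = (UNIV :: nat set)" "{j. Suc j \<in> - {Suc i}} = - {i}"
  "{j. Suc j \<in> - {0, Suc i}} = - {i}" "{k. Suc k \<in> - {Suc i, Suc j}} = - {i, j}" by auto
 then show "nths (x # xs) (- {0}) = xs" "nths (x # xs) (- {Suc i}) = x # nths xs (- {i})"
  "nths (x # xs) (- {0, Suc i}) = nths xs (- {i})"
  "nths (x # xs) (- {Suc i, Suc j}) = x # nths xs (- {i, j})" by (simp_all add: nths_Cons nths_all)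
qed

lemma pick1_sum: "pick1 F xs = (\<Sum>i<length xs. (-1) ^ i * F (xs ! i) (nths xs (- {i})))"
proof (induction xs arbitrary: F)
 case (Cons x xs)
 show ?case unfolding list.size add_0_right add_Suc_right sum.lessThan_Suc_shift by (simp add: Cons nths_omit sum_negf)
qed simp

lemma pick2_sum:
 "pick2 F xs = (\<Sum>(i, j) \<in> {(i, j). i < j & j < length xs}.
   (-1) ^ (i + j) * F (xs ! i) (xs ! j) (nths xs (- {i, j})))"
proof (induction xs arbitrary: F)
 case (Cons x xs)
 let ?A = "(%j. (0::nat, Suc j)) ` {..<length xs}"
 let ?I = "{(i, j). i < j & j < length xs}"
 let ?B = "(%(i, j). (Suc i, Suc j)) ` ?I"
 let ?f = "%(i, j). (-1) ^ (i + j) * F ((x # xs) ! i) ((x # xs) ! j) (nths (x # xs) (- {i, j}))"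
 have fin: "finite ?I" by (rule finite_subset[of _ "{..<length xs} \<times> {..<length xs}"]) auto
 have eq: "{(i, j). i < j & j < length (x # xs)} = ?A \<union> ?B"
 proof (rule Set.set_eqI)
  fix z :: "nat \<times> nat"
  obtain i j where z: "z = (i, j)" by force
  show "z \<in> {(i, j). i < j & j < length (x # xs)} \<longleftrightarrow> z \<in> ?A \<union> ?B"
   unfolding z by (cases i; cases j) (auto simp: image_iff)
 qed
 have "sum ?f (?A \<union> ?B) = sum ?f ?A + sum ?f ?B" using fin by (intro sum.union_disjoint) auto
 also have "sum ?f ?A = - pick1 (F x) xs" unfolding pick1_sum sum_negf[symmetric] by (subst sum.reindex) (simp_all add: inj_on_def nths_omit)
 also have "sum ?f ?B = (\<Sum>(i, j)\<in>?I. (-1) ^ (i + j) * F (xs ! i) (xs ! j) (x # nths xs (- {i, j})))"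
  by (subst sum.reindex) (auto simp: inj_on_def nths_omit split_def intro!: sum.cong)
 finally show ?case unfolding eq by (simp add: Cons)
qed simp

context smooth_mfd
begin

lemma evf_linear:
 "evf (P + Q) fs = (%p. evf P fs p + evf Q fs p)" "evf (c *\<^sub>R P) fs = (%p. c * evf P fs p)"
 "evf (- P) fs = (%p. - evf P fs p)" "evf 0 fs = (%p. 0)" "evf (P - Q) fs = (%p. evf P fs p - evf Q fs p)" by (simp_all add: evf_def scaleR_fun_def)

lemma iprod_linear:
 "iprod X (P + Q) = iprod X P + iprod X Q" "iprod X (c *\<^sub>R P) = c *\<^sub>R iprod X P"
 "iprod X (- P) = - iprod X P" "iprod X 0 = 0" "iprod X (P - Q) = iprod X P - iprod X Q"
 by (intro ext; simp add: iprod_def contract_def scaleR_fun_def)+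

lemma evf_add:
 assumes w: "w \<in> FM" and s: "set pre <= VF" "X \<in> VF" "Y \<in> VF" "set post <= VF"
 shows "evf w (pre @ (X + Y) # post) p = evf w (pre @ X # post) p + evf w (pre @ Y # post) p"
proof -
 have "set (map (%X. X p) pre) <= T p" "set (map (%X. X p) post) <= T p" "X p \<in> T p" "Y p \<in> T p" using s VF_tangent' by auto
 then show ?thesis using alt_all_add[OF FM_alt[OF w, of p]] by (simp add: evf_def)
qed

lemma evf_vmul:
 assumes w: "w \<in> FM" and s: "set pre <= VF" "X \<in> VF" "set post <= VF"
 shows "evf w (pre @ vmul g X # post) p = g p * evf w (pre @ X # post) p"
proof -
 have "set (map (%X. X p) pre) <= T p" "set (map (%X. X p) post) <= T p" "X p \<in> T p" using s VF_tangent' by auto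
 then show ?thesis using alt_all_scaleR[OF FM_alt[OF w, of p]] by (simp add: evf_def vmul_def)
qed

lemma evf_swap: "w \<in> FM ==> evf w (pre @ X # Y # post) p = - evf w (pre @ Y # X # post) p"
 using alt_all_swap[OF FM_alt subspace_tangent] by (simp add: evf_def)

lemma evf_adjacent: "w \<in> FM ==> evf w (pre @ X # X # post) p = 0" using alt_all_nondistinct[OF FM_alt] by (simp add: evf_def)

lemma VF_smooth': "X \<in> VF ==> (%p. X p f) \<in> A"
proof (cases "f \<in> A")
 case False
 assume X: "X \<in> VF"
 have "(%p. X p f) = (%p. 0)" by (rule ext) (rule tangent_outside[OF VF_tangent'[OF X] False])
 then show ?thesis using A_zero by simp
qed (rule VF_smooth)

lemma lie_bracket_add:
 assumes "X \<in> VF" "Y \<in> VF" "Z \<in> VF"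
 shows "lie_bracket X (Y + Z) = lie_bracket X Y + lie_bracket X Z"
proof (intro ext)
 fix p f
 note s = VF_smooth'[OF assms(2), of f] VF_smooth'[OF assms(3), of f]
 show "lie_bracket X (Y + Z) p f = (lie_bracket X Y + lie_bracket X Z) p f" by (simp add: lie_bracket_def tangent_add[OF VF_tangent'[OF assms(1)] s])
qed

lemma lie_bracket_swap: "lie_bracket Y X = - lie_bracket X Y" by (intro ext) (simp add: lie_bracket_def)

lemma lie_bracket_vmul:
 assumes "X \<in> VF" "Y \<in> VF" "g \<in> A"
 shows "lie_bracket X (vmul g Y) = vmul g (lie_bracket X Y) + vmul (%p. X p g) Y"
proof (intro ext)
 fix p f
 note s = VF_smooth'[OF assms(2), of f]
 show "lie_bracket X (vmul g Y) p f = (vmul g (lie_bracket X Y) + vmul (%p. X p g) Y) p f"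
  by (simp add: lie_bracket_def vmul_def scaleR_fun_def tangent_mult[OF VF_tangent'[OF assms(1)] assms(3) s]
    algebra_simps)
qed

lemma lie_bracket_Jacobi:
 assumes "X \<in> VF" "Y \<in> VF" "Z \<in> VF"
 shows "lie_bracket X (lie_bracket Y Z) - lie_bracket Y (lie_bracket X Z) = lie_bracket (lie_bracket X Y) Z"
proof (intro ext)
 fix p f
 have d: "X p (%q. g q - h q) = X p g - X p h" if "X \<in> VF" "g \<in> A" "h \<in> A" for X g h
  using tangent_add[OF VF_tangent'[OF that(1)] that(2) A_minus[OF that(3)]]
   tangent_minus[OF VF_tangent'[OF that(1)] that(3)] by simp
 show "(lie_bracket X (lie_bracket Y Z) - lie_bracket Y (lie_bracket X Z)) p f =
   lie_bracket (lie_bracket X Y) Z p f" by (simp add: lie_bracket_def d[OF assms(1)] d[OF assms(2)] d[OF assms(3)]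
    VF_smooth'[OF assms(1)] VF_smooth'[OF assms(2)] VF_smooth'[OF assms(3)])
qed

section \<open>The Lie derivative\<close>

primrec replace_sum :: "('a => 'a tan) => (('a => 'a tan) list => real) => ('a => 'a tan) list => real" where
 "replace_sum X F [] = 0"
| "replace_sum X F (Y # Ys) = F (lie_bracket X Y # Ys) + replace_sum X (%Zs. F (Y # Zs)) Ys"

lemma replace_sum_append:
 "replace_sum X F (pre @ Y # post) = replace_sum X (%Zs. F (Zs @ Y # post)) pre
   + F (pre @ lie_bracket X Y # post) + replace_sum X (%Zs. F (pre @ Y # Zs)) post" by (induction pre arbitrary: F) simp_all

lemma replace_sum_cong:
 "(!!Zs. set Zs <= VF ==> F Zs = G Zs) ==> X \<in> VF ==> set Ys <= VF ==>
  replace_sum X F Ys = replace_sum X G Ys"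
proof (induction Ys arbitrary: F G)
 case (Cons Y Ys)
 have "replace_sum X (%Zs. F (Y # Zs)) Ys = replace_sum X (%Zs. G (Y # Zs)) Ys" by (rule Cons.IH) (use Cons.prems in auto)
 moreover have "F (lie_bracket X Y # Ys) = G (lie_bracket X Y # Ys)" using Cons.prems lie_bracket_VF by auto
 ultimately show ?case by simp
qed simp

lemma replace_sum_linear:
 "replace_sum X (%Zs. F Zs + G Zs) Ys = replace_sum X F Ys + replace_sum X G Ys"
 "replace_sum X (%Zs. c * F Zs) Ys = c * replace_sum X F Ys"
 "replace_sum X (%Zs. 0) Ys = 0" by (induction Ys arbitrary: F G) (simp_all add: algebra_simps)

lemma replace_sum_smooth:
 "(!!Zs. set Zs <= VF ==> F Zs \<in> A) ==> X \<in> VF ==> set Ys <= VF ==>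
  (%p. replace_sum X (%Zs. F Zs p) Ys) \<in> A"
proof (induction Ys arbitrary: F)
 case (Cons Y Ys)
 have "(%p. replace_sum X (%Zs. F (Y # Zs) p) Ys) \<in> A" by (rule Cons.IH) (use Cons.prems in auto)
 moreover have "F (lie_bracket X Y # Ys) \<in> A" using Cons.prems lie_bracket_VF by auto
 ultimately show ?case unfolding replace_sum.simps by (intro A_add)
qed (simp add: A_zero)

definition lie_ev :: "('a => 'a tan) => 'a form => ('a => 'a tan) list => 'a => real" where
 "lie_ev X w Xs p = X p (evf w Xs) - replace_sum X (%Zs. evf w Zs p) Xs"

lemma lie_ev_smooth:
 assumes "X \<in> VF" "w \<in> FM" "set Xs <= VF" shows "lie_ev X w Xs \<in> A"
proof -
 have "(%p. X p (evf w Xs) - replace_sum X (%Zs. evf w Zs p) Xs) \<in> A" by (rule A_diff[OF VF_smooth[OF assms(1) evf_smooth[OF assms(2,3)]]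
     replace_sum_smooth[OF evf_smooth[OF assms(2)] assms(1,3)]])
 also have "(%p. X p (evf w Xs) - replace_sum X (%Zs. evf w Zs p) Xs) = lie_ev X w Xs" by (rule ext) (simp only: lie_ev_def)
 finally show ?thesis .
qed

lemma evf_lin:
 assumes w: "w \<in> FM" and s: "set pre <= VF" "g \<in> A" "Y \<in> VF" "Z \<in> VF" "set post <= VF"
 shows "evf w (pre @ (vmul g Y + Z) # post) p = g p * evf w (pre @ Y # post) p + evf w (pre @ Z # post) p"
 by (simp only: evf_add[OF w s(1) vmul_VF[OF s(2,3)] s(4,5)] evf_vmul[OF w s(1,3,5)])

text \<open>The derivative of g appears twice, once when X acts on the value of w and once in the
  Lie bracket of X with \<open>vmul g Y\<close>; the two contributions cancel.\<close>

lemma lie_ev_lin: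
 assumes X: "X \<in> VF" and w: "w \<in> FM" and s: "set pre <= VF" "g \<in> A" "Y \<in> VF" "Z \<in> VF" "set post <= VF"
 shows "lie_ev X w (pre @ (vmul g Y + Z) # post) p = g p * lie_ev X w (pre @ Y # post) p + lie_ev X w (pre @ Z # post) p"
proof -
 note t = VF_tangent'[OF X] and b = lie_bracket_VF[OF X]
 have e: "evf w (pre @ Y # post) \<in> A" "evf w (pre @ Z # post) \<in> A" using s by (simp_all add: evf_smooth[OF w])
 have "evf w (pre @ (vmul g Y + Z) # post) = (%p. g p * evf w (pre @ Y # post) p + evf w (pre @ Z # post) p)" by (rule ext) (rule evf_lin[OF w s])
 then have 1: "X p (evf w (pre @ (vmul g Y + Z) # post)) =
   X p g * evf w (pre @ Y # post) p + g p * X p (evf w (pre @ Y # post)) + X p (evf w (pre @ Z # post))"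
  by (simp add: tangent_add[OF t A_mult[OF s(2) e(1)] e(2)] tangent_mult[OF t s(2) e(1)])
 have 2: "replace_sum X (%Zs. evf w (Zs @ (vmul g Y + Z) # post) p) pre =
   g p * replace_sum X (%Zs. evf w (Zs @ Y # post) p) pre + replace_sum X (%Zs. evf w (Zs @ Z # post) p) pre"
  unfolding replace_sum_linear[symmetric] by (rule replace_sum_cong[OF _ X s(1)]) (rule evf_lin[OF w _ s(2-5)])
 have 3: "replace_sum X (%Zs. evf w (pre @ (vmul g Y + Z) # Zs) p) post =
   g p * replace_sum X (%Zs. evf w (pre @ Y # Zs) p) post + replace_sum X (%Zs. evf w (pre @ Z # Zs) p) post"
  unfolding replace_sum_linear[symmetric] by (rule replace_sum_cong[OF _ X s(5)]) (rule evf_lin[OF w s(1-4)])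
 have 4: "evf w (pre @ lie_bracket X (vmul g Y + Z) # post) p = g p * evf w (pre @ lie_bracket X Y # post) p +
   (X p g * evf w (pre @ Y # post) p + evf w (pre @ lie_bracket X Z # post) p)"
  unfolding lie_bracket_add[OF X vmul_VF[OF s(2,3)] s(4)] lie_bracket_vmul[OF X s(3,2)] add.assoc
   evf_lin[OF w s(1,2) b[OF s(3)] subspace_add[OF subspace_VF vmul_VF[OF VF_smooth[OF X s(2)] s(3)] b[OF s(4)]] s(5)]
   evf_lin[OF w s(1) VF_smooth[OF X s(2)] s(3) b[OF s(4)] s(5)] ..
 show ?thesis unfolding lie_ev_def replace_sum_append 1 2 3 4 by (simp add: algebra_simps)
qed

lemma lie_ev_adjacent:
 assumes X: "X \<in> VF" and w: "w \<in> FM" and s: "set pre <= VF" "Y \<in> VF" "set post <= VF"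
 shows "lie_ev X w (pre @ Y # Y # post) p = 0"
proof -
 have "evf w (pre @ Y # Y # post) = (%p. 0)" by (rule ext) (rule evf_adjacent[OF w])
 then have 1: "X p (evf w (pre @ Y # Y # post)) = 0" by (simp add: tangent_zero[OF VF_tangent'[OF X]])
 have 2: "evf w ((pre @ [Y]) @ lie_bracket X Y # post) p = - evf w (pre @ lie_bracket X Y # Y # post) p"
  using evf_swap[OF w, of pre Y "lie_bracket X Y" post p] by simp
 show ?thesis unfolding lie_ev_def 1 replace_sum_append using replace_sum_append[of X "%Zs. evf w (pre @ Y # Zs) p" "[]" Y post] 2 evf_adjacent[OF w]
  by (simp add: replace_sum_linear)
qed

definition lie_der :: "('a => 'a tan) => 'a form => 'a form" where
 "lie_der X w = mk_fm (lie_ev X w)"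

lemma lie_der_FM: "X \<in> VF ==> w \<in> FM ==> lie_der X w \<in> FM"
 and evf_lie_der: "X \<in> VF ==> w \<in> FM ==> set Xs <= VF ==> evf (lie_der X w) Xs = lie_ev X w Xs" unfolding lie_der_def
 by (rule mk_fm[where F="lie_ev X w"]; simp add: lie_ev_smooth lie_ev_lin lie_ev_adjacent)+

text \<open>Cartan's formula, contraction after d equals Lie derivative minus d after contraction,
  read as a recursion over the arguments. Proofs about d thus become inductions over the argument
  list, and the invariant formula is derived later.\<close>

primrec d_ev :: "('a => 'a tan) list => 'a form => 'a => real" where
 "d_ev [] = (%w p. 0)"
| "d_ev (X # Xs) = (%w p. lie_ev X w Xs p - d_ev Xs (iprod X w) p)"

lemma lie_ev_form_add:
 assumes "X \<in> VF" "w \<in> FM" "w' \<in> FM" "set Xs <= VF"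
 shows "lie_ev X (w + w') Xs p = lie_ev X w Xs p + lie_ev X w' Xs p"
 using tangent_add[OF VF_tangent'[OF assms(1)] evf_smooth[OF assms(2,4)] evf_smooth[OF assms(3,4)]]
 by (simp add: lie_ev_def evf_linear replace_sum_linear)

lemma lie_ev_form_scaleR:
 assumes "X \<in> VF" "w \<in> FM" "set Xs <= VF"
 shows "lie_ev X (c *\<^sub>R w) Xs p = c * lie_ev X w Xs p" using tangent_cmult[OF VF_tangent'[OF assms(1)] evf_smooth[OF assms(2,3)]]
 by (simp add: lie_ev_def evf_linear replace_sum_linear algebra_simps)

lemma d_ev_linear:
 "w \<in> FM ==> w' \<in> FM ==> set Xs <= VF ==> d_ev Xs (w + w') p = d_ev Xs w p + d_ev Xs w' p"
 "w \<in> FM ==> set Xs <= VF ==> d_ev Xs (c *\<^sub>R w) p = c * d_ev Xs w p"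
 by (induction Xs arbitrary: w w') (simp_all add: lie_ev_form_add lie_ev_form_scaleR iprod_linear iprod_FM algebra_simps)

lemma d_ev_minus: "w \<in> FM ==> set Xs <= VF ==> d_ev Xs (- w) p = - d_ev Xs w p" using d_ev_linear(2)[of w Xs "-1" p] by simp

lemma d_ev_smooth: "w \<in> FM ==> set Xs <= VF ==> d_ev Xs w \<in> A"
proof (induction Xs arbitrary: w)
 case (Cons X Xs)
 then have "lie_ev X w Xs \<in> A" "d_ev Xs (iprod X w) \<in> A" by (simp_all add: lie_ev_smooth iprod_FM)
 then show ?case unfolding d_ev.simps by (rule A_diff)
qed (simp add: A_zero)

lemma iprod_swap: "w \<in> FM ==> iprod Y (iprod X w) = - iprod X (iprod Y w)"
proof (intro ext)
 fix p xs assume "w \<in> FM"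
 then show "iprod Y (iprod X w) p xs = (- iprod X (iprod Y w)) p xs" using alt_all_swap[OF FM_alt[of w p] subspace_tangent, of "[]" "X p" "Y p" xs]
  by (simp add: iprod_def contract_def)
qed

lemma d_ev_swap:
 assumes w: "w \<in> FM" and s: "X \<in> VF" "Y \<in> VF" "set Zs <= VF"
 shows "d_ev (X # Y # Zs) w p = - d_ev (Y # X # Zs) w p"
proof -
 have "evf w (lie_bracket Y X # Zs) p = - evf w (lie_bracket X Y # Zs) p" using evf_vmul[OF w _ lie_bracket_VF[OF s(1,2)] s(3), of "[]" "%_. -1" p]
  by (simp add: lie_bracket_swap[of Y X] vmul_def[abs_def] fun_Compl_def)
 moreover have "d_ev Zs (iprod Y (iprod X w)) p = - d_ev Zs (iprod X (iprod Y w)) p"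
  unfolding iprod_swap[OF w, of Y X] by (intro d_ev_minus iprod_FM w s)
 ultimately show ?thesis by (simp add: lie_ev_def evf_iprod)
qed

lemma d_ev_lin:
 "w \<in> FM ==> set pre <= VF ==> g \<in> A ==> Y \<in> VF ==> Z \<in> VF ==> set post <= VF ==>
  d_ev (pre @ (vmul g Y + Z) # post) w p = g p * d_ev (pre @ Y # post) w p + d_ev (pre @ Z # post) w p"
proof (induction pre arbitrary: w)
 case (Cons X pre)
 then show ?case by (simp add: lie_ev_lin iprod_FM del: plus_fun_apply) (simp add: algebra_simps)
next
 case Nil
 have YZ: "vmul g Y + Z \<in> VF" using Nil by (intro subspace_add[OF subspace_VF] vmul_VF)
 show ?case using Nil
 proof (induction post arbitrary: w)
  case Nil then show ?case by (simp add: lie_ev_def vmul_def scaleR_fun_def)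
 next
  case (Cons X post)
  have 1: "d_ev (X # V # post) w p = lie_ev X w (V # post) p - d_ev (V # post) (iprod X w) p" for V by (simp only: d_ev.simps(2))
  have 2: "d_ev ((vmul g Y + Z) # post) (iprod X w) p = g p * d_ev (Y # post) (iprod X w) p + d_ev (Z # post) (iprod X w) p"
   using Cons.IH[of "iprod X w"] Cons.prems iprod_FM unfolding append_Nil by simp
  have 3: "lie_ev X w ((vmul g Y + Z) # post) p = g p * lie_ev X w (Y # post) p + lie_ev X w (Z # post) p"
   using lie_ev_lin[of X w "[]" g Y Z post p] Cons.prems unfolding append_Nil by simp
  have sw: "d_ev (V # X # post) w p = - d_ev (X # V # post) w p" if "V \<in> VF" for V using Cons.prems that by (intro d_ev_swap) auto
  show ?case unfolding append_Nil sw[OF YZ] sw[OF Cons.prems(4)] sw[OF Cons.prems(5)] 1 2 3 by (simp add: algebra_simps)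
 qed
qed

lemma d_ev_adjacent:
 "w \<in> FM ==> set pre <= VF ==> Y \<in> VF ==> set post <= VF ==> d_ev (pre @ Y # Y # post) w p = 0"
proof (induction pre arbitrary: w)
 case Nil
 then show ?case using d_ev_swap[of w Y Y post p] by simp
next
 case (Cons X pre)
 then show ?case by (simp add: lie_ev_adjacent iprod_FM)
qed

definition d_form :: "'a form => 'a form" where
 "d_form w = mk_fm (%Xs. d_ev Xs w)"

lemma d_form_FM: "w \<in> FM ==> d_form w \<in> FM"
 and evf_d_form: "w \<in> FM ==> set Xs <= VF ==> evf (d_form w) Xs = d_ev Xs w" unfolding d_form_def
 by (rule mk_fm[where F="%Xs. d_ev Xs w"]; simp add: d_ev_smooth d_ev_lin d_ev_adjacent)+

lemma d_form_linear:
 assumes "w \<in> FM" "w' \<in> FM"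
 shows "d_form (w + w') = d_form w + d_form w'" "d_form (c *\<^sub>R w) = c *\<^sub>R d_form w"
 by (rule FM_eqI; simp add: assms d_form_FM subspace_add[OF subspace_FM] subspace_scale[OF subspace_FM]
   evf_d_form evf_linear d_ev_linear fun_eq_iff)+

lemma lie_der_linear:
 assumes "X \<in> VF" "w \<in> FM" "w' \<in> FM"
 shows "lie_der X (w + w') = lie_der X w + lie_der X w'" "lie_der X (c *\<^sub>R w) = c *\<^sub>R lie_der X w"
 by (rule FM_eqI; simp add: assms lie_der_FM subspace_add[OF subspace_FM] subspace_scale[OF subspace_FM]
   evf_lie_der evf_linear lie_ev_form_add lie_ev_form_scaleR fun_eq_iff)+

section \<open>Cartan calculus\<close>

lemma FM_diff: "w \<in> FM ==> w' \<in> FM ==> w - w' \<in> FM" by (rule subspace_diff[OF subspace_FM])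

lemma d_form_diff: "w \<in> FM ==> w' \<in> FM ==> d_form (w - w') = d_form w - d_form w'"
 using d_form_linear(1)[of w "(-1) *\<^sub>R w'"] d_form_linear(2)[of w' w' "-1"] subspace_scale[OF subspace_FM, of w' "-1"] by simp

lemma lie_der_diff: "X \<in> VF ==> w \<in> FM ==> w' \<in> FM ==> lie_der X (w - w') = lie_der X w - lie_der X w'"
 using lie_der_linear(1)[of X w "(-1) *\<^sub>R w'"] lie_der_linear(2)[of X w' w' "-1"]
  subspace_scale[OF subspace_FM, of w' "-1"] by simp

lemma Cartan: "X \<in> VF ==> w \<in> FM ==> iprod X (d_form w) = lie_der X w - d_form (iprod X w)" by (rule FM_eqI)
  (simp_all add: iprod_FM d_form_FM lie_der_FM FM_diff evf_iprod evf_linear evf_d_form evf_lie_der fun_eq_iff)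

lemma iprod_lie_der:
 assumes "X \<in> VF" "Y \<in> VF" "w \<in> FM"
 shows "iprod Y (lie_der X w) = lie_der X (iprod Y w) - iprod (lie_bracket X Y) w" by (rule FM_eqI)
  (simp_all add: assms iprod_FM lie_der_FM FM_diff evf_iprod evf_linear evf_lie_der lie_bracket_VF lie_ev_def
   fun_eq_iff)

lemma evf_Cons: "evf w (X # Xs) = evf (iprod X w) Xs" by (simp add: evf_iprod)

lemma iprod_VF_diff:
 assumes "X \<in> VF" "Y \<in> VF" "w \<in> FM" shows "iprod (X - Y) w = iprod X w - iprod Y w"
proof (intro ext)
 fix p xs
 note XY = VF_tangent'[OF assms(1), of p] VF_tangent'[OF assms(2), of p]
  subspace_scale[OF subspace_tangent VF_tangent'[OF assms(2), of p], of "-1"]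
 show "iprod (X - Y) w p xs = (iprod X w - iprod Y w) p xs"
 proof (cases "set xs <= T p")
  case True
  have e: "(X - Y) p = X p + (-1) *\<^sub>R Y p" by simp
  show ?thesis unfolding iprod_def contract_def e using alt_all_add[OF FM_alt[OF assms(3), of p], of "[]" xs "X p" "(-1) *\<^sub>R Y p"]
    alt_all_scaleR[OF FM_alt[OF assms(3), of p], of "[]" xs "Y p" "-1"] XY True by simp
 next
  case False
  then show ?thesis using alt_all_outside[OF FM_alt[OF assms(3), of p], of "_ # xs"] by (simp add: iprod_def contract_def)
 qed
qed

text \<open>Moving the contraction with the first argument Z through the Lie derivatives reduces the
  claim for w to the claim for \<open>iprod Z w\<close>; the contractions with double Lie brackets
  that remain match by the Jacobi identity of vector fields.\<close>

lemma evf_lie_commutator: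
 "X \<in> VF ==> Y \<in> VF ==> w \<in> FM ==> set Zs <= VF ==>
  evf (lie_der X (lie_der Y w)) Zs p = evf (lie_der Y (lie_der X w)) Zs p + evf (lie_der (lie_bracket X Y) w) Zs p"
proof (induction Zs arbitrary: w)
 case Nil
 have e: "evf (lie_der V u) [] = (%p. V p (evf u []))" if "V \<in> VF" "u \<in> FM" for V u
  using that by (intro ext) (simp add: evf_lie_der lie_ev_def)
 have "evf (lie_der (lie_bracket X Y) w) [] p = X p (%p. Y p (evf w [])) - Y p (%p. X p (evf w []))"
  using e[OF lie_bracket_VF[OF Nil(1,2)] Nil(3)] by (simp only: lie_bracket_def)
 then show ?case using Nil by (simp add: e lie_der_FM)
next
 case (Cons Z Zs)
 note vf = Cons.prems(1,2) and w = Cons.prems(3)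
 have Z: "Z \<in> VF" and Zs: "set Zs <= VF" using Cons.prems by auto
 note m = vf w Z lie_der_FM iprod_FM lie_bracket_VF FM_diff
 have J: "lie_bracket X (lie_bracket Y Z) - lie_bracket Y (lie_bracket X Z) = lie_bracket (lie_bracket X Y) Z" by (rule lie_bracket_Jacobi[OF vf Z])
 have 1: "iprod Z (lie_der X (lie_der Y w)) = lie_der X (lie_der Y (iprod Z w)) - lie_der X (iprod (lie_bracket Y Z) w)
   - lie_der Y (iprod (lie_bracket X Z) w) + iprod (lie_bracket Y (lie_bracket X Z)) w"
  if "X \<in> VF" "Y \<in> VF" for X Y using that w Z by (simp add: iprod_lie_der lie_der_FM lie_bracket_VF lie_der_diff iprod_FM)
 have 2: "iprod Z (lie_der (lie_bracket X Y) w) = lie_der (lie_bracket X Y) (iprod Z w)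
   - (iprod (lie_bracket X (lie_bracket Y Z)) w - iprod (lie_bracket Y (lie_bracket X Z)) w)"
  using iprod_lie_der[of "lie_bracket X Y" Z w] iprod_VF_diff[of "lie_bracket X (lie_bracket Y Z)" "lie_bracket Y (lie_bracket X Z)" w]
   m by (simp add: J)
 show ?case unfolding evf_Cons[of _ Z] 1[OF vf] 1[OF vf(2,1)] 2 evf_linear using Cons.IH[OF vf iprod_FM[OF Z w] Zs] by simp
qed

lemma lie_commutator:
 assumes "X \<in> VF" "Y \<in> VF" "w \<in> FM"
 shows "lie_der X (lie_der Y w) = lie_der Y (lie_der X w) + lie_der (lie_bracket X Y) w"
proof (rule FM_eqI)
 show "evf (lie_der X (lie_der Y w)) Zs = evf (lie_der Y (lie_der X w) + lie_der (lie_bracket X Y) w) Zs"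
  if "set Zs <= VF" for Zs by (rule ext) (simp only: evf_linear evf_lie_commutator[OF assms that])
qed (simp_all add: assms lie_der_FM lie_bracket_VF subspace_add[OF subspace_FM])

lemma evf_lie_d: "X \<in> VF ==> w \<in> FM ==> set Zs <= VF ==>
  evf (lie_der X (d_form w)) Zs p = evf (d_form (lie_der X w)) Zs p"
proof (induction Zs arbitrary: w)
 case Nil
 have "evf (d_form w) [] = (%p. 0)" using Nil by (simp add: evf_d_form)
 then show ?case using Nil by (simp add: evf_d_form evf_lie_der d_form_FM lie_der_FM lie_ev_def tangent_zero[OF VF_tangent'])
next
 case (Cons Z Zs)
 have Z: "Z \<in> VF" and Zs: "set Zs <= VF" using Cons.prems by auto
 note m = Cons.prems(1,2) Z
 have "iprod Z (lie_der X (d_form w)) =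
   lie_der X (lie_der Z w) - lie_der X (d_form (iprod Z w)) - lie_der (lie_bracket X Z) w + d_form (iprod (lie_bracket X Z) w)"
  using m by (simp add: iprod_lie_der Cartan d_form_FM lie_der_FM iprod_FM lie_bracket_VF lie_der_diff)
 moreover have "iprod Z (d_form (lie_der X w)) =
   lie_der Z (lie_der X w) - d_form (lie_der X (iprod Z w)) + d_form (iprod (lie_bracket X Z) w)"
  using m by (simp add: iprod_lie_der Cartan d_form_FM lie_der_FM iprod_FM lie_bracket_VF d_form_diff)
 ultimately show ?case unfolding evf_Cons[of _ Z] lie_commutator[OF m(1,3,2)] using Cons.IH[OF m(1) iprod_FM[OF Z m(2)] Zs] by (simp only: evf_linear)
qed

text \<open>By Cartan's formula, contracting the second differential with Z leaves the commutator of
  d with the Lie derivative, which vanishes, and the second differential of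
  \<open>iprod Z w\<close>, which has one argument less.\<close>

lemma evf_dd: "w \<in> FM ==> set Zs <= VF ==> evf (d_form (d_form w)) Zs p = 0"
proof (induction Zs arbitrary: w)
 case Nil then show ?case by (simp add: evf_d_form d_form_FM)
next
 case (Cons Z Zs)
 have Z: "Z \<in> VF" and Zs: "set Zs <= VF" and w: "w \<in> FM" using Cons.prems by auto
 have "iprod Z (d_form (d_form w)) = lie_der Z (d_form w) - d_form (lie_der Z w) + d_form (d_form (iprod Z w))"
  using Z w by (simp add: Cartan d_form_FM lie_der_FM iprod_FM d_form_diff)
 then show ?case unfolding evf_Cons[of _ Z] using evf_lie_d[OF Z w Zs] Cons.IH[OF iprod_FM[OF Z w] Zs] by (simp add: evf_linear)
qed

lemma d_form_d_form:
 assumes "w \<in> FM" shows "d_form (d_form w) = 0"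
proof (rule FM_eqI)
 show "evf (d_form (d_form w)) Zs = evf 0 Zs" if "set Zs <= VF" for Zs by (rule ext) (simp only: evf_linear evf_dd[OF assms that])
qed (intro d_form_FM assms FM_0)+

section \<open>The invariant formula for the differential\<close>

lemma pick1_replace_sum:
 "w \<in> FM ==> pick1 (%Y Ys. evf w (lie_bracket X Y # Ys) p) Xs = replace_sum X (%Zs. evf w Zs p) Xs"
 if "X \<in> VF" and "set Xs <= VF" using that(2)
proof (induction Xs arbitrary: w)
 case (Cons Y Ys)
 have "evf w (lie_bracket X Z # Y # Zs) p = - evf (iprod Y w) (lie_bracket X Z # Zs) p" for Z Zs
  using evf_swap[OF Cons.prems(1), of "[]" "lie_bracket X Z" Y Zs p] by (simp add: evf_iprod)
 moreover have "pick1 (%y ys. - F y ys) xs = - pick1 F xs" for F and xs :: "('a => 'a tan) list" by (induction xs arbitrary: F) simp_all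
 ultimately show ?case using Cons by (simp add: iprod_FM) (simp add: evf_iprod)
qed simp

lemma d_ev_pick:
 "w \<in> FM ==> set Xs <= VF ==> d_ev Xs w p =
  pick1 (%X Ys. X p (evf w Ys)) Xs + pick2 (%X Y Zs. evf w (lie_bracket X Y # Zs) p) Xs"
proof (induction Xs arbitrary: w)
 case (Cons X Xs)
 have "evf w (lie_bracket Y Z # X # Zs) p = - evf (iprod X w) (lie_bracket Y Z # Zs) p" for Y Z Zs
  using evf_swap[OF Cons.prems(1), of "[]" "lie_bracket Y Z" X Zs p] by (simp add: evf_iprod)
 moreover have m1: "pick1 (%y ys. - F y ys) xs = - pick1 F xs" for F and xs :: "('a => 'a tan) list" by (induction xs arbitrary: F) simp_all
 moreover have "pick2 (%y z zs. - F y z zs) xs = - pick2 F xs" for F and xs :: "('a => 'a tan) list" by (induction xs arbitrary: F) (simp_all add: m1)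
 ultimately show ?case using Cons by (simp add: iprod_FM pick1_replace_sum lie_ev_def) (simp add: evf_iprod)
qed simp

lemma ext_deriv_d_form:
 assumes w: "w \<in> forms M k" shows "ext_deriv M k w = d_form w" and "d_form w \<in> forms M (Suc k)"
proof -
 have FM: "w \<in> FM" and len: "!!p xs. length xs ~= k ==> w p xs = 0" using w by (auto simp: forms_iff)
 have z: "d_ev Xs w p = 0" if "set Xs <= VF" "length Xs ~= Suc k" "w \<in> FM" "!!p xs. length xs ~= k ==> w p xs = 0"
  for Xs p w k using that
 proof (induction Xs arbitrary: w k)
  case (Cons X Xs)
  have X: "X \<in> VF" using Cons.prems by simp
  have e: "evf w Ys p = 0" if "length Ys = length Xs" for Ys p using Cons.prems(2,4) that by (simp add: evf_def)
  have "evf w Xs = (%p. 0)" using e by blast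
  moreover have r: "replace_sum X F Ys = 0" if "!!Zs. length Zs = length Ys ==> F Zs = 0" for F Ys using that by (induction Ys arbitrary: F) simp_all
  ultimately have "lie_ev X w Xs p = 0" using e by (simp add: lie_ev_def tangent_zero[OF VF_tangent'[OF X]])
  moreover have "d_ev Xs (iprod X w) p = 0"
  proof (cases k)
   case 0
   have "iprod X w = 0" using Cons.prems(4) 0 by (intro ext) (simp add: iprod_def contract_def)
   then show ?thesis using d_ev_linear(2)[of 0 Xs 0 p] Cons.prems FM_0 by simp
  next
   case (Suc k')
   have "iprod X w p xs = 0" if "length xs ~= k'" for p xs using Cons.prems(4) that Suc by (simp add: iprod_def contract_def)
   then show ?thesis using Cons.prems Suc iprod_FM[OF X] by (intro Cons.IH[of k' "iprod X w"]) auto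
  qed
  ultimately show ?case by simp
 qed simp
 show F: "d_form w \<in> forms M (Suc k)" unfolding forms_iff
 proof (intro conjI allI impI)
  fix p and xs :: "'a tan list" assume l: "length xs ~= Suc k"
  show "d_form w p xs = 0"
  proof (cases "p \<in> pts M & set xs <= T p")
   case True
   then have "set (map (vfext p) xs) <= VF" using vfext by auto
   then show ?thesis using z[OF _ _ FM len, of "map (vfext p) xs"] l True by (simp add: d_form_def mk_alt_def)
  qed (auto simp: d_form_def mk_alt_def)
 qed (rule d_form_FM[OF FM])
 define R where "R Xs p =
  (\<Sum>i\<le>k. (-1) ^ i * (Xs ! i) p (%q. w q (map (%X. X q) (nths Xs (- {i}))))) +
  (\<Sum>(i, j) \<in> {(i, j). i < j & j \<le> k}. (-1) ^ (i + j) *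
    w p (lie_bracket (Xs ! i) (Xs ! j) p # map (%X. X p) (nths Xs (- {i, j}))))" for Xs p
 have f: "d_form w p (map (%X. X p) Xs) = R Xs p" if "length Xs = Suc k" "set Xs <= VF" for Xs p
 proof -
  have "d_form w p (map (%X. X p) Xs) = d_ev Xs w p" using fun_cong[OF evf_d_form[OF FM that(2)], of p] by (simp add: evf_def)
  then show ?thesis unfolding d_ev_pick[OF FM that(2)] pick1_sum pick2_sum that(1) R_def by (simp add: evf_def lessThan_Suc_atMost less_Suc_eq_le)
 qed
 show "ext_deriv M k w = d_form w" unfolding ext_deriv_def R_def[symmetric]
 proof (rule the_equality)
  show "d_form w \<in> forms M (Suc k) & (\<forall>Xs. length Xs = Suc k & set Xs <= VF -->
    (\<forall>p\<in>pts M. d_form w p (map (%X. X p) Xs) = R Xs p))" using F f by blast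
  fix e assume e: "e \<in> forms M (Suc k) & (\<forall>Xs. length Xs = Suc k & set Xs <= VF -->
    (\<forall>p\<in>pts M. e p (map (%X. X p) Xs) = R Xs p))"
  show "e = d_form w"
  proof (rule FM_eqI)
   show eF: "e \<in> FM" and dF: "d_form w \<in> FM" using e F by (auto simp: forms_iff)
   fix Xs assume Xs: "set Xs <= VF"
   show "evf e Xs = evf (d_form w) Xs"
   proof
    fix p
    consider "p ~: pts M" | "length Xs ~= Suc k" | "p \<in> pts M" "length Xs = Suc k" by blast
    then show "evf e Xs p = evf (d_form w) Xs p"
    proof cases
     case 1 then show ?thesis by (simp add: evf_def FM_outside[OF eF] FM_outside[OF dF])
    next
     case 2
     have X: "x p (map (%X. X p) Xs) = 0" if "x \<in> forms M (Suc k)" for x using that 2 by (simp add: forms_iff)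
     show ?thesis unfolding evf_def by (simp only: X[OF conjunct1[OF e]] X[OF F])
    next
     case 3
     then show ?thesis using e Xs f[OF 3(2) Xs, of p] by (simp add: evf_def)
    qed
   qed
  qed
 qed
qed

end

subsection \<open>Derivations on lists\<close>

text \<open>The terms of the graded Leibniz rule: an odd derivation i hits one entry, and every
  entry that it has to pass receives the sign operator t.\<close>

primrec dlist :: "('b => 'b) => ('b => 'b) => 'b list => 'b list list" where
 "dlist i t [] = []"
| "dlist i t (x # xs) = (i x # xs) # map ((#) (t x)) (dlist i t xs)"

definition dsum :: "('b => 'b) => ('b => 'b) => ('b list => 'c::comm_monoid_add) => 'b list => 'c" where
 "dsum i t G xs = (\<Sum>ys\<leftarrow>dlist i t xs. G ys)"

lemma dsum_simps [simp]:
 "dsum i t G [] = 0"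
 "dsum i t G (x # xs) = G (i x # xs) + dsum i t (%ys. G (t x # ys)) xs" by (simp_all add: dsum_def comp_def)

lemma dsum_append:
 "dsum i t G (xs @ ys) =
   dsum i t (%zs. G (zs @ ys)) xs + dsum i t (%zs. G (map t xs @ zs)) ys" by (induction xs arbitrary: G) (simp_all add: add.assoc)

lemma dsum_cong:
 assumes "!!ys. ys \<in> set (dlist i t xs) ==> G ys = H ys"
 shows "dsum i t G xs = dsum i t H xs" unfolding dsum_def using assms by (metis map_cong)

lemma dsum_cong_set:
 assumes "!!ys. set ys <= S ==> length ys = length xs ==> G ys = H ys"
  and "set xs <= S" "!!x. x \<in> S ==> i x \<in> S" "!!x. x \<in> S ==> t x \<in> S"
 shows "dsum i t G xs = dsum i t H xs" using assms(1,2)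
proof (induction xs arbitrary: G H)
 case (Cons x xs)
 have "dsum i t (%ys. G (t x # ys)) xs = dsum i t (%ys. H (t x # ys)) xs" by (rule Cons.IH) (use Cons.prems assms(3,4) in auto)
 moreover have "G (i x # xs) = H (i x # xs)" by (rule Cons.prems) (use Cons.prems assms(3,4) in auto)
 ultimately show ?case by simp
qed simp

lemma dsum_add: "dsum i t (%ys. G ys + H ys) xs = dsum i t G xs + dsum i t H xs" by (induction xs arbitrary: G H) (simp_all add: ac_simps)

lemma dsum_scaleR:
 fixes G :: "'b list => 'c::real_vector"
 shows "dsum i t (%ys. c *\<^sub>R G ys) xs = c *\<^sub>R dsum i t G xs" by (induction xs arbitrary: G) (simp_all add: scaleR_add_right)

lemma dsum_mult:
 "dsum i t (%ys. c * G ys) xs = c * (dsum i t G xs :: real)" using dsum_scaleR[of i t c G xs] by simp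

lemma dsum_map:
 assumes "!!x. i' (h x) = h (i x)" "!!x. t' (h x) = h (t x)"
 shows "dsum i' t' G (map h xs) = dsum i t (%ys. G (map h ys)) xs" by (induction xs arbitrary: G) (simp_all add: assms)

lemma dsum_apply:
 fixes G :: "'b list => 'c => 'd::comm_monoid_add"
 shows "dsum i t G xs p = dsum i t (%ys. G ys p) xs" by (induction xs arbitrary: G) simp_all

lemma multilin_onD:
 assumes "multilin_on S G" "set xs <= S" "set ys <= S"
 shows multilin_on_add: "x \<in> S ==> y \<in> S ==> G (xs @ (x + y) # ys) = G (xs @ x # ys) + G (xs @ y # ys)"
  and multilin_on_scaleR: "x \<in> S ==> G (xs @ (c *\<^sub>R x) # ys) = c *\<^sub>R G (xs @ x # ys)"
 using assms by (simp_all add: multilin_on_def lin_on_def)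

lemma multilin_on_zero:
 "multilin_on S G ==> set xs <= S ==> set ys <= S ==> 0 \<in> S ==> G (xs @ 0 # ys) = 0" using multilin_on_scaleR[of S G xs ys 0 0] by simp

lemma multilin_on_minus:
 "multilin_on S G ==> set xs <= S ==> set ys <= S ==> x \<in> S ==> G (xs @ (- x) # ys) = - G (xs @ x # ys)"
 using multilin_on_scaleR[of S G xs ys x "-1"] by simp

lemma multilin_on_appendD:
 assumes "multilin_on S G" "set xs <= S" "set ys <= S" shows "multilin_on S (%zs. G (xs @ zs @ ys))" unfolding multilin_on_def
proof (intro allI impI)
 fix us vs assume "set us <= S & set vs <= S"
 then have "lin_on S (%x. G ((xs @ us) @ x # (vs @ ys)))" using assms(2,3) by (intro assms(1)[unfolded multilin_on_def, rule_format]) auto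
 then show "lin_on S (%x. G (xs @ (us @ x # vs) @ ys))" by simp
qed

lemma multilin_on_ConsD: "multilin_on S G ==> x \<in> S ==> multilin_on S (%xs. G (x # xs))" using multilin_on_appendD[of S G "[x]" "[]"] by simp

lemma lin_on_plus: "lin_on V f ==> lin_on V g ==> lin_on V (%x. f x + g x :: 'c::real_vector)" by (simp add: lin_on_def scaleR_add_right ac_simps)

context
 fixes S :: "'b::real_vector set" and i t :: "'b => 'b"
 assumes S: "subspace S"
  and i: "!!x. x \<in> S ==> i x \<in> S" "lin_on S i" and t: "!!x. x \<in> S ==> t x \<in> S" "lin_on S t"
begin

lemma lin_on_dsum:
 "(!!ys. set ys <= S ==> lin_on V (%x. G x ys :: 'c::real_vector)) ==> set xs <= S ==> lin_on V (%x. dsum i t (G x) xs)"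
proof (induction xs arbitrary: G)
 case (Cons x xs)
 have "lin_on V (%v. dsum i t (%ys. G v (t x # ys)) xs)" by (rule Cons.IH) (use Cons.prems t in auto)
 moreover have "lin_on V (%v. G v (i x # xs))" by (rule Cons.prems) (use Cons.prems i in auto)
 ultimately show ?case by (simp add: lin_on_plus)
qed (simp add: lin_on_def)

lemma multilin_on_dsum:
 assumes G: "multilin_on S (G :: 'b list => 'c::real_vector)"
 shows "multilin_on S (dsum i t G)" unfolding multilin_on_def
proof (intro allI impI)
 fix xs ys assume s: "set xs <= S & set ys <= S"
 then have m: "set (map t xs) <= S" using t(1) by auto
 have g: "lin_on S (%x. G (zs @ x # ws))" if "set zs <= S" "set ws <= S" for zs ws using G that by (simp add: multilin_on_def)
 have "lin_on S (%x. G (zs @ t x # ws))" "lin_on S (%x. G (zs @ i x # ws))" if "set zs <= S" "set ws <= S" for zs ws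
  using g[OF that] t i by (auto simp: lin_on_def)
 then have "lin_on S (%x. dsum i t (%zs. G (map t xs @ t x # zs)) ys)" "lin_on S (%x. G (map t xs @ i x # ys))"
  "lin_on S (%x. dsum i t (%zs. G (zs @ x # ys)) xs)" using m s g by (auto intro!: lin_on_dsum)
 then show "lin_on S (%x. dsum i t G (xs @ x # ys))" by (simp add: dsum_append lin_on_plus)
qed

text \<open>Hitting one entry twice gives 0. Hitting two different entries in either order gives
  opposite terms, because i anticommutes with the sign operator t.\<close>

lemma dsum_twice:
 assumes sq: "!!x. x \<in> S ==> i (i x) = 0" "!!x. x \<in> S ==> i (t x) = - t (i x)"
  and xs: "set xs <= S" and G: "multilin_on S (G :: 'b list => 'c::real_vector)"
 shows "dsum i t (dsum i t G) xs = 0" using xs G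
proof (induction xs arbitrary: G)
 case (Cons x xs)
 have x: "x \<in> S" and xs: "set xs <= S" using Cons.prems by auto
 have m: "multilin_on S (%ys. G (t (t x) # ys))" using Cons.prems(2) t(1) x by (intro multilin_on_ConsD) auto
 have z: "G (i (i x) # xs) = 0" unfolding sq(1)[OF x] using multilin_on_zero[OF Cons.prems(2), of "[]" xs] xs subspace_0[OF S] by simp
 have n: "dsum i t (%ys. G (i (t x) # ys)) xs = - dsum i t (%ys. G (t (i x) # ys)) xs"
 proof -
  have "dsum i t (%ys. G (i (t x) # ys)) xs = dsum i t (%ys. (-1) *\<^sub>R G (t (i x) # ys)) xs" unfolding sq(2)[OF x]
   by (rule dsum_cong_set[where S=S, OF _ xs i(1) t(1)])
    (use multilin_on_minus[OF Cons.prems(2), of "[]" _ "t (i x)"] i t x in auto)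
  then show ?thesis unfolding dsum_scaleR by simp
 qed
 have "dsum i t (dsum i t G) (x # xs) =
   G (i (i x) # xs) + (dsum i t (%ys. G (t (i x) # ys)) xs
   + (dsum i t (%ys. G (i (t x) # ys)) xs
    + dsum i t (dsum i t (%ys. G (t (t x) # ys))) xs))" by (simp add: dsum_add add.assoc)
 then show ?case using Cons.IH[OF xs m] z n by simp
qed simp

lemma dsum_fun_add:
 assumes i': "!!x. x \<in> S ==> i' x \<in> S" and xs: "set xs <= S" and G: "multilin_on S (G :: 'b list => 'c::real_vector)"
 shows "dsum (%x. i x + i' x) t G xs = dsum i t G xs + dsum i' t G xs" using xs G
proof (induction xs arbitrary: G)
 case (Cons x xs)
 have "G ((i x + i' x) # xs) = G (i x # xs) + G (i' x # xs)" using multilin_on_add[OF Cons.prems(2), of "[]" xs] Cons.prems(1) i(1) i' by simp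
 moreover have "multilin_on S (%ys. G (t x # ys))" using Cons.prems t(1) by (intro multilin_on_ConsD) auto
 ultimately show ?case using Cons by (simp add: ac_simps)
qed simp

lemma dsum_fun_scaleR:
 assumes xs: "set xs <= S" and G: "multilin_on S (G :: 'b list => 'c::real_vector)"
 shows "dsum (%x. c *\<^sub>R i x) t G xs = c *\<^sub>R dsum i t G xs" using xs G
proof (induction xs arbitrary: G)
 case (Cons x xs)
 have "G ((c *\<^sub>R i x) # xs) = c *\<^sub>R G (i x # xs)" using multilin_on_scaleR[OF Cons.prems(2), of "[]" xs] Cons.prems(1) i(1) by simp
 moreover have "multilin_on S (%ys. G (t x # ys))" using Cons.prems t(1) by (intro multilin_on_ConsD) auto
 ultimately show ?case using Cons by (simp add: scaleR_add_right)
qed simp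

end

lemma length_dlist: "ys \<in> set (dlist i t xs) ==> length ys = length xs" by (induction xs arbitrary: ys) auto

lemma contract_linear:
 "contract x (A + B) = contract x A + contract x B" "contract x (c *\<^sub>R A) = c *\<^sub>R contract x A"
 "contract x (- A) = - contract x A" by (intro ext; simp add: contract_def scaleR_fun_def)+

lemma parity_linear:
 "parity (A + B) = parity A + parity B" "parity (c *\<^sub>R A) = c *\<^sub>R parity A" "parity (- A) = - parity A"
 by (intro ext; simp add: parity_def scaleR_fun_def algebra_simps)+

lemma contract_add:
 assumes "A \<in> alt_all V" "x \<in> V" "y \<in> V" "subspace V"
 shows "contract (x + y) A = contract x A + contract y A" "contract (c *\<^sub>R x) A = c *\<^sub>R contract x A"
proof -
 have "contract (x + y) A ys = (contract x A + contract y A) ys" for ys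
  using alt_all_add[OF assms(1), of "[]" ys x y] assms(2,3) alt_all_outside[OF assms(1), of "_ # ys"]
  by (cases "set ys <= V") (simp_all add: contract_def)
 then show "contract (x + y) A = contract x A + contract y A" by blast
 have "contract (c *\<^sub>R x) A ys = (c *\<^sub>R contract x A) ys" for ys
  using alt_all_scaleR[OF assms(1), of "[]" ys x c] assms(2,3) alt_all_outside[OF assms(1), of "_ # ys"]
  by (cases "set ys <= V") (simp_all add: contract_def scaleR_fun_def)
 then show "contract (c *\<^sub>R x) A = c *\<^sub>R contract x A" by blast
qed

lemma lin_on_contract: "lin_on S (contract x)" and lin_on_parity: "lin_on S parity" by (simp_all add: lin_on_def contract_linear parity_linear)

subsection \<open>Wedge products\<close>

lemma wedge_Nil: "wedge A B [] = A [] * B []" by (simp add: wedge_shuf)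

lemma prod_list_minus_one: "(\<Prod>y\<leftarrow>ys. -1) = (-1::real) ^ length ys" by (induction ys) simp_all

lemma wedge_Cons: "wedge A B (x # xs) = wedge (contract x A) B xs + wedge (parity A) (contract x B) xs"
 by (simp add: wedge_shuf contract_def parity_def prod_list_minus_one mult_ac)

lemma wedge_linear:
 "wedge (A + A') B xs = wedge A B xs + wedge A' B xs" "wedge A (B + B') xs = wedge A B xs + wedge A B' xs"
 "wedge (c *\<^sub>R A) B xs = c * wedge A B xs" "wedge A (c *\<^sub>R B) xs = c * wedge A B xs"
 "wedge (- A) B xs = - wedge A B xs" "wedge A (- B) xs = - wedge A B xs"
 "wedge 0 B xs = 0" "wedge A 0 xs = 0" using shuf_scaleR[of _ c "%ys zs. A ys * B zs"] shuf_minus[of _ "%ys zs. A ys * B zs"]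
 by (simp_all add: wedge_shuf distrib_left distrib_right shuf_add shuf_zero scaleR_fun_def mult_ac)

lemma wedge_list_simps [simp]:
 "wedge_list [] = (%xs. if xs = [] then 1 else 0)" "wedge_list (A # As) = wedge A (wedge_list As)" by (simp_all add: wedge_list_def)

lemma wedge_dsum:
 "wedge A (%xs. dsum i t (%ys. G ys xs) l) xs = dsum i t (%ys. wedge A (G ys) xs) l"
proof (induction l arbitrary: G)
 case (Cons x l)
 have "(%xs. dsum i t (%ys. G ys xs) (x # l)) =
   G (i x # l) + (%xs. dsum i t (%ys. G (t x # ys) xs) l)" by (rule ext) simp
 then show ?case by (simp only: wedge_linear Cons dsum_simps)
next
 case Nil
 have "(%xs. dsum i t (%ys. G ys xs) []) = 0" by (rule ext) simp
 then show ?case by (simp only: wedge_linear dsum_simps)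
qed

lemma wedge_list_Cons_dsum:
 "wedge_list As (x # xs) = dsum (contract x) parity (%Bs. wedge_list Bs xs) As"
proof (induction As arbitrary: xs)
 case (Cons A As)
 have "contract x (wedge_list As) = (%xs. dsum (contract x) parity (%Bs. wedge_list Bs xs) As)"
  by (rule ext) (simp only: contract_def[of x "wedge_list As"] Cons)
 then show ?case by (simp add: wedge_Cons wedge_dsum)
qed simp

lemma alt_all_wedge:
 assumes A: "A \<in> alt_all V" and B: "B \<in> alt_all V" and V: "subspace V"
 shows "wedge A B \<in> alt_all V"
proof (rule alt_allI_adjacent[OF _ V])
 have add: "wedge A B (pre @ (x + y) # post) = wedge A B (pre @ x # post) + wedge A B (pre @ y # post)"
  if "A \<in> alt_all V" "B \<in> alt_all V" "set pre <= V" "x \<in> V" "y \<in> V" for A B pre post x y using that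
 proof (induction pre arbitrary: A B)
  case Nil
  show ?case unfolding append_Nil wedge_Cons by (simp only: contract_add[OF Nil(1,4,5) V] contract_add[OF Nil(2,4,5) V] wedge_linear ac_simps)
 next
  case (Cons z pre)
  then show ?case by (simp add: wedge_Cons alt_all_contract alt_all_parity del: plus_fun_apply)
 qed
 have scale: "wedge A B (pre @ (c *\<^sub>R x) # post) = c * wedge A B (pre @ x # post)"
  if "A \<in> alt_all V" "B \<in> alt_all V" "set pre <= V" "x \<in> V" for A B pre post x c using that
 proof (induction pre arbitrary: A B)
  case Nil
  show ?case unfolding append_Nil wedge_Cons
   by (simp only: contract_add[OF Nil(1,4,4) V] contract_add[OF Nil(2,4,4) V] wedge_linear) (simp add: algebra_simps)
 next
  case (Cons z pre)
  then show ?case by (simp add: wedge_Cons alt_all_contract alt_all_parity algebra_simps)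
 qed
 show "multilin_on V (wedge A B)" unfolding multilin_on_def lin_on_def real_scaleR_def by (intro allI impI conjI ballI add scale A B) auto
 have adj: "wedge A B (pre @ x # x # post) = 0"
  if "A \<in> alt_all V" "B \<in> alt_all V" "set pre <= V" "x \<in> V" for A B pre post x using that
 proof (induction pre arbitrary: A B)
  case Nil
  then show ?case by (simp add: wedge_Cons contract_contract contract_parity wedge_linear)
 next
  case (Cons z pre)
  then show ?case by (simp add: wedge_Cons alt_all_contract alt_all_parity)
 qed
 show "wedge A B (pre @ x # x # post) = 0" if "set pre <= V" "x \<in> V" "set post <= V" for pre x post using adj[OF A B] that by blast
 show "wedge A B xs = 0" if "\<not> set xs <= V" for xs unfolding wedge_shuf
 proof (rule shuf_eq_zero)
  fix ys zs assume "mset ys + mset zs = mset xs"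
  then have "set ys \<union> set zs = set xs" by (metis set_mset_mset set_mset_union)
  then have "\<not> set ys <= V \<or> \<not> set zs <= V" using that by blast
  then show "A ys * B zs = 0" using alt_all_outside[OF A] alt_all_outside[OF B] by auto
 qed
qed

lemma wedge_list_length:
 "(!!A xs. A \<in> set As ==> length xs ~= 1 ==> A xs = 0) ==> length xs ~= length As ==> wedge_list As xs = 0"
proof (induction As arbitrary: xs)
 case (Cons A As)
 show ?case unfolding wedge_list_simps wedge_shuf
 proof (rule shuf_eq_zero)
  fix ys zs assume "mset ys + mset zs = mset xs"
  then have l: "length ys + length zs = length xs" by (metis size_mset size_union)
  show "A ys * wedge_list As zs = 0"
  proof (cases "length ys = 1")
   case True
   then have "wedge_list As zs = 0" using l Cons.prems by (intro Cons.IH) auto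
   then show ?thesis by simp
  qed (use Cons.prems in simp)
 qed
qed simp

section \<open>Wedge products of covectors\<close>

lemma alt1_simps [simp]: "alt1 \<xi> [] = 0" "alt1 \<xi> [x] = \<xi> x" "alt1 \<xi> (x # y # xs) = 0" by (simp_all add: alt1_def)

lemma alt1_length: "length xs ~= 1 ==> alt1 \<xi> xs = 0" by (auto simp: alt1_def split: list.splits)

lemma wedge_alt1_Cons: "wedge (alt1 \<xi>) B (x # xs) = \<xi> x * B xs - wedge (alt1 \<xi>) (contract x B) xs"
proof -
 have "parity (alt1 \<xi>) ys = (- alt1 \<xi>) ys" for ys by (cases "length ys = 1") (simp_all add: parity_def alt1_length)
 then have p: "parity (alt1 \<xi>) = - alt1 \<xi>" by blast
 have "contract x (alt1 \<xi>) ys = (\<xi> x *\<^sub>R wedge_list []) ys" for ys by (cases ys) (simp_all add: contract_def scaleR_fun_def)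
 then have c: "contract x (alt1 \<xi>) = \<xi> x *\<^sub>R wedge_list []" by blast
 have u: "wedge (wedge_list []) B xs = B xs" for B xs
 proof (induction xs arbitrary: B)
  case (Cons y ys)
  have 1: "contract y (wedge_list []) = 0" by (rule ext) (simp add: contract_def)
  have 2: "parity (wedge_list []) = wedge_list []" by (rule ext) (simp add: parity_def)
  show ?case by (simp only: wedge_Cons 1 2 wedge_linear Cons add_0 contract_def[of y B])
 qed (simp add: wedge_Nil)
 show ?thesis unfolding wedge_Cons p c wedge_linear u by simp
qed

lemma pick1_linear:
 "pick1 (%y ys. F y ys + G y ys) xs = pick1 F xs + pick1 G xs"
 "pick1 (%y ys. - F y ys) xs = - pick1 F xs" "pick1 (%y ys. c * F y ys) xs = c * pick1 F xs"
 "pick1 (%y ys. 0) xs = 0" by (induction xs arbitrary: F G) (simp_all add: algebra_simps)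

lemma pick1_cong:
 "(!!y ys. mset (y # ys) = mset xs ==> F y ys = G y ys) ==> pick1 F xs = pick1 G xs"
proof (induction xs arbitrary: F G)
 case (Cons x xs)
 have "pick1 (%y ys. F y (x # ys)) xs = pick1 (%y ys. G y (x # ys)) xs" by (rule Cons.IH) (rule Cons.prems, simp)
 then show ?case using Cons.prems by simp
qed simp

lemma pick1_sum_fun: "pick1 (%y ys. \<Sum>i\<in>I. F i y ys) xs = (\<Sum>i\<in>I. pick1 (F i) xs)"
 by (induction xs arbitrary: F) (simp_all add: sum_subtractf)

lemma wedge_alt1_pick1: "wedge (alt1 \<xi>) B xs = pick1 (%x xs. \<xi> x * B xs) xs"
 by (induction xs arbitrary: B) (simp_all add: wedge_Nil wedge_alt1_Cons contract_def)

text \<open>Putting the picked entry back in its place costs exactly the alternating sign of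
  \<open>pick1\<close>, so each of the \<open>length xs\<close> picks contributes A xs. This
  provides the factor in the reconstruction of a form from its contractions.\<close>

lemma pick1_alternating:
 assumes "A \<in> alt_all V" "subspace V"
 shows "pick1 (%x xs. A (x # xs)) xs = real (length xs) * A xs" using assms(1)
proof (induction xs arbitrary: A)
 case (Cons x xs)
 have "pick1 (%y ys. A (y # x # ys)) xs = pick1 (%y ys. - contract x A (y # ys)) xs" unfolding contract_def
  by (rule pick1_cong) (rule alt_all_swap[OF Cons.prems assms(2), of "[]", unfolded append_Nil])
 moreover have "contract x A \<in> alt_all V"
 proof (cases "x \<in> V")
  case False
  then have "contract x A = 0" by (intro ext) (simp add: contract_def alt_all_outside[OF Cons.prems])
  then show ?thesis using subspace_0[OF subspace_alt_all] by simp
 qed (rule alt_all_contract[OF Cons.prems])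
 note Cons.IH[OF this]
 ultimately show ?case by (simp only: pick1.simps pick1_linear) (simp add: contract_def algebra_simps)
qed simp

lemma wedge_pick1: "wedge A (%xs. pick1 (%y ys. c y * G ys xs) l) xs = pick1 (%y ys. c y * wedge A (G ys) xs) l"
proof (induction l arbitrary: G)
 case (Cons x l)
 have "(%xs. pick1 (%y ys. c y * G ys xs) (x # l)) =
   c x *\<^sub>R G l + (- (%xs. pick1 (%y ys. c y * G (x # ys) xs) l))" by (rule ext) (simp add: scaleR_fun_def)
 then show ?case by (simp only: wedge_linear Cons pick1.simps)
next
 case Nil
 have "(%xs. pick1 (%y ys. c y * G ys xs) []) = 0" by (rule ext) simp
 then show ?case by (simp only: wedge_linear pick1.simps)
qed

lemma wedge_list_alt1_Cons:
 "wedge_list (map alt1 \<xi>s) (v # vs) = pick1 (%\<xi> \<zeta>s. \<xi> v * wedge_list (map alt1 \<zeta>s) vs) \<xi>s"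
proof (induction \<xi>s arbitrary: vs)
 case (Cons \<xi> \<xi>s)
 have "contract v (wedge_list (map alt1 \<xi>s)) =
   (%vs. pick1 (%\<xi> \<zeta>s. \<xi> v * wedge_list (map alt1 \<zeta>s) vs) \<xi>s)" by (rule ext) (simp add: contract_def Cons)
 then show ?case by (simp add: wedge_alt1_Cons wedge_pick1)
qed simp

lemma nth_nths_omit: "j < length xs ==> k < length xs - 1 ==> nths xs (- {j}) ! k = xs ! (if k < j then k else Suc k)"
proof (induction xs arbitrary: j k)
 case (Cons x xs)
 show ?case
 proof (cases j)
  case 0 then show ?thesis by (simp add: nths_omit)
 next
  case (Suc j')
  then show ?thesis using Cons by (cases k) (auto simp: nths_omit)
 qed
qed simp

lemma length_nths_omit: "j < length xs ==> length (nths xs (- {j})) = length xs - 1"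
proof (induction xs arbitrary: j)
 case (Cons x xs)
 then show ?case by (cases j) (auto simp: nths_omit)
qed simp

text \<open>Both sides are the determinant of the matrix of pairings: the recursion over the first
  vector is the Laplace expansion along the first row, and the sum over permutations is the Leibniz
  formula.\<close>

lemma wedge_list_alt1_det:
 "length \<xi>s = length vs ==> wedge_list (map alt1 \<xi>s) vs =
   (\<Sum>\<sigma> | \<sigma> permutes {..<length vs}. of_int (sign \<sigma>) * (\<Prod>i<length vs. (\<xi>s ! \<sigma> i) (vs ! i)))"
proof -
 define m where "m \<xi>s vs = Matrix.mat (length vs) (length vs) (%(i, j). (\<xi>s ! j) (vs ! i) :: real)"
  for \<xi>s :: "('a => real) list" and vs
 have m: "m \<xi>s vs \<in> carrier_mat (length vs) (length vs)" for \<xi>s vs by (simp add: m_def)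
 have "length \<xi>s = length vs ==> wedge_list (map alt1 \<xi>s) vs = Determinant.det (m \<xi>s vs)" for \<xi>s vs
 proof (induction vs arbitrary: \<xi>s)
  case Nil
  then show ?case by (simp add: m_def Determinant.det_def)
 next
  case (Cons v vs)
  let ?n = "Suc (length vs)"
  have "wedge_list (map alt1 \<xi>s) (v # vs) =
    (\<Sum>j<?n. (-1) ^ j * ((\<xi>s ! j) v * wedge_list (map alt1 (nths \<xi>s (- {j}))) vs))"
   unfolding wedge_list_alt1_Cons pick1_sum using Cons.prems by simp
  also have "\<dots> = (\<Sum>j<?n. m \<xi>s (v # vs) $$ (0, j) * cofactor (m \<xi>s (v # vs)) 0 j)"
  proof (rule sum.cong[OF refl])
   fix j assume "j \<in> {..<?n}"
   then have j: "j < length \<xi>s" using Cons.prems by simp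
   have "mat_delete (m \<xi>s (v # vs)) 0 j = m (nths \<xi>s (- {j})) vs"
    using j Cons.prems by (intro eq_matI) (auto simp: mat_delete_def m_def nth_nths_omit)
   moreover have "wedge_list (map alt1 (nths \<xi>s (- {j}))) vs = Determinant.det (m (nths \<xi>s (- {j})) vs)"
    using j Cons.prems by (intro Cons.IH) (simp add: length_nths_omit)
   ultimately show "(-1) ^ j * ((\<xi>s ! j) v * wedge_list (map alt1 (nths \<xi>s (- {j}))) vs) =
     m \<xi>s (v # vs) $$ (0, j) * cofactor (m \<xi>s (v # vs)) 0 j" using j Cons.prems by (simp add: cofactor_def m_def)
  qed
  also have "\<dots> = Determinant.det (m \<xi>s (v # vs))" using m[of \<xi>s "v # vs"] by (intro laplace_expansion_row[symmetric]) auto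
  finally show ?case .
 qed
 then show "length \<xi>s = length vs ==> ?thesis"
  by (auto simp: Determinant.det_def m_def atLeast0LessThan permutes_in_image[of _ "{..<length vs}", simplified]
    intro!: sum.cong prod.cong)
qed

subsection \<open>Contracting a form with multivector fields\<close>

text \<open>This is (-1)^(n (n - 1) / 2), the sign of c) when all n multivectors have degree
  1.\<close>

fun tsign :: "nat => real" where
 "tsign 0 = 1"
| "tsign (Suc n) = (-1) ^ n * tsign n"

lemma dsum_cong_fun:
 "(!!x. x \<in> set xs ==> i x = i' x) ==> dsum i t G xs = dsum i' t G xs" by (induction xs arbitrary: G) simp_all

lemma dsum_zero [simp]: "dsum i t (%_. 0) xs = 0" by (induction xs) simp_all

lemma dsum_length:
 "dsum i t (%ys. c (length ys) *\<^sub>R G ys) xs = c (length xs) *\<^sub>R (dsum i t G xs :: 'c::real_vector)"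
proof -
 have "dsum i t (%ys. c (length ys) *\<^sub>R G ys) xs = dsum i t (%ys. c (length xs) *\<^sub>R G ys) xs" by (rule dsum_cong) (simp add: length_dlist)
 then show ?thesis by (simp add: dsum_scaleR)
qed

lemma dsum_length_mult:
 "dsum i t (%ys. c (length ys) * G ys) xs = c (length xs) * (dsum i t G xs :: real)" using dsum_length[of i t c G xs] by simp

lemma multilin_on_length:
 "multilin_on S (G :: 'b::real_vector list => real) ==> multilin_on S (%xs. c (length xs) * G xs)"
 unfolding multilin_on_def lin_on_def by (simp add: distrib_left mult.left_commute)

lemma dlist_mem:
 assumes "x \<in> set xs" "ys \<in> set (dlist i t xs)" shows "x \<in> set ys \<or> i x \<in> set ys \<or> t x \<in> set ys" using assms
proof (induction xs arbitrary: ys)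
 case (Cons z xs)
 show ?case
 proof (cases "ys = i z # xs")
  case False
  then obtain zs where zs: "zs \<in> set (dlist i t xs)" "ys = t z # zs" using Cons.prems by auto
  then show ?thesis using Cons.prems(1) Cons.IH[OF _ zs(1)] by (cases "x = z") auto
 qed (use Cons.prems in auto)
qed simp

context smooth_mfd
begin

lemma vec_linear: "vec p (P + Q) = vec p P + vec p Q" "vec p (c *\<^sub>R Q) = c *\<^sub>R vec p Q" by (intro ext; simp add: vec_def scaleR_fun_def)+

text \<open>The bracket c) at a point, sign included. Without covectors only the vector parts of the
  multivectors are inserted into H. A covector is inserted by the Leibniz rule over the
  multivectors, and (-1)^n is the sign for passing the form, since only forms of degree n
  contribute.\<close>

primrec tw :: "'a => ('a tan list => real) => 'a cotan list => ('a cotan list => real) list => real" where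
 "tw p H [] = (%Qs. tsign (length Qs) * H (map (vec p) Qs))"
| "tw p H (\<xi> # \<xi>s) = (%Qs. (-1) ^ length Qs * dsum (contract \<xi>) parity (tw p H \<xi>s) Qs)"

lemma dsum_tw_multilin:
 assumes "multilin_on (alt_all (C p)) G" "\<xi> \<in> C p"
 shows "multilin_on (alt_all (C p)) (dsum (contract \<xi>) parity G :: _ => real)"
 by (rule multilin_on_dsum[OF subspace_alt_all alt_all_contract[OF _ assms(2)] lin_on_contract
   alt_all_parity lin_on_parity assms(1)])

lemma multilin_on_tw:
 assumes H: "H \<in> alt_all (T p)"
 shows "set \<xi>s <= C p ==> multilin_on (alt_all (C p)) (tw p H \<xi>s)"
proof (induction \<xi>s)
 case Nil
 have "multilin_on (alt_all (C p)) (%Qs. H (map (vec p) Qs))" unfolding multilin_on_def lin_on_def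
 proof (intro allI impI conjI ballI)
  fix xs ys assume s: "set xs <= alt_all (C p) & set ys <= alt_all (C p)"
  then have s: "set (map (vec p) xs) <= T p" "set (map (vec p) ys) <= T p" using vec_tangent by auto
  fix x assume x: "x \<in> alt_all (C p)"
  show "H (map (vec p) (xs @ (c *\<^sub>R x) # ys)) = c *\<^sub>R H (map (vec p) (xs @ x # ys))" for c
   using alt_all_scaleR[OF H s vec_tangent[OF x], of c] by (simp add: vec_linear)
  show "H (map (vec p) (xs @ (x + y) # ys)) = H (map (vec p) (xs @ x # ys)) + H (map (vec p) (xs @ y # ys))"
   if "y \<in> alt_all (C p)" for y unfolding map_append list.map vec_linear using alt_all_add[OF H s vec_tangent[OF x] vec_tangent[OF that]] .
 qed
 then show ?case unfolding tw.simps by (rule multilin_on_length)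
next
 case (Cons \<xi> \<xi>s)
 then have "multilin_on (alt_all (C p)) (dsum (contract \<xi>) parity (tw p H \<xi>s))" by (intro dsum_tw_multilin) auto
 then show ?case unfolding tw.simps by (rule multilin_on_length)
qed

lemma tw_add:
 assumes H: "H \<in> alt_all (T p)" and s: "x \<in> C p" "y \<in> C p" "set post <= C p"
 shows "set pre <= C p ==> set Qs <= alt_all (C p) ==>
  tw p H (pre @ (x + y) # post) Qs = tw p H (pre @ x # post) Qs + tw p H (pre @ y # post) Qs"
proof (induction pre arbitrary: Qs)
 case Nil
 let ?S = "alt_all (C p)"
 have c: "contract x Q \<in> ?S" "contract y Q \<in> ?S" "contract (x + y) Q = contract x Q + contract y Q" if "Q \<in> ?S" for Q
  using that s alt_all_contract contract_add(1)[OF that s(1,2) subspace_cotangent] by auto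
 have "dsum (contract (x + y)) parity (tw p H post) Qs =
   dsum (%Q. contract x Q + contract y Q) parity (tw p H post) Qs" using Nil.prems c by (intro dsum_cong_fun) auto
 also have "\<dots> = dsum (contract x) parity (tw p H post) Qs + dsum (contract y) parity (tw p H post) Qs"
  by (rule dsum_fun_add[OF subspace_alt_all c(1) lin_on_contract alt_all_parity lin_on_parity c(2) Nil.prems(2)
     multilin_on_tw[OF H s(3)]])
 finally show ?case by (simp add: distrib_left del: plus_fun_apply)
next
 case (Cons z pre)
 have "dsum (contract z) parity (tw p H (pre @ (x + y) # post)) Qs =
   dsum (contract z) parity (%Qs. tw p H (pre @ x # post) Qs + tw p H (pre @ y # post) Qs) Qs"
  by (rule dsum_cong_set[where S="alt_all (C p)", OF Cons.IH])
   (use Cons.prems alt_all_contract alt_all_parity in auto)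
 then show ?case by (simp add: dsum_add distrib_left del: plus_fun_apply)
qed

lemma tw_scaleR:
 assumes H: "H \<in> alt_all (T p)" and s: "x \<in> C p" "set post <= C p"
 shows "set pre <= C p ==> set Qs <= alt_all (C p) ==>
  tw p H (pre @ (c *\<^sub>R x) # post) Qs = c * tw p H (pre @ x # post) Qs"
proof (induction pre arbitrary: Qs)
 case Nil
 let ?S = "alt_all (C p)"
 have c: "contract x Q \<in> ?S" "contract (c *\<^sub>R x) Q = c *\<^sub>R contract x Q" if "Q \<in> ?S" for Q
  using that s alt_all_contract contract_add(2)[OF that s(1,1) subspace_cotangent] by auto
 have "dsum (contract (c *\<^sub>R x)) parity (tw p H post) Qs =
   dsum (%Q. c *\<^sub>R contract x Q) parity (tw p H post) Qs" using Nil.prems c by (intro dsum_cong_fun) auto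
 also have "\<dots> = c *\<^sub>R dsum (contract x) parity (tw p H post) Qs"
  by (rule dsum_fun_scaleR[OF subspace_alt_all c(1) lin_on_contract alt_all_parity lin_on_parity Nil.prems(2)
     multilin_on_tw[OF H s(2)]])
 finally show ?case by simp
next
 case (Cons z pre)
 have "dsum (contract z) parity (tw p H (pre @ (c *\<^sub>R x) # post)) Qs =
   dsum (contract z) parity (%Qs. c * tw p H (pre @ x # post) Qs) Qs" by (rule dsum_cong_set[where S="alt_all (C p)", OF Cons.IH])
   (use Cons.prems alt_all_contract alt_all_parity in auto)
 then show ?case by (simp add: dsum_mult)
qed

lemma tw_adjacent:
 assumes H: "H \<in> alt_all (T p)" and s: "x \<in> C p" "set post <= C p"
 shows "set pre <= C p ==> set Qs <= alt_all (C p) ==> tw p H (pre @ x # x # post) Qs = 0"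
proof (induction pre arbitrary: Qs)
 case Nil
 have "dsum (contract x) parity (dsum (contract x) parity (tw p H post)) Qs = 0" by (rule dsum_twice[where S="alt_all (C p)"])
   (use Nil.prems(2) multilin_on_tw[OF H s(2)] s(1) in \<open>simp_all add: subspace_alt_all alt_all_contract
    lin_on_contract alt_all_parity lin_on_parity contract_contract contract_parity\<close>)
 then show ?case by (simp add: dsum_length_mult)
next
 case (Cons z pre)
 have "dsum (contract z) parity (tw p H (pre @ x # x # post)) Qs =
   dsum (contract z) parity (%Qs. 0) Qs" by (rule dsum_cong_set[where S="alt_all (C p)", OF Cons.IH])
   (use Cons.prems alt_all_contract alt_all_parity in auto)
 then show ?case by simp
qed

lemma tw_form_linear:
 "tw p (H + H') \<xi>s Qs = tw p H \<xi>s Qs + tw p H' \<xi>s Qs" "tw p (c *\<^sub>R H) \<xi>s Qs = c * tw p H \<xi>s Qs"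
proof -
 show "tw p (H + H') \<xi>s Qs = tw p H \<xi>s Qs + tw p H' \<xi>s Qs"
 proof (induction \<xi>s arbitrary: Qs)
  case (Cons \<xi> \<xi>s)
  have "tw p (H + H') \<xi>s = (%Qs. tw p H \<xi>s Qs + tw p H' \<xi>s Qs)" by (rule ext) (rule Cons)
  then show ?case by (simp add: dsum_add distrib_left del: plus_fun_apply)
 qed (simp add: distrib_left)
 show "tw p (c *\<^sub>R H) \<xi>s Qs = c * tw p H \<xi>s Qs"
 proof (induction \<xi>s arbitrary: Qs)
  case (Cons \<xi> \<xi>s)
  have "tw p (c *\<^sub>R H) \<xi>s = (%Qs. c * tw p H \<xi>s Qs)" by (rule ext) (rule Cons)
  then show ?case by (simp add: dsum_mult)
 qed (simp add: scaleR_fun_def)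
qed

lemma tw_alt:
 assumes H: "H \<in> alt_all (T p)" and Qs: "set Qs <= alt_all (C p)"
 shows "(%\<xi>s. if set \<xi>s <= C p then tw p H \<xi>s Qs else 0) \<in> alt_all (C p)" (is "?F \<in> _")
proof (rule alt_allI_adjacent[OF _ subspace_cotangent])
 show "multilin_on (C p) ?F" unfolding multilin_on_def lin_on_def
  using tw_add[OF H _ _ _ _ Qs] tw_scaleR[OF H _ _ _ Qs] subspace_add[OF subspace_cotangent]
   subspace_scale[OF subspace_cotangent] by auto
 show "?F (pre @ x # x # post) = 0" if "set pre <= C p" "x \<in> C p" "set post <= C p" for pre x post
  using that tw_adjacent[OF H that(2,3,1) Qs] by simp
qed simp

definition twist :: "'a form => 'a mvf list => 'a mvf" where
 "twist H Ps p \<xi>s = (if p \<in> pts M & set \<xi>s <= C p then tw p (H p) \<xi>s (map (%P. P p) Ps) else 0)"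

lemma delta_twist: "delta f (twist H Ps) = (-1) ^ length Ps *\<^sub>R dsum (delta f) par (twist H) Ps"
proof (intro ext)
 fix p \<xi>s
 have "dsum (contract (dif p f)) parity (tw p (H p) \<xi>s) (map (%P. P p) Ps) =
   dsum (delta f) par (%Ps. tw p (H p) \<xi>s (map (%P. P p) Ps)) Ps" by (rule dsum_map) (simp_all add: delta_def par_def)
 then show "delta f (twist H Ps) p \<xi>s = ((-1) ^ length Ps *\<^sub>R dsum (delta f) par (twist H) Ps) p \<xi>s"
  by (cases "p \<in> pts M"; cases "set \<xi>s <= C p")
   (simp_all add: scaleR_fun_def dsum_apply delta_def contract_def twist_def dif_cotangent)
qed

lemma ev_twist_Nil: "ev (twist H Ps) [] p = (if p \<in> pts M then tsign (length Ps) * evf H (map vecf Ps) p else 0)"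
 by (simp add: ev_def twist_def evf_def comp_def vecf_def)

lemma ev_twist_Cons:
 "ev (twist H Ps) (f # fs) p = (-1) ^ length Ps * dsum (delta f) par (%Ps. ev (twist H Ps) fs p) Ps"
 unfolding ev_delta[symmetric] delta_twist by (simp add: ev_def scaleR_fun_def dsum_apply)

lemma dsum_smooth:
 assumes "!!Qs. set Qs <= MV ==> G Qs \<in> A" "f \<in> A"
 shows "set Ps <= MV ==> (%p. dsum (delta f) par (%Ps. G Ps p) Ps) \<in> A" using assms(1)
proof (induction Ps arbitrary: G)
 case (Cons P Ps)
 have "(%p. dsum (delta f) par (%Ps. G (par P # Ps) p) Ps) \<in> A" by (rule Cons.IH) (use Cons.prems par_MV in auto)
 moreover have "G (delta f P # Ps) \<in> A" using Cons.prems delta_MV[OF assms(2)] by auto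
 ultimately show ?case unfolding dsum_simps by (rule A_add[rotated])
qed (simp add: A_zero)

lemma ev_twist_smooth:
 assumes H: "H \<in> FM"
 shows "set fs <= A ==> set Ps <= MV ==> ev (twist H Ps) fs \<in> A"
proof (induction fs arbitrary: Ps)
 case Nil
 then have "evf H (map vecf Ps) \<in> A" using vecf_VF by (intro evf_smooth[OF H]) auto
 note A_cmult[OF this, of "tsign (length Ps)"]
 moreover have "ev (twist H Ps) [] = (%p. tsign (length Ps) * evf H (map vecf Ps) p)"
  by (rule ext) (simp add: ev_twist_Nil, simp add: evf_def FM_outside[OF H])
 ultimately show ?case by simp
next
 case (Cons f fs)
 have "(%p. dsum (delta f) par (%Ps. ev (twist H Ps) fs p) Ps) \<in> A" by (rule dsum_smooth) (use Cons in auto)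
 note A_cmult[OF this, of "(-1) ^ length Ps"]
 moreover have "ev (twist H Ps) (f # fs) = (%p. (-1) ^ length Ps * dsum (delta f) par (%Ps. ev (twist H Ps) fs p) Ps)"
  by (rule ext) (rule ev_twist_Cons)
 ultimately show ?case by simp
qed

lemma twist_MV:
 assumes H: "H \<in> FM" and Ps: "set Ps <= MV" shows "twist H Ps \<in> MV" unfolding MV_def
proof (intro CollectI conjI ballI allI impI)
 fix p assume "p \<in> pts M"
 then have "twist H Ps p = (%\<xi>s. if set \<xi>s <= C p then tw p (H p) \<xi>s (map (%P. P p) Ps) else 0)" by (intro ext) (simp add: twist_def)
 then show "twist H Ps p \<in> alt_all (C p)" using tw_alt[OF FM_alt[OF H], of "map (%P. P p) Ps" p] Ps MV_alt by auto
next
 fix fs assume "set fs <= A"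
 then show "(%p. twist H Ps p (map (dif p) fs)) \<in> A" using ev_twist_smooth[OF H _ Ps] by (simp add: ev_def)
qed (simp add: twist_def fun_eq_iff)

lemma multilin_on_twist:
 assumes H: "H \<in> FM" shows "multilin_on MV (twist H)" unfolding multilin_on_def lin_on_def
proof (intro allI impI conjI ballI ext)
 fix xs ys p \<xi>s assume s: "set xs <= MV & set ys <= MV"
 have s: "set (map (%P. P p) xs) <= alt_all (C p)" "set (map (%P. P p) ys) <= alt_all (C p)" using s MV_alt by auto
 fix x assume x: "x \<in> MV"
 note m = multilin_onD[OF multilin_on_tw[OF FM_alt[OF H]] s]
 show "twist H (xs @ (c *\<^sub>R x) # ys) p \<xi>s = (c *\<^sub>R twist H (xs @ x # ys)) p \<xi>s" for c
  using m(2)[OF _ MV_alt[OF x], of \<xi>s c] by (simp add: twist_def scaleR_fun_def[of c])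
 show "twist H (xs @ (x + y) # ys) p \<xi>s = (twist H (xs @ x # ys) + twist H (xs @ y # ys)) p \<xi>s" if "y \<in> MV" for y
 proof -
  have "(x + y) p = x p + y p" by simp
  then show ?thesis using m(1)[OF _ MV_alt[OF x] MV_alt[OF that], of \<xi>s] unfolding plus_fun_apply by (simp add: twist_def)
 qed
qed

lemma twist_form_linear: "twist (H + H') Ps = twist H Ps + twist H' Ps" "twist (c *\<^sub>R H) Ps = c *\<^sub>R twist H Ps"
proof -
 have "(H + H') p = H p + H' p" "(c *\<^sub>R H) p = c *\<^sub>R H p" for p by (simp_all add: scaleR_fun_def)
 note e = this tw_form_linear
 show "twist (H + H') Ps = twist H Ps + twist H' Ps" unfolding plus_fun_def[of "twist H Ps"] plus_fun_def[of "twist H Ps _"]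
  by (intro ext) (simp add: twist_def e del: plus_fun_apply)
 show "twist (c *\<^sub>R H) Ps = c *\<^sub>R twist H Ps"
  by (intro ext) (simp add: twist_def e scaleR_fun_def[of c "twist H Ps"] scaleR_fun_def[of c "twist H Ps _"])
qed

lemma vecf_zero:
 assumes "hdeg a P" "a ~= 1" shows "vecf P = 0" using assms by (intro ext) (simp add: vecf_def vec_def hdegD)

lemma evf_zero_slot: "H \<in> FM ==> evf H (Xs @ 0 # Ys) p = 0"
 using alt_all_zero[OF FM_alt tan_zero, of H p "map (%X. X p) Xs" "map (%X. X p) Ys"] by (simp add: evf_def)

lemma evf_zero_mem: "H \<in> FM ==> 0 \<in> set Xs ==> evf H Xs p = 0" using evf_zero_slot[of H] by (auto simp: in_set_conv_decomp)

text \<open>A function has no vector part to put into H, and every insertion either kills it or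
  leaves it a function. This agrees with the convention that the sharp map of a function is
  0.\<close>

lemma ev_twist_hom_zero:
 assumes H: "H \<in> FM"
 shows "P \<in> set Ps ==> hdeg 0 P ==> ev (twist H Ps) fs p = 0"
proof (induction fs arbitrary: P Ps)
 case Nil
 then have "0 \<in> set (map vecf Ps)" using vecf_zero[of 0 P] by force
 then show ?case using evf_zero_mem[OF H] by (simp add: ev_twist_Nil)
next
 case (Cons f fs)
 have "delta f P = 0" using hdeg_delta[OF Cons.prems(2)] hdeg_neg by force
 moreover have "par P = P" using hdeg_par[OF Cons.prems(2)] by simp
 ultimately have h: "hdeg 0 (delta f P)" "hdeg 0 (par P)" using Cons.prems hdeg_zero by auto
 have "dsum (delta f) par (%Ps. ev (twist H Ps) fs p) Ps = dsum (delta f) par (%Ps. 0) Ps"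
  by (rule dsum_cong) (use dlist_mem[OF Cons.prems(1)] Cons.prems Cons.IH h in fastforce)
 then show ?case unfolding ev_twist_Cons by simp
qed

lemma twist_hom_zero:
 assumes "H \<in> FM" "set Ps <= MV" "P \<in> set Ps" "hdeg 0 P" shows "twist H Ps = 0" by (rule MV_eqI[OF twist_MV[OF assms(1,2)] MV_0])
  (use ev_twist_hom_zero[OF assms(1,3,4)] ev_linear(4) in auto)

lemma twist_length:
 assumes "hdeg k H" "int (length Ps) ~= k" shows "twist H Ps = 0"
proof -
 have "tw p (H p) \<xi>s Qs = 0" if "int (length Qs) ~= k" for p \<xi>s Qs using that
 proof (induction \<xi>s arbitrary: Qs)
  case (Cons \<xi> \<xi>s)
  have "dsum (contract \<xi>) parity (tw p (H p) \<xi>s) Qs = dsum (contract \<xi>) parity (%_. 0) Qs"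
   by (rule dsum_cong) (use Cons in \<open>simp add: length_dlist\<close>)
  then show ?case by simp
 qed (simp add: hdegD[OF assms(1)])
 then show ?thesis using assms(2) by (intro ext) (simp add: twist_def)
qed

lemma dlist_hom:
 "list_all2 hdeg as Ps ==> Qs \<in> set (dlist (delta f) par Ps) ==>
  \<exists>bs. list_all2 hdeg bs Qs & sum_list bs = sum_list as - 1"
proof (induction as Ps arbitrary: Qs rule: list_all2_induct)
 case (Cons a as P Ps)
 have par: "hdeg a (par P)" using Cons hdeg_par hdeg_linear(2) by metis
 from Cons.prems consider "Qs = delta f P # Ps"
  | Qs' where "Qs' \<in> set (dlist (delta f) par Ps)" "Qs = par P # Qs'" by auto
 then show ?case
 proof cases
  case 1
  then show ?thesis using Cons hdeg_delta by (intro exI[of _ "(a - 1) # as"]) simp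
 next
  case 2
  then obtain bs where "list_all2 hdeg bs Qs'" "sum_list bs = sum_list as - 1" using Cons.IH by blast
  then show ?thesis using par 2 by (intro exI[of _ "a # bs"]) simp
 qed
qed simp

lemma ev_twist_hom:
 assumes H: "H \<in> FM"
 shows "list_all2 hdeg as Ps ==> int (length fs) ~= sum_list as - int (length Ps) ==> ev (twist H Ps) fs p = 0"
proof (induction fs arbitrary: as Ps)
 case Nil
 have "\<exists>i<length as. as ! i ~= 1"
 proof (rule ccontr)
  assume "\<not> ?thesis"
  then have "as = replicate (length as) 1" by (intro nth_equalityI) auto
  then have "sum_list as = int (length as)" by (metis mult.right_neutral sum_list_replicate)
  then show False using Nil list_all2_lengthD by fastforce
 qed
 then obtain i where "i < length as" "as ! i ~= 1" by blast
 then have "vecf (Ps ! i) = 0" "i < length Ps" using Nil.prems(1) by (auto simp: list_all2_conv_all_nth intro!: vecf_zero)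
 then have "0 \<in> set (map vecf Ps)" by (metis in_set_conv_nth length_map nth_map)
 then show ?case using evf_zero_mem[OF H] by (simp add: ev_twist_Nil)
next
 case (Cons f fs)
 have "dsum (delta f) par (%Ps. ev (twist H Ps) fs p) Ps = dsum (delta f) par (%_. 0) Ps"
 proof (rule dsum_cong)
  fix Qs assume Q: "Qs \<in> set (dlist (delta f) par Ps)"
  then obtain bs where "list_all2 hdeg bs Qs" "sum_list bs = sum_list as - 1" using dlist_hom[OF Cons.prems(1)] by blast
  then show "ev (twist H Qs) fs p = 0" using Cons.prems length_dlist[OF Q] by (intro Cons.IH) auto
 qed
 then show ?case unfolding ev_twist_Cons by simp
qed

lemma hdeg_MV:
 fixes P :: "'a mvf"
 assumes "P \<in> MV" "!!fs p. set fs <= A ==> int (length fs) ~= a ==> ev P fs p = 0" shows "hdeg a P" unfolding hdeg_def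
proof (intro allI impI)
 fix p and xs :: "'a cotan list" assume l: "int (length xs) ~= a"
 show "P p xs = 0"
 proof (cases "p \<in> pts M & set xs <= C p")
  case True
  let ?fs = "map (cofun p) xs"
  have "map (dif p) ?fs = xs" using True cofun by (induction xs) auto
  moreover have "set ?fs <= A" using True cofun by auto
  ultimately show ?thesis using assms(2)[of ?fs p] l by (simp add: ev_def)
 next
  case False
  then show ?thesis using assms MV_outside alt_all_outside[OF MV_alt] by metis
 qed
qed

lemma hdeg_twist:
 assumes "H \<in> FM" "set Ps <= MV" "list_all2 hdeg as Ps"
 shows "hdeg (sum_list as - int (length Ps)) (twist H Ps)" by (rule hdeg_MV[OF twist_MV[OF assms(1,2)]]) (rule ev_twist_hom[OF assms(1,3)])

text \<open>Induction over the functions. When an insertion lowers the degree of one of the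
  exchanged entries, the exchange sign changes by the parity of the other one; this is the sign with
  which \<open>par\<close> acts on that other entry as soon as it precedes the insertion.\<close>

lemma ev_twist_swap:
 assumes H: "H \<in> FM"
 shows "set fs <= A ==> hdeg a P ==> hdeg b Q ==> set (pre @ P # Q # post) <= MV ==>
  ev (twist H (pre @ P # Q # post)) fs p = sg (a * b) * ev (twist H (pre @ Q # P # post)) fs p"
proof (induction fs arbitrary: a b pre P Q post)
 case Nil
 show ?case
 proof (cases "a = 1 & b = 1")
  case True
  then show ?thesis using evf_swap[OF H, of "map vecf pre" "vecf P" "vecf Q" "map vecf post" p] by (simp add: ev_twist_Nil)
 next
  case False
  then have "vecf P = 0 \<or> vecf Q = 0" using vecf_zero Nil.prems by blast
  then have "0 \<in> set (map vecf (pre @ P # Q # post))" "0 \<in> set (map vecf (pre @ Q # P # post))" by force+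
  then show ?thesis using evf_zero_mem[OF H] unfolding ev_twist_Nil by simp
 qed
next
 case (Cons f fs)
 let ?D = "dsum (delta f) par" and ?G = "%Ps. ev (twist H Ps) fs p"
 have f: "f \<in> A" and fs: "set fs <= A" using Cons.prems by auto
 note PQ = Cons.prems(2,3)
 have mv: "P \<in> MV" "Q \<in> MV" "set pre <= MV" "set post <= MV" using Cons.prems(4) by auto
 have par: "par P = sg a *\<^sub>R P" "par Q = sg b *\<^sub>R Q" using hdeg_par PQ by auto
 have G: "?G (xs @ (c *\<^sub>R x) # ys) = c * ?G (xs @ x # ys)" if "set xs <= MV" "x \<in> MV" "set ys <= MV" for xs c x ys
  using multilin_on_scaleR[OF multilin_on_twist[OF H] that(1,3,2)] by (simp add: ev_linear)
 have mp: "set (map par pre) <= MV" using mv par_MV by auto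
 have dP: "delta f P \<in> MV" "delta f Q \<in> MV" using delta_MV[OF f] mv by auto
 have sw: "?G (pre @ P # Q # post) = sg (a * b) * ?G (pre @ Q # P # post)"
  if "hdeg a P" "hdeg b Q" "P \<in> MV" "Q \<in> MV" "set pre <= MV" "set post <= MV" for a b P Q pre post
  by (rule Cons.IH[OF fs that(1,2)]) (use that in auto)
 have 1: "?D (%zs. ?G (zs @ P # Q # post)) pre = sg (a * b) * ?D (%zs. ?G (zs @ Q # P # post)) pre" unfolding dsum_mult[symmetric]
  by (rule dsum_cong_set[where S=MV]) (use sw[OF PQ mv(1,2) _ mv(4)] mv delta_MV[OF f] par_MV in auto)
 have hp: "hdeg a (par P)" "hdeg b (par Q)" unfolding par using PQ hdeg_linear(2) by auto
 have 4: "?D (%zs. ?G (map par pre @ par P # par Q # zs)) post =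
   sg (a * b) * ?D (%zs. ?G (map par pre @ par Q # par P # zs)) post" unfolding dsum_mult[symmetric] by (rule dsum_cong_set[where S=MV])
   (use sw[OF hp par_MV[OF mv(1)] par_MV[OF mv(2)] mp] mv delta_MV[OF f] par_MV in auto)
 have 2: "?G (map par pre @ delta f P # Q # post) = sg (a * b) * ?G (map par pre @ par Q # delta f P # post)"
 proof -
  have "?G (map par pre @ delta f P # Q # post) = sg ((a - 1) * b) * ?G (map par pre @ Q # delta f P # post)"
   by (rule sw[OF hdeg_delta[OF PQ(1)] PQ(2) dP(1) mv(2) mp mv(4)])
  also have "?G (map par pre @ par Q # delta f P # post) = sg b * ?G (map par pre @ Q # delta f P # post)"
   unfolding par by (rule G[OF mp mv(2)]) (use dP mv in auto)
  moreover have "sg ((a - 1) * b) = sg (a * b) * sg b" by (simp add: sg_def)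
  ultimately show ?thesis by simp
 qed
 have 3: "?G (map par pre @ par P # delta f Q # post) = sg (a * b) * ?G (map par pre @ delta f Q # P # post)"
 proof -
  have "?G (map par pre @ P # delta f Q # post) = sg (a * (b - 1)) * ?G (map par pre @ delta f Q # P # post)"
   by (rule sw[OF PQ(1) hdeg_delta[OF PQ(2)] mv(1) dP(2) mp mv(4)])
  moreover have "?G (map par pre @ par P # delta f Q # post) = sg a * ?G (map par pre @ P # delta f Q # post)"
   unfolding par by (rule G[OF mp mv(1)]) (use dP mv in auto)
  moreover have "sg (a * (b - 1)) = sg (a * b) * sg a" by (simp add: sg_def)
  ultimately show ?thesis by simp
 qed
 have "?D ?G (pre @ P # Q # post) = sg (a * b) * ?D ?G (pre @ Q # P # post)" using 1 2 3 4 by (simp add: dsum_append distrib_left)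
 then show ?case unfolding ev_twist_Cons by simp
qed

lemma twist_swap:
 assumes "H \<in> FM" "hdeg a P" "hdeg b Q" "set (pre @ P # Q # post) <= MV"
 shows "twist H (pre @ P # Q # post) = sg (a * b) *\<^sub>R twist H (pre @ Q # P # post)"
proof (rule MV_eqI)
 show "twist H (pre @ P # Q # post) \<in> MV" "sg (a * b) *\<^sub>R twist H (pre @ Q # P # post) \<in> MV"
  using assms(4) by (auto intro!: twist_MV[OF assms(1)] subspace_scale[OF subspace_MV])
 show "ev (twist H (pre @ P # Q # post)) fs = ev (sg (a * b) *\<^sub>R twist H (pre @ Q # P # post)) fs" if "set fs <= A" for fs
  by (rule ext) (simp only: ev_twist_swap[OF assms(1) that assms(2,3,4)] ev_linear)
qed

end

subsection \<open>The map \<open>\<pi>\<^sub>1\<^sup>\<sharp> \<and> \<dots> \<and> \<pi>\<^sub>n\<^sup>\<sharp>\<close>\<close>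

text \<open>The sign in front of the wedge product of the sharp maps amounts to twisting the \<open>i\<close>-th
  multivector by the \<open>(n - i)\<close>-th power of the parity.\<close>

primrec parity_twist :: "('v list => real) list => ('v list => real) list" where
 "parity_twist [] = []"
| "parity_twist (Q # Qs) = (parity ^^ length Qs) Q # parity_twist Qs"

lemma length_parity_twist [simp]: "length (parity_twist Qs) = length Qs" by (induction Qs) simp_all

lemma parity_funpow: "(parity ^^ m) Q = (%xs. (-1) ^ (m * length xs) * Q xs)"
 by (induction m) (auto simp: parity_def power_add power_mult fun_eq_iff mult_ac)

lemma alt_all_parity_funpow: "Q \<in> alt_all V ==> (parity ^^ m) Q \<in> alt_all V" by (induction m) (simp_all add: alt_all_parity)

lemma alt_all_uminus: "Q \<in> alt_all V ==> - Q \<in> alt_all V" by (rule subspace_neg[OF subspace_alt_all])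

lemma parity_twist_alt: "set Qs <= alt_all V ==> set (parity_twist Qs) <= alt_all V" by (induction Qs) (auto simp: alt_all_parity_funpow)

lemma parity_funpow_minus: "(parity ^^ m) (- Q) = - (parity ^^ m) Q" by (rule ext) (simp add: parity_funpow)

lemma contract_parity_funpow: "contract x ((parity ^^ m) Q) = (-1) ^ m *\<^sub>R (parity ^^ m) (contract x Q)"
 by (rule ext) (simp add: parity_funpow contract_def scaleR_fun_def power_add)

text \<open>Insertion into \<open>sharp Q \<zeta>\<close> passes the covector \<zeta>, so the sharp
  maps obey the Leibniz rule with - \<open>contract\<close> and - \<open>parity\<close>, whereas
  \<open>tw\<close> uses \<open>contract\<close> and \<open>parity\<close>. The twist by powers of
  the parity translates one rule into the other.\<close>

lemma dsum_parity_twist: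
 assumes x: "x \<in> V"
 shows "set Qs <= alt_all V ==> multilin_on (alt_all V) (G :: _ => real) ==>
  dsum (%Q. - contract x Q) (%Q. - parity Q) (%Qs. G (parity_twist Qs)) Qs =
   (-1) ^ length Qs * dsum (contract x) parity G (parity_twist Qs)"
proof (induction Qs arbitrary: G)
 case (Cons Q Qs)
 let ?S = "alt_all V" and ?m = "length Qs"
 let ?D = "dsum (%Q. - contract x Q) (%Q. - parity Q)"
 have Q: "Q \<in> ?S" and Qs: "set Qs <= ?S" "set (parity_twist Qs) <= ?S" using Cons.prems parity_twist_alt by auto
 note m = multilin_on_minus[OF Cons.prems(2), of "[]", simplified]
 have *: "(parity ^^ ?m) (contract x Q) \<in> ?S" "(parity ^^ Suc ?m) Q \<in> ?S" using Q x by (simp_all only: alt_all_parity_funpow alt_all_contract)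
 have 1: "G (parity_twist (- contract x Q # Qs)) =
   (-1) ^ Suc ?m * G (contract x ((parity ^^ ?m) Q) # parity_twist Qs)"
  using m[OF Qs(2) *(1)] multilin_on_scaleR[OF Cons.prems(2), of "[]", OF _ Qs(2) *(1), of "(-1) ^ ?m"]
  by (simp add: parity_funpow_minus contract_parity_funpow mult.assoc[symmetric])
 have "?D (%Rs. G (parity_twist (- parity Q # Rs))) Qs = ?D (%Rs. (-1) * G ((parity ^^ Suc ?m) Q # parity_twist Rs)) Qs"
 proof (rule dsum_cong_set[where S="?S", OF _ Qs(1)])
  fix Rs assume "set Rs <= ?S" "length Rs = length Qs"
  then show "G (parity_twist (- parity Q # Rs)) = (-1) * G ((parity ^^ Suc ?m) Q # parity_twist Rs)"
   using m[OF parity_twist_alt *(2), of Rs] by (simp add: parity_funpow_minus funpow_swap1)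
 qed (auto intro!: alt_all_uminus alt_all_contract[OF _ x] alt_all_parity)
 also have "\<dots> = (-1) ^ Suc ?m * dsum (contract x) parity (%Rs. G ((parity ^^ Suc ?m) Q # Rs)) (parity_twist Qs)" unfolding dsum_mult
  by (subst Cons.IH[OF Qs(1) multilin_on_ConsD[OF Cons.prems(2) *(2)]]) simp
 finally have 2: "?D (%Rs. G (parity_twist (- parity Q # Rs))) Qs =
   (-1) ^ Suc ?m * dsum (contract x) parity (%Rs. G ((parity ^^ Suc ?m) Q # Rs)) (parity_twist Qs)" .
 have "?D (%Rs. G (parity_twist Rs)) (Q # Qs) =
   G (parity_twist (- contract x Q # Qs)) + ?D (%Rs. G (parity_twist (- parity Q # Rs))) Qs" by (rule dsum_simps(2))
 also have "\<dots> = (-1) ^ length (Q # Qs) * dsum (contract x) parity G (parity_twist (Q # Qs))" unfolding 1 2 by (simp add: distrib_left)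
 finally show ?case .
qed simp

lemma lin_on_eq_span:
 assumes "lin_on V \<Phi>" "lin_on V \<Psi>" "subspace V" "S <= V" "!!x. x \<in> S ==> \<Phi> x = \<Psi> x" "x \<in> span S"
 shows "\<Phi> x = (\<Psi> x :: 'c::real_vector)"
proof -
 have "subspace {x \<in> V. \<Phi> x = \<Psi> x}" using assms(1-3) unfolding subspace_def lin_on_def by (auto, metis scaleR_zero_left)
 moreover have "S <= {x \<in> V. \<Phi> x = \<Psi> x}" using assms by auto
 ultimately show ?thesis using assms(6) span_minimal by blast
qed

lemma sum_scaleR_apply: "(\<Sum>i\<in>I. c i *\<^sub>R f i) x = (\<Sum>i\<in>I. c i * f i x)" for f :: "'b => 'c => real"
 by (induction I rule: infinite_finite_induct) (simp_all add: scaleR_fun_def)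

lemma dsum_sum:
 "dsum i t (%ys. \<Sum>j\<in>I. c j * G j ys) xs = (\<Sum>j\<in>I. c j * dsum i t (G j) xs :: real)"
 by (induction xs arbitrary: G) (simp_all add: sum.distrib distrib_left)

lemma dsum_map2:
 assumes "!!x y. t' (h x y) = h (t x) y"
 shows "length xs = length ys ==> (!!x y. x \<in> set xs ==> i' (h x y) = h (i x) y) ==>
  dsum i' t' G (map2 h xs ys) = dsum i t (%xs. G (map2 h xs ys)) xs"
proof (induction xs ys arbitrary: G rule: list_induct2)
 case (Cons x xs y ys)
 then show ?case by (simp add: assms)
qed simp

lemma alt_maps_alt_all: "A \<in> alt_maps V k ==> A \<in> alt_all V" by (simp add: alt_maps_iff)

lemma subspace_alt_maps: "subspace (alt_maps V k)" for V :: "'v::real_vector set"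
proof -
 have "alt_maps V k = alt_all V \<inter> {A. \<forall>xs. length xs ~= k --> A xs = 0}" using alt_maps_iff by blast
 moreover have "subspace {A :: 'v list => real. \<forall>xs. length xs ~= k --> A xs = 0}" by (simp add: subspace_def scaleR_fun_def)
 ultimately show ?thesis using subspace_inter[OF subspace_alt_all] by simp
qed

lemma alt1_alt_all:
 assumes "lin_on V \<xi>" "!!v. v ~: V ==> \<xi> v = 0" "subspace V" shows "alt1 \<xi> \<in> alt_all V"
proof (rule alt_allI_adjacent[OF _ assms(3)])
 show "multilin_on V (alt1 \<xi>)" unfolding multilin_on_def
 proof (intro allI impI)
  fix xs ys assume "set xs <= V & set ys <= V"
  show "lin_on V (%x. alt1 \<xi> (xs @ x # ys))"
  proof (cases "xs = [] & ys = []")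
   case False
   then have "(%x. alt1 \<xi> (xs @ x # ys)) = (%x. 0)" by (intro ext alt1_length) auto
   then show ?thesis by (simp add: lin_on_def)
  qed (use assms(1) in simp)
 qed
 show "alt1 \<xi> xs = 0" if "\<not> set xs <= V" for xs using that assms(2) by (auto simp: alt1_def split: list.splits)
qed (simp add: alt1_length)

lemma wedge_list_alt:
 assumes "subspace V" shows "set As <= alt_all V ==> wedge_list As \<in> alt_all V"
proof (induction As)
 case Nil
 show ?case by (rule alt_allI_adjacent[OF _ assms]) (auto simp: multilin_on_def lin_on_def split: if_splits)
qed (simp add: assms alt_all_wedge)

lemma wedge_list_Nil: "wedge_list As [] = (\<Prod>A\<leftarrow>As. A [])" by (induction As) (simp_all add: wedge_Nil)

lemma tsign_square [simp]: "tsign n * tsign n = 1" "tsign n * (tsign n * x) = x"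
proof -
 show "tsign n * tsign n = 1" for n by (induction n) (simp_all add: mult_ac power_mult_distrib[symmetric])
 then show "tsign n * (tsign n * x) = x" by (simp add: mult.assoc[symmetric])
qed

context smooth_mfd
begin

lemma vec_parity_twist:
 "multilin_on (T p) (G :: _ => real) ==> set Qs <= alt_all (C p) ==>
  G (map (vec p) (parity_twist Qs)) = tsign (length Qs) * G (map (vec p) Qs)"
proof (induction Qs arbitrary: G)
 case (Cons Q Qs)
 have Q: "vec p Q \<in> T p" "set (map (vec p) (parity_twist Qs)) <= T p" using Cons.prems(2) vec_tangent parity_twist_alt[of Qs "C p"] by auto
 have "vec p ((parity ^^ m) Q) = (-1) ^ m *\<^sub>R vec p Q" for m by (rule ext) (simp add: vec_def parity_funpow scaleR_fun_def)
 then show ?case using multilin_on_scaleR[OF Cons.prems(1), of "[]", OF _ Q(2,1), of "(-1) ^ length Qs"]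
   Cons.IH[OF multilin_on_ConsD[OF Cons.prems(1) Q(1)]] Cons.prems(2) by simp
qed simp

lemma cotangent_lin: "\<xi> \<in> C p ==> lin_on (T p) \<xi>" and cotangent_outside: "\<xi> \<in> C p ==> v ~: T p ==> \<xi> v = 0"
 by (simp_all add: cotangent_def)

lemma wedge_covectors_alt:
 "set \<xi>s <= C p ==> wedge_list (map alt1 \<xi>s) \<in> alt_maps (T p) (length \<xi>s)" unfolding alt_maps_iff
proof (intro conjI allI impI)
 assume "set \<xi>s <= C p"
 then show "wedge_list (map alt1 \<xi>s) \<in> alt_all (T p)" using cotangent_lin cotangent_outside
  by (intro wedge_list_alt subspace_tangent) (auto intro!: alt1_alt_all subspace_tangent)
 show "wedge_list (map alt1 \<xi>s) xs = 0" if "length xs ~= length \<xi>s" for xs by (rule wedge_list_length) (use that alt1_length in auto)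
qed

text \<open>A form is recovered from its contractions:
  \<open>(n + 1) A = \<Sum>\<^sub>i \<kappa>\<^sup>-\<^sup>1 dx\<^sub>i \<and> \<iota>\<^bsub>E\<^sub>i\<^esub> A\<close>.\<close>

lemma alt_maps_span:
 assumes p: "p \<in> pts M"
 shows "W \<in> alt_maps (T p) m ==> W \<in> span {wedge_list (map alt1 \<xi>s) |\<xi>s. length \<xi>s = m & set \<xi>s <= C p}"
proof (induction m arbitrary: W)
 case 0
 then have "W = W [] *\<^sub>R wedge_list []" by (intro ext) (simp add: alt_maps_iff scaleR_fun_def)
 moreover have "W [] *\<^sub>R wedge_list [] \<in> span {wedge_list (map alt1 \<xi>s) |\<xi>s. length \<xi>s = 0 & set \<xi>s <= C p}"
  by (intro span_scale span_base CollectI exI[of _ "[]"]) simp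
 ultimately show ?case by simp
next
 case (Suc m)
 let ?W = "%m. {wedge_list (map alt1 \<xi>s) |\<xi>s. length \<xi>s = m & set \<xi>s <= C p}"
 note W = alt_maps_alt_all[OF Suc.prems]
 obtain N \<kappa> x E where F: "at_frame p N \<kappa> x E" using ex_frame[OF p] by blast
 have E: "E i p \<in> T p" if "i < N" for i using F that VF_tangent' by (auto simp: at_frame_def)
 define B where "B i = wedge (alt1 (dif p (x i))) (contract (E i p) W)" for i
 have B: "B i \<in> span (?W (Suc m))" if i: "i < N" for i
 proof -
  have "contract (E i p) W \<in> alt_maps (T p) m" using alt_all_contract[OF W E[OF i]] Suc.prems by (auto simp: alt_maps_iff contract_def)
  then have "contract (E i p) W \<in> span (?W m)" by (rule Suc.IH)
  then show ?thesis unfolding B_def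
  proof (induction rule: span_induct_alt)
   case base
   have "wedge (alt1 (dif p (x i))) 0 = 0" by (rule ext) (simp only: wedge_linear zero_fun_apply)
   then show ?case by (simp only: span_0)
  next
   case (step c w y)
   have e: "wedge (alt1 (dif p (x i))) (c *\<^sub>R w + y) =
     c *\<^sub>R wedge (alt1 (dif p (x i))) w + wedge (alt1 (dif p (x i))) y"
    by (rule ext) (simp only: wedge_linear plus_fun_apply, simp add: scaleR_fun_def)
   have w: "wedge (alt1 (dif p (x i))) w \<in> ?W (Suc m)"
   proof -
    obtain \<xi>s where "w = wedge_list (map alt1 \<xi>s)" "length \<xi>s = m" "set \<xi>s <= C p" using step by blast
    then show ?thesis using dif_cotangent by (intro CollectI exI[of _ "dif p (x i) # \<xi>s"]) simp
   qed
   show ?case unfolding e by (rule span_add[OF span_scale[OF span_base[OF w]] step(2)])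
  qed
 qed
 have "W = (\<Sum>i<N. (1 / (real (Suc m) * \<kappa> p)) *\<^sub>R B i)"
 proof
  fix vs
  show "W vs = (\<Sum>i<N. (1 / (real (Suc m) * \<kappa> p)) *\<^sub>R B i) vs"
  proof (cases "length vs = Suc m & set vs <= T p")
   case True
   have k: "\<kappa> p ~= 0" using F by (simp add: at_frame_def)
   have "(\<Sum>i<N. (1 / \<kappa> p) * B i vs) = pick1 (%v vs. W (v # vs)) vs"
    unfolding B_def wedge_alt1_pick1 pick1_linear(3)[symmetric] pick1_sum_fun[symmetric]
   proof (rule pick1_cong)
    fix v ws assume ms: "mset (v # ws) = mset vs"
    then have s: "v \<in> T p" "set ws <= T p" using True by (metis insert_subset list.simps(15) set_mset_mset)+
    have "W (v # ws) = W ((\<Sum>i<N. (v (x i) / \<kappa> p) *\<^sub>R E i p) # ws)" using frame_tangent[OF F p s(1)] by simp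
    also have "\<dots> = (\<Sum>i<N. (v (x i) / \<kappa> p) * W (E i p # ws))"
    proof -
     have "W ((\<Sum>i\<in>I. (v (x i) / \<kappa> p) *\<^sub>R E i p) # ws) = (\<Sum>i\<in>I. (v (x i) / \<kappa> p) * W (E i p # ws))"
      if "finite I" "I <= {..<N}" for I using that
     proof (induction I rule: finite_induct)
      case empty
      show ?case using alt_all_zero[OF W tan_zero, of "[]" ws] by (simp only: sum.empty append_Nil)
     next
      case (insert i I)
      let ?a = "(v (x i) / \<kappa> p) *\<^sub>R E i p" and ?b = "\<Sum>i\<in>I. (v (x i) / \<kappa> p) *\<^sub>R E i p"
      have ab: "?a \<in> T p" "?b \<in> T p" using insert E by (auto intro!: subspace_sum[OF subspace_tangent] subspace_scale[OF subspace_tangent])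
      have "W ((?a + ?b) # ws) = W (?a # ws) + W (?b # ws)" using alt_all_add[OF W, of "[]" ws ?a ?b] ab s(2) unfolding append_Nil by simp
      moreover have "W (?a # ws) = v (x i) / \<kappa> p * W (E i p # ws)"
       using alt_all_scaleR[OF W, of "[]" ws "E i p"] insert.prems E s(2) unfolding append_Nil by simp
      moreover have "W (?b # ws) = (\<Sum>i\<in>I. (v (x i) / \<kappa> p) * W (E i p # ws))" using insert by simp
      ultimately show ?case unfolding sum.insert[OF insert(1,2)] by (simp del: plus_fun_apply)
     qed
     then show ?thesis by simp
    qed
    finally show "(\<Sum>i<N. 1 / \<kappa> p * (dif p (x i) v * contract (E i p) W ws)) = W (v # ws)" using s by (simp add: diff_at_def contract_def)
   qed
   also have "\<dots> = real (Suc m) * W vs" using pick1_alternating[OF W subspace_tangent, of vs] True by simp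
   finally have "(\<Sum>i<N. B i vs) = \<kappa> p * (real (Suc m) * W vs)" using k by (simp add: sum_divide_distrib[symmetric] field_simps)
   then show ?thesis unfolding sum_scaleR_apply sum_distrib_left[symmetric] using k by simp
  next
   case False
   have "B i vs = 0" if "i < N" for i
   proof -
    have "B i \<in> alt_maps (T p) (Suc m)"
    proof -
     have "?W (Suc m) <= alt_maps (T p) (Suc m)" by (auto dest!: wedge_covectors_alt)
     from span_minimal[OF this subspace_alt_maps] B[OF that] show ?thesis by (rule subsetD)
    qed
    then show ?thesis using False alt_all_outside[of "B i" "T p" vs] by (auto simp: alt_maps_iff)
   qed
   moreover have "W vs = 0" using False Suc.prems alt_all_outside[of W "T p" vs] by (auto simp: alt_maps_iff)
   ultimately show ?thesis unfolding sum_scaleR_apply by simp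
  qed
 qed
 moreover have "(\<Sum>i<N. (1 / (real (Suc m) * \<kappa> p)) *\<^sub>R B i) \<in> span (?W (Suc m))" by (intro span_sum span_scale B) simp
 ultimately show ?case by simp
qed

lemma contract_sharp: "Q \<in> alt_all (C p) ==> contract \<eta> (sharp Q \<zeta>) = sharp (- contract \<eta> Q) \<zeta>"
 using alt_all_swap[OF _ subspace_cotangent, of Q p "[]" \<zeta> \<eta>] by (intro ext) (simp add: sharp_def contract_def)

lemma parity_sharp: "parity (sharp Q \<zeta>) = sharp (- parity Q) \<zeta>" by (intro ext) (simp add: sharp_def parity_def)

lemma sharp_alt: "Q \<in> alt_all (C p) ==> \<zeta> \<in> C p ==> sharp Q \<zeta> \<in> alt_all (C p)"
 using alt_all_contract[of Q "C p" \<zeta>] by (simp add: sharp_def contract_def[abs_def])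

definition sharp_sum :: "'a cotan list => ('a cotan list => real) list => 'a cotan list => real" where
 "sharp_sum \<xi>s Qs \<eta>s = (\<Sum>\<sigma> | \<sigma> permutes {..<length \<xi>s}. of_int (sign \<sigma>) *
   wedge_list (map2 sharp Qs (map (%i. \<xi>s ! \<sigma> i) [0..<length \<xi>s])) \<eta>s)"

text \<open>Both sides follow the same Leibniz rule under insertion of a covector, so the claim
  reduces to the case without covectors. There it is the expansion of a determinant, and the signs
  of the twist on vectors amount to \<open>tsign\<close>.\<close>

lemma tw_sharp_sum:
 assumes p: "p \<in> pts M" and \<xi>s: "set \<xi>s <= C p"
 shows "set \<eta>s <= C p ==> set Qs <= alt_all (C p) ==> length Qs = length \<xi>s ==>
  tw p (wedge_list (map alt1 \<xi>s)) \<eta>s (parity_twist Qs) = sharp_sum \<xi>s Qs \<eta>s"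
proof (induction \<eta>s arbitrary: Qs)
 case Nil
 note W = alt_maps_alt_all[OF wedge_covectors_alt[OF \<xi>s]]
 have m: "multilin_on (T p) (wedge_list (map alt1 \<xi>s))" using W by (simp add: alt_all_def)
 have "tw p (wedge_list (map alt1 \<xi>s)) [] (parity_twist Qs) = wedge_list (map alt1 \<xi>s) (map (vec p) Qs)"
  using vec_parity_twist[OF m Nil.prems(2)] by simp
 also have "\<dots> = (\<Sum>\<sigma> | \<sigma> permutes {..<length \<xi>s}. of_int (sign \<sigma>) * (\<Prod>i<length \<xi>s. (\<xi>s ! \<sigma> i) (map (vec p) Qs ! i)))"
  using wedge_list_alt1_det[of \<xi>s "map (vec p) Qs"] Nil.prems(3) by simp
 also have "\<dots> = sharp_sum \<xi>s Qs []" unfolding sharp_sum_def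
 proof (intro sum.cong refl arg_cong2[of _ _ _ _ "(*)"])
  fix \<sigma> assume "\<sigma> \<in> {\<sigma>. \<sigma> permutes {..<length \<xi>s}}"
  then have \<sigma>: "\<sigma> permutes {..<length \<xi>s}" by simp
  have "map2 sharp Qs (map (%i. \<xi>s ! \<sigma> i) [0..<length \<xi>s]) = map (%i. sharp (Qs ! i) (\<xi>s ! \<sigma> i)) [0..<length \<xi>s]"
   using Nil.prems(3) by (intro nth_equalityI) auto
  then have "wedge_list (map2 sharp Qs (map (%i. \<xi>s ! \<sigma> i) [0..<length \<xi>s])) [] =
    (\<Prod>i<length \<xi>s. sharp (Qs ! i) (\<xi>s ! \<sigma> i) [])"
   using prod.distinct_set_conv_list[of "[0..<length \<xi>s]" "%i. sharp (Qs ! i) (\<xi>s ! \<sigma> i) []"]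
   by (simp add: wedge_list_Nil comp_def atLeast0LessThan)
  also have "\<dots> = (\<Prod>i<length \<xi>s. (\<xi>s ! \<sigma> i) (map (vec p) Qs ! i))"
  proof (rule prod.cong[OF refl])
   fix i assume i: "i \<in> {..<length \<xi>s}"
   then have "\<sigma> i < length \<xi>s" using permutes_in_image[OF \<sigma>] by auto
   then have "\<xi>s ! \<sigma> i \<in> C p" using \<xi>s by auto
   moreover have "Qs ! i \<in> alt_all (C p)" using Nil.prems i by auto
   ultimately have "(\<xi>s ! \<sigma> i) (vec p (Qs ! i)) = (Qs ! i) [\<xi>s ! \<sigma> i]" by (intro cotangent_vec[OF p])
   then show "sharp (Qs ! i) (\<xi>s ! \<sigma> i) [] = (\<xi>s ! \<sigma> i) (map (vec p) Qs ! i)" using i Nil.prems(3) by (simp add: sharp_def)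
  qed
  finally show "(\<Prod>i<length \<xi>s. (\<xi>s ! \<sigma> i) (map (vec p) Qs ! i)) =
    wedge_list (map2 sharp Qs (map (%i. \<xi>s ! \<sigma> i) [0..<length \<xi>s])) []" by simp
 qed
 finally show ?case .
next
 case (Cons \<eta> \<eta>s)
 have \<eta>: "\<eta> \<in> C p" and \<eta>s: "set \<eta>s <= C p" using Cons.prems by auto
 let ?S = "alt_all (C p)"
 let ?D = "dsum (%Q. - contract \<eta> Q) (%Q. - parity Q)"
 let ?z = "%\<sigma>. map (%i. \<xi>s ! \<sigma> i) [0..<length \<xi>s]"
 note W = alt_maps_alt_all[OF wedge_covectors_alt[OF \<xi>s]]
 have "wedge_list (map2 sharp Qs (?z \<sigma>)) (\<eta> # \<eta>s) = ?D (%Qs. wedge_list (map2 sharp Qs (?z \<sigma>)) \<eta>s) Qs" for \<sigma>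
  unfolding wedge_list_Cons_dsum by (rule dsum_map2) (use Cons.prems in \<open>auto simp: parity_sharp contract_sharp simp del: uminus_apply\<close>)
 then have "sharp_sum \<xi>s Qs (\<eta> # \<eta>s) = ?D (%Qs. sharp_sum \<xi>s Qs \<eta>s) Qs" unfolding sharp_sum_def dsum_sum by simp
 also have "\<dots> = ?D (%Qs. tw p (wedge_list (map alt1 \<xi>s)) \<eta>s (parity_twist Qs)) Qs" by (rule dsum_cong_set[where S="?S"])
   (use Cons.IH[OF \<eta>s] Cons.prems in \<open>auto intro!: alt_all_uminus alt_all_contract \<eta> alt_all_parity\<close>)
 also have "\<dots> = (-1) ^ length Qs *
   dsum (contract \<eta>) parity (tw p (wedge_list (map alt1 \<xi>s)) \<eta>s) (parity_twist Qs)"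
  by (rule dsum_parity_twist[OF \<eta> Cons.prems(2) multilin_on_tw[OF W \<eta>s]])
 finally show ?case by simp
qed

text \<open>\<open>tw\<close> is linear in the form and has the prescribed values on decomposable
  ones; as these span, it is the map that \<open>sharp_wedge\<close> describes.\<close>

lemma sharp_wedge_tw:
 assumes p: "p \<in> pts M" and H: "H p \<in> alt_maps (T p) (length Ps)" and Ps: "set Ps <= MV"
 shows "sharp_wedge M Ps H p = (%\<eta>s. if set \<eta>s <= C p then tw p (H p) \<eta>s (parity_twist (map (%P. P p) Ps)) else 0)"
proof -
 let ?V = "alt_maps (T p) (length Ps)" and ?Qs = "map (%P. P p) Ps"
 define \<Psi> where "\<Psi> W = (if W \<in> ?V then (%\<eta>s. if set \<eta>s <= C p then tw p W \<eta>s (parity_twist ?Qs) else 0) else 0)" for W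
 define G where "G \<xi>s = (\<Sum>\<sigma> | \<sigma> permutes {..<length Ps}. of_int (sign \<sigma>) *\<^sub>R
   wedge_list (map (%i. sharp ((Ps ! i) p) (\<xi>s ! \<sigma> i)) [0..<length Ps]))" for \<xi>s
 have Qs: "set ?Qs <= alt_all (C p)" using Ps MV_alt by auto
 have G: "G \<xi>s \<eta>s = (if set \<eta>s <= C p then sharp_sum \<xi>s ?Qs \<eta>s else 0)"
  if "length \<xi>s = length Ps" "set \<xi>s <= C p" for \<xi>s \<eta>s
 proof -
  have m: "map2 sharp ?Qs (map (%i. \<xi>s ! \<sigma> i) [0..<length \<xi>s]) =
    map (%i. sharp ((Ps ! i) p) (\<xi>s ! \<sigma> i)) [0..<length Ps]" for \<sigma> using that by (intro nth_equalityI) auto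
  have "wedge_list (map (%i. sharp ((Ps ! i) p) (\<xi>s ! \<sigma> i)) [0..<length Ps]) \<eta>s = 0"
   if \<sigma>: "\<sigma> permutes {..<length Ps}" and "\<not> set \<eta>s <= C p" for \<sigma>
  proof (rule alt_all_outside[OF wedge_list_alt[OF subspace_cotangent] \<open>\<not> set \<eta>s <= C p\<close>])
   have "sharp ((Ps ! i) p) (\<xi>s ! \<sigma> i) \<in> alt_all (C p)" if "i < length Ps" for i
   proof (rule sharp_alt)
    have "\<sigma> i < length \<xi>s" using permutes_in_image[OF \<sigma>] that \<open>length \<xi>s = length Ps\<close> by auto
    then show "\<xi>s ! \<sigma> i \<in> C p" using \<open>set \<xi>s <= C p\<close> by auto
    show "(Ps ! i) p \<in> alt_all (C p)" using Ps nth_mem[OF that] by (intro MV_alt) (rule subsetD)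
   qed
   then show "set (map (%i. sharp ((Ps ! i) p) (\<xi>s ! \<sigma> i)) [0..<length Ps]) <= alt_all (C p)" by auto
  qed
  then show ?thesis unfolding G_def sum_scaleR_apply sharp_sum_def m by (simp add: that(1))
 qed
 have \<Psi>: "lin_on ?V \<Psi>" unfolding lin_on_def
 proof (intro conjI ballI allI ext)
  fix W W' \<eta>s assume W: "W \<in> ?V" and W': "W' \<in> ?V"
  show "\<Psi> (W + W') \<eta>s = (\<Psi> W + \<Psi> W') \<eta>s"
   using W W' subspace_add[OF subspace_alt_maps W W'] unfolding \<Psi>_def plus_fun_apply[of "if _ then _ else _"]
   by (simp add: tw_form_linear del: plus_fun_apply)
 next
  fix c W \<eta>s assume W: "W \<in> ?V"
  show "\<Psi> (c *\<^sub>R W) \<eta>s = (c *\<^sub>R \<Psi> W) \<eta>s"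
   using W subspace_scale[OF subspace_alt_maps W] unfolding \<Psi>_def scaleR_fun_def[of c "if _ then _ else _"] by (simp add: tw_form_linear)
 qed
 have val: "\<Psi> (wedge_list (map alt1 \<xi>s)) = G \<xi>s" if "length \<xi>s = length Ps" "set \<xi>s <= C p" for \<xi>s
  using wedge_covectors_alt[OF that(2)] tw_sharp_sum[OF p that(2) _ Qs] that(1) by (intro ext) (simp add: G[OF that] \<Psi>_def)
 have "(THE \<Phi>. lin_on ?V \<Phi> & (\<forall>W. W ~: ?V --> \<Phi> W = 0) &
   (\<forall>\<xi>s. length \<xi>s = length Ps & set \<xi>s <= C p --> \<Phi> (wedge_list (map alt1 \<xi>s)) = G \<xi>s)) = \<Psi>"
 proof (rule the_equality)
  show "lin_on ?V \<Psi> & (\<forall>W. W ~: ?V --> \<Psi> W = 0) &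
   (\<forall>\<xi>s. length \<xi>s = length Ps & set \<xi>s <= C p --> \<Psi> (wedge_list (map alt1 \<xi>s)) = G \<xi>s)"
   using \<Psi> val by (simp add: \<Psi>_def)
  fix \<Phi> assume \<Phi>: "lin_on ?V \<Phi> & (\<forall>W. W ~: ?V --> \<Phi> W = 0) &
   (\<forall>\<xi>s. length \<xi>s = length Ps & set \<xi>s <= C p --> \<Phi> (wedge_list (map alt1 \<xi>s)) = G \<xi>s)"
  show "\<Phi> = \<Psi>"
  proof
   fix W show "\<Phi> W = \<Psi> W"
   proof (cases "W \<in> ?V")
    case True
    show ?thesis by (rule lin_on_eq_span[OF conjunct1[OF \<Phi>] \<Psi> subspace_alt_maps _ _ alt_maps_span[OF p True]])
      (use wedge_covectors_alt val \<Phi> in \<open>force, auto\<close>)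
   qed (simp add: \<Phi> \<Psi>_def)
  qed
 qed
 then show ?thesis unfolding sharp_wedge_def G_def[symmetric] using p H by (simp add: \<Psi>_def)
qed

primrec koszul_exponent :: "nat list => nat" where
 "koszul_exponent [] = 0"
| "koszul_exponent (a # as) = a * length as + koszul_exponent as"

lemma koszul_exponent_sum: "koszul_exponent as = (\<Sum>i<length as. as ! i * (length as - Suc i))"
proof (induction as)
 case (Cons a as)
 show ?case unfolding koszul_exponent.simps Cons list.size add_0_right add_Suc_right sum.lessThan_Suc_shift nth_Cons_0 nth_Cons_Suc by simp
qed simp

lemma parity_twist_hom:
 "list_all2 (%a Q. \<forall>xs. length xs ~= a --> Q xs = 0) as Qs ==> set Qs <= S ==> subspace S ==>
  multilin_on S (G :: _ => real) ==> G (parity_twist Qs) = (-1) ^ koszul_exponent as * G Qs"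
proof (induction as Qs arbitrary: G rule: list_all2_induct)
 case (Cons a as Q Qs)
 have "(parity ^^ length Qs) Q xs = ((-1) ^ (a * length as) *\<^sub>R Q) xs" for xs using Cons.hyps by (cases "length xs = a")
   (simp_all add: parity_funpow scaleR_fun_def mult.commute list_all2_lengthD[OF Cons.hyps(2)])
 then have e: "(parity ^^ length Qs) Q = (-1) ^ (a * length as) *\<^sub>R Q" by blast
 have Q: "Q \<in> S" "set Qs <= S" using Cons.prems by auto
 have "(-1) ^ (a * length as) *\<^sub>R Q \<in> S" by (rule subspace_scale[OF Cons.prems(2) Q(1)])
 note Cons.IH[OF Q(2) Cons.prems(2) multilin_on_ConsD[OF Cons.prems(3) this]]
 then show ?case using multilin_on_scaleR[OF Cons.prems(3), of "[]" Qs Q "(-1) ^ (a * length as)"] Q by (simp add: e power_add)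
qed simp

text \<open>On homogeneous entries the powers of the parity become one scalar sign. Counting from 0,
  the exponent n - i of c) reads \<open>k - Suc i\<close>.\<close>

lemma twist_sharp_wedge:
 assumes H: "H \<in> forms M k" and P: "!!i. i < k ==> P i \<in> multivector_fields M (a i)"
 shows "(-1) ^ (\<Sum>i<k. a i * (k - Suc i)) *\<^sub>R sharp_wedge M (map P [0..<k]) H = twist H (map P [0..<k])"
proof (intro ext)
 fix p \<eta>s
 let ?Ps = "map P [0..<k]" and ?s = "(-1) ^ (\<Sum>i<k. a i * (k - Suc i)) :: real"
 have HF: "H \<in> FM" "!!p xs. length xs ~= k ==> H p xs = 0" using H by (auto simp: forms_iff)
 have Ps: "set ?Ps <= MV" using P by (auto simp: multivector_fields_iff)
 show "(?s *\<^sub>R sharp_wedge M ?Ps H) p \<eta>s = twist H ?Ps p \<eta>s"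
 proof (cases "p \<in> pts M & set \<eta>s <= C p")
  case True
  let ?Qs = "map (%P. P p) ?Ps"
  have Hp: "H p \<in> alt_maps (T p) (length ?Ps)" using HF FM_alt by (simp add: alt_maps_iff)
  have "list_all2 (%a Q. \<forall>xs. length xs ~= a --> Q xs = 0) (map a [0..<k]) ?Qs"
   using P by (auto simp: list_all2_conv_all_nth multivector_fields_iff)
  then have "tw p (H p) \<eta>s (parity_twist ?Qs) = (-1) ^ koszul_exponent (map a [0..<k]) * tw p (H p) \<eta>s ?Qs"
   by (rule parity_twist_hom[OF _ _ subspace_alt_all multilin_on_tw[OF FM_alt[OF HF(1)]]])
    (use True Ps MV_alt in auto)
  moreover have "koszul_exponent (map a [0..<k]) = (\<Sum>i<k. a i * (k - Suc i))" by (simp add: koszul_exponent_sum)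
  ultimately show ?thesis using True sharp_wedge_tw[of p H ?Ps] Hp Ps by (simp add: scaleR_fun_def twist_def flip: power_add)
 next
  case False
  have Hp: "p \<in> pts M ==> H p \<in> alt_maps (T p) (length ?Ps)" using HF FM_alt by (simp add: alt_maps_iff)
  show ?thesis
  proof (cases "p \<in> pts M")
   case True
   then show ?thesis using sharp_wedge_tw[of p H ?Ps] True Hp Ps False by (simp add: scaleR_fun_def twist_def)
  qed (simp add: scaleR_fun_def twist_def sharp_wedge_def)
 qed
qed

end

subsection \<open>The multibrackets\<close>

text \<open>The sum over all ways of using the form part of one entry and the multivector part of the
  others; moving the form to the front changes the entries before it by \<open>t\<close>.\<close>

primrec fsum :: "('v => 'v) => ('f => 'v list => 'c::comm_monoid_add) => ('f \<times> 'v) list => 'c" where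
 "fsum t G [] = 0"
| "fsum t G (z # zs) = G (fst z) (map snd zs) + fsum t (%om Ps. G om (t (snd z) # Ps)) zs"

lemma fsum_add: "fsum t (%om Ps. G om Ps + G' om Ps) zs = fsum t G zs + fsum t G' zs" by (induction zs arbitrary: G G') (simp_all add: ac_simps)

lemma fsum_scaleR: "fsum t (%om Ps. c *\<^sub>R G om Ps) zs = c *\<^sub>R (fsum t G zs :: 'c::real_vector)"
 by (induction zs arbitrary: G) (simp_all add: scaleR_add_right)

lemma fsum_cong:
 assumes t: "!!P. P \<in> S ==> t P \<in> S"
 shows "(!!om Ps. om \<in> F ==> set Ps <= S ==> Suc (length Ps) = length zs ==> G om Ps = G' om Ps) ==>
  set zs <= F \<times> S ==> fsum t G zs = fsum t G' zs"
proof (induction zs arbitrary: G G')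
 case (Cons z zs)
 have "fsum t (%om Ps. G om (t (snd z) # Ps)) zs = fsum t (%om Ps. G' om (t (snd z) # Ps)) zs" by (rule Cons.IH) (use Cons.prems t in auto)
 moreover have "G (fst z) (map snd zs) = G' (fst z) (map snd zs)" by (rule Cons.prems) (use Cons.prems in auto)
 ultimately show ?case by simp
qed simp

lemma fsum_zero [simp]: "fsum t (%om Ps. 0) zs = 0" by (induction zs) simp_all

lemma fsum_mem:
 assumes t: "!!P. P \<in> S ==> t P \<in> S" and V: "subspace V"
 shows "(!!om Ps. om \<in> F ==> set Ps <= S ==> G om Ps \<in> V) ==> set zs <= F \<times> S ==> fsum t G zs \<in> V"
proof (induction zs arbitrary: G)
 case (Cons z zs)
 have "fsum t (%om Ps. G om (t (snd z) # Ps)) zs \<in> V" by (rule Cons.IH) (use Cons.prems t in auto)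
 moreover have "G (fst z) (map snd zs) \<in> V" by (rule Cons.prems) (use Cons.prems in auto)
 ultimately show ?case by (simp add: subspace_add[OF V])
qed (simp add: subspace_0[OF V])

definition form_multilin :: "'f::real_vector set => 'v::real_vector set => ('f => 'v list => 'c::real_vector) => bool" where
 "form_multilin F S G \<longleftrightarrow> (\<forall>Ps. set Ps <= S --> lin_on F (%om. G om Ps)) & (\<forall>om\<in>F. multilin_on S (G om))"

lemma form_multilinD:
 assumes "form_multilin F S G"
 shows "set Ps <= S ==> om \<in> F ==> om' \<in> F ==> G (om + om') Ps = G om Ps + G om' Ps"
  and "set Ps <= S ==> om \<in> F ==> G (c *\<^sub>R om) Ps = c *\<^sub>R G om Ps"
  and "om \<in> F ==> multilin_on S (G om)" using assms by (auto simp: form_multilin_def lin_on_def)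

lemma form_multilin_Cons: "form_multilin F S G ==> P \<in> S ==> form_multilin F S (%om Ps. G om (P # Ps))"
 by (simp add: form_multilin_def multilin_on_ConsD)

lemma lin_on_fsum:
 assumes t: "!!P. P \<in> S ==> t P \<in> S"
 shows "(!!om Ps. om \<in> F ==> set Ps <= S ==> lin_on V (%x. G x om Ps)) ==> set zs <= F \<times> S ==> lin_on V (%x. fsum t (G x) zs)"
proof (induction zs arbitrary: G)
 case (Cons z zs)
 have "lin_on V (%x. fsum t (%om Ps. G x om (t (snd z) # Ps)) zs)" by (rule Cons.IH) (use Cons.prems t in auto)
 moreover have "lin_on V (%x. G x (fst z) (map snd zs))" by (rule Cons.prems) (use Cons.prems in auto)
 ultimately show ?case by (simp add: lin_on_plus)
qed (simp add: lin_on_def)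

lemma fsum_slot:
 "fsum t G (pre @ x # post) = fsum t (%om Ps. G om (Ps @ snd x # map snd post)) pre +
  (G (fst x) (map (t \<circ> snd) pre @ map snd post) + fsum t (%om Ps. G om (map (t \<circ> snd) pre @ t (snd x) # Ps)) post)"
 by (induction pre arbitrary: G) (simp_all add: add.assoc)

lemma multilin_on_fsum:
 assumes G: "form_multilin F S G" and t: "!!P. P \<in> S ==> t P \<in> S" "lin_on S t"
 shows "multilin_on (F \<times> S) (fsum t G)" unfolding multilin_on_def
proof (intro allI impI)
 fix pre post assume s: "set pre <= F \<times> S & set post <= F \<times> S"
 then have m: "set (map (t \<circ> snd) pre) <= S" "set (map snd post) <= S" using t by auto
 note g = form_multilinD(3)[OF G, unfolded multilin_on_def, rule_format, OF _ conjI]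
 have "lin_on (F \<times> S) (%x. G om (Ps @ snd x # Qs))" "lin_on (F \<times> S) (%x. G om (Ps @ t (snd x) # Qs))"
  if "om \<in> F" "set Ps <= S" "set Qs <= S" for om Ps Qs using g[OF that] t by (auto simp: lin_on_def)
 then have "lin_on (F \<times> S) (%x. fsum t (%om Ps. G om (Ps @ snd x # map snd post)) pre)"
  "lin_on (F \<times> S) (%x. fsum t (%om Ps. G om (map (t \<circ> snd) pre @ t (snd x) # Ps)) post)"
  using m s t(1) by (intro lin_on_fsum[where S=S and F=F]; blast)+
 moreover have "lin_on (F \<times> S) (%x. G (fst x) (map (t \<circ> snd) pre @ map snd post))"
  using form_multilinD(1,2)[OF G, of "map (t \<circ> snd) pre @ map snd post"] m by (auto simp: lin_on_def)
 ultimately show "lin_on (F \<times> S) (%x. fsum t G (pre @ x # post))" unfolding fsum_slot by (intro lin_on_plus)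
qed

text \<open>If neither x nor y supplies the form, the symmetry of G in the multivectors applies. If
  one of them does, the other stands before the form in one order and behind it in the other, so the
  two terms differ by t; assumptions 3 and 4 say that this is worth the factor c.\<close>

lemma fsum_swap:
 assumes t: "!!P. P \<in> S ==> t P \<in> S" and x: "x \<in> F \<times> S" and y: "y \<in> F \<times> S" and post: "set post <= F \<times> S" and c: "c * c = 1"
  and pre: "set pre <= F \<times> S"
  and 1: "!!om Ps Qs. om \<in> F ==> set Ps <= S ==> set Qs <= S ==> G om (Ps @ snd x # snd y # Qs) = c *\<^sub>R G om (Ps @ snd y # snd x # Qs)"
  and 2: "!!om Ps Qs. om \<in> F ==> set Ps <= S ==> set Qs <= S ==> G om (Ps @ t (snd x) # t (snd y) # Qs) = c *\<^sub>R G om (Ps @ t (snd y) # t (snd x) # Qs)"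
  and 3: "!!Ps Qs. set Ps <= S ==> set Qs <= S ==> length Ps + length Qs = length pre + length post ==>
   G (fst x) (Ps @ t (snd y) # Qs) = c *\<^sub>R G (fst x) (Ps @ snd y # Qs)"
  and 4: "!!Ps Qs. set Ps <= S ==> set Qs <= S ==> length Ps + length Qs = length pre + length post ==>
   G (fst y) (Ps @ t (snd x) # Qs) = c *\<^sub>R G (fst y) (Ps @ snd x # Qs)"
 shows "fsum t G (pre @ x # y # post) = c *\<^sub>R (fsum t G (pre @ y # x # post) :: 'c::real_vector)"
proof -
 let ?r = "map (t \<circ> snd) pre" and ?p = "map snd post"
 have m: "set ?r <= S" "set ?p <= S" using pre post t by auto
 have "fsum t (%om Ps. G om (Ps @ snd x # snd y # ?p)) pre = fsum t (%om Ps. c *\<^sub>R G om (Ps @ snd y # snd x # ?p)) pre"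
  by (rule fsum_cong[OF t _ pre]) (simp_all only: 1[OF _ _ m(2)])
 moreover have "fsum t (%om Ps. G om (?r @ t (snd x) # t (snd y) # Ps)) post =
   fsum t (%om Ps. c *\<^sub>R G om (?r @ t (snd y) # t (snd x) # Ps)) post" by (rule fsum_cong[OF t _ post]) (simp_all only: 2[OF _ m(1)])
 moreover have "G (fst x) (?r @ snd y # ?p) = c *\<^sub>R G (fst x) (?r @ t (snd y) # ?p)" using 3[OF m] c by simp
 moreover have "G (fst y) (?r @ t (snd x) # ?p) = c *\<^sub>R G (fst y) (?r @ snd x # ?p)" using 4[OF m] by simp
 ultimately show ?thesis unfolding fsum_slot[of t G pre] by (simp add: fsum_scaleR scaleR_add_right ac_simps)
qed

text \<open>A derivation over the multivectors becomes one over the pairs; hitting a pair removes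
  its form. On its way the derivation meets entries already changed by t or the form itself, and
  both encounters cost the same factor - c.\<close>

lemma fsum_dsum:
 fixes G :: "'f::real_vector => 'v::real_vector list => 'c::real_vector"
 assumes t: "!!P. P \<in> S ==> t P \<in> S" and d: "!!P. P \<in> S ==> d P \<in> S" and q: "!!P. P \<in> S ==> q P \<in> S"
  and qF: "!!om. om \<in> F ==> qF om \<in> F" and F0: "0 \<in> F"
  and dt: "!!P. P \<in> S ==> d (t P) = (- c) *\<^sub>R t (d P)" and qt: "!!P. P \<in> S ==> q (t P) = t (q P)" and c: "c * c = 1"
 shows "set zs <= F \<times> S ==> form_multilin F S G ==>
  (!!om Ps. om \<in> F ==> set Ps <= S ==> Suc (length Ps) = length zs ==> G (qF om) Ps = (- c) *\<^sub>R G om Ps) ==>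
  c *\<^sub>R fsum t (%om Ps. dsum d q (G om) Ps) zs =
   - dsum (%z. (0, d (snd z))) (%z. (qF (fst z), q (snd z))) (fsum t G) zs"
proof (induction zs arbitrary: G)
 case (Cons z zs)
 let ?D = "dsum d q" and ?E = "dsum (%z. (0, d (snd z))) (%z. (qF (fst z), q (snd z)))"
 obtain om P where z: "z = (om, P)" by force
 have P: "om \<in> F" "P \<in> S" "t P \<in> S" "t (d P) \<in> S" and zs: "set zs <= F \<times> S" and ps: "set (map snd zs) <= S"
  using Cons.prems(1) z t d by auto
 have 1: "fsum t (%om Ps. G om (d (t P) # Ps)) zs = (- c) *\<^sub>R fsum t (%om Ps. G om (t (d P) # Ps)) zs"
  unfolding fsum_scaleR[symmetric] dt[OF P(2)]
 proof (rule fsum_cong[OF t _ zs])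
  fix om Ps assume "om \<in> F" "set Ps <= S"
  then show "G om ((- c) *\<^sub>R t (d P) # Ps) = (- c) *\<^sub>R G om (t (d P) # Ps)"
   using multilin_on_scaleR[OF form_multilinD(3)[OF Cons.prems(2)], of om "[]" Ps "t (d P)" "- c"] P by simp
 qed
 have 2: "c *\<^sub>R fsum t (%om Ps. ?D (%Ps. G om (q (t P) # Ps)) Ps) zs = - ?E (fsum t (%om Ps. G om (q (t P) # Ps))) zs"
  by (rule Cons.IH[OF zs form_multilin_Cons[OF Cons.prems(2) q[OF P(3)]]])
   (rule Cons.prems(3), use q[OF P(3)] in auto)
 have 3: "c *\<^sub>R ?D (G om) (map snd zs) = - ?E (%ys. G (qF om) (map snd ys)) zs"
 proof -
  have "?E (%ys. G (qF om) (map snd ys)) zs = ?D (G (qF om)) (map snd zs)" by (rule dsum_map[symmetric]) simp_all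
  also have "\<dots> = ?D (%Ps. (- c) *\<^sub>R G om Ps) (map snd zs)"
   by (rule dsum_cong_set[where S=S, OF _ ps d q]) (use Cons.prems(3)[OF P(1)] in simp)
  finally show ?thesis unfolding dsum_scaleR by simp
 qed
 have 4: "G 0 (map snd zs) = 0" using form_multilinD(2)[OF Cons.prems(2) ps F0, of 0] by simp
 show ?case unfolding z using 1 2 3 4 c by (simp add: fsum_add dsum_add scaleR_add_right scaleR_diff_right qt[OF P(2)])
qed simp

context smooth_mfd
begin

lemma tw_parity: "tw p (parity H) \<xi>s Qs = (-1) ^ length Qs * tw p H \<xi>s Qs"
proof (induction \<xi>s arbitrary: Qs)
 case (Cons \<xi> \<xi>s)
 have "tw p (parity H) \<xi>s = (%Qs. (-1) ^ length Qs * tw p H \<xi>s Qs)" by (rule ext) (rule Cons)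
 then show ?case by (simp add: dsum_length_mult)
qed (simp add: parity_def)

lemma twist_par: "twist (par H) Ps = (-1) ^ length Ps *\<^sub>R twist H Ps" by (intro ext) (simp add: twist_def par_def tw_parity scaleR_fun_def)

lemma form_multilin_twist: "form_multilin FM MV twist" by (simp add: form_multilin_def lin_on_def twist_form_linear multilin_on_twist)

lemma par_funpow_MV: "P \<in> MV ==> (par ^^ k) P \<in> MV" by (induction k) (simp_all add: par_MV)

lemma par_funpow_linear: "(par ^^ k) (P + Q) = (par ^^ k) P + (par ^^ k) Q" "(par ^^ k) (c *\<^sub>R P) = c *\<^sub>R (par ^^ k) P"
 by (induction k) (simp_all only: funpow.simps id_apply comp_apply par_linear)

lemma lin_on_par_funpow: "lin_on MV (par ^^ k)" by (simp only: lin_on_def par_funpow_linear) simp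

lemma par_funpow_hom: "hdeg a P ==> (par ^^ k) P = sg (a * int k) *\<^sub>R P"
proof (induction k)
 case (Suc k)
 then show ?case by (simp add: par_linear hdeg_par) (simp add: sg_def algebra_simps)
qed simp

lemma delta_par_funpow: "delta h ((par ^^ k) P) = (-1) ^ k *\<^sub>R (par ^^ k) (delta h P)" by (induction k) (simp_all add: delta_par par_linear)

definition br :: "('a form \<times> 'a mvf) list => 'a mvf" where
 "br zs = (if length zs = 2 then bracket (snd (zs ! 0)) (snd (zs ! 1)) else 0)"

text \<open>With n entries only a form of degree n - 1 contributes, which has degree n - 4 in the
  graded space. Moving a multivector field of degree a, hence of degree a - 2 in the graded space,
  past it costs (-1)^(n a), that is, the n-th power of \<open>par\<close>.\<close>

definition mbr :: "('a form \<times> 'a mvf) list => 'a form \<times> 'a mvf" where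
 "mbr zs = (if length zs = 1 then (- d_form (fst (hd zs)), 0)
  else (0, br zs + fsum (par ^^ length zs) twist zs))"

lemma br_simps [simp]: "br [] = 0" "br [x] = 0" "br [x, y] = bracket (snd x) (snd y)" "br (x # y # z # zs) = 0" by (simp_all add: br_def)

lemma mbr_single: "mbr [z] = (- d_form (fst z), 0)" by (simp add: mbr_def)

lemma mbr_many: "length zs ~= 1 ==> mbr zs = (0, br zs + fsum (par ^^ length zs) twist zs)" by (simp add: mbr_def)

lemma multilin_on_br: "multilin_on (FM \<times> MV) br" unfolding multilin_on_def
proof (intro allI impI)
 fix pre post assume s: "set pre <= FM \<times> MV & set post <= FM \<times> MV"
 consider y where "pre = []" "post = [y]" | y where "pre = [y]" "post = []" | "length (pre @ post) ~= 1"
  by (cases pre; cases post) (auto simp: length_Suc_conv)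
 then show "lin_on (FM \<times> MV) (%x. br (pre @ x # post))"
 proof cases
  case 1
  then show ?thesis using s by (auto simp: lin_on_def bracket_linear simp del: plus_fun_apply)
 next
  case 2
  then show ?thesis using s by (auto simp: lin_on_def bracket_linear simp del: plus_fun_apply)
 next
  case 3
  then have "(%x. br (pre @ x # post)) = (%x. 0)" by (auto simp: br_def)
  then show ?thesis by (simp add: lin_on_def)
 qed
qed

lemma multilin_on_mbr: "multilin_on (FM \<times> MV) mbr" unfolding multilin_on_def
proof (intro allI impI)
 fix pre post assume s: "set pre <= FM \<times> MV & set post <= FM \<times> MV"
 show "lin_on (FM \<times> MV) (%x. mbr (pre @ x # post))"
 proof (cases "pre @ post = []")
  case True
  have "- d_form (om + om') = - d_form om + - d_form om'" "- d_form (c *\<^sub>R om) = c *\<^sub>R - d_form om"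
   if "om \<in> FM" "om' \<in> FM" for om om' c using d_form_linear[OF that] by simp_all
  then show ?thesis using True by (auto simp: lin_on_def mbr_single simp del: plus_fun_apply scaleR_minus_right)
 next
  case False
  let ?l = "Suc (length (pre @ post))"
  have e: "mbr (pre @ x # post) = (0, br (pre @ x # post) + fsum (par ^^ ?l) twist (pre @ x # post))" for x using False by (subst mbr_many) auto
  note m = multilin_on_fsum[OF form_multilin_twist par_funpow_MV lin_on_par_funpow, of ?l]
  show ?thesis unfolding lin_on_def e by (intro conjI ballI allI)
    (simp_all only: multilin_onD[OF multilin_on_br conjunct1[OF s] conjunct2[OF s]]
     multilin_onD[OF m conjunct1[OF s] conjunct2[OF s]], simp_all add: scaleR_add_right ac_simps del: plus_fun_apply)
 qed
qed

lemma mbr_mem: "set zs <= FM \<times> MV ==> mbr zs \<in> FM \<times> MV"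
proof (cases "length zs = 1")
 case True
 assume "set zs <= FM \<times> MV"
 then show ?thesis using True d_form_FM subspace_neg[OF subspace_FM] MV_0 by (auto simp: length_Suc_conv mbr_single)
next
 case False
 assume s: "set zs <= FM \<times> MV"
 have "br zs \<in> MV"
 proof (cases "length zs = 2")
  case True
  then show ?thesis using s bracket_MV by (auto simp: length_Suc_conv numeral_2_eq_2)
 qed (simp add: br_def MV_0)
 moreover have "fsum (par ^^ length zs) twist zs \<in> MV" by (rule fsum_mem[OF par_funpow_MV subspace_MV _ s]) (auto intro: twist_MV)
 ultimately show ?thesis using False FM_0 subspace_add[OF subspace_MV] by (simp add: mbr_many del: plus_fun_apply)
qed

text \<open>The last condition excludes functions from the form component; together with
  \<open>hdeg\<close> it also covers the degrees in which that component is zero.\<close>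

lemma Lspace_iff:
 "z \<in> Lspace M d \<longleftrightarrow> z \<in> FM \<times> MV & hdeg (d + 3) (fst z) & hdeg (d + 2) (snd z) & (\<forall>p. fst z p [] = 0)"
proof -
 have "om \<in> (if d + 3 \<ge> 1 then forms M (nat (d + 3)) else {0}) \<longleftrightarrow> om \<in> FM & hdeg (d + 3) om & (\<forall>p. om p [] = 0)" for om
 proof (cases "d + 3 \<ge> 1")
  case True
  then show ?thesis by (auto simp: forms_hom hdeg_def)
 next
  case False
  have "om = 0" if "hdeg (d + 3) om" "\<forall>p. om p [] = 0"
  proof (intro ext)
   fix p xs show "om p xs = 0 p xs" using that False by (cases xs) (auto intro: hdegD)
  qed
  then show ?thesis using False FM_0 hdeg_zero by auto
 qed
 moreover have "P \<in> (if d + 2 \<ge> 0 then multivector_fields M (nat (d + 2)) else {0}) \<longleftrightarrow> P \<in> MV & hdeg (d + 2) P" for P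
  using MV_0 hdeg_zero hdeg_neg[of "d + 2" P] by (auto simp: multivector_fields_hom)
 ultimately show ?thesis by (auto simp: Lspace_def mem_Times_iff)
qed

lemma LspaceD:
 assumes "z \<in> Lspace M d"
 shows "z \<in> FM \<times> MV" "hdeg (d + 3) (fst z)" "hdeg (d + 2) (snd z)" "fst z p [] = 0" using assms by (auto simp: Lspace_iff)

lemma hdeg_d_form:
 assumes w: "om \<in> FM" "hdeg k om" shows "hdeg (k + 1) (d_form om)" "d_form om p [] = 0"
proof -
 have "hdeg (k + 1) (d_form om) & d_form om p [] = 0"
 proof (cases "k < 0")
  case True
  then have "om = 0" using hdeg_neg w by blast
  then have "d_form om = 0" using d_form_linear(2)[OF w(1,1), of 0] by simp
  then show ?thesis by (simp add: hdeg_zero)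
 next
  case False
  then have "om \<in> forms M (nat k)" using w by (simp add: forms_hom)
  then show ?thesis using ext_deriv_d_form(2)[of om "nat k"] False by (auto simp: forms_iff hdeg_def)
 qed
 then show "hdeg (k + 1) (d_form om)" "d_form om p [] = 0" by auto
qed

text \<open>The offset e absorbs the degrees of the entries that the recursion has already handed to
  G.\<close>

lemma fsum_hom:
 assumes t: "!!P. P \<in> MV ==> t P \<in> MV" "!!a P. hdeg a P ==> hdeg a (t P)"
 shows "list_all2 (%d z. z \<in> Lspace M d) ds zs ==>
  (!!om k as Ps. om \<in> FM ==> hdeg (k + 3) om ==> set Ps <= MV ==> list_all2 hdeg as Ps ==>
   hdeg (k + sum_list as - 2 * int (length Ps) + e) (G om Ps)) ==>
  hdeg (sum_list ds + e) (fsum t G zs)"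
proof (induction ds zs arbitrary: G e rule: list_all2_induct)
 case (Cons d ds z zs)
 have "list_all2 hdeg (map (%d. d + 2) ds) (map snd zs)" "set (map snd zs) <= MV"
  using Cons.hyps(2) by (auto simp: list_all2_conv_all_nth in_set_conv_nth intro: LspaceD(3)) (metis LspaceD(1) SigmaE2)
 moreover have "sum_list (map (%d. d + 2) ds) = sum_list ds + 2 * int (length zs)"
  unfolding list_all2_lengthD[OF Cons.hyps(2), symmetric] by (induction ds) auto
 ultimately have 1: "hdeg (sum_list (d # ds) + e) (G (fst z) (map snd zs))"
  using Cons.prems[of "fst z" d "map snd zs" "map (%d. d + 2) ds"] LspaceD[OF Cons.hyps(1)] by (simp add: mem_Times_iff)
 have "hdeg (sum_list ds + (d + e)) (fsum t (%om Ps. G om (t (snd z) # Ps)) zs)"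
 proof (rule Cons.IH)
  fix om k as Ps assume s: "om \<in> FM" "hdeg (k + 3) om" "set Ps <= MV" "list_all2 hdeg as Ps"
  have "hdeg (k + sum_list ((d + 2) # as) - 2 * int (length (t (snd z) # Ps)) + e) (G om (t (snd z) # Ps))"
   using s t LspaceD[OF Cons.hyps(1)] by (intro Cons.prems) (auto simp: mem_Times_iff)
  then show "hdeg (k + sum_list as - 2 * int (length Ps) + (d + e)) (G om (t (snd z) # Ps))" by (simp add: algebra_simps)
 qed
 then have "hdeg (sum_list (d # ds) + e) (fsum t (%om Ps. G om (t (snd z) # Ps)) zs)" by (simp add: ac_simps)
 from hdeg_linear(1)[OF 1 this] show ?case unfolding fsum.simps .
qed (simp add: hdeg_zero)

lemma mbr_degree:
 assumes z: "list_all2 (%d z. z \<in> Lspace M d) ds zs" and "zs ~= []"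
 shows "mbr zs \<in> Lspace M (sum_list ds + 1)"
proof -
 have s: "set zs <= FM \<times> MV"
 proof
  fix z assume "z \<in> set zs"
  then obtain d where "z \<in> Lspace M d" using z by (metis in_set_conv_nth list_all2_conv_all_nth)
  then show "z \<in> FM \<times> MV" by (rule LspaceD)
 qed
 show ?thesis
 proof (cases "length zs = 1")
  case True
  then obtain z where zs: "zs = [z]" by (auto simp: length_Suc_conv)
  then obtain d where d: "ds = [d]" "z \<in> Lspace M d" using z by (auto simp: list_all2_Cons2)
  have "fst z \<in> FM" using LspaceD(1)[OF d(2)] by auto
  note h = hdeg_d_form[OF this LspaceD(2)[OF d(2)]]
  have "hdeg (d + 1 + 3) (- d_form (fst z))" using hdeg_linear(3)[OF h(1)] by (simp add: add.commute add.left_commute)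
  then show ?thesis using mbr_mem[OF s] h(2) by (simp add: zs d Lspace_iff mbr_single hdeg_zero)
 next
  case False
  have f: "hdeg (sum_list ds + 3) (fsum (par ^^ length zs) twist zs)"
  proof (rule fsum_hom[OF par_funpow_MV _ z])
   show "hdeg a P ==> hdeg a ((par ^^ length zs) P)" for a P by (simp add: par_funpow_hom hdeg_linear(2))
   fix om k as Ps assume w: "om \<in> FM" "hdeg (k + 3) om" "set Ps <= MV" "list_all2 hdeg as Ps"
   show "hdeg (k + sum_list as - 2 * int (length Ps) + 3) (twist om Ps)"
   proof (cases "int (length Ps) = k + 3")
    case True
    then have e: "k + sum_list as - 2 * int (length Ps) + 3 = sum_list as - int (length Ps)" by simp
    show ?thesis unfolding e by (rule hdeg_twist[OF w(1,3,4)])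
   qed (simp add: twist_length[OF w(2)] hdeg_zero)
  qed
  have b: "hdeg (sum_list ds + 3) (br zs)"
  proof (cases "length zs = 2")
   case True
   then obtain x y where zs: "zs = [x, y]" by (auto simp: length_Suc_conv numeral_2_eq_2)
   then obtain a b where d: "ds = [a, b]" "x \<in> Lspace M a" "y \<in> Lspace M b" using z by (auto simp: list_all2_Cons2)
   have "hdeg (a + 2 + (b + 2) - 1) (bracket (snd x) (snd y))"
    using LspaceD[OF d(2)] LspaceD[OF d(3)] by (intro hdeg_bracket) (auto simp: mem_Times_iff)
   then show ?thesis by (simp add: zs d algebra_simps)
  qed (simp add: br_def hdeg_zero)
  show ?thesis using mbr_mem[OF s] hdeg_linear(1)[OF b f] False by (simp add: Lspace_iff mbr_many hdeg_zero add.assoc del: plus_fun_apply)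
 qed
qed

lemma mbr_swap:
 assumes x: "x \<in> Lspace M a" and y: "y \<in> Lspace M b" and s: "set pre <= FM \<times> MV" "set post <= FM \<times> MV"
 shows "mbr (pre @ x # y # post) = sg (a * b) *\<^sub>R mbr (pre @ y # x # post)"
proof -
 note x' = LspaceD[OF x] and y' = LspaceD[OF y]
 have P: "snd x \<in> MV" "snd y \<in> MV" using x' y' by (auto simp: mem_Times_iff)
 let ?l = "Suc (Suc (length pre + length post))"
 let ?t = "par ^^ ?l"
 have h: "hdeg (a + 2) (?t (snd x))" "hdeg (b + 2) (?t (snd y))" using x' y' by (auto simp only: par_funpow_hom intro!: hdeg_linear(2))
 have e: "sg ((a + 2) * (b + 2)) = sg (a * b)" by (simp add: sg_def)
 \<comment> \<open>Here u supplies the form and v moves past it. Unless the degree of the form is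
   the number of the other entries, both sides vanish; otherwise the degree c of u is the number of
   all entries minus 4, and the power of \<open>par\<close> acts on v as the required sign.\<close>
 have sw: "twist (fst u) (Ps @ ?t (snd v) # Qs) = sg (a * b) *\<^sub>R twist (fst u) (Ps @ snd v # Qs)"
  if u: "u \<in> Lspace M c" and v: "v \<in> Lspace M d" and cd: "c * d = a * b" and l: "set Ps <= MV" "set Qs <= MV"
   "length Ps + length Qs = length pre + length post" for u v c d Ps Qs
 proof (cases "int ?l = c + 4")
  case True
  have "snd v \<in> MV" "fst u \<in> FM" using LspaceD(1)[OF u] LspaceD(1)[OF v] by (auto simp: mem_Times_iff)
  moreover have "?t (snd v) = sg (a * b) *\<^sub>R snd v" unfolding par_funpow_hom[OF LspaceD(3)[OF v]] True cd[symmetric] by (simp add: sg_def)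
  ultimately show ?thesis using multilin_on_scaleR[OF multilin_on_twist l(1,2)] by simp
 next
  case False
  have "twist (fst u) (Ps @ R # Qs) = 0" for R by (rule twist_length[OF LspaceD(2)[OF u]]) (use False l(3) in simp)
  then show ?thesis by simp
 qed
 have "fsum ?t twist (pre @ x # y # post) = sg (a * b) *\<^sub>R fsum ?t twist (pre @ y # x # post)"
 proof (rule fsum_swap[where S=MV and F=FM, OF par_funpow_MV x'(1) y'(1) s(2) _ s(1)])
  fix om Ps Qs assume w: "om \<in> FM" "set Ps <= MV" "set Qs <= MV"
  show "twist om (Ps @ snd x # snd y # Qs) = sg (a * b) *\<^sub>R twist om (Ps @ snd y # snd x # Qs)"
   using twist_swap[OF w(1) x'(3) y'(3), of Ps Qs] w P unfolding e by simp
  show "twist om (Ps @ ?t (snd x) # ?t (snd y) # Qs) = sg (a * b) *\<^sub>R twist om (Ps @ ?t (snd y) # ?t (snd x) # Qs)"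
   using twist_swap[OF w(1) h, of Ps Qs] w par_funpow_MV[OF P(1)] par_funpow_MV[OF P(2)] unfolding e by simp
 next
  fix Ps Qs assume l: "set Ps <= MV" "set Qs <= MV" "length Ps + length Qs = length pre + length post"
  show "twist (fst x) (Ps @ ?t (snd y) # Qs) = sg (a * b) *\<^sub>R twist (fst x) (Ps @ snd y # Qs)" by (rule sw[OF x y _ l]) simp
  show "twist (fst y) (Ps @ ?t (snd x) # Qs) = sg (a * b) *\<^sub>R twist (fst y) (Ps @ snd x # Qs)" by (rule sw[OF y x _ l]) simp
 qed simp_all
 moreover have "br (pre @ x # y # post) = sg (a * b) *\<^sub>R br (pre @ y # x # post)"
 proof (cases "pre @ post = []")
  case True
  then show ?thesis using bracket_commute[OF P(1) x'(3) P(2) y'(3)] unfolding e by simp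
 next
  case False
  then have "br (pre @ u # v # post) = 0" for u v by (cases pre) (auto simp: br_def)
  then show ?thesis by simp
 qed
 ultimately show ?thesis by (simp add: mbr_many scaleR_add_right del: plus_fun_apply funpow.simps)
qed

lemma dsum_Pair: "dsum i t (%ys. (0, G ys)) xs = (0, dsum i t G xs)" by (induction xs arbitrary: G) (simp_all add: zero_prod_def del: plus_fun_apply)

lemma delta_fsum: "delta h (fsum t G zs) = fsum t (%om Ps. delta h (G om Ps)) zs"
 by (induction zs arbitrary: G) (simp_all add: delta_linear del: plus_fun_apply)

text \<open>On an entry of degree d the pair of maps - \<open>par\<close> and \<open>par\<close> is
  multiplication by (-1)^d, since its form has degree d + 3 and its multivector field degree d + 2.
  Thus insertion of dh is an odd derivation of all brackets, and it sends forms to 0.\<close>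

lemma mbr_derive:
 assumes h: "h \<in> A" and s: "set zs <= FM \<times> MV" and ne: "zs ~= []"
 shows "(0, delta h (snd (mbr zs))) =
  - dsum (%z. (0, delta h (snd z))) (%z. (- par (fst z), par (snd z))) mbr zs"
proof (cases "length zs = 1")
 case True
 have "d_form 0 = 0" using d_form_linear(2)[OF FM_0 FM_0, of 0] by simp
 then show ?thesis using True by (auto simp: length_Suc_conv mbr_single delta_linear zero_prod_def)
next
 case False
 let ?i = "%z. (0, delta h (snd z))" and ?q = "%z. (- par (fst z), par (snd z))"
 let ?t = "par ^^ length zs" and ?c = "(-1 :: real) ^ Suc (length zs)"
 have "dsum ?i ?q mbr zs = dsum ?i ?q (%ys. (0, br ys + fsum ?t twist ys)) zs"
  by (rule dsum_cong) (use False in \<open>simp add: mbr_many length_dlist\<close>)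
 also have "\<dots> = (0, dsum ?i ?q br zs + dsum ?i ?q (fsum ?t twist) zs)" by (simp add: dsum_Pair dsum_add del: plus_fun_apply)
 finally have D: "dsum ?i ?q mbr zs = (0, dsum ?i ?q br zs + dsum ?i ?q (fsum ?t twist) zs)" .
 have "?c *\<^sub>R fsum ?t (%om Ps. dsum (delta h) par (twist om) Ps) zs = - dsum ?i ?q (fsum ?t twist) zs"
 proof (rule fsum_dsum[OF par_funpow_MV delta_MV[OF h] par_MV _ FM_0 _ _ _ s form_multilin_twist])
  show "- par om \<in> FM" if "om \<in> FM" for om using that par_FM subspace_neg[OF subspace_FM] by blast
  show "delta h (?t P) = (- ?c) *\<^sub>R ?t (delta h P)" for P by (simp add: delta_par_funpow)
  show "par (?t P) = ?t (par P)" for P by (rule funpow_swap1)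
  fix om and Ps :: "'a mvf list" assume w: "om \<in> FM" "Suc (length Ps) = length zs"
  have "- par om = (-1) *\<^sub>R par om" by simp
  then show "twist (- par om) Ps = (- ?c) *\<^sub>R twist om Ps" using w(2)[symmetric] by (simp only: twist_form_linear twist_par) simp
 qed simp_all
 moreover have "delta h (fsum ?t twist zs) = fsum ?t (%om Ps. ?c *\<^sub>R dsum (delta h) par (twist om) Ps) zs" unfolding delta_fsum delta_twist
  by (rule fsum_cong[OF par_funpow_MV _ s]) (assumption, drule sym, simp)
 ultimately have 1: "delta h (fsum ?t twist zs) = - dsum ?i ?q (fsum ?t twist) zs" by (simp only: fsum_scaleR)
 have 2: "delta h (br zs) = - dsum ?i ?q br zs"
 proof (cases "length zs = 2")
  case True
  then obtain x y where zs: "zs = [x, y]" by (auto simp: length_Suc_conv numeral_2_eq_2)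
  then show ?thesis using delta_bracket[OF _ _ h, of "snd x" "snd y"] s by (auto simp del: minus_apply uminus_apply plus_fun_apply)
 next
  case False
  have "dsum ?i ?q br zs = dsum ?i ?q (%_. 0) zs" by (rule dsum_cong) (use False in \<open>simp add: br_def length_dlist\<close>)
  then show ?thesis using False by (simp add: br_def delta_linear)
 qed
 show ?thesis unfolding D using False by (simp add: mbr_many delta_linear 1 2 del: plus_fun_apply uminus_apply minus_apply)
qed

end

subsection \<open>Shuffle sums of graded symmetric functions\<close>

lemma shuf_cong_set:
 assumes "!!ys zs. set ys <= S ==> set zs <= S ==> G ys zs = H ys zs" "set xs <= S"
 shows "shuf w G xs = shuf w H xs"
proof (rule shuf_cong)
 fix ys zs assume "mset ys + mset zs = mset xs"
 then have "set ys \<union> set zs = set xs" by (metis set_mset_mset set_mset_union)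
 then show "G ys zs = H ys zs" using assms by blast
qed

lemma shuf_append:
 "shuf w G (xs @ ys) = shuf w (%as cs. shuf w (%bs ds. (\<Prod>u\<leftarrow>cs. \<Prod>v\<leftarrow>bs. w u v) *\<^sub>R G (as @ bs) (cs @ ds)) ys) xs"
 by (induction xs arbitrary: G) (simp_all add: shuf_scaleR[symmetric] mult_ac)

text \<open>Splittings that keep x and y in one block are covered by the symmetry of G. If they are
  separated, the one that goes to the left passes the other in just one of the two orders, and the
  weights account for the factor.\<close>

lemma shuf_swap:
 assumes c: "w x y = c" "c * w y x = 1" and S: "set pre <= S" "set post <= S"
  and G: "!!as bs rs. set as <= S ==> set bs <= S ==> set rs <= S ==> G (as @ x # y # bs) rs = c *\<^sub>R G (as @ y # x # bs) rs"
   "!!ys as bs. set ys <= S ==> set as <= S ==> set bs <= S ==> G ys (as @ x # y # bs) = c *\<^sub>R G ys (as @ y # x # bs)"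
 shows "shuf w G (pre @ x # y # post) = c *\<^sub>R shuf w G (pre @ y # x # post)" unfolding shuf_append[of w G pre] shuf_scaleR[symmetric]
proof (rule shuf_cong_set[OF _ S(1)])
 fix as cs assume s: "set as <= S" "set cs <= S"
 let ?p = "%bs. \<Prod>u\<leftarrow>cs. \<Prod>v\<leftarrow>bs. w u v"
 have p: "?p (y # x # bs) = ?p (x # y # bs)" for bs by (simp add: mult_ac)
 have "w x y *\<^sub>R r = c *\<^sub>R r" "c *\<^sub>R w y x *\<^sub>R r = r" for r :: 'b using c by simp_all
 then show "shuf w (%bs ds. ?p bs *\<^sub>R G (as @ bs) (cs @ ds)) (x # y # post) =
   shuf w (%bs ds. c *\<^sub>R ?p bs *\<^sub>R G (as @ bs) (cs @ ds)) (y # x # post)" unfolding shuf.simps shuf_add[symmetric] p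
  by (intro shuf_cong_set[OF _ S(2)]) (simp add: G s c mult_ac)
qed

lemma shuf_slot_add:
 assumes w: "!!u. w x u = w x' u" "!!u. w x u = w x'' u" "!!u. w u x = w u x'" "!!u. w u x = w u x''"
  and S: "set pre <= S" "set post <= S"
  and G: "!!as bs rs. set as <= S ==> set bs <= S ==> set rs <= S ==> G (as @ x # bs) rs = G (as @ x' # bs) rs + G (as @ x'' # bs) rs"
   "!!ys as bs. set ys <= S ==> set as <= S ==> set bs <= S ==> G ys (as @ x # bs) = G ys (as @ x' # bs) + G ys (as @ x'' # bs)"
 shows "shuf w G (pre @ x # post) = shuf w G (pre @ x' # post) + shuf w G (pre @ x'' # post)" unfolding shuf_append[of w G pre] shuf_add[symmetric]
proof (rule shuf_cong_set[OF _ S(1)])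
 fix as cs assume s: "set as <= S" "set cs <= S"
 have "w x' = w x" "w x'' = w x" using w by auto
 then show "shuf w (%bs ds. (\<Prod>u\<leftarrow>cs. \<Prod>v\<leftarrow>bs. w u v) *\<^sub>R G (as @ bs) (cs @ ds)) (x # post) =
   shuf w (%bs ds. (\<Prod>u\<leftarrow>cs. \<Prod>v\<leftarrow>bs. w u v) *\<^sub>R G (as @ bs) (cs @ ds)) (x' # post) +
   shuf w (%bs ds. (\<Prod>u\<leftarrow>cs. \<Prod>v\<leftarrow>bs. w u v) *\<^sub>R G (as @ bs) (cs @ ds)) (x'' # post)"
  unfolding shuf.simps shuf_add[symmetric] by (intro shuf_cong_set[OF _ S(2)]) (simp add: G s w(3,4)[symmetric] scaleR_add_right)
qed

lemma zero_perm_invariant: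
 fixes F :: "'b list => 'c::real_vector"
 assumes sw: "!!pre x y post. set (pre @ x # y # post) <= S ==> \<exists>c. F (pre @ x # y # post) = c *\<^sub>R F (pre @ y # x # post)"
 shows "mset xs = mset ys ==> set (pre @ xs) <= S ==> F (pre @ ys) = 0 ==> F (pre @ xs) = 0"
proof (induction ys arbitrary: xs pre)
 case (Cons y ys)
 then obtain as bs where xs: "xs = as @ y # bs" by (metis in_set_conv_decomp list.set_intros(1) set_mset_mset)
 have move: "set (pre @ as @ y # bs) <= S ==> F (pre @ y # as @ bs) = 0 ==> F (pre @ as @ y # bs) = 0" for pre
 proof (induction as arbitrary: pre)
  case (Cons a as)
  obtain c where "F (pre @ y # a # as @ bs) = c *\<^sub>R F (pre @ a # y # as @ bs)" using sw[of pre y a "as @ bs"] Cons.prems(1) by auto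
  obtain c where "F (pre @ a # y # as @ bs) = c *\<^sub>R F (pre @ y # a # as @ bs)" using sw[of pre a y "as @ bs"] Cons.prems(1) by auto
  then have "F ((pre @ [a]) @ y # as @ bs) = 0" using Cons.prems(2) by simp
  then show ?case using Cons.IH[of "pre @ [a]"] Cons.prems(1) by simp
 qed simp
 have "F ((pre @ [y]) @ as @ bs) = 0" by (rule Cons.IH) (use Cons.prems xs in auto)
 then show ?case using move[of pre] Cons.prems(2) xs by simp
qed simp

lemma dlist_mem_set:
 assumes "!!x. x \<in> S ==> i x \<in> S" "!!x. x \<in> S ==> t x \<in> S"
 shows "set xs <= S ==> ys \<in> set (dlist i t xs) ==> set ys <= S" using assms by (induction xs arbitrary: ys) (auto, blast+)

lemma scale_map:
 assumes t: "!!x. x \<in> S ==> t x \<in> S"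
  and G: "!!pre x post. set (pre @ x # post) <= S ==> G (pre @ t x # post) = s x *\<^sub>R (G (pre @ x # post) :: 'c::real_vector)"
 shows "set (pre @ ys) <= S ==> G (pre @ map t ys) = (\<Prod>y\<leftarrow>ys. s y) *\<^sub>R G (pre @ ys)"
proof (induction ys arbitrary: pre)
 case (Cons y ys)
 then have "set ((pre @ [t y]) @ ys) <= S" using t by auto
 from Cons.IH[OF this] show ?case using G[OF Cons.prems] by (simp add: mult.commute)
qed simp

context
 fixes S :: "'b set" and i t :: "'b => 'b" and w :: "'b => 'b => real" and s :: "'b => real"
 assumes i: "!!x. x \<in> S ==> i x \<in> S" and t: "!!x. x \<in> S ==> t x \<in> S"
  and wt: "!!x y. w (t x) y = w x y" "!!x y. w x (t y) = w x y"
  and wi: "!!x y. w x (i y) = w x y * s x" "!!x y. w (i x) y = w x y * s y"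
  and s: "!!x. s x * s x = 1"
begin

lemma prod_dlist: "ys \<in> set (dlist i t xs) ==> wprod w x ys = wprod w x xs * s x" by (induction xs arbitrary: ys) (auto simp: wt wi mult_ac)

text \<open>Changing an entry by i changes its exchange weight with every other entry by the sign of
  that entry. For a hit in the right block, the signs are supplied by t on the whole left block; for
  a hit in the left block, by t on the right entries that precede it.\<close>

lemma shuf_dsum:
 assumes xs: "set xs <= S"
 shows "(!!pre x post rs. set (pre @ x # post) <= S ==> set rs <= S ==> G (pre @ t x # post) rs = s x *\<^sub>R (G (pre @ x # post) rs :: 'c::real_vector)) ==>
  (!!ys pre x post. set ys <= S ==> set (pre @ x # post) <= S ==> G ys (pre @ t x # post) = s x *\<^sub>R G ys (pre @ x # post)) ==>
  shuf w (%ys rs. dsum i t (%ys. G ys rs) ys + dsum i t (%rs. G (map t ys) rs) rs) xs =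
  dsum i t (shuf w G) xs" using xs
proof (induction xs arbitrary: G)
 case (Cons x xs)
 let ?D = "dsum i t"
 have x: "x \<in> S" "t x \<in> S" "i x \<in> S" and xs: "set xs <= S" using Cons.prems i t by auto
 note G1 = Cons.prems(1) and G2 = Cons.prems(2)
 let ?H1 = "%ys rs. G (t x # ys) rs" and ?H2 = "%ys rs. wprod w (t x) ys *\<^sub>R G ys (t x # rs)"
 have IH1: "shuf w (%ys rs. ?D (%ys. ?H1 ys rs) ys + ?D (%rs. ?H1 (map t ys) rs) rs) xs = ?D (shuf w ?H1) xs"
 proof (rule Cons.IH[OF _ _ xs])
  fix pre z post rs assume "set (pre @ z # post) <= S" "set rs <= S"
  then show "G (t x # pre @ t z # post) rs = s z *\<^sub>R G (t x # pre @ z # post) rs" using G1[of "t x # pre" z post rs] x by simp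
 next
  fix ys pre z post assume "set ys <= S" "set (pre @ z # post) <= S"
  then show "G (t x # ys) (pre @ t z # post) = s z *\<^sub>R G (t x # ys) (pre @ z # post)" using G2[of "t x # ys" pre z post] x by simp
 qed
 have IH2: "shuf w (%ys rs. ?D (%ys. ?H2 ys rs) ys + ?D (%rs. ?H2 (map t ys) rs) rs) xs = ?D (shuf w ?H2) xs"
 proof (rule Cons.IH[OF _ _ xs])
  fix pre z post rs assume "set (pre @ z # post) <= S" "set rs <= S"
  then show "wprod w (t x) (pre @ t z # post) *\<^sub>R G (pre @ t z # post) (t x # rs) =
    s z *\<^sub>R wprod w (t x) (pre @ z # post) *\<^sub>R G (pre @ z # post) (t x # rs)"
   using G1[of pre z post "t x # rs"] x by (simp add: wt mult_ac)
 next
  fix ys pre z post assume "set ys <= S" "set (pre @ z # post) <= S"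
  then show "wprod w (t x) ys *\<^sub>R G ys (t x # pre @ t z # post) =
    s z *\<^sub>R wprod w (t x) ys *\<^sub>R G ys (t x # pre @ z # post)" using G2[of ys "t x # pre" z post] x by (simp add: mult_ac)
 qed
 have 2: "wprod w x ys *\<^sub>R (?D (%ys. G ys (x # rs)) ys + ?D (%rs. G (map t ys) rs) (x # rs)) =
   wprod w (i x) ys *\<^sub>R G ys (i x # rs) + (?D (%ys. ?H2 ys rs) ys + ?D (%rs. ?H2 (map t ys) rs) rs)"
  if ys: "set ys <= S" and rs: "set rs <= S" for ys rs
 proof -
  have "?D (%ys. ?H2 ys rs) ys = ?D (%ys'. wprod w x ys *\<^sub>R G ys' (x # rs)) ys"
  proof (rule dsum_cong)
   fix zs assume zs: "zs \<in> set (dlist i t ys)"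
   have "set zs <= S" using dlist_mem_set[OF i t ys zs] .
   then have "G zs (t x # rs) = s x *\<^sub>R G zs (x # rs)" using G2[of zs "[]" x rs] x rs by simp
   then show "?H2 zs rs = wprod w x ys *\<^sub>R G zs (x # rs)" using prod_dlist[OF zs, of x] s[of x] by (simp add: wt mult.assoc)
  qed
  then have a: "?D (%ys. ?H2 ys rs) ys = wprod w x ys *\<^sub>R ?D (%ys. G ys (x # rs)) ys" by (simp add: dsum_scaleR)
  have "G (map t ys) (i x # rs) = (\<Prod>y\<leftarrow>ys. s y) *\<^sub>R G ys (i x # rs)"
   using scale_map[of S t "%ys. G ys (i x # rs)" s "[]" ys] t G1 x rs ys by simp
  moreover have "wprod w (i x) ys = wprod w x ys * (\<Prod>u\<leftarrow>ys. s u)" by (induction ys) (simp_all add: wi mult_ac)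
  ultimately have b: "wprod w x ys *\<^sub>R G (map t ys) (i x # rs) = wprod w (i x) ys *\<^sub>R G ys (i x # rs)" by simp
  have "wprod w (t x) (map t ys) = wprod w x ys" by (simp add: wt comp_def)
  then have c: "?D (%rs. ?H2 (map t ys) rs) rs = wprod w x ys *\<^sub>R ?D (%rs. G (map t ys) (t x # rs)) rs" by (simp add: dsum_scaleR)
  show ?thesis unfolding a c dsum_simps b[symmetric] by (simp add: scaleR_add_right ac_simps)
 qed
 have "shuf w (%ys rs. ?D (%ys. G ys rs) ys + ?D (%rs. G (map t ys) rs) rs) (x # xs) =
   shuf w (%ys rs. G (i x # ys) rs + (?D (%ys. ?H1 ys rs) ys + ?D (%rs. ?H1 (map t ys) rs) rs)) xs +
   shuf w (%ys rs. wprod w x ys *\<^sub>R (?D (%ys. G ys (x # rs)) ys + ?D (%rs. G (map t ys) rs) (x # rs))) xs" by (simp add: add.assoc)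
 also have "shuf w (%ys rs. wprod w x ys *\<^sub>R (?D (%ys. G ys (x # rs)) ys + ?D (%rs. G (map t ys) rs) (x # rs))) xs =
   shuf w (%ys rs. wprod w (i x) ys *\<^sub>R G ys (i x # rs) + (?D (%ys. ?H2 ys rs) ys + ?D (%rs. ?H2 (map t ys) rs) rs)) xs"
  by (rule shuf_cong_set[OF 2 xs])
 finally show ?case unfolding shuf_add[of _ "%ys rs. G (i x # ys) rs"] shuf_add[of _ "%ys rs. wprod w (i x) ys *\<^sub>R G ys (i x # rs)"] IH1 IH2
  by (simp add: dsum_add ac_simps)
qed simp

end

subsection \<open>The Jacobiator\<close>

context smooth_mfd
begin

lemma subspace_FM_MV: "subspace (FM \<times> MV)" by (rule subspace_Times[OF subspace_FM subspace_MV])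

lemma Lspace_subset: "Lspace M d <= FM \<times> MV" using LspaceD(1) by blast

lemma subspace_Lspace: "subspace (Lspace M d)"
proof (rule subspaceI)
 show "0 \<in> Lspace M d" using FM_0 MV_0 by (simp add: Lspace_iff hdeg_zero mem_Times_iff)
 fix x y assume x: "x \<in> Lspace M d" and y: "y \<in> Lspace M d"
 show "x + y \<in> Lspace M d"
  using x y subspace_add[OF subspace_FM_MV, of x y] unfolding Lspace_iff by (simp add: hdeg_linear del: plus_fun_apply) simp
 fix c
 have "fst (c *\<^sub>R x) p [] = 0" for p using LspaceD(4)[OF x] by (simp add: scaleR_fun_def)
 then show "c *\<^sub>R x \<in> Lspace M d"
  using x subspace_scale[OF subspace_FM_MV, of x c] hdeg_linear(2)[of "d + 3" "fst x" c] hdeg_linear(2)[of "d + 2" "snd x" c]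
  unfolding Lspace_iff fst_scaleR snd_scaleR by metis
qed

text \<open>Entries carry their degree along: 0 lies in every degree, and an insertion must lower
  the recorded degree even when its result is 0.\<close>

abbreviation gelts :: "(int \<times> 'a form \<times> 'a mvf) set" where
 "gelts \<equiv> {(d, z). z \<in> Lspace M d}"

definition wt :: "int \<times> 'a form \<times> 'a mvf => int \<times> 'a form \<times> 'a mvf => real" where
 "wt x y = sg (fst x * fst y)"

text \<open>The value 0 for an empty inner block reflects that the Jacobi identity has no term with
  i = 0, while \<open>shuf\<close> runs over all splittings.\<close>

definition nested :: "(int \<times> 'a form \<times> 'a mvf) list => (int \<times> 'a form \<times> 'a mvf) list => 'a form \<times> 'a mvf" where
 "nested ys rs = (if ys = [] then 0 else mbr (mbr (map snd ys) # map snd rs))"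

definition Jac :: "(int \<times> 'a form \<times> 'a mvf) list => 'a form \<times> 'a mvf" where
 "Jac = shuf wt nested"

lemma graded_snd: "set xs <= gelts ==> set (map snd xs) <= FM \<times> MV" using Lspace_subset by fastforce

lemma mbr_graded: "set xs <= gelts ==> xs ~= [] ==> mbr (map snd xs) \<in> Lspace M (sum_list (map fst xs) + 1)"
 by (rule mbr_degree) (auto simp: list_all2_conv_all_nth dest!: nth_mem)

lemma nested_graded:
 assumes "set ys <= gelts" "set rs <= gelts"
 shows "nested ys rs \<in> Lspace M (sum_list (map fst ys) + sum_list (map fst rs) + 2)"
proof (cases "ys = []")
 case False
 have "mbr (map snd ((sum_list (map fst ys) + 1, mbr (map snd ys)) # rs)) \<in>
   Lspace M (sum_list (map fst ((sum_list (map fst ys) + 1, mbr (map snd ys)) # rs)) + 1)"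
  using mbr_graded[OF assms(1) False] assms(2) by (intro mbr_graded) auto
 then show ?thesis using False by (simp add: nested_def algebra_simps)
qed (simp add: nested_def subspace_0[OF subspace_Lspace])

lemma shuf_mem:
 assumes "subspace V" shows "(!!ys zs. mset ys + mset zs = mset xs ==> G ys zs \<in> V) ==> shuf w G xs \<in> V"
proof (induction xs arbitrary: G)
 case (Cons x xs)
 have "shuf w (%ys zs. G (x # ys) zs) xs \<in> V" by (rule Cons.IH) (simp add: Cons.prems)
 moreover have "shuf w (%ys zs. wprod w x ys *\<^sub>R G ys (x # zs)) xs \<in> V" by (rule Cons.IH) (simp add: Cons.prems subspace_scale[OF assms])
 ultimately show ?case using subspace_add[OF assms] by simp
qed simp

lemma Jac_graded: "set xs <= gelts ==> Jac xs \<in> Lspace M (sum_list (map fst xs) + 2)" unfolding Jac_def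
proof (rule shuf_mem[OF subspace_Lspace])
 fix ys zs assume xs: "set xs <= gelts" and m: "mset ys + mset zs = mset xs"
 have "set ys \<union> set zs = set xs" using m by (metis set_mset_mset set_mset_union)
 moreover have "sum_list (map fst ys) + sum_list (map fst zs) = sum_list (map fst xs)"
  using arg_cong[OF m, of "%m. sum_mset (image_mset fst m)"] by (simp flip: sum_mset_sum_list)
 ultimately show "nested ys zs \<in> Lspace M (sum_list (map fst xs) + 2)" using nested_graded[of ys zs] xs by auto
qed

lemma mbr_zero_mem: "set zs <= FM \<times> MV ==> 0 \<in> set zs ==> mbr zs = 0"
 using multilin_on_zero[OF multilin_on_mbr] subspace_0[OF subspace_FM_MV] by (auto simp: in_set_conv_decomp)

lemma mbr_Cons_mem: "set ys <= gelts ==> ys ~= [] ==> mbr (map snd ys) \<in> FM \<times> MV" by (rule mbr_mem[OF graded_snd])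

lemma Jac_zero_mem:
 assumes "set xs <= gelts" "(d, 0) \<in> set xs" shows "Jac xs = 0" unfolding Jac_def
proof (rule shuf_eq_zero)
 fix ys zs assume "mset ys + mset zs = mset xs"
 then have e: "set ys \<union> set zs = set xs" by (metis set_mset_mset set_mset_union)
 then have s: "set ys <= gelts" "set zs <= gelts" using assms by auto
 show "nested ys zs = 0"
 proof (cases "ys = []")
  case False
  have "0 \<in> set (map snd ys) \<or> 0 \<in> set (map snd zs)" using e assms(2) by force
  then have "mbr (map snd ys) = 0 \<or> 0 \<in> set (map snd zs)" using mbr_zero_mem[OF graded_snd[OF s(1)]] by blast
  then show ?thesis using mbr_zero_mem[of "mbr (map snd ys) # map snd zs"] mbr_Cons_mem[OF s(1) False] graded_snd[OF s(2)] False
   by (auto simp: nested_def)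
 qed (simp add: nested_def)
qed

lemma nested_swap:
 assumes x: "x \<in> gelts" and y: "y \<in> gelts"
  and s: "set as <= gelts" "set bs <= gelts" "set cs <= gelts"
 shows "nested (as @ x # y # bs) cs = wt x y *\<^sub>R nested (as @ y # x # bs) cs"
  and "nested cs (as @ x # y # bs) = wt x y *\<^sub>R nested cs (as @ y # x # bs)"
proof -
 note g = graded_snd[OF s(1)] graded_snd[OF s(2)] graded_snd[OF s(3)]
 have xy: "snd x \<in> Lspace M (fst x)" "snd y \<in> Lspace M (fst y)" using x y by auto
 have "mbr (map snd (as @ x # y # bs)) = wt x y *\<^sub>R mbr (map snd (as @ y # x # bs))" using mbr_swap[OF xy g(1,2)] by (simp add: wt_def)
 moreover have "mbr (map snd (as @ y # x # bs)) \<in> FM \<times> MV" using x y s by (intro mbr_Cons_mem) auto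
 ultimately show "nested (as @ x # y # bs) cs = wt x y *\<^sub>R nested (as @ y # x # bs) cs"
  using multilin_on_scaleR[OF multilin_on_mbr, of "[]" "map snd cs"] g(3) by (simp add: nested_def)
 show "nested cs (as @ x # y # bs) = wt x y *\<^sub>R nested cs (as @ y # x # bs)"
 proof (cases "cs = []")
  case False
  then show ?thesis using mbr_swap[OF xy, of "mbr (map snd cs) # map snd as" "map snd bs"] mbr_Cons_mem[OF s(3) False] g
   by (simp add: nested_def wt_def)
 qed (simp add: nested_def)
qed

lemma Jac_swap:
 assumes "set (pre @ x # y # post) <= gelts"
 shows "Jac (pre @ x # y # post) = wt x y *\<^sub>R Jac (pre @ y # x # post)" unfolding Jac_def
proof (rule shuf_swap[where S=gelts])
 have xy: "x \<in> gelts" "y \<in> gelts" using assms by auto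
 fix as bs cs :: "(int \<times> 'a form \<times> 'a mvf) list"
 assume s: "set as <= gelts" "set bs <= gelts" "set cs <= gelts"
 show "nested (as @ x # y # bs) cs = wt x y *\<^sub>R nested (as @ y # x # bs) cs" by (rule nested_swap(1)[OF xy s])
 show "nested as (bs @ x # y # cs) = wt x y *\<^sub>R nested as (bs @ y # x # cs)" by (rule nested_swap(2)[OF xy s(2,3,1)])
qed (use assms in \<open>auto simp: wt_def mult.commute[of "fst y"]\<close>)

lemma Jac_perm: "mset xs = mset ys ==> set xs <= gelts ==> Jac ys = 0 ==> Jac xs = 0"
proof (rule zero_perm_invariant[where pre="[]" and S=gelts and F=Jac, unfolded append_Nil])
 show "\<exists>c. Jac (pre @ x # y # post) = c *\<^sub>R Jac (pre @ y # x # post)"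
  if "set (pre @ x # y # post) <= gelts" for pre x y post using Jac_swap[OF that] by (rule exI)
qed

lemma nested_add:
 assumes x: "x \<in> Lspace M d" and y: "y \<in> Lspace M d"
  and s: "set as <= gelts" "set bs <= gelts" "set cs <= gelts"
 shows "nested (as @ (d, x + y) # bs) cs = nested (as @ (d, x) # bs) cs + nested (as @ (d, y) # bs) cs"
  and "nested cs (as @ (d, x + y) # bs) = nested cs (as @ (d, x) # bs) + nested cs (as @ (d, y) # bs)"
proof -
 note g = graded_snd[OF s(1)] graded_snd[OF s(2)] graded_snd[OF s(3)]
 have xy: "x \<in> FM \<times> MV" "y \<in> FM \<times> MV" using x y Lspace_subset by auto
 have "mbr (map snd (as @ (d, x) # bs)) \<in> FM \<times> MV" "mbr (map snd (as @ (d, y) # bs)) \<in> FM \<times> MV"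
  using x y s by (intro mbr_Cons_mem; auto)+
 from multilin_on_add[OF multilin_on_mbr, of "[]" "map snd cs", OF _ g(3) this]
 show "nested (as @ (d, x + y) # bs) cs = nested (as @ (d, x) # bs) cs + nested (as @ (d, y) # bs) cs"
  using multilin_on_add[OF multilin_on_mbr g(1,2) xy] by (simp add: nested_def)
 show "nested cs (as @ (d, x + y) # bs) = nested cs (as @ (d, x) # bs) + nested cs (as @ (d, y) # bs)"
 proof (cases "cs = []")
  case False
  then show ?thesis using multilin_on_add[OF multilin_on_mbr, of "mbr (map snd cs) # map snd as" "map snd bs"] mbr_Cons_mem[OF s(3) False] g xy
   by (simp add: nested_def)
 qed (simp add: nested_def)
qed

lemma Jac_add:
 assumes "x \<in> Lspace M d" "y \<in> Lspace M d" "set pre <= gelts" "set post <= gelts"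
 shows "Jac (pre @ (d, x + y) # post) = Jac (pre @ (d, x) # post) + Jac (pre @ (d, y) # post)" unfolding Jac_def
proof (rule shuf_slot_add[where S=gelts])
 fix as bs cs :: "(int \<times> 'a form \<times> 'a mvf) list"
 assume s: "set as <= gelts" "set bs <= gelts" "set cs <= gelts"
 show "nested (as @ (d, x + y) # bs) cs = nested (as @ (d, x) # bs) cs + nested (as @ (d, y) # bs) cs" by (rule nested_add(1)[OF assms(1,2) s])
 show "nested as (bs @ (d, x + y) # cs) = nested as (bs @ (d, x) # cs) + nested as (bs @ (d, y) # cs)" by (rule nested_add(2)[OF assms(1,2) s(2,3,1)])
qed (use assms in \<open>simp_all add: wt_def\<close>)

definition lower :: "('a => real) => int \<times> 'a form \<times> 'a mvf => int \<times> 'a form \<times> 'a mvf" where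
 "lower h x = (fst x - 1, (0, delta h (snd (snd x))))"

definition grade :: "int \<times> 'a form \<times> 'a mvf => int \<times> 'a form \<times> 'a mvf" where
 "grade x = (fst x, sg (fst x) *\<^sub>R snd x)"

lemma lower_graded: "h \<in> A ==> x \<in> gelts ==> lower h x \<in> gelts"
 using hdeg_delta[of "fst x + 2" "snd (snd x)" h] FM_0 delta_MV[of h "snd (snd x)"]
 by (auto simp: lower_def Lspace_iff hdeg_zero mem_Times_iff algebra_simps)

lemma grade_graded: "x \<in> gelts ==> grade x \<in> gelts" using subspace_scale[OF subspace_Lspace] by (auto simp: grade_def)

lemma grade_par: "z \<in> Lspace M d ==> (- par (fst z), par (snd z)) = sg d *\<^sub>R z"
 using LspaceD(2,3)[of z d] hdeg_par[of "d + 3" "fst z"] hdeg_par[of "d + 2" "snd z"] by (cases z) (simp add: sg_def)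

definition mdelta :: "('a => real) => 'a form \<times> 'a mvf => 'a form \<times> 'a mvf" where
 "mdelta h z = (0, delta h (snd z))"

lemma mdelta_linear: "mdelta h (x + y) = mdelta h x + mdelta h y" "mdelta h (c *\<^sub>R x) = c *\<^sub>R mdelta h x" "mdelta h 0 = 0"
 by (simp_all add: mdelta_def delta_linear zero_prod_def del: plus_fun_apply)

lemma mdelta_mbr:
 assumes h: "h \<in> A" and xs: "set xs <= gelts" "xs ~= []"
 shows "mdelta h (mbr (map snd xs)) = - dsum (lower h) grade (%xs. mbr (map snd xs)) xs"
proof -
 have "dsum (%z. (0, delta h (snd z))) (%z. (- par (fst z), par (snd z))) G (map snd xs) =
   dsum (lower h) grade (%xs. G (map snd xs)) xs" for G :: "_ => 'a form \<times> 'a mvf" using xs(1)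
 proof (induction xs arbitrary: G)
  case (Cons x xs)
  have "snd x \<in> Lspace M (fst x)" "set xs <= gelts" using Cons.prems by auto
  note grade_par[OF this(1)] Cons.IH[OF this(2)]
  then show ?case by (simp only: dsum_simps list.map lower_def grade_def snd_conv)
 qed simp
 then show ?thesis using mbr_derive[OF h graded_snd[OF xs(1)]] xs(2) by (simp add: mdelta_def)
qed

lemma mbr_grade:
 assumes "set (pre @ x # post) <= gelts"
 shows "mbr (map snd (pre @ grade x # post)) = sg (fst x) *\<^sub>R mbr (map snd (pre @ x # post))"
 using multilin_on_scaleR[OF multilin_on_mbr, of "map snd pre" "map snd post" "snd x" "sg (fst x)"]
  graded_snd[of pre] graded_snd[of post] graded_snd[of "[x]"] assms by (simp add: grade_def)

lemma nested_grade:
 assumes "set (pre @ x # post) <= gelts" "set cs <= gelts"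
 shows "nested (pre @ grade x # post) cs = sg (fst x) *\<^sub>R nested (pre @ x # post) cs"
  and "nested cs (pre @ grade x # post) = sg (fst x) *\<^sub>R nested cs (pre @ x # post)"
proof -
 note g = graded_snd[OF assms(2)]
 have "mbr (map snd (pre @ x # post)) \<in> FM \<times> MV" using assms by (intro mbr_Cons_mem) auto
 then show "nested (pre @ grade x # post) cs = sg (fst x) *\<^sub>R nested (pre @ x # post) cs"
  using multilin_on_scaleR[OF multilin_on_mbr, of "[]" "map snd cs"] g mbr_grade[OF assms(1)] by (simp add: nested_def)
 show "nested cs (pre @ grade x # post) = sg (fst x) *\<^sub>R nested cs (pre @ x # post)"
 proof (cases "cs = []")
  case False
  then show ?thesis using mbr_grade[of "(sum_list (map fst cs) + 1, mbr (map snd cs)) # pre" x post] mbr_graded[OF assms(2) False] assms(1)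
   by (simp add: nested_def)
 qed (simp add: nested_def)
qed

text \<open>The derivation rule is used for the outer and then for the inner bracket. The minus
  signs cancel when the inner entries are hit, and the odd degree of the bracket map does the same
  for the outer ones.\<close>

lemma mdelta_nested:
 assumes h: "h \<in> A" and s: "set ys <= gelts" "set rs <= gelts"
 shows "mdelta h (nested ys rs) =
  dsum (lower h) grade (%ys. nested ys rs) ys + dsum (lower h) grade (%rs. nested (map grade ys) rs) rs"
proof (cases "ys = []")
 case True
 then show ?thesis by (simp add: nested_def mdelta_linear)
next
 case False
 let ?d = "sum_list (map fst ys) + 1"
 let ?x = "(?d, mbr (map snd ys))"
 let ?D = "dsum (lower h) grade"
 note L = mbr_graded[OF s(1) False]
 note g = graded_snd[OF s(1)] graded_snd[OF s(2)]
 have "mdelta h (nested ys rs) = - ?D (%xs. mbr (map snd xs)) (?x # rs)" using mdelta_mbr[OF h, of "?x # rs"] L s(2) False by (simp add: nested_def)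
 also have "\<dots> = - mbr (mdelta h (mbr (map snd ys)) # map snd rs) - ?D (%zs. mbr (sg ?d *\<^sub>R mbr (map snd ys) # map snd zs)) rs"
  by (simp add: lower_def grade_def mdelta_def)
 also have "- mbr (mdelta h (mbr (map snd ys)) # map snd rs) = ?D (%ys. nested ys rs) ys"
 proof -
  have sum: "mbr ((\<Sum>ys\<leftarrow>Ls. G ys) # map snd rs) = (\<Sum>ys\<leftarrow>Ls. mbr (G ys # map snd rs))"
   if "\<forall>ys\<in>set Ls. G ys \<in> FM \<times> MV" for G :: "(int \<times> 'a form \<times> 'a mvf) list => 'a form \<times> 'a mvf" and Ls
   using that
  proof (induction Ls)
   case Nil
   then show ?case using multilin_on_zero[OF multilin_on_mbr, of "[]"] g(2) subspace_0[OF subspace_FM_MV] by simp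
  next
   case (Cons L Ls)
   have "(\<Sum>ys\<leftarrow>Ls. G ys) \<in> FM \<times> MV"
    using Cons.prems by (induction Ls) (auto intro!: subspace_add[OF subspace_FM_MV] subspace_0[OF subspace_FM_MV] simp del: mem_Sigma_iff)
   then show ?case using Cons multilin_on_add[OF multilin_on_mbr, of "[]" "map snd rs"] g(2) by simp
  qed
  have m: "mbr (map snd zs) \<in> FM \<times> MV" "zs ~= []" if "zs \<in> set (dlist (lower h) grade ys)" for zs
  proof -
   show "zs ~= []" using length_dlist[OF that] False by auto
   have "set zs <= gelts" by (rule dlist_mem_set[OF lower_graded[OF h] grade_graded s(1) that])
   then show "mbr (map snd zs) \<in> FM \<times> MV" using \<open>zs ~= []\<close> by (rule mbr_Cons_mem)
  qed
  have "mbr (?D (%ys. mbr (map snd ys)) ys # map snd rs) = ?D (%ys. mbr (mbr (map snd ys) # map snd rs)) ys"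
   unfolding dsum_def by (rule sum) (use m in blast)
  also have "\<dots> = ?D (%ys. nested ys rs) ys" by (rule dsum_cong) (use m(2) in \<open>auto simp: nested_def\<close>)
  finally have e: "mbr (?D (%ys. mbr (map snd ys)) ys # map snd rs) = ?D (%ys. nested ys rs) ys" .
  have "mdelta h (mbr (map snd ys)) = (-1) *\<^sub>R ?D (%ys. mbr (map snd ys)) ys" using mdelta_mbr[OF h s(1) False] by simp
  moreover have "?D (%ys. mbr (map snd ys)) ys \<in> FM \<times> MV"
  proof -
   have "- mdelta h (mbr (map snd ys)) \<in> FM \<times> MV" using mbr_Cons_mem[OF s(1) False] delta_MV[OF h] FM_0
    by (intro subspace_neg[OF subspace_FM_MV]) (auto simp: mdelta_def)
   then show ?thesis using mdelta_mbr[OF h s(1) False] by simp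
  qed
  ultimately show ?thesis using multilin_on_scaleR[OF multilin_on_mbr, of "[]" "map snd rs" "?D (%ys. mbr (map snd ys)) ys" "-1"] g(2) e by simp
 qed
 finally have m: "mdelta h (nested ys rs) = ?D (%ys. nested ys rs) ys -
   ?D (%zs. mbr (sg ?d *\<^sub>R mbr (map snd ys) # map snd zs)) rs" .
 have "- ?D (%zs. mbr (sg ?d *\<^sub>R mbr (map snd ys) # map snd zs)) rs = ?D (%rs. nested (map grade ys) rs) rs"
 proof -
  have "?D (%zs. mbr (sg ?d *\<^sub>R mbr (map snd ys) # map snd zs)) rs = ?D (%zs. (-1) *\<^sub>R nested (map grade ys) zs) rs"
  proof (rule dsum_cong)
   fix zs assume zs: "zs \<in> set (dlist (lower h) grade rs)"
   have z: "set zs <= gelts" by (rule dlist_mem_set[OF lower_graded[OF h] grade_graded s(2) zs])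
   have "nested (map grade ys) zs = (\<Prod>y\<leftarrow>ys. sg (fst y)) *\<^sub>R nested ys zs"
    using scale_map[of gelts grade "%ys. nested ys zs" "%x. sg (fst x)" "[]" ys, OF grade_graded nested_grade(1)[OF _ z]]
     s(1) by simp
   \<comment> \<open>The inner bracket has degree one more than its entries together, so its own
     sign is minus the product of theirs.\<close>
   moreover have "(\<Prod>y\<leftarrow>ys. sg (fst y)) = - sg ?d" by (induction ys) (simp_all add: sg_def)
   moreover have "mbr (sg ?d *\<^sub>R mbr (map snd ys) # map snd zs) = sg ?d *\<^sub>R nested ys zs"
    using multilin_on_scaleR[OF multilin_on_mbr, of "[]" "map snd zs" "mbr (map snd ys)"] graded_snd[OF z]
     mbr_Cons_mem[OF s(1) False] False by (simp add: nested_def)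
   ultimately show "mbr (sg ?d *\<^sub>R mbr (map snd ys) # map snd zs) = (-1) *\<^sub>R nested (map grade ys) zs" by simp
  qed
  then show ?thesis unfolding dsum_scaleR by simp
 qed
 then show ?thesis unfolding m by (simp only: diff_conv_add_uminus)
qed

lemma mdelta_shuf: "mdelta h (shuf w G xs) = shuf w (%ys zs. mdelta h (G ys zs)) xs" by (induction xs arbitrary: G) (simp_all add: mdelta_linear)

lemma mdelta_Jac:
 assumes h: "h \<in> A" and xs: "set xs <= gelts"
 shows "mdelta h (Jac xs) = dsum (lower h) grade Jac xs"
proof -
 have "mdelta h (Jac xs) = shuf wt (%ys rs. dsum (lower h) grade (%ys. nested ys rs) ys +
   dsum (lower h) grade (%rs. nested (map grade ys) rs) rs) xs" unfolding Jac_def mdelta_shuf by (rule shuf_cong_set[OF mdelta_nested[OF h] xs])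
 also have "\<dots> = dsum (lower h) grade Jac xs" unfolding Jac_def
  by (rule shuf_dsum[where S=gelts and s="%x. sg (fst x)", OF lower_graded[OF h] grade_graded _ _ _ _ _ xs])
   (simp_all add: nested_grade, simp_all add: wt_def grade_def lower_def sg_def)
 finally show ?thesis .
qed

lemma Jac_single:
 assumes "x \<in> gelts" shows "Jac [x] = 0"
proof -
 have w: "fst (snd x) \<in> FM" using assms LspaceD(1) by auto
 have "d_form (- d_form (fst (snd x))) = - d_form (d_form (fst (snd x)))" using d_form_linear(2)[OF d_form_FM[OF w] d_form_FM[OF w], of "-1"] by simp
 then show ?thesis using d_form_d_form[OF w] by (simp add: Jac_def nested_def mbr_single zero_prod_def)
qed

text \<open>Brackets with several entries have no form part. A unary outer bracket is then applied
  to an inner bracket with several entries, whose form part is already 0.\<close>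

lemma fst_Jac:
 assumes xs: "set xs <= gelts" shows "fst (Jac xs) = 0"
proof (cases "length xs = 1")
 case True
 then show ?thesis using Jac_single xs by (auto simp: length_Suc_conv)
next
 case False
 have d0: "d_form 0 = 0" using d_form_linear(2)[OF FM_0 FM_0, of 0] by simp
 have "subspace {z :: 'a form \<times> 'a mvf. fst z = 0}" by (simp add: subspace_def)
 moreover have "nested ys zs \<in> {z. fst z = 0}" if "mset ys + mset zs = mset xs" for ys zs
 proof -
  have "length ys + length zs ~= 1" using that False by (metis size_mset size_union)
  then show ?thesis using d0 by (cases zs; cases "length ys = 1") (auto simp: nested_def mbr_single mbr_many)
 qed
 ultimately have "Jac xs \<in> {z. fst z = 0}" unfolding Jac_def by (rule shuf_mem)
 then show ?thesis by simp
qed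

end

subsection \<open>The Jacobi identity in output degree zero\<close>

lemma shuf_right_Nil: "shuf w (%ys zs. if zs = [] then F ys else 0) xs = F xs" by (induction xs arbitrary: F) (simp_all add: shuf_zero)

lemma shuf_left_Nil: "shuf w (%ys zs. if ys = [] then F zs else 0) xs = F xs"
proof (induction xs arbitrary: F)
 case (Cons x xs)
 have "shuf w (%ys zs. wprod w x ys *\<^sub>R (if ys = [] then F (x # zs) else 0)) xs =
   shuf w (%ys zs. if ys = [] then F (x # zs) else 0) xs" by (rule shuf_cong) simp
 then show ?case using Cons by (simp add: shuf_zero)
qed simp

text \<open>Splittings that single out one entry form a Leibniz sum: bringing the changed entry back
  from the front to its place turns the exchange weights into the sign operator t.\<close>

lemma shuf_single_dsum:
 assumes sw: "!!pre x y post. set (pre @ x # y # post) <= S ==> K (pre @ t x # i y # post) = w x y *\<^sub>R K (pre @ i y # x # post)"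
  and t: "!!x. x \<in> S ==> t x \<in> S"
 shows "set (pre @ xs) <= S ==>
  shuf w (%ys rs. if length ys = 1 then K (pre @ i (hd ys) # rs) else 0) xs = dsum i t (%ys. K (pre @ ys)) xs"
proof (induction xs arbitrary: pre)
 case (Cons x xs)
 have 1: "shuf w (%ys rs. if length (x # ys) = 1 then K (pre @ i (hd (x # ys)) # rs) else 0) xs = K (pre @ i x # xs)"
  using shuf_left_Nil[of w "%rs. K (pre @ i x # rs)" xs] by (simp cong: if_cong)
 have xs: "set xs <= S" and pre: "set ((pre @ [t x]) @ xs) <= S" using Cons.prems t by auto
 have "shuf w (%ys rs. wprod w x ys *\<^sub>R (if length ys = 1 then K (pre @ i (hd ys) # x # rs) else 0)) xs =
   shuf w (%ys rs. if length ys = 1 then K ((pre @ [t x]) @ i (hd ys) # rs) else 0) xs"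
 proof (rule shuf_cong_set[OF _ xs])
  fix ys rs assume "set ys <= S" "set rs <= S"
  then show "wprod w x ys *\<^sub>R (if length ys = 1 then K (pre @ i (hd ys) # x # rs) else 0) =
    (if length ys = 1 then K ((pre @ [t x]) @ i (hd ys) # rs) else 0)" using sw[of pre x "hd ys" rs] Cons.prems by (auto simp: length_Suc_conv)
 qed
 also have "\<dots> = dsum i t (%ys. K ((pre @ [t x]) @ ys)) xs" by (rule Cons.IH[OF pre])
 finally show ?case using 1 by simp
qed simp

lemma shuf_linear:
 assumes "!!x y. f (x + y) = f x + f y" "!!c x. f (c *\<^sub>R x) = c *\<^sub>R f x"
 shows "f (shuf w G xs) = shuf w (%ys zs. f (G ys zs)) xs" by (induction xs arbitrary: G) (simp_all add: assms)

lemma shuf_commute: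
 fixes G :: "'b list => 'b list => real"
 shows "shuf (%_ _. -1) G xs = shuf (%_ _. -1) (%ys zs. (-1) ^ (length ys * length zs) * G zs ys) xs"
proof (induction xs arbitrary: G)
 case (Cons x xs)
 have "shuf (%_ _. -1) G (x # xs) = shuf (%_ _. -1) (%ys zs. G (x # ys) zs) xs
   + shuf (%_ _. -1) (%ys zs. (-1) ^ length ys * G ys (x # zs)) xs" by (simp add: prod_list_minus_one)
 also have "shuf (%_ _. -1) (%ys zs. G (x # ys) zs) xs =
   shuf (%_ _. -1) (%ys zs. (-1) ^ (length ys * length zs) * G (x # zs) ys) xs" by (rule Cons)
 also have "shuf (%_ _. -1) (%ys zs. (-1) ^ length ys * G ys (x # zs)) xs =
   shuf (%_ _. -1) (%ys zs. (-1) ^ (length ys * length zs) * ((-1) ^ length zs * G zs (x # ys))) xs" by (rule Cons)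
 finally show ?case by (simp add: prod_list_minus_one power_add mult_ac)
qed simp

lemma pick1_map: "pick1 F (map h xs) = pick1 (%x ys. F (h x) (map h ys)) xs" by (induction xs arbitrary: F) simp_all

lemma pick2_map: "pick2 F (map h xs) = pick2 (%x y zs. F (h x) (h y) (map h zs)) xs" by (induction xs arbitrary: F) (simp_all add: pick1_map)

lemma shuf_pick1_left:
 "shuf (%_ _. -1) (%ys zs. if length ys = 1 then F (hd ys) zs else 0) xs = pick1 F xs"
proof (induction xs arbitrary: F)
 case (Cons x xs)
 have "shuf (%_ _. -1) (%ys zs. (\<Prod>u\<leftarrow>ys. -1) *\<^sub>R (if length ys = 1 then F (hd ys) (x # zs) else 0)) xs =
   shuf (%_ _. -1) (%ys zs. if length ys = 1 then - F (hd ys) (x # zs) else 0) xs" by (rule shuf_cong) (simp add: prod_list_minus_one)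
 moreover have "shuf (%_ _. -1) (%ys zs. if length ys = 1 then - F (hd ys) (x # zs) else 0) xs =
   pick1 (%y zs. - F y (x # zs)) xs" by (rule Cons)
 ultimately show ?case using shuf_left_Nil[of "%_ _. -1" "F x" xs] by (simp add: pick1_linear cong: if_cong)
qed simp

lemma shuf_pick1_right:
 "shuf (%_ _. -1) (%ys zs. if length zs = 1 then F (hd zs) ys else 0) xs = (-1) ^ (length xs - 1) * pick1 F xs"
proof -
 have "shuf (%_ _. -1) (%ys zs. if length zs = 1 then F (hd zs) ys else 0) xs =
   shuf (%_ _. -1) (%ys zs. (-1) ^ (length ys * length zs) * (if length ys = 1 then F (hd ys) zs else 0)) xs" by (rule shuf_commute)
 also have "\<dots> = shuf (%_ _. -1) (%ys zs. (-1) ^ (length xs - 1) *\<^sub>R (if length ys = 1 then F (hd ys) zs else 0)) xs"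
 proof (rule shuf_cong)
  fix ys zs assume "mset ys + mset zs = mset xs"
  then have "length xs = length ys + length zs" by (metis size_mset size_union)
  then show "(-1) ^ (length ys * length zs) * (if length ys = 1 then F (hd ys) zs else 0) =
   (-1) ^ (length xs - 1) *\<^sub>R (if length ys = 1 then F (hd ys) zs else 0)" by simp
 qed
 finally show ?thesis unfolding shuf_scaleR shuf_pick1_left by simp
qed

lemma shuf_pick2:
 "shuf (%_ _. -1) (%ys zs. if length ys = 2 then F (hd ys) (hd (tl ys)) zs else 0) xs = - pick2 F xs"
proof (induction xs arbitrary: F)
 case (Cons x xs)
 have "shuf (%_ _. -1) (%ys zs. (\<Prod>u\<leftarrow>ys. -1) *\<^sub>R (if length ys = 2 then F (hd ys) (hd (tl ys)) (x # zs) else 0)) xs =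
   shuf (%_ _. -1) (%ys zs. if length ys = 2 then F (hd ys) (hd (tl ys)) (x # zs) else 0) xs" by (rule shuf_cong) (simp add: prod_list_minus_one)
 moreover have "shuf (%_ _. -1) (%ys zs. if length (x # ys) = 2 then F (hd (x # ys)) (hd (tl (x # ys))) zs else 0) xs =
   pick1 (F x) xs" using shuf_pick1_left[of "F x" xs] by (simp cong: if_cong)
 ultimately show ?case using Cons[of "%y z zs. F y z (x # zs)"] by simp
qed simp

context smooth_mfd
begin

section \<open>An entry that is a function\<close>

lemma bracket_function:
 assumes g: "g \<in> MV" "hdeg 0 g" and P: "P \<in> MV"
 shows "bracket g P = delta (ev g []) P"
proof (rule MV_eqI[OF bracket_MV[OF g(1) P]])
 have gA: "ev g [] \<in> A" using ev_smooth[OF g(1), of "[]"] by simp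
 show "delta (ev g []) P \<in> MV" by (rule delta_MV[OF gA P])
 have z: "delta f g = 0" for f using hdeg_delta[OF g(2)] hdeg_neg by force
 have pg: "par g = g" using hdeg_par[OF g(2)] by simp
 show "ev (bracket g P) fs = ev (delta (ev g []) P) fs" if "set fs <= A" for fs using that P
 proof (induction fs arbitrary: P)
  case Nil
  then show ?case using ev_bracket[OF g(1) Nil(2), of "[]"] ev_hom[OF g(2)] by (simp add: ev_delta)
 next
  case (Cons f fs)
  then have f: "f \<in> A" and fs: "set fs <= A" by auto
  have "bracket 0 P = 0" using bracket_linear(3)[OF Cons.prems(2,2,2), of 0] by simp
  then have "delta f (bracket g P) = - bracket g (delta f P)" unfolding delta_bracket[OF g(1) Cons.prems(2) f] z pg by simp
  then have "ev (bracket g P) (f # fs) = (%p. - ev (bracket g (delta f P)) fs p)" unfolding ev_delta[symmetric] by (simp only: ev_linear)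
  also have "\<dots> = (%p. - ev (delta (ev g []) (delta f P)) fs p)" using Cons.IH[OF fs delta_MV[OF f Cons.prems(2)]] by simp
  also have "\<dots> = ev (delta f (delta (ev g []) P)) fs" unfolding delta_swap[OF Cons.prems(2), of f "ev g []"] by (simp only: ev_linear)
  finally show ?case by (simp only: ev_delta)
 qed
qed

lemma twist_zero_form: "twist 0 Ps = 0" using twist_form_linear(2)[of 0 0 Ps] by simp

lemma d_form_zero: "d_form 0 = 0" using d_form_linear(2)[OF FM_0 FM_0, of 0] by simp

lemma mbr_function:
 assumes g: "g \<in> MV" "hdeg 0 g" and zs: "set zs <= FM \<times> MV"
 shows "mbr ((0, g) # zs) = (if length zs = 1 then mdelta (ev g []) (hd zs) else 0)"
proof (cases "zs = []")
 case True
 then show ?thesis by (simp add: mbr_single d_form_zero zero_prod_def)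
next
 case False
 let ?t = "par ^^ Suc (length zs)"
 have tg: "?t g = g" using par_funpow_hom[OF g(2), of "Suc (length zs)"] by (simp del: funpow.simps)
 have "fsum ?t (%om Ps. twist om (?t g # Ps)) zs = fsum ?t (%om Ps. 0) zs" unfolding tg by (rule fsum_cong[OF par_funpow_MV _ zs], assumption)
   (rule twist_hom_zero[OF _ _ _ g(2)], use g(1) in simp_all)
 then have "fsum ?t twist ((0, g) # zs) = 0" by (simp add: twist_zero_form)
 moreover have "br ((0, g) # zs) = (if length zs = 1 then delta (ev g []) (snd (hd zs)) else 0)"
  using False zs bracket_function[OF g] by (cases zs) (auto simp: br_def)
 ultimately show ?thesis using False by (simp add: mbr_many mdelta_def zero_prod_def del: funpow.simps)
qed

text \<open>A bracket containing a function g is nonzero only with one further entry, where it is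
  the insertion of dg. With g in the inner bracket one obtains a Leibniz sum over the other entries,
  which is minus dg inserted into their bracket; with g in the outer bracket one obtains dg inserted
  into that same bracket.\<close>

lemma Jac_function:
 assumes g: "g \<in> MV" "hdeg 0 g" and xs: "set xs <= gelts"
 shows "Jac ((-2, (0, g)) # xs) = 0"
proof (cases "xs = []")
 case True
 then show ?thesis using Jac_single[of "(-2, (0, g))"] g FM_0 by (simp add: Lspace_iff hdeg_zero)
next
 case False
 let ?g = "ev g []" and ?x = "(-2 :: int, (0 :: 'a form, g))"
 have gA: "?g \<in> A" using ev_smooth[OF g(1), of "[]"] by simp
 have x: "?x \<in> gelts" using g FM_0 by (simp add: Lspace_iff hdeg_zero)
 have "shuf wt (%ys rs. nested (?x # ys) rs) xs =
   shuf wt (%ys rs. if length ys = 1 then mbr (map snd ([] @ lower ?g (hd ys) # rs)) else 0) xs"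
 proof (rule shuf_cong_set[OF _ xs])
  fix ys rs assume s: "set ys <= gelts" "set rs <= gelts"
  show "nested (?x # ys) rs = (if length ys = 1 then mbr (map snd ([] @ lower ?g (hd ys) # rs)) else 0)"
   using mbr_function[OF g graded_snd[OF s(1)]] mbr_zero_mem[of "0 # map snd rs"] graded_snd[OF s(2)] subspace_0[OF subspace_FM_MV]
   by (auto simp: nested_def mdelta_def lower_def length_Suc_conv)
 qed
 also have "\<dots> = dsum (lower ?g) grade (%ys. mbr (map snd ([] @ ys))) xs"
 proof (rule shuf_single_dsum[where S=gelts and K="%xs. mbr (map snd xs)", OF _ grade_graded])
  show "set ([] @ xs) <= gelts" using xs by simp
  fix pre x y post assume s: "set (pre @ x # y # post) <= gelts"
  have y: "lower ?g y \<in> gelts" using s lower_graded[OF gA] by auto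
  have "mbr (map snd (pre @ grade x # lower ?g y # post)) = sg (fst x) *\<^sub>R mbr (map snd (pre @ x # lower ?g y # post))"
   using mbr_grade[of pre x "lower ?g y # post"] s y by simp
  also have "mbr (map snd (pre @ x # lower ?g y # post)) = sg (fst x * (fst y - 1)) *\<^sub>R mbr (map snd (pre @ lower ?g y # x # post))"
   using mbr_swap[of "snd x" "fst x" "snd (lower ?g y)" "fst y - 1" "map snd pre" "map snd post"] s y graded_snd[of pre] graded_snd[of post]
   by (auto simp: lower_def)
  finally show "mbr (map snd (pre @ grade x # lower ?g y # post)) = wt x y *\<^sub>R mbr (map snd (pre @ lower ?g y # x # post))"
   by (simp add: wt_def sg_def)
 qed
 also have "\<dots> = - mdelta ?g (mbr (map snd xs))" using mdelta_mbr[OF gA xs False] by simp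
 finally have 1: "shuf wt (%ys rs. nested (?x # ys) rs) xs = - mdelta ?g (mbr (map snd xs))" .
 have "shuf wt (%ys rs. wprod wt ?x ys *\<^sub>R nested ys (?x # rs)) xs =
   shuf wt (%ys rs. if rs = [] then (if ys = [] then 0 else mdelta ?g (mbr (map snd ys))) else 0) xs"
 proof (rule shuf_cong_set[OF _ xs])
  fix ys rs assume s: "set ys <= gelts" "set rs <= gelts"
  have w: "wprod wt ?x ys = 1" by (induction ys) (simp_all add: wt_def sg_def)
  show "wprod wt ?x ys *\<^sub>R nested ys (?x # rs) = (if rs = [] then (if ys = [] then 0 else mdelta ?g (mbr (map snd ys))) else 0)"
  proof (cases "ys = []")
   case False
   have "mbr (mbr (map snd ys) # (0, g) # map snd rs) = mbr ((0, g) # mbr (map snd ys) # map snd rs)"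
    using mbr_swap[OF mbr_graded[OF s(1) False], of "(0, g)" "-2" "[]" "map snd rs"] x graded_snd[OF s(2)] by (simp add: sg_def)
   also have "\<dots> = (if rs = [] then mdelta ?g (mbr (map snd ys)) else 0)"
    using mbr_function[OF g, of "mbr (map snd ys) # map snd rs"] mbr_Cons_mem[OF s(1) False] graded_snd[OF s(2)] by simp
   finally show ?thesis unfolding w using False by (simp add: nested_def)
  qed (simp add: nested_def)
 qed
 also have "\<dots> = mdelta ?g (mbr (map snd xs))" unfolding shuf_right_Nil using False by simp
 finally show ?thesis unfolding Jac_def shuf.simps 1 by simp
qed

section \<open>Brackets with a given number of forms\<close>

lemma fsum_two_forms:
 assumes "!!om Ps. 0 \<in> set Ps ==> G om Ps = 0" and t: "t 0 = 0" and "length (filter (%z. snd z = 0) zs) \<ge> 2"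
 shows "fsum t (G :: 'f => 'v::real_vector list => 'c::real_vector) zs = 0" using assms(1,3)
proof (induction zs arbitrary: G)
 case (Cons z zs)
 have "0 \<in> set (map snd zs)"
 proof -
  have "filter (%z. snd z = 0) zs ~= []" using Cons.prems(2) by (auto split: if_splits)
  then obtain y where "y \<in> set zs" "snd y = 0" by (auto simp: filter_empty_conv)
  then show ?thesis by force
 qed
 then have 1: "G (fst z) (map snd zs) = 0" by (rule Cons.prems)
 have "fsum t (%om Ps. G om (t (snd z) # Ps)) zs = 0"
 proof (cases "snd z = 0")
  case True
  then have "(%om Ps. G om (t (snd z) # Ps)) = (%om Ps. 0)" using Cons.prems(1) t by (intro ext) simp
  then show ?thesis by simp
 next
  case False
  show ?thesis by (rule Cons.IH) (use Cons.prems False in auto)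
 qed
 then show ?case using 1 by simp
qed simp

lemma fsum_no_forms:
 fixes G :: "'f::zero => 'v list => 'c::comm_monoid_add"
 assumes "!!Ps. G 0 Ps = 0" "!!z. z \<in> set zs ==> fst z = 0"
 shows "fsum t G zs = 0" using assms by (induction zs arbitrary: G) auto

lemma fsum_one_form:
 fixes G :: "'f::zero => 'v list => 'c::comm_monoid_add"
 shows "(!!Ps. G 0 Ps = 0) ==> (!!z. z \<in> set (pre @ post) ==> fst z = 0) ==>
  fsum t G (pre @ (om, q) # post) = G om (map t (map snd pre) @ map snd post)"
proof (induction pre arbitrary: G)
 case Nil
 then show ?case using fsum_no_forms[of "%om Ps. G om (t q # Ps)" post t] by simp
next
 case (Cons z pre)
 have "fst z = 0" using Cons.prems(2) by simp
 moreover have "fsum t (%om Ps. G om (t (snd z) # Ps)) (pre @ (om, q) # post) = G om (t (snd z) # map t (map snd pre) @ map snd post)"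
  by (rule Cons.IH) (use Cons.prems in auto)
 ultimately show ?case using Cons.prems(1) by simp
qed

lemma par_funpow_zero [simp]: "(par ^^ k) 0 = 0" using par_funpow_linear(2)[of k 0 0] by simp

lemma bracket_zero: "P \<in> MV ==> bracket 0 P = 0" "P \<in> MV ==> bracket P 0 = 0"
 using bracket_linear(3)[of P P P 0] bracket_linear(4)[of P P P 0] by auto

text \<open>At most one entry can supply the form; another one whose multivector part is 0 then
  stands among the multivectors.\<close>

lemma mbr_two_forms:
 assumes zs: "set zs <= FM \<times> MV" and f: "length (filter (%z. snd z = 0) zs) \<ge> 2"
 shows "mbr zs = 0"
proof -
 have l: "length zs \<ge> 2" using f length_filter_le[of "%z. snd z = 0" zs] by linarith
 have "br zs = 0"
 proof (cases "length zs = 2")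
  case True
  then obtain x y where "zs = [x, y]" by (auto simp: length_Suc_conv numeral_2_eq_2)
  then show ?thesis using f bracket_zero(2)[OF MV_0] by (auto split: if_splits)
 qed (simp add: br_def)
 moreover have "fsum (par ^^ length zs) (%om Ps. if om \<in> FM & set Ps <= MV then twist om Ps else 0) zs = 0"
 proof (rule fsum_two_forms[where t="par ^^ length zs", OF _ par_funpow_zero f])
  fix om :: "'a form" and Ps :: "'a mvf list" assume "0 \<in> set Ps"
  then show "(if om \<in> FM & set Ps <= MV then twist om Ps else 0) = 0" using twist_hom_zero[OF _ _ _ hdeg_zero] by auto
 qed
 moreover have "fsum (par ^^ length zs) twist zs =
   fsum (par ^^ length zs) (%om Ps. if om \<in> FM & set Ps <= MV then twist om Ps else 0) zs"
  by (rule fsum_cong[where F=FM and S=MV]) (use zs par_funpow_MV in auto)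
 ultimately show ?thesis using l by (simp add: mbr_many zero_prod_def)
qed

lemma mbr_no_forms:
 assumes "!!z. z \<in> set zs ==> fst z = 0" "zs ~= []" shows "mbr zs = (0, br zs)"
proof (cases "length zs = 1")
 case True
 then show ?thesis using assms by (auto simp: length_Suc_conv mbr_single d_form_zero)
next
 case False
 then show ?thesis using fsum_no_forms[of twist zs "par ^^ length zs"] twist_zero_form assms by (simp add: mbr_many)
qed

lemma mbr_one_form:
 assumes zs: "!!z. z \<in> set (pre @ post) ==> fst z = 0" and ne: "pre @ post ~= []"
  and s: "om \<in> FM" "set (pre @ post) <= FM \<times> MV"
 shows "mbr (pre @ (om, 0) # post) = (0, twist om (map (par ^^ Suc (length (pre @ post))) (map snd pre) @ map snd post))"
proof -
 have 1: "fsum t twist (pre @ (om, 0) # post) = twist om (map t (map snd pre) @ map snd post)" for t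
  by (rule fsum_one_form[where G=twist, OF twist_zero_form zs])
 have 2: "br (pre @ (om, 0) # post) = 0"
 proof (cases "length (pre @ (om, 0) # post) = 2")
  case True
  then show ?thesis using s bracket_zero by (cases pre; cases post) auto
 qed (simp only: br_def if_False)
 show ?thesis using ne by (subst mbr_many) (auto simp: 1 2 simp del: funpow.simps)
qed

lemma ev_vecf: "f \<in> A ==> ev P [f] = (%p. vecf P p f)" by (simp add: ev_def vecf_def vec_def)

lemma vecf_bracket:
 assumes P: "P \<in> MV" "hdeg 1 P" and Q: "Q \<in> MV" "hdeg 1 Q"
 shows "vecf (bracket P Q) = lie_bracket (vecf P) (vecf Q)"
proof (intro ext)
 fix p f
 show "vecf (bracket P Q) p f = lie_bracket (vecf P) (vecf Q) p f"
 proof (cases "f \<in> A")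
  case True
  have h: "hdeg 0 (delta f P)" "hdeg 0 (delta f Q)" using hdeg_delta[OF P(2)] hdeg_delta[OF Q(2)] by auto
  have par: "par P = - P" using hdeg_par[OF P(2)] by simp
  have s: "ev P [f] \<in> A" "ev Q [f] \<in> A" using ev_smooth P Q True by auto
  have "vecf (bracket P Q) p f = brev [f] P Q p"
   using ev_bracket[OF P(1) Q(1), of "[f]"] ev_vecf[OF True, of "bracket P Q"] True by (metis empty_set empty_subsetI insert_subset list.simps(15))
  also have "\<dots> = - ev Q [ev P [f]] p + ev P [ev Q [f]] p" using ev_hom[OF h(1)] ev_hom[OF h(2)] by (simp add: par ev_linear ev_delta)
  also have "\<dots> = lie_bracket (vecf P) (vecf Q) p f"
   unfolding ev_vecf[OF s(1)] ev_vecf[OF s(2)] unfolding ev_vecf[OF True] lie_bracket_def by simp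
  finally show ?thesis .
 next
  case False
  then show ?thesis using tangent_outside[OF VF_tangent'[OF lie_bracket_VF[OF vecf_VF[OF P(1)] vecf_VF[OF Q(1)]]] False]
   by (simp add: vecf_def vec_def)
 qed
qed

lemma no_formsD: "\<forall>x\<in>set xs. fst (snd x) = 0 ==> z \<in> set (map snd xs) ==> fst z = 0" unfolding set_map by (erule imageE) simp

abbreviation mvs :: "(int \<times> 'a form \<times> 'a mvf) list => 'a mvf list" where
 "mvs xs \<equiv> map snd (map snd xs)"

section \<open>One form together with multivector fields\<close>

definition felt :: "'a form => nat => int \<times> 'a form \<times> 'a mvf" where
 "felt om k = (int k - 3, (om, 0))"

context
 fixes om :: "'a form" and k :: nat
 assumes w: "om \<in> FM" "hdeg (int k) om" "!!p. om p [] = 0"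
begin

lemma felt_graded: "felt om k \<in> gelts" using w MV_0 by (simp add: felt_def Lspace_iff hdeg_zero)

lemma mbr_felt:
 assumes xs: "set xs <= gelts" and nf: "\<forall>x\<in>set xs. fst (snd x) = 0" and "xs ~= []"
 shows "mbr (map snd (felt om k # xs)) = (0, twist om (mvs xs))"
proof -
 have "!!z. z \<in> set (map snd xs) ==> fst z = 0" by (rule no_formsD[OF nf])
 then show ?thesis using mbr_one_form[of "[]" "map snd xs", OF _ _ w(1)] graded_snd[OF xs] assms(3) by (simp add: felt_def)
qed

lemma nested_felt_alone:
 assumes rs: "set rs <= gelts" and nf: "\<forall>x\<in>set rs. fst (snd x) = 0" and "rs ~= []"
 shows "nested [felt om k] rs = (0, twist (- d_form om) (mvs rs))"
proof -
 have "!!z. z \<in> set (map snd rs) ==> fst z = 0" by (rule no_formsD[OF nf])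
 then show ?thesis using mbr_one_form[of "[]" "map snd rs", OF _ _ subspace_neg[OF subspace_FM d_form_FM[OF w(1)]]] graded_snd[OF rs] assms(3)
  by (simp add: felt_def nested_def mbr_single)
qed

lemma nested_felt_left:
 assumes ys: "set ys <= gelts" and rs: "set rs <= gelts"
  and nf: "\<forall>x\<in>set ys \<union> set rs. fst (snd x) = 0" and "ys ~= []"
 shows "nested (felt om k # ys) rs = (0, if length rs = 1 then bracket (twist om (mvs ys)) (hd (mvs rs)) else 0)"
proof -
 have nf': "\<forall>x\<in>set ys. fst (snd x) = 0" "\<forall>x\<in>set rs. fst (snd x) = 0" using nf by blast+
 have "mbr ((0, twist om (mvs ys)) # map snd rs) = (0, br ((0, twist om (mvs ys)) # map snd rs))"
 proof (rule mbr_no_forms)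
  fix z assume "z \<in> set ((0, twist om (mvs ys)) # map snd rs)"
  then consider "z = (0, twist om (mvs ys))" | "z \<in> set (map snd rs)" unfolding list.set by blast
  then show "fst z = 0" by cases (simp, rule no_formsD[OF nf'(2)])
 qed simp
 moreover have "br ((0, twist om (mvs ys)) # map snd rs) = (if length rs = 1 then bracket (twist om (mvs ys)) (hd (mvs rs)) else 0)"
  by (cases rs) (auto simp: br_def)
 ultimately show ?thesis using mbr_felt[OF ys nf'(1) assms(4)] by (simp add: nested_def)
qed

lemma nested_felt_right:
 assumes ys: "set ys <= gelts" and rs: "set rs <= gelts"
  and nf: "\<forall>x\<in>set ys \<union> set rs. fst (snd x) = 0" and "ys ~= []"
 shows "nested ys (felt om k # rs) = (0, twist om ((par ^^ (length rs + 2)) (br (map snd ys)) # mvs rs))"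
proof -
 have nf': "\<forall>x\<in>set ys. fst (snd x) = 0" "\<forall>x\<in>set rs. fst (snd x) = 0" using nf by blast+
 have 1: "mbr (map snd ys) = (0, br (map snd ys))" by (rule mbr_no_forms) (rule no_formsD[OF nf'(1)], use assms(4) in auto)
 then have b: "(0, br (map snd ys)) \<in> FM \<times> MV" using mbr_Cons_mem[OF ys assms(4)] by simp
 have "mbr ([(0, br (map snd ys))] @ (om, 0) # map snd rs) =
   (0, twist om (map (par ^^ Suc (length ([(0 :: 'a form, br (map snd ys))] @ map snd rs))) (map snd [(0 :: 'a form, br (map snd ys))]) @ map snd (map snd rs)))"
 proof (rule mbr_one_form[OF _ _ w(1)])
  fix z assume "z \<in> set ([(0, br (map snd ys))] @ map snd rs)"
  then consider "z = (0, br (map snd ys))" | "z \<in> set (map snd rs)" unfolding set_append list.set by blast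
  then show "fst z = 0" by cases (simp, rule no_formsD[OF nf'(2)])
 qed (use b graded_snd[OF rs] in simp_all)
 then show ?thesis using assms(4) 1 by (simp add: nested_def felt_def del: funpow.simps)
qed

text \<open>The contraction requires as many multivectors as the degree of the form. Either d om, of
  degree k + 1, consumes all entries, or one binary bracket, inner or outer, uses up one entry in
  addition to the k inserted into om.\<close>

lemma Jac_one_form_length:
 assumes xs: "set xs <= gelts" and nf: "\<forall>x\<in>set xs. fst (snd x) = 0" and l: "length xs ~= Suc k"
 shows "Jac (felt om k # xs) = 0"
proof (cases "xs = []")
 case True
 then show ?thesis using Jac_single[OF felt_graded] by simp
next
 case False
 have dw: "hdeg (int k + 1) (- d_form om)" using hdeg_d_form(1)[OF w(1,2)] hdeg_linear(3) by blast
 have *: "nested (felt om k # ys) rs = 0" "nested ys (felt om k # rs) = 0" if m: "mset ys + mset rs = mset xs" for ys rs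
 proof -
  have e: "set ys \<union> set rs = set xs" using m by (metis set_mset_mset set_mset_union)
  then have s: "set ys <= gelts" "set rs <= gelts" and nf': "\<forall>x\<in>set ys \<union> set rs. fst (snd x) = 0" using xs nf by blast+
  have len: "length ys + length rs = length xs" using m by (metis size_mset size_union)
  show "nested (felt om k # ys) rs = 0"
  proof (cases "ys = []")
   case True
   then have "rs ~= []" "int (length (mvs rs)) ~= int k + 1" using len False l by auto
   then show ?thesis using nested_felt_alone[OF s(2)] nf' twist_length[OF dw] True by (simp add: zero_prod_def)
  next
   case False
   have "length rs = 1 ==> twist om (mvs ys) = 0" using len l by (intro twist_length[OF w(2)]) auto
   moreover have "length rs = 1 ==> hd (mvs rs) \<in> MV" using graded_snd[OF s(2)] by (auto simp: length_Suc_conv)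
   ultimately show ?thesis unfolding nested_felt_left[OF s nf' False] by (auto simp: bracket_zero zero_prod_def)
  qed
  show "nested ys (felt om k # rs) = 0"
  proof (cases "ys = []")
   case False
   let ?Q = "(par ^^ (length rs + 2)) (br (map snd ys)) # mvs rs"
   have "twist om ?Q = 0"
   proof (cases "length ys = 2")
    case True
    then show ?thesis using len l by (intro twist_length[OF w(2)]) auto
   next
    case ly: False
    have "set (0 # mvs rs) <= MV" using graded_snd[OF s(2)] MV_0 by auto
    from twist_hom_zero[OF w(1) this, of 0] show ?thesis using ly by (simp add: br_def hdeg_zero del: funpow.simps)
   qed
   then show ?thesis unfolding nested_felt_right[OF s nf' False] by (simp add: zero_prod_def)
  qed (simp add: nested_def)
 qed
 have "shuf wt (%ys rs. nested (felt om k # ys) rs) xs = 0"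
  "shuf wt (%ys rs. wprod wt (felt om k) ys *\<^sub>R nested ys (felt om k # rs)) xs = 0" by (rule shuf_eq_zero; simp add: *)+
 then show ?thesis by (simp add: Jac_def)
qed

end

text \<open>The Jacobiator raises the degree by 2. In degree -2 the multivector component consists
  of functions, and these are given by their values on the empty list.\<close>

lemma Jac_zeroI:
 assumes xs: "set xs <= gelts" and d: "sum_list (map fst xs) = -4"
  and p: "!!p. p \<in> pts M ==> snd (Jac xs) p [] = 0"
 shows "Jac xs = 0"
proof -
 have L: "Jac xs \<in> Lspace M (-2)" using Jac_graded[OF xs] d by simp
 have "snd (Jac xs) q ys = 0" for q ys
 proof (cases "ys = []")
  case True
  have "snd (Jac xs) \<in> MV" using LspaceD(1)[OF L] by auto
  then show ?thesis using p MV_outside[of "snd (Jac xs)" q] True by blast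
 next
  case False
  then show ?thesis using LspaceD(3)[OF L] by (simp add: hdeg_def)
 qed
 then have "snd (Jac xs) = 0" by (intro ext) simp
 then show ?thesis using fst_Jac[OF xs] by (simp add: prod_eq_iff zero_prod_def)
qed

lemma snd_shuf: "snd (shuf w G xs) p \<eta> = shuf w (%ys zs. snd (G ys zs) p \<eta>) xs"
 for G :: "_ => _ => 'a form \<times> 'a mvf" by (rule shuf_linear[where f="%z. snd z p \<eta>"]) (simp_all add: scaleR_fun_def)

lemma twist_Nil: "p \<in> pts M ==> twist H Ps p [] = tsign (length Ps) * evf H (map vecf Ps) p" using ev_twist_Nil[of H Ps p] by (simp add: ev_def)

definition vfe :: "'a mvf => int \<times> 'a form \<times> 'a mvf" where
 "vfe P = (-1, (0, P))"

abbreviation MV1 :: "'a mvf set" where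
 "MV1 \<equiv> {P \<in> MV. hdeg 1 P}"

lemma vfe_graded: "set Ps <= MV1 ==> set (map vfe Ps) <= gelts" using FM_0 by (auto simp: vfe_def Lspace_iff hdeg_zero)

lemma vfe_no_forms: "\<forall>x\<in>set (map vfe Ps) \<union> set (map vfe Qs). fst (snd x) = 0" by (auto simp: vfe_def)

lemma mvs_vfe: "mvs (map vfe Ps) = Ps" by (simp add: comp_def vfe_def)

lemma wt_vfe: "wt (vfe P) (vfe Q) = -1" "wt (felt om k) (vfe P) = - ((-1) ^ k)" by (simp_all add: wt_def vfe_def felt_def sg_def)

lemma hdeg_twist_MV1:
 assumes "om \<in> FM" "set Ps <= MV1" shows "hdeg 0 (twist om Ps)"
proof -
 have "list_all2 hdeg (replicate (length Ps) 1) Ps" using assms(2) nth_mem by (auto simp: list_all2_conv_all_nth)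
 from hdeg_twist[OF assms(1) _ this] show ?thesis using assms(2) by (auto simp: sum_list_replicate)
qed

lemma bracket_function_vector_field:
 assumes t: "t \<in> MV" "hdeg 0 t" and R: "R \<in> MV"
 shows "bracket t R p [] = vecf R p (ev t [])"
proof -
 have "ev t [] \<in> A" using ev_smooth[OF t(1), of "[]"] by simp
 then show ?thesis using ev_bracket[OF t(1) R, of "[]"] ev_hom[OF t(2), of "[_]"] ev_vecf[of "ev t []" R] by (simp add: ev_def fun_eq_iff)
qed

text \<open>Three kinds of splittings survive: the form alone inside gives - d om; one vector field
  X alone outside gives X applied to a value of om; two vector fields alone inside give om evaluated
  with their Lie bracket. As \<open>tsign (Suc k)\<close> is (-1)^k times \<open>tsign k\<close>,
  all carry the same sign, and the sum is the invariant formula for d.\<close>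

lemma Jac_one_form:
 assumes w: "om \<in> FM" "hdeg (int k) om" "!!p. om p [] = 0" and k: "k \<ge> 1"
  and Ps: "set Ps <= MV1" "length Ps = Suc k"
 shows "Jac (felt om k # map vfe Ps) = 0"
proof (rule Jac_zeroI)
 show "set (felt om k # map vfe Ps) <= gelts" using felt_graded[OF w] vfe_graded[OF Ps(1)] by simp
 show "sum_list (map fst (felt om k # map vfe Ps)) = -4" using Ps(2) by (simp add: comp_def vfe_def felt_def sum_list_triv)
 fix p assume p: "p \<in> pts M"
 let ?x = "felt om k" and ?c = "tsign k" and ?s = "%_ _. -1 :: real"
 let ?F = "%R Ys. vecf R p (evf om (map vecf Ys))"
 let ?G = "%P Q Rs. evf om (lie_bracket (vecf P) (vecf Q) # map vecf Rs) p"
 have mem: "set ys <= MV1" "set zs <= MV1" "length ys + length zs = Suc k" if m: "mset ys + mset zs = mset Ps" for ys zs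
 proof -
  have "set ys \<union> set zs = set Ps" using m by (metis set_mset_mset set_mset_union)
  then show "set ys <= MV1" "set zs <= MV1" using Ps by blast+
  show "length ys + length zs = Suc k" using m Ps(2) by (metis size_mset size_union)
 qed
 have VF: "set (map vecf ys) <= VF" if "set ys <= MV1" for ys using that vecf_VF by auto
 have 1: "snd (nested (?x # map vfe ys) (map vfe zs)) p [] =
   (if ys = [] then - (tsign (Suc k) * d_ev (map vecf zs) om p) else 0)
   + ?c *\<^sub>R (if length zs = 1 then ?F (hd zs) ys else 0)" if m: "mset ys + mset zs = mset Ps" for ys zs
 proof (cases "ys = []")
  case True
  then have l: "length zs = Suc k" "zs ~= []" using mem(3)[OF m] by auto
  have "snd (nested (?x # map vfe ys) (map vfe zs)) p [] = twist (- d_form om) zs p []"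
   using nested_felt_alone[OF w vfe_graded[OF mem(2)[OF m]]] vfe_no_forms[of zs "[]"] l True mvs_vfe by simp
  also have "\<dots> = - (tsign (Suc k) * d_ev (map vecf zs) om p)"
   unfolding twist_Nil[OF p] l evf_linear evf_d_form[OF w(1) VF[OF mem(2)[OF m]]] by simp
  \<comment> \<open>As k is at least 1, \<open>zs\<close> has at least two entries here, so the
    second summand vanishes.\<close>
  finally show ?thesis using True l k by simp
 next
  case False
  have e: "nested (?x # map vfe ys) (map vfe zs) = (0, if length zs = 1 then bracket (twist om ys) (hd zs) else 0)"
   using nested_felt_left[OF w vfe_graded[OF mem(1)[OF m]] vfe_graded[OF mem(2)[OF m]] vfe_no_forms] False unfolding mvs_vfe by simp
  have "bracket (twist om ys) (hd zs) p [] = ?c * ?F (hd zs) ys" if l: "length zs = 1"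
  proof -
   have ly: "length ys = k" using mem(3)[OF m] l by simp
   have ys: "set ys <= MV" using mem(1)[OF m] by auto
   have R: "hd zs \<in> MV" using mem(2)[OF m] l by (auto simp: length_Suc_conv)
   have "ev (twist om ys) [] = (%q. ?c * evf om (map vecf ys) q)"
   proof
    fix q show "ev (twist om ys) [] q = ?c * evf om (map vecf ys) q" unfolding ev_twist_Nil ly using FM_outside[OF w(1), of q] by (simp add: evf_def)
   qed
   then show ?thesis using bracket_function_vector_field[OF twist_MV[OF w(1) ys] hdeg_twist_MV1[OF w(1) mem(1)[OF m]] R]
     tangent_cmult[OF VF_tangent'[OF vecf_VF[OF R]] evf_smooth[OF w(1) VF[OF mem(1)[OF m]]]] by simp
  qed
  then show ?thesis using False unfolding e by simp
 qed
 have 2: "wprod wt ?x (map vfe ys) * snd (nested (map vfe ys) (?x # map vfe zs)) p [] =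
   - ((-1) ^ k * ?c) *\<^sub>R (if length ys = 2 then ?G (hd ys) (hd (tl ys)) zs else 0)" if m: "mset ys + mset zs = mset Ps" for ys zs
 proof (cases "ys = []")
  case False
  have e: "nested (map vfe ys) (?x # map vfe zs) = (0, twist om ((par ^^ (length zs + 2)) (br (map snd (map vfe ys))) # zs))"
   using nested_felt_right[OF w vfe_graded[OF mem(1)[OF m]] vfe_graded[OF mem(2)[OF m]] vfe_no_forms] False
   unfolding mvs_vfe by (simp del: funpow.simps)
  have zs: "set zs <= MV" using mem(2)[OF m] by auto
  show ?thesis
  proof (cases "length ys = 2")
   case True
   then obtain P Q where y: "ys = [P, Q]" by (auto simp: length_Suc_conv numeral_2_eq_2)
   have PQ: "P \<in> MV" "hdeg 1 P" "Q \<in> MV" "hdeg 1 Q" using mem(1)[OF m] y by auto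
   have l: "length zs + 2 = Suc k" "Suc (length zs) = k" using mem(3)[OF m] y by auto
   have B: "bracket P Q \<in> MV" "hdeg 1 (bracket P Q)" using bracket_MV hdeg_bracket[OF PQ] PQ by auto
   have "(par ^^ (length zs + 2)) (bracket P Q) = - ((-1) ^ k) *\<^sub>R bracket P Q" unfolding l(1) par_funpow_hom[OF B(2)] by (simp add: sg_def)
   then have "twist om ((par ^^ (length zs + 2)) (bracket P Q) # zs) = - ((-1) ^ k) *\<^sub>R twist om (bracket P Q # zs)"
    using multilin_on_scaleR[OF multilin_on_twist[OF w(1)], of "[]" zs "bracket P Q" "- ((-1) ^ k)"] zs B by simp
   moreover have "twist om (bracket P Q # zs) p [] = ?c * ?G P Q zs" using twist_Nil[OF p, of om "bracket P Q # zs"] l(2) vecf_bracket[OF PQ] by simp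
   moreover have "br (map snd (map vfe ys)) = bracket P Q" by (simp add: y vfe_def)
   moreover have "wprod wt ?x (map vfe ys) = 1" by (simp add: y wt_vfe)
   ultimately show ?thesis unfolding e by (simp add: y scaleR_fun_def del: funpow.simps)
  next
   case ly: False
   have "twist om (0 # zs) = 0" using multilin_on_zero[OF multilin_on_twist[OF w(1)], of "[]" zs] zs MV_0 by simp
   then show ?thesis unfolding e using ly by (simp add: br_def del: funpow.simps)
  qed
 qed (simp add: nested_def)
 have map: "shuf wt G (map vfe Ps) = shuf ?s (%ys zs. G (map vfe ys) (map vfe zs)) Ps" for G :: "_ => _ => real" unfolding shuf_map wt_vfe ..
 have "snd (Jac (?x # map vfe Ps)) p [] =
   shuf ?s (%ys zs. snd (nested (?x # map vfe ys) (map vfe zs)) p []) Ps +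
   shuf ?s (%ys zs. wprod wt ?x (map vfe ys) * snd (nested (map vfe ys) (?x # map vfe zs)) p []) Ps"
  unfolding Jac_def shuf.simps snd_add plus_fun_apply snd_shuf map by (simp add: scaleR_fun_def)
 also have "shuf ?s (%ys zs. snd (nested (?x # map vfe ys) (map vfe zs)) p []) Ps =
   shuf ?s (%ys zs. (if ys = [] then - (tsign (Suc k) * d_ev (map vecf zs) om p) else 0)
    + ?c *\<^sub>R (if length zs = 1 then ?F (hd zs) ys else 0)) Ps" by (rule shuf_cong[OF 1])
 also have "\<dots> = - (tsign (Suc k) * d_ev (map vecf Ps) om p) + ?c * ((-1) ^ k * pick1 ?F Ps)"
  unfolding shuf_add shuf_scaleR shuf_left_Nil shuf_pick1_right[of ?F Ps] Ps(2) by simp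
 also have "shuf ?s (%ys zs. wprod wt ?x (map vfe ys) * snd (nested (map vfe ys) (?x # map vfe zs)) p []) Ps =
   shuf ?s (%ys zs. - ((-1) ^ k * ?c) *\<^sub>R (if length ys = 2 then ?G (hd ys) (hd (tl ys)) zs else 0)) Ps" by (rule shuf_cong[OF 2])
 also have "\<dots> = (-1) ^ k * ?c * pick2 ?G Ps" unfolding shuf_scaleR shuf_pick2[of ?G Ps] by simp
 also have "d_ev (map vecf Ps) om p = pick1 ?F Ps + pick2 ?G Ps" unfolding d_ev_pick[OF w(1) VF[OF Ps(1)]] pick1_map pick2_map by simp
 finally show "snd (Jac (?x # map vfe Ps)) p [] = 0" by (simp add: algebra_simps)
qed

section \<open>Two forms together with multivector fields\<close>

lemma nested_two_forms:
 assumes w1: "om1 \<in> FM" "hdeg (int k1) om1" "!!p. om1 p [] = 0" and w2: "om2 \<in> FM" "hdeg (int k2) om2" "!!p. om2 p [] = 0"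
  and ys: "set ys <= gelts" and rs: "set rs <= gelts" and nf: "\<forall>x\<in>set ys \<union> set rs. fst (snd x) = 0"
 shows "nested (felt om1 k1 # ys) (felt om2 k2 # rs) =
   (if ys = [] then 0 else (0, twist om2 ((par ^^ (length rs + 2)) (twist om1 (mvs ys)) # mvs rs)))"
  and "nested (felt om1 k1 # felt om2 k2 # ys) rs = 0" "nested ys (felt om1 k1 # felt om2 k2 # rs) = 0"
proof -
 note g = graded_snd[OF ys] graded_snd[OF rs]
 have f1: "(om1, 0) \<in> FM \<times> MV" and f2: "(om2, 0) \<in> FM \<times> MV" using w1 w2 MV_0 by auto
 have nf': "\<forall>x\<in>set ys. fst (snd x) = 0" "\<forall>x\<in>set rs. fst (snd x) = 0" using nf by blast+
 have "mbr (map snd (felt om1 k1 # felt om2 k2 # ys)) = 0" by (rule mbr_two_forms) (use g f1 f2 in \<open>auto simp: felt_def\<close>)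
 then show "nested (felt om1 k1 # felt om2 k2 # ys) rs = 0"
  using mbr_zero_mem[of "0 # map snd rs"] g subspace_0[OF subspace_FM_MV] by (simp add: nested_def)
 show "nested ys (felt om1 k1 # felt om2 k2 # rs) = 0"
 proof (cases "ys = []")
  case False
  have "mbr (mbr (map snd ys) # map snd (felt om1 k1 # felt om2 k2 # rs)) = 0"
   by (rule mbr_two_forms) (use mbr_Cons_mem[OF ys False] g f1 f2 in \<open>auto simp: felt_def\<close>)
  then show ?thesis using False by (simp add: nested_def)
 qed (simp add: nested_def)
 show "nested (felt om1 k1 # ys) (felt om2 k2 # rs) =
   (if ys = [] then 0 else (0, twist om2 ((par ^^ (length rs + 2)) (twist om1 (mvs ys)) # mvs rs)))"
 proof (cases "ys = []")
  case True
  have "(- d_form om1, 0) \<in> FM \<times> MV" using subspace_neg[OF subspace_FM d_form_FM[OF w1(1)]] MV_0 by simp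
  then have "mbr ((- d_form om1, 0) # (om2, 0) # map snd rs) = 0" by (intro mbr_two_forms) (use g f2 in auto)
  then show ?thesis using True by (simp add: nested_def mbr_single felt_def)
 next
  case False
  let ?t = "twist om1 (mvs ys)"
  have "set (mvs ys) <= MV" using g by auto
  then have t: "?t \<in> MV" by (rule twist_MV[OF w1(1)])
  have "mbr ([(0, ?t)] @ (om2, 0) # map snd rs) =
    (0, twist om2 (map (par ^^ Suc (length ([(0 :: 'a form, ?t)] @ map snd rs))) (map snd [(0 :: 'a form, ?t)]) @ map snd (map snd rs)))"
  proof (rule mbr_one_form[OF _ _ w2(1)])
   fix z assume "z \<in> set ([(0, ?t)] @ map snd rs)"
   then consider "z = (0, ?t)" | "z \<in> set (map snd rs)" unfolding set_append list.set by blast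
   then show "fst z = 0" by cases (simp, rule no_formsD[OF nf'(2)])
  qed (use t g FM_0 in simp_all)
  then show ?thesis using False mbr_felt[OF w1 ys nf'(1) False] by (simp add: nested_def felt_def[of om2] del: funpow.simps)
 qed
qed

lemma Jac_two_forms_expand:
 assumes w1: "om1 \<in> FM" "hdeg (int k1) om1" "!!p. om1 p [] = 0" and w2: "om2 \<in> FM" "hdeg (int k2) om2" "!!p. om2 p [] = 0"
  and xs: "set xs <= gelts" and nf: "\<forall>x\<in>set xs. fst (snd x) = 0"
 shows "Jac (felt om1 k1 # felt om2 k2 # xs) =
  shuf wt (%ys rs. wprod wt (felt om2 k2) ys *\<^sub>R nested (felt om1 k1 # ys) (felt om2 k2 # rs)) xs +
  wt (felt om1 k1) (felt om2 k2) *\<^sub>R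
   shuf wt (%ys rs. wprod wt (felt om1 k1) ys *\<^sub>R nested (felt om2 k2 # ys) (felt om1 k1 # rs)) xs"
proof -
 have z: "shuf wt (%ys rs. nested (felt om1 k1 # felt om2 k2 # ys) rs) xs = 0"
  "shuf wt (%ys rs. wprod wt (felt om2 k2) ys *\<^sub>R wprod wt (felt om1 k1) ys *\<^sub>R nested ys (felt om1 k1 # felt om2 k2 # rs)) xs = 0"
 proof -
  have s: "set ys <= gelts" "set rs <= gelts" "\<forall>x\<in>set ys \<union> set rs. fst (snd x) = 0"
   if "mset ys + mset rs = mset xs" for ys rs
  proof -
   have "set ys \<union> set rs = set xs" using that by (metis set_mset_mset set_mset_union)
   then show "set ys <= gelts" "set rs <= gelts" "\<forall>x\<in>set ys \<union> set rs. fst (snd x) = 0" using xs nf by auto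
  qed
  show "shuf wt (%ys rs. nested (felt om1 k1 # felt om2 k2 # ys) rs) xs = 0" by (rule shuf_eq_zero) (rule nested_two_forms(2)[OF w1 w2 s])
  show "shuf wt (%ys rs. wprod wt (felt om2 k2) ys *\<^sub>R wprod wt (felt om1 k1) ys *\<^sub>R nested ys (felt om1 k1 # felt om2 k2 # rs)) xs = 0"
   by (rule shuf_eq_zero) (simp only: nested_two_forms(3)[OF w1 w2 s] scaleR_zero_right)
 qed
 show ?thesis unfolding Jac_def shuf.simps z shuf_scaleR[symmetric] by (simp add: mult_ac)
qed

lemma Jac_two_forms_length:
 assumes w1: "om1 \<in> FM" "hdeg (int k1) om1" "!!p. om1 p [] = 0" and w2: "om2 \<in> FM" "hdeg (int k2) om2" "!!p. om2 p [] = 0"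
  and xs: "set xs <= gelts" and nf: "\<forall>x\<in>set xs. fst (snd x) = 0" and l: "Suc (length xs) ~= k1 + k2"
 shows "Jac (felt om1 k1 # felt om2 k2 # xs) = 0"
proof -
 have z: "nested (felt om k # ys) (felt om' k' # rs) = 0"
  if w: "om \<in> FM" "hdeg (int k) om" "!!p. om p [] = 0" and w': "om' \<in> FM" "hdeg (int k') om'" "!!p. om' p [] = 0"
   and k: "k + k' = k1 + k2" and m: "mset ys + mset rs = mset xs" for om k om' k' ys rs
 proof -
  have "set ys \<union> set rs = set xs" using m by (metis set_mset_mset set_mset_union)
  then have s: "set ys <= gelts" "set rs <= gelts" "\<forall>x\<in>set ys \<union> set rs. fst (snd x) = 0" using xs nf by auto
  have len: "length ys + length rs = length xs" using m by (metis size_mset size_union)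
  have "twist om' ((par ^^ (length rs + 2)) (twist om (mvs ys)) # mvs rs) = 0"
  proof (cases "length ys = k")
   case True
   then show ?thesis using len l k by (intro twist_length[OF w'(2)]) auto
  next
   case False
   then have "twist om (mvs ys) = 0" by (intro twist_length[OF w(2)]) simp
   moreover have "set (mvs rs) <= MV" using graded_snd[OF s(2)] by auto
   then have "twist om' (0 # mvs rs) = 0" using multilin_on_zero[OF multilin_on_twist[OF w'(1)], of "[]" "mvs rs"] MV_0 by simp
   ultimately show ?thesis by (simp del: funpow.simps)
  qed
  then show ?thesis unfolding nested_two_forms(1)[OF w w' s] by (simp add: zero_prod_def)
 qed
 have k: "k2 + k1 = k1 + k2" by simp
 show ?thesis unfolding Jac_two_forms_expand[OF w1 w2 xs nf]
  by (subst (1 2) shuf_eq_zero) (simp_all only: z[OF w1 w2 refl] z[OF w2 w1 k] scaleR_zero_right add_0)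
qed

lemma slot_cotangent:
 assumes "om \<in> FM" "set vs <= T p" shows "(%v. om p (v # vs)) \<in> C p"
 using alt_all_add[OF FM_alt[OF assms(1)], of "[]" p vs] alt_all_scaleR[OF FM_alt[OF assms(1)], of "[]" p vs]
  alt_all_outside[OF FM_alt[OF assms(1)], of _ p] assms(2) by (auto simp: cotangent_def lin_on_def simp del: plus_fun_apply)

definition slot :: "'a form => 'a => 'a mvf list => 'a cotan" where
 "slot om p Ps = (%v. om p (v # map (%P. vecf P p) Ps))"

lemma slot: "om \<in> FM ==> set Ps <= MV ==> slot om p Ps \<in> C p"
 unfolding slot_def by (rule slot_cotangent) (auto intro: VF_tangent'[OF vecf_VF])

lemma evf_slot:
 assumes p: "p \<in> pts M" and w: "om \<in> FM" and P: "P \<in> MV" "set Ps <= MV"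
 shows "evf om (map vecf (P # Ps)) p = P p [slot om p Ps]"
 using cotangent_vec[OF p MV_alt[OF P(1)] slot[OF w P(2)]] by (simp add: evf_def comp_def vecf_def slot_def)

text \<open>Filling om1 with \<pi> and \<open>ys\<close> leaves a vector field, namely \<pi> with
  one slot taken by the covector that om1 and \<open>ys\<close> define. Inserting it into om2
  together with \<open>rs\<close> pairs it with the corresponding covector of om2.\<close>

lemma nested_bivector:
 assumes p: "p \<in> pts M"
  and w1: "om1 \<in> FM" "hdeg (int k1) om1" "!!p. om1 p [] = 0" and w2: "om2 \<in> FM" "hdeg (int k2) om2" "!!p. om2 p [] = 0"
  and \<pi>: "\<pi> \<in> MV" "hdeg 2 \<pi>" and ys: "set ys <= MV1" and rs: "set rs <= MV1"
  and l: "Suc (length ys) + Suc (length rs) = k1 + k2"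
 shows "snd (nested (felt om1 k1 # (0, (0, \<pi>)) # map vfe ys) (felt om2 k2 # map vfe rs)) p [] =
  (if Suc (length ys) = k1 then - ((-1) ^ (k1 + k2)) * tsign k1 * tsign k2 * \<pi> p [slot om2 p rs, slot om1 p ys] else 0)"
proof -
 let ?b = "(0 :: int, (0 :: 'a form, \<pi>))" and ?t = "twist om1 (\<pi> # ys)"
 have b: "?b \<in> gelts" using \<pi> FM_0 by (simp add: Lspace_iff hdeg_zero)
 have mem: "set ys <= MV" "set rs <= MV" using ys rs by auto
 have "\<forall>x\<in>set (?b # map vfe ys) \<union> set (map vfe rs). fst (snd x) = 0" using vfe_no_forms by auto
 then have e: "nested (felt om1 k1 # ?b # map vfe ys) (felt om2 k2 # map vfe rs) = (0, twist om2 ((par ^^ (length rs + 2)) ?t # rs))"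
  using nested_two_forms(1)[OF w1 w2, of "?b # map vfe ys" "map vfe rs"] b vfe_graded[OF ys] vfe_graded[OF rs] mvs_vfe by (simp del: funpow.simps)
 show ?thesis
 proof (cases "Suc (length ys) = k1")
  case False
  then have "?t = 0" by (intro twist_length[OF w1(2)]) simp
  moreover have "twist om2 (0 # rs) = 0" using multilin_on_zero[OF multilin_on_twist[OF w2(1)], of "[]" rs] mem MV_0 by simp
  ultimately show ?thesis unfolding e using False by (simp del: funpow.simps)
 next
  case True
  then have k2: "Suc (length rs) = k2" using l by simp
  have "list_all2 hdeg (replicate (length ys) 1) ys" using ys nth_mem by (auto simp: list_all2_conv_all_nth)
  then have "list_all2 hdeg (2 # replicate (length ys) 1) (\<pi> # ys)" using \<pi>(2) by simp
  from hdeg_twist[OF w1(1) _ this] have t: "hdeg 1 ?t" using \<pi>(1) mem by (simp add: sum_list_replicate)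
  have tM: "?t \<in> MV" by (rule twist_MV[OF w1(1)]) (use \<pi> mem in auto)
  have "(par ^^ (length rs + 2)) ?t = - ((-1) ^ k2) *\<^sub>R ?t" unfolding par_funpow_hom[OF t] using k2 by (auto simp: sg_def)
  then have 1: "twist om2 ((par ^^ (length rs + 2)) ?t # rs) = - ((-1) ^ k2) *\<^sub>R twist om2 (?t # rs)"
   using multilin_on_scaleR[OF multilin_on_twist[OF w2(1)], of "[]" rs ?t "- ((-1) ^ k2)"] mem tM by simp
  have 2: "twist om2 (?t # rs) p [] = tsign k2 * ?t p [slot om2 p rs]" unfolding twist_Nil[OF p] evf_slot[OF p w2(1) tM mem(2)] using k2 by simp
  obtain f where f: "f \<in> A" "dif p f = slot om2 p rs" using cotangent_dif[OF p slot[OF w2(1) mem(2)]] by blast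
  have "vecf (par \<pi>) = 0" using vecf_zero[of 2 "par \<pi>"] hdeg_par[OF \<pi>(2)] \<pi>(2) by simp
  then have z: "ev (twist om1 (par \<pi> # zs)) [] p = 0" for zs
   using evf_zero_mem[OF w1(1), of "map vecf (par \<pi> # zs)"] by (simp add: ev_twist_Nil)
  have d: "delta f \<pi> \<in> MV" by (rule delta_MV[OF f(1) \<pi>(1)])
  have "?t p [slot om2 p rs] = ev ?t [f] p" by (simp add: ev_def f)
  also have "\<dots> = (-1) ^ k1 * ev (twist om1 (delta f \<pi> # ys)) [] p" unfolding ev_twist_Cons dsum_simps z using True by simp
  also have "ev (twist om1 (delta f \<pi> # ys)) [] p = tsign k1 * delta f \<pi> p [slot om1 p ys]"
   unfolding ev_twist_Nil evf_slot[OF p w1(1) d mem(1)] using p True by simp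
  also have "delta f \<pi> p [slot om1 p ys] = \<pi> p [slot om2 p rs, slot om1 p ys]" by (simp add: delta_def contract_def f)
  finally show ?thesis unfolding e snd_conv 1 using True by (simp add: scaleR_fun_def 2 power_add)
 qed
qed

text \<open>The two forms occur in two orders of nesting. For the same distribution of the vector
  fields the two terms are \<pi> on the same two covectors in opposite order, with equal
  signs.\<close>

lemma Jac_two_forms:
 assumes w1: "om1 \<in> FM" "hdeg (int k1) om1" "!!p. om1 p [] = 0" and w2: "om2 \<in> FM" "hdeg (int k2) om2" "!!p. om2 p [] = 0"
  and \<pi>: "\<pi> \<in> MV" "hdeg 2 \<pi>" and Ps: "set Ps <= MV1" "length Ps + 2 = k1 + k2"
 shows "Jac (felt om1 k1 # felt om2 k2 # (0, (0, \<pi>)) # map vfe Ps) = 0"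
proof (rule Jac_zeroI)
 let ?b = "(0 :: int, (0 :: 'a form, \<pi>))"
 have b: "?b \<in> gelts" using \<pi> FM_0 by (simp add: Lspace_iff hdeg_zero)
 then show g: "set (felt om1 k1 # felt om2 k2 # ?b # map vfe Ps) <= gelts" using felt_graded[OF w1] felt_graded[OF w2] vfe_graded[OF Ps(1)] by simp
 have "int (length Ps) = int k1 + int k2 - 2" using Ps(2) by linarith
 then show "sum_list (map fst (felt om1 k1 # felt om2 k2 # ?b # map vfe Ps)) = -4" by (simp add: comp_def vfe_def felt_def sum_list_triv)
 fix p assume p: "p \<in> pts M"
 let ?s = "%_ _. -1 :: real"
 have mem: "set ys <= MV1" "set zs <= MV1" "Suc (length ys) + Suc (length zs) = k1 + k2" if m: "mset ys + mset zs = mset Ps" for ys zs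
 proof -
  have "set ys \<union> set zs = set Ps" using m by (metis set_mset_mset set_mset_union)
  then show "set ys <= MV1" "set zs <= MV1" using Ps by blast+
  have "length ys + length zs = length Ps" using m by (metis size_mset size_union)
  then show "Suc (length ys) + Suc (length zs) = k1 + k2" using Ps(2) by simp
 qed
 have map: "shuf wt G (map vfe Ps) = shuf ?s (%ys zs. G (map vfe ys) (map vfe zs)) Ps" for G :: "_ => _ => real" unfolding shuf_map wt_vfe ..
 have half: "snd (shuf wt (%ys rs. wprod wt (felt om' k') ys *\<^sub>R nested (felt om k # ys) (felt om' k' # rs)) (?b # map vfe Ps)) p [] =
   shuf ?s (%ys rs. (- ((-1) ^ k')) ^ length ys * (if Suc (length ys) = k
    then - ((-1) ^ (k1 + k2)) * tsign k1 * tsign k2 * \<pi> p [slot om' p rs, slot om p ys] else 0)) Ps"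
  if w: "om \<in> FM" "hdeg (int k) om" "!!p. om p [] = 0" and w': "om' \<in> FM" "hdeg (int k') om'" "!!p. om' p [] = 0"
   and k: "k + k' = k1 + k2" "tsign k * tsign k' = tsign k1 * tsign k2" for om k om' k'
 proof -
  let ?f = "felt om k" and ?f' = "felt om' k'"
  have 1: "wprod wt ?f' (?b # map vfe ys) * snd (nested (?f # ?b # map vfe ys) (?f' # map vfe rs)) p [] =
    (- ((-1) ^ k')) ^ length ys * (if Suc (length ys) = k
    then - ((-1) ^ (k1 + k2)) * tsign k1 * tsign k2 * \<pi> p [slot om' p rs, slot om p ys] else 0)"
   if m: "mset ys + mset rs = mset Ps" for ys rs
  proof -
   have "wprod wt ?f' (map vfe ys) = (- ((-1) ^ k')) ^ length ys" by (induction ys) (simp_all add: wt_vfe)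
   moreover have "wt ?f' ?b = 1" by (simp add: wt_def)
   ultimately show ?thesis using nested_bivector[OF p w w' \<pi> mem(1,2)[OF m]] mem(3)[OF m] k by (simp add: mult.assoc)
  qed
  \<comment> \<open>The bivector has to be inside: if it stays outside, it is an argument of the
    outer form without a vector part.\<close>
  have 2: "snd (nested (?f # map vfe ys) (?f' # ?b # map vfe rs)) p [] = 0" if m: "mset ys + mset rs = mset Ps" for ys rs
  proof (cases "ys = []")
   case True
   then show ?thesis using nested_two_forms(1)[OF w w', of "[]" "?b # map vfe rs"] b vfe_graded[OF mem(2)[OF m]] vfe_no_forms[of rs "[]"] by simp
  next
   case False
   let ?R = "(par ^^ (length rs + 3)) (twist om ys) # \<pi> # rs"
   have nf: "\<forall>x\<in>set (map vfe ys) \<union> set (?b # map vfe rs). fst (snd x) = 0" using vfe_no_forms by auto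
   have "nested (?f # map vfe ys) (?f' # ?b # map vfe rs) = (0, twist om' ?R)"
    using nested_two_forms(1)[OF w w' vfe_graded[OF mem(1)[OF m]] _ nf] b vfe_graded[OF mem(2)[OF m]] mvs_vfe False
    by (simp del: funpow.simps add: numeral_3_eq_3)
   moreover have "0 \<in> set (map vecf ?R)" using vecf_zero[OF \<pi>(2)] by (simp del: funpow.simps)
   ultimately show ?thesis using twist_Nil[OF p, of om' ?R] evf_zero_mem[OF w'(1)] by (simp only: snd_conv mult_zero_right)
  qed
  have "snd (shuf wt (%ys rs. wprod wt ?f' ys *\<^sub>R nested (?f # ys) (?f' # rs)) (?b # map vfe Ps)) p [] =
    shuf ?s (%ys rs. wprod wt ?f' (?b # map vfe ys) * snd (nested (?f # ?b # map vfe ys) (?f' # map vfe rs)) p []) Ps +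
    shuf ?s (%ys rs. wprod wt ?b (map vfe ys) * wprod wt ?f' (map vfe ys) * snd (nested (?f # map vfe ys) (?f' # ?b # map vfe rs)) p []) Ps"
   unfolding shuf.simps snd_add plus_fun_apply snd_shuf map by (simp add: scaleR_fun_def mult.assoc)
  also have "shuf ?s (%ys rs. wprod wt ?b (map vfe ys) * wprod wt ?f' (map vfe ys) * snd (nested (?f # map vfe ys) (?f' # ?b # map vfe rs)) p []) Ps = 0"
   by (rule shuf_eq_zero) (simp only: 2 mult_zero_right)
  also have "shuf ?s (%ys rs. wprod wt ?f' (?b # map vfe ys) * snd (nested (?f # ?b # map vfe ys) (?f' # map vfe rs)) p []) Ps =
   shuf ?s (%ys rs. (- ((-1) ^ k')) ^ length ys * (if Suc (length ys) = k
    then - ((-1) ^ (k1 + k2)) * tsign k1 * tsign k2 * \<pi> p [slot om' p rs, slot om p ys] else 0)) Ps" by (rule shuf_cong[OF 1])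
  finally show ?thesis by (simp only: add_0_right)
 qed
 let ?c = "- ((-1) ^ (k1 + k2)) * tsign k1 * tsign k2"
 let ?L = "%ys rs. (- ((-1) ^ k2)) ^ length ys * (if Suc (length ys) = k1 then ?c * \<pi> p [slot om2 p rs, slot om1 p ys] else 0)"
 let ?R = "%ys rs. (- ((-1) ^ k1)) ^ length ys * (if Suc (length ys) = k2 then ?c * \<pi> p [slot om1 p rs, slot om2 p ys] else 0)"
 have xs: "set (?b # map vfe Ps) <= gelts" "\<forall>x\<in>set (?b # map vfe Ps). fst (snd x) = 0" using g vfe_no_forms[of Ps "[]"] by auto
 \<comment> \<open>Exchanging the roles of the blocks makes both sums run over the same splittings,
   so that they can be compared term by term.\<close>
 have c: "shuf ?s ?R Ps = shuf ?s (%ys rs. (-1) ^ (length ys * length rs) * ?R rs ys) Ps" by (rule shuf_commute)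
 have "wt (felt om1 k1) (felt om2 k2) * shuf ?s ?R Ps =
   shuf ?s (%ys rs. wt (felt om1 k1) (felt om2 k2) *\<^sub>R ((-1) ^ (length ys * length rs) * ?R rs ys)) Ps"
  unfolding shuf_scaleR c[symmetric] by (simp only: real_scaleR_def)
 also have "\<dots> = shuf ?s (%ys rs. - ?L ys rs) Ps"
 proof (rule shuf_cong)
  fix ys rs assume m: "mset ys + mset rs = mset Ps"
  show "wt (felt om1 k1) (felt om2 k2) *\<^sub>R ((-1) ^ (length ys * length rs) * ?R rs ys) = - ?L ys rs"
  proof (cases "Suc (length ys) = k1")
   case True
   then have k2: "Suc (length rs) = k2" using mem(3)[OF m] by simp
   have w: "wt (felt om1 k1) (felt om2 k2) = (-1) ^ (length ys * length rs)"
    unfolding True[symmetric] k2[symmetric] by (simp add: wt_def felt_def sg_def)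
   have sw: "\<pi> p [slot om1 p ys, slot om2 p rs] = - \<pi> p [slot om2 p rs, slot om1 p ys]"
    by (rule alt_all_swap[OF MV_alt[OF \<pi>(1)] subspace_cotangent, of p "[]", unfolded append_Nil])
   have e: "- ((-1 :: real) ^ Suc m) = (-1) ^ m" for m by simp
   have "(- ((-1 :: real) ^ Suc (length ys))) ^ length rs = (-1) ^ (length ys * length rs)"
    "(- ((-1 :: real) ^ Suc (length rs))) ^ length ys = (-1) ^ (length ys * length rs)"
    unfolding e power_mult[symmetric] by (simp_all add: mult.commute)
   then show ?thesis using True k2 unfolding w sw by (simp add: mult.assoc[symmetric])
  next
   case False
   then have "Suc (length rs) ~= k2" using mem(3)[OF m] by simp
   then show ?thesis using False by simp
  qed
 qed
 finally have "wt (felt om1 k1) (felt om2 k2) * shuf ?s ?R Ps = - shuf ?s ?L Ps" by (simp only: shuf_minus)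
 moreover have "snd (Jac (felt om1 k1 # felt om2 k2 # ?b # map vfe Ps)) p [] =
   shuf ?s ?L Ps + wt (felt om1 k1) (felt om2 k2) * shuf ?s ?R Ps"
  unfolding Jac_two_forms_expand[OF w1 w2 xs] snd_add plus_fun_apply snd_scaleR scaleR_fun_def
  by (simp only: half[OF w1 w2 refl refl] half[OF w2 w1 add.commute mult.commute] real_scaleR_def)
 ultimately show "snd (Jac (felt om1 k1 # felt om2 k2 # ?b # map vfe Ps)) p [] = 0" by simp
qed

section \<open>The degree count\<close>

lemma graded_nonzero:
 assumes "x \<in> gelts"
 shows "fst (snd x) ~= 0 ==> fst x \<ge> -2" "snd (snd x) ~= 0 ==> fst x \<ge> -2"
proof -
 note L = LspaceD[of "snd x" "fst x"]
 have x: "snd x \<in> Lspace M (fst x)" using assms by auto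
 show "fst x \<ge> -2" if "fst (snd x) ~= 0"
 proof (rule ccontr)
  assume n: "\<not> ?thesis"
  have "fst (snd x) p ys = 0" for p ys using hdegD[OF L(2)[OF x], of ys p] L(4)[OF x] n by (cases ys) auto
  then have "fst (snd x) = 0" by (intro ext) simp
  then show False using that by simp
 qed
 show "fst x \<ge> -2" if "snd (snd x) ~= 0" using hdeg_neg[OF L(3)[OF x]] that by linarith
qed

lemma graded_form:
 assumes x: "x \<in> gelts" and z: "snd (snd x) = 0" and nz: "snd x ~= 0"
 obtains om k where "x = felt om k" "om \<in> FM" "hdeg (int k) om" "!!p. om p [] = 0" "k \<ge> 1"
proof -
 have "fst (snd x) ~= 0" using z nz by (metis prod.collapse zero_prod_def)
 then have d: "fst x \<ge> -2" by (rule graded_nonzero(1)[OF x])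
 have L: "snd x \<in> Lspace M (fst x)" using x by auto
 show thesis
 proof (rule that[of "fst (snd x)" "nat (fst x + 3)"])
  show "x = felt (fst (snd x)) (nat (fst x + 3))" using d z by (simp add: felt_def prod_eq_iff)
  show "fst (snd x) \<in> FM" using LspaceD(1)[OF L] by auto
  show "hdeg (int (nat (fst x + 3))) (fst (snd x))" using LspaceD(2)[OF L] d by simp
  show "fst (snd x) p [] = 0" for p by (rule LspaceD(4)[OF L])
  show "nat (fst x + 3) \<ge> 1" using d by simp
 qed
qed

lemma length_filter_map_snd: "length (filter (%z. snd z = 0) (map snd xs)) = length (filter (%x. snd (snd x) = 0) xs)"
 by (simp add: filter_map comp_def)

text \<open>However three forms are distributed, the inner or the outer bracket receives two of them
  directly.\<close>

lemma Jac_three_forms: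
 assumes xs: "set xs <= gelts" and f: "length (filter (%x. snd (snd x) = 0) xs) \<ge> 3"
 shows "Jac xs = 0" unfolding Jac_def
proof (rule shuf_eq_zero)
 fix ys rs assume m: "mset ys + mset rs = mset xs"
 have "set ys \<union> set rs = set xs" using m by (metis set_mset_mset set_mset_union)
 then have s: "set ys <= gelts" "set rs <= gelts" using xs by auto
 note g = graded_snd[OF s(1)] graded_snd[OF s(2)]
 let ?f = "%xs :: (int \<times> 'a form \<times> 'a mvf) list. length (filter (%x. snd (snd x) = 0) xs)"
 have "?f ys + ?f rs = ?f xs" using arg_cong[OF m, of "%m. size (filter_mset (%x. snd (snd x) = 0) m)"] by (simp flip: mset_filter)
 then consider "?f ys \<ge> 2" | "?f rs \<ge> 2" using f by linarith
 then show "nested ys rs = 0"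
 proof cases
  case 1
  then have "mbr (map snd ys) = 0" by (intro mbr_two_forms[OF g(1)]) (simp only: length_filter_map_snd)
  then show ?thesis using mbr_zero_mem[of "0 # map snd rs"] g(2) subspace_0[OF subspace_FM_MV] by (simp add: nested_def)
 next
  case 2
  show ?thesis
  proof (cases "ys = []")
   case False
   have "length (filter (%z. snd z = 0) (map snd rs)) \<ge> 2" unfolding length_filter_map_snd by (rule 2)
   then have "mbr (mbr (map snd ys) # map snd rs) = 0" using mbr_Cons_mem[OF s(1) False] g(2) by (intro mbr_two_forms) auto
   then show ?thesis by (simp add: nested_def)
  qed (simp add: nested_def)
 qed
qed

lemma Jac_no_forms:
 assumes xs: "set xs <= gelts" and nf: "\<forall>x\<in>set xs. fst (snd x) = 0" and l: "length xs ~= 3"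
 shows "Jac xs = 0" unfolding Jac_def
proof (rule shuf_eq_zero)
 fix ys rs assume m: "mset ys + mset rs = mset xs"
 have e: "set ys \<union> set rs = set xs" using m by (metis set_mset_mset set_mset_union)
 then have s: "set ys <= gelts" "set rs <= gelts" "\<forall>x\<in>set ys. fst (snd x) = 0" "\<forall>x\<in>set rs. fst (snd x) = 0"
  using xs nf by auto
 have len: "length ys + length rs = length xs" using m by (metis size_mset size_union)
 show "nested ys rs = 0"
 proof (cases "ys = []")
  case False
  have 1: "mbr (map snd ys) = (0, br (map snd ys))" by (rule mbr_no_forms) (rule no_formsD[OF s(3)], use False in auto)
  have "mbr ((0, br (map snd ys)) # map snd rs) = (0, br ((0, br (map snd ys)) # map snd rs))"
  proof (rule mbr_no_forms)
   fix z assume "z \<in> set ((0, br (map snd ys)) # map snd rs)"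
   then consider "z = (0, br (map snd ys))" | "z \<in> set (map snd rs)" unfolding list.set by blast
   then show "fst z = 0" by cases (simp, rule no_formsD[OF s(4)])
  qed simp
  moreover have "br ((0, br (map snd ys)) # map snd rs) = 0"
  proof (cases "length rs = 1")
   case True
   then have "length ys ~= 2" using len l by simp
   moreover obtain r where "rs = [r]" using True by (auto simp: length_Suc_conv)
   moreover have "snd (snd (hd rs)) \<in> MV" using graded_snd[OF s(2)] \<open>rs = [r]\<close> by auto
   ultimately show ?thesis by (simp add: br_def[of "map snd ys"] bracket_zero)
  qed (simp add: br_def)
  ultimately show ?thesis using 1 False by (simp add: nested_def zero_prod_def)
 qed (simp add: nested_def)
qed

lemma sum_list_ge_minus_length: "\<forall>x\<in>set xs. (-1 :: int) \<le> f x ==> sum_list (map f xs) \<ge> - int (length xs)" by (induction xs) auto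

lemma sum_list_eq_minus_length:
 "\<forall>x\<in>set xs. (-1 :: int) \<le> f x ==> sum_list (map f xs) = - int (length xs) ==> \<forall>x\<in>set xs. f x = -1"
proof (induction xs)
 case (Cons x xs)
 then show ?case using sum_list_ge_minus_length[of xs f] by auto
qed simp

lemma vfe_list:
 assumes "set xs <= gelts" "\<forall>x\<in>set xs. fst (snd x) = 0" "\<forall>x\<in>set xs. fst x = -1"
 shows "xs = map vfe (mvs xs)" "set (mvs xs) <= MV1"
proof -
 have "vfe (snd (snd x)) = x" if "x \<in> set xs" for x
 proof -
  have "fst (snd x) = 0" "fst x = -1" using that assms(2,3) by blast+
  then show ?thesis by (cases x) (simp add: vfe_def split: prod.splits)
 qed
 then have "map (%x. vfe (snd (snd x))) xs = xs" by (rule map_idI)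
 then show "xs = map vfe (mvs xs)" by (simp only: map_map comp_def)
 show "set (mvs xs) <= MV1"
 proof
  fix P assume "P \<in> set (mvs xs)"
  then obtain x where x: "x \<in> set xs" "P = snd (snd x)" by auto
  then have "snd x \<in> Lspace M (-1)" using assms by fastforce
  from LspaceD(1,3)[OF this] show "P \<in> MV1" using x(2) by auto
 qed
qed

text \<open>A k-form has degree k - 3 and an a-vector field degree a - 2. Once functions are dealt
  with, all multivector entries have degree at least -1, and the total -4 together with the number
  of entries required by the brackets leaves no freedom.\<close>

lemma Jac_pure:
 assumes xs: "set xs <= gelts" and d: "sum_list (map fst xs) = -4"
  and pure: "\<forall>x\<in>set xs. fst (snd x) = 0 \<or> snd (snd x) = 0"
 shows "Jac xs = 0"
proof (cases "\<exists>x\<in>set xs. snd x = 0")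
 case True
 then obtain d where "(d, 0) \<in> set xs" by (metis prod.collapse)
 then show ?thesis by (rule Jac_zero_mem[OF xs])
next
 case nz: False
 let ?f = "%x :: int \<times> 'a form \<times> 'a mvf. snd (snd x) = 0"
 define fs where "fs = filter ?f xs"
 define ps where "ps = filter (%x. \<not> ?f x) xs"
 have m: "mset xs = mset (fs @ ps)" by (simp add: fs_def ps_def)
 have g: "set fs <= gelts" "set ps <= gelts" using xs by (auto simp: fs_def ps_def)
 have fs_mem: "?f x & snd x ~= 0 & x \<in> gelts" if "x \<in> set fs" for x
 proof -
  have "x \<in> set xs" "?f x" using that by (simp_all add: fs_def)
  then show ?thesis using nz xs by blast
 qed
 have nf: "\<forall>x\<in>set ps. fst (snd x) = 0" using pure by (auto simp: ps_def)
 have ps2: "\<forall>x\<in>set ps. fst x \<ge> -2" using graded_nonzero(2) xs by (auto simp: ps_def)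
 have sum: "sum_list (map fst fs) + sum_list (map fst ps) = -4"
  using arg_cong[OF m, of "%m. sum_mset (image_mset fst m)"] d by (simp flip: sum_mset_sum_list)
 show ?thesis
 proof (cases "\<exists>x\<in>set ps. fst x = -2")
  case True
  then obtain x where x: "x \<in> set ps" "fst x = -2" by blast
  then have "fst (snd x) = 0" "x \<in> gelts" "x \<in> set xs" using nf g xs by (auto simp only: ps_def set_filter)
  then have x': "x = (-2, (0, snd (snd x)))" "x \<in> gelts" "x \<in> set xs" using x by (auto simp: prod_eq_iff)
  have "snd x \<in> Lspace M (-2)" using x'(2) x(2) by auto
  then have "snd (snd x) \<in> MV" "hdeg 0 (snd (snd x))" using LspaceD(1,3)[of "snd x" "-2"] by auto
  from Jac_function[OF this, of "remove1 x xs"] have "Jac (x # remove1 x xs) = 0" using x'(1) xs set_remove1_subset[of x xs] by auto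
  then show ?thesis by (rule Jac_perm[OF _ xs, rotated]) (use x'(3) in simp)
 next
  case False
  then have ps1: "\<forall>x\<in>set ps. -1 \<le> fst x" using ps2 by force
  have "Jac (fs @ ps) = 0"
  proof (cases fs)
   case Nil
   \<comment> \<open>Without forms a nonzero term would consist of two binary brackets, hence of
     three entries, whose degrees sum up to at least -3.\<close>
   have "length ps ~= 3" using sum_list_ge_minus_length[OF ps1] sum Nil by auto
   then show ?thesis using Jac_no_forms[OF g(2) nf] Nil by simp
  next
   case (Cons f1 fs1)
   have "?f f1 & snd f1 ~= 0 & f1 \<in> gelts" by (rule fs_mem) (simp add: Cons)
   then obtain om1 k1 where w1: "f1 = felt om1 k1" "om1 \<in> FM" "hdeg (int k1) om1" "!!p. om1 p [] = 0" "k1 \<ge> 1"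
    using graded_form[of f1] by blast
   show ?thesis
   proof (cases fs1)
    case Nil
    show ?thesis
    proof (cases "length ps = Suc k1")
     case True
     \<comment> \<open>The k1 + 1 multivectors have total degree -4 - (k1 - 3) = -(k1 + 1), so all
       of them are vector fields.\<close>
     have "sum_list (map fst ps) = - int (length ps)" using sum Cons Nil w1(1) True by (simp add: felt_def)
     then have "\<forall>x\<in>set ps. fst x = -1" by (rule sum_list_eq_minus_length[OF ps1])
     note v = vfe_list[OF g(2) nf this]
     have "length (mvs ps) = Suc k1" using True by simp
     from Jac_one_form[OF w1(2-5) v(2) this] show ?thesis using Cons Nil w1(1) v(1) by simp
    next
     case False
     then show ?thesis using Jac_one_form_length[OF w1(2-4) g(2) nf] Cons Nil w1(1) by simp
    qed
   next
    case (Cons f2 fs2)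
    note fs = \<open>fs = f1 # fs1\<close> Cons
    have "?f f2 & snd f2 ~= 0 & f2 \<in> gelts" by (rule fs_mem) (simp add: fs)
    then obtain om2 k2 where w2: "f2 = felt om2 k2" "om2 \<in> FM" "hdeg (int k2) om2" "!!p. om2 p [] = 0" "k2 \<ge> 1"
     using graded_form[of f2] by blast
    show ?thesis
    proof (cases fs2)
     case Nil
     show ?thesis
     proof (cases "Suc (length ps) = k1 + k2")
      case True
      \<comment> \<open>There are k1 + k2 - 1 multivectors of total degree 2 - k1 - k2, one above
        the minimum, so exactly one of them is a bivector field and the others are vector
        fields.\<close>
      have s: "sum_list (map fst ps) = 1 - int (length ps)" using sum fs Nil w1(1) w2(1) arg_cong[OF True, of int] by (simp add: felt_def)
      have "\<exists>b\<in>set ps. fst b ~= -1"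
      proof (rule ccontr)
       assume "\<not> ?thesis"
       then have "map fst ps = replicate (length ps) (-1)" by (intro replicate_eqI) auto
       then have "sum_list (map fst ps) = - int (length ps)" by (simp add: sum_list_replicate)
       then show False using s by simp
      qed
      then obtain b where b: "b \<in> set ps" "fst b ~= -1" by blast
      then obtain as bs where ps: "ps = as @ b # bs" by (meson split_list)
      have b0: "fst b \<ge> 0" using b ps1 by force
      have ab: "\<forall>x\<in>set (as @ bs). fst x \<ge> -1" using ps1 ps by simp
      have "sum_list (map fst (as @ bs)) = - int (length (as @ bs)) - fst b" using s ps by simp
      moreover have "sum_list (map fst (as @ bs)) \<ge> - int (length (as @ bs))" by (rule sum_list_ge_minus_length[OF ab])
      ultimately have b1: "fst b = 0" and "sum_list (map fst (as @ bs)) = - int (length (as @ bs))" using b0 by auto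
      then have v: "\<forall>x\<in>set (as @ bs). fst x = -1" by (intro sum_list_eq_minus_length[OF ab])
      have gab: "set (as @ bs) <= gelts" "\<forall>x\<in>set (as @ bs). fst (snd x) = 0" using g(2) nf ps by auto
      note v = vfe_list[OF gab v]
      have "snd b \<in> Lspace M 0" "fst (snd b) = 0" using g(2) nf b b1 by auto
      then have \<pi>: "snd (snd b) \<in> MV" "hdeg 2 (snd (snd b))" "b = (0, (0, snd (snd b)))"
       using LspaceD(1,3)[of "snd b" 0] b1 by (auto simp: prod_eq_iff)
      have l: "length (mvs (as @ bs)) + 2 = k1 + k2" using True ps by simp
      have "Jac (felt om1 k1 # felt om2 k2 # b # as @ bs) = 0"
       using Jac_two_forms[OF w1(2-4) w2(2-4) \<pi>(1,2) v(2) l] unfolding v(1)[symmetric] \<pi>(3)[symmetric] .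
      then show ?thesis by (rule Jac_perm[rotated 2]) (use fs Nil w1(1) w2(1) ps g in auto)
     next
      case False
      then show ?thesis using Jac_two_forms_length[OF w1(2-4) w2(2-4) g(2) nf] fs Nil w1(1) w2(1) by simp
     qed
    next
     case (Cons f3 fs3)
     have "filter ?f (fs @ ps) = fs" unfolding fs_def ps_def by simp
     moreover have "length fs \<ge> 3" using fs Cons by simp
     ultimately have "length (filter ?f (fs @ ps)) \<ge> 3" by (simp only:)
     then show ?thesis using g by (intro Jac_three_forms) auto
    qed
   qed
  qed
  then show ?thesis by (rule Jac_perm[OF m xs])
 qed
qed

text \<open>Additivity splits every entry into its form and its multivector part; \<open>pre\<close>
  collects the entries that have already been split.\<close>

lemma Jac_base:
 "set (pre @ xs) <= gelts ==> sum_list (map fst (pre @ xs)) = -4 ==>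
  \<forall>x\<in>set pre. fst (snd x) = 0 \<or> snd (snd x) = 0 ==> Jac (pre @ xs) = 0"
proof (induction xs arbitrary: pre)
 case Nil
 have "Jac pre = 0" by (rule Jac_pure) (use Nil(1,2) in simp, use Nil(2) in simp, rule Nil(3))
 then show ?case by simp
next
 case (Cons x xs)
 obtain d om P where x: "x = (d, (om, P))" by (metis prod.exhaust)
 have L: "(om, P) \<in> Lspace M d" using Cons.prems x by auto
 then have L1: "(om, 0) \<in> Lspace M d" and L2: "(0, P) \<in> Lspace M d" using FM_0 MV_0 by (auto simp: Lspace_iff hdeg_zero)
 have "Jac ((pre @ [(d, (om, 0))]) @ xs) = 0" "Jac ((pre @ [(d, (0, P))]) @ xs) = 0" by (rule Cons.IH; use Cons.prems L1 L2 x in force)+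
 moreover have "(om, P) = (om, 0) + (0, P)" by simp
 ultimately show ?case using Jac_add[OF L1 L2, of pre xs] Cons.prems(1) unfolding x by (simp del: add_Pair)
qed

text \<open>Nonzero entries have degree at least -2, so the shifted degree
  \<open>nat (fst x + 3)\<close> is positive and drops whenever an entry is hit by an
  insertion.\<close>

theorem Jac_zero: "set xs <= gelts ==> Jac xs = 0"
proof (induction "\<Sum>x\<leftarrow>xs. nat (fst x + 3)" arbitrary: xs rule: less_induct)
 case less
 note xs = less.prems
 show ?case
 proof (cases "\<exists>x\<in>set xs. snd x = 0")
  case True
  then obtain d where "(d, 0) \<in> set xs" by (metis prod.collapse)
  then show ?thesis by (rule Jac_zero_mem[OF xs])
 next
  case nz: False
  have d: "\<forall>x\<in>set xs. fst x \<ge> -2"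
  proof
   fix x assume x: "x \<in> set xs"
   then have "fst (snd x) ~= 0 \<or> snd (snd x) ~= 0" using nz by (metis prod.collapse zero_prod_def)
   then show "fst x \<ge> -2" using graded_nonzero xs x by blast
  qed
  show ?thesis
  proof (cases "sum_list (map fst xs) = -4")
   case True
   then show ?thesis using Jac_base[of "[]" xs] xs by simp
  next
   case False
   note L = Jac_graded[OF xs]
   have R: "snd (Jac xs) \<in> MV" using LspaceD(1)[OF L] by auto
   have "snd (Jac xs) = 0"
   proof (rule MV_eqI_delta[OF R MV_0])
    show "snd (Jac xs) p [] = 0 p []" for p using hdegD[OF LspaceD(3)[OF L], of "[]" p] False by simp
    fix h assume h: "h \<in> A"
    have dec: "(\<Sum>x\<leftarrow>ys. nat (fst x + 3)) < (\<Sum>x\<leftarrow>xs. nat (fst x + 3))"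
     if "ys \<in> set (dlist (lower h) grade xs)" "\<forall>x\<in>set xs. fst x \<ge> -2" for ys xs using that
    proof (induction xs arbitrary: ys)
     case (Cons x xs)
     from Cons.prems(1) consider "ys = lower h x # xs"
      | zs where "zs \<in> set (dlist (lower h) grade xs)" "ys = grade x # zs" by auto
     then show ?case
     proof cases
      case 1
      then show ?thesis using Cons.prems(2) by (simp add: lower_def)
     next
      case 2
      then show ?thesis using Cons.IH[OF 2(1)] Cons.prems(2) by (simp add: grade_def)
     qed
    qed simp
    have "dsum (lower h) grade Jac xs = dsum (lower h) grade (%_. 0) xs"
    proof (rule dsum_cong)
     fix ys assume ys: "ys \<in> set (dlist (lower h) grade xs)"
     show "Jac ys = 0" by (rule less.hyps[OF dec[OF ys d] dlist_mem_set[OF lower_graded[OF h] grade_graded xs ys]])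
    qed
    then have "mdelta h (Jac xs) = 0" using mdelta_Jac[OF h xs] by simp
    then show "delta h (snd (Jac xs)) = delta h 0" by (simp add: mdelta_def zero_prod_def delta_linear)
   qed
   then show ?thesis using fst_Jac[OF xs] by (simp add: prod_eq_iff zero_prod_def)
  qed
 qed
qed

subsection \<open>The algebra and its Maurer-Cartan elements\<close>

lemma graded_space_Lspace: "graded_space (Lspace M)" unfolding graded_space_def
proof (intro conjI allI impI ballI)
 show "subspace (Lspace M i)" for i by (rule subspace_Lspace)
 fix I w i assume a: "finite I & (\<forall>i\<in>I. w i \<in> Lspace M i) & sum w I = 0" and i: "i \<in> I"
 have L: "w j \<in> Lspace M j" if "j \<in> I" for j using a that by blast
 have app: "(\<Sum>j\<in>I. fst (w j)) p xs = (\<Sum>j\<in>I. fst (w j) p xs)" "(\<Sum>j\<in>I. snd (w j)) p ys = (\<Sum>j\<in>I. snd (w j) p ys)"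
  for p xs ys by (induction I rule: infinite_finite_induct) simp_all
 have fst: "(\<Sum>j\<in>I. fst (w j)) = 0" and snd: "(\<Sum>j\<in>I. snd (w j)) = 0" using a by (simp_all flip: fst_sum snd_sum)
 have "fst (w i) p xs = 0" for p xs
 proof (cases "int (length xs) = i + 3")
  case True
  have "(\<Sum>j\<in>I. fst (w j) p xs) = (\<Sum>j\<in>I. if j = i then fst (w i) p xs else 0)"
   by (rule sum.cong[OF refl]) (use True hdegD[OF LspaceD(2)[OF L]] in auto)
  then show ?thesis using app(1)[of p xs] fst a i by simp
 qed (use hdegD[OF LspaceD(2)[OF L[OF i]]] in simp)
 moreover have "snd (w i) p xs = 0" for p xs
 proof (cases "int (length xs) = i + 2")
  case True
  have "(\<Sum>j\<in>I. snd (w j) p xs) = (\<Sum>j\<in>I. if j = i then snd (w i) p xs else 0)"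
   by (rule sum.cong[OF refl]) (use True hdegD[OF LspaceD(3)[OF L]] in auto)
  then show ?thesis using app(2)[of p xs] snd a i by simp
 qed (use hdegD[OF LspaceD(3)[OF L[OF i]]] in simp)
 ultimately show "w i = 0" by (auto simp: prod_eq_iff fun_eq_iff)
qed

lemma total_space_subset: "total_space (Lspace M) <= FM \<times> MV"
 unfolding total_space_def by (rule span_minimal[OF _ subspace_FM_MV]) (use Lspace_subset in blast)

lemma Linf1_mbr: "Linf1_algebra (Lspace M) mbr" unfolding Linf1_algebra_def
proof (intro conjI allI impI)
 show "graded_space (Lspace M)" by (rule graded_space_Lspace)
 show "multilin_on (total_space (Lspace M)) mbr" unfolding multilin_on_def lin_on_def
 proof (intro allI impI conjI ballI)
  fix xs ys x assume "set xs <= total_space (Lspace M) & set ys <= total_space (Lspace M)" and x: "x \<in> total_space (Lspace M)"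
  then have s: "set xs <= FM \<times> MV" "set ys <= FM \<times> MV" "x \<in> FM \<times> MV" using total_space_subset by auto
  show "mbr (xs @ (c *\<^sub>R x) # ys) = c *\<^sub>R mbr (xs @ x # ys)" for c by (rule multilin_on_scaleR[OF multilin_on_mbr s])
  show "mbr (xs @ (x + y) # ys) = mbr (xs @ x # ys) + mbr (xs @ y # ys)" if "y \<in> total_space (Lspace M)" for y
   by (rule multilin_on_add[OF multilin_on_mbr s]) (use that total_space_subset in blast)
 qed
 fix k :: nat and d v assume k: "1 \<le> k" and v: "\<forall>i<k. v i \<in> Lspace M (d i)"
 have vS: "v i \<in> FM \<times> MV" if "i < k" for i by (rule LspaceD(1)[of _ "d i"]) (use v that in simp)
 let ?w = "%i j. (-1) powi (d i * d j) :: real"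
 have w: "?w i j = ?w j i" for i j by (simp add: mult.commute)
 show "mbr (map v [0..<k]) \<in> Lspace M ((\<Sum>i<k. d i) + 1)"
 proof -
  have z: "list_all2 (%d z. z \<in> Lspace M d) (map d [0..<k]) (map v [0..<k])" using v by (simp add: list_all2_conv_all_nth)
  have "sum_list (map d [0..<k]) = (\<Sum>i<k. d i)" by (simp add: interv_sum_list_conv_sum_set_nat atLeast0LessThan)
  then show ?thesis using mbr_degree[OF z] k by simp
 qed
 show "mbr (map v [0..<k]) = koszul_sign d \<sigma> k *\<^sub>R mbr (map (%i. v (\<sigma> i)) [0..<k])" if \<sigma>: "\<sigma> permutes {..<k}" for \<sigma>
 proof -
  let ?L = "map \<sigma> [0..<k]"
  have L: "distinct ?L" "set ?L <= {..<k}"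
   using permutes_inj_on[OF \<sigma>] permutes_image[OF \<sigma>] by (auto simp: distinct_map atLeast0LessThan)
  have "mbr (map v ?L) = inversion_weight ?w ?L *\<^sub>R mbr (map v (sort ?L))"
  proof (rule inversion_weight_sort[where S="{..<k}" and G="%L. mbr (map v L)", OF _ L])
   fix pre x y post assume s: "set (pre @ x # y # post) <= {..<k}"
   have "v i \<in> FM \<times> MV" if "i \<in> set (pre @ post)" for i using that s by (intro vS) auto
   then have "set (map v pre) <= FM \<times> MV" "set (map v post) <= FM \<times> MV" unfolding set_map image_subset_iff by simp_all
   moreover have "v x \<in> Lspace M (d x)" "v y \<in> Lspace M (d y)" using s v by auto
   ultimately show "mbr (map v (pre @ x # y # post)) = ?w x y *\<^sub>R mbr (map v (pre @ y # x # post))"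
    using mbr_swap[of "v x" "d x" "v y" "d y" "map v pre" "map v post"] by (simp add: sg_power)
  qed
  \<comment> \<open>The weight is a sign, so it may be moved to the other side of the
    equation.\<close>
  moreover have "inversion_weight ?w L * inversion_weight ?w L = 1" for L
  proof (induction L)
   case (Cons x L)
   have "(\<Prod>y\<leftarrow>M. ?w x y) * (\<Prod>y\<leftarrow>M. ?w x y) = 1" for M
    by (induction M) (simp_all add: sg_power mult.commute mult.left_commute)
   then show ?case using Cons by (simp add: mult.commute mult.left_commute)
  qed simp
  ultimately show ?thesis unfolding koszul_sign_inversion_weight sort_map_permutes[OF \<sigma>] by (simp add: comp_def)
 qed
 let ?x = "%i. (d i, v i)"
 let ?N = "%ys zs. if ys = [] then 0 else mbr (mbr (map v ys) # map v zs)"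
 have "(\<Sum>i=1..k. \<Sum>\<sigma>\<in>unshuffles i k. koszul_sign d \<sigma> k *\<^sub>R
   mbr (mbr (map (%k. v (\<sigma> k)) [0..<i]) # map (%k. v (\<sigma> k)) [i..<k])) =
  (\<Sum>i=1..k. shuf ?w (%ys zs. if length ys = i then ?N ys zs else 0) [0..<k])"
 proof (rule sum.cong[OF refl])
  fix i assume i: "i \<in> {1..k}"
  have "(\<Sum>\<sigma>\<in>unshuffles i k. koszul_sign d \<sigma> k *\<^sub>R mbr (mbr (map (%k. v (\<sigma> k)) [0..<i]) # map (%k. v (\<sigma> k)) [i..<k])) =
    (\<Sum>\<sigma>\<in>unshuffles i k. inversion_weight ?w (map \<sigma> [0..<k]) *\<^sub>R ?N (map \<sigma> [0..<i]) (map \<sigma> [i..<k]))"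
   unfolding koszul_sign_inversion_weight using i by (intro sum.cong) (simp_all add: comp_def)
  also have "\<dots> = shuf ?w (%ys zs. if length ys = i then ?N ys zs else 0) [0..<k]" by (rule sum_unshuffles[OF _ w]) (use i in simp)
  finally show "(\<Sum>\<sigma>\<in>unshuffles i k. koszul_sign d \<sigma> k *\<^sub>R mbr (mbr (map (%k. v (\<sigma> k)) [0..<i]) # map (%k. v (\<sigma> k)) [i..<k])) =
    shuf ?w (%ys zs. if length ys = i then ?N ys zs else 0) [0..<k]" .
 qed
 \<comment> \<open>The term i = 0 may be added because an empty inner block counts as 0.\<close>
 also have "\<dots> = (\<Sum>i\<le>k. shuf ?w (%ys zs. if length ys = i then ?N ys zs else 0) [0..<k])"
 proof (rule sum.mono_neutral_left)
  show "\<forall>i\<in>{..k} - {1..k}. shuf ?w (%ys zs. if length ys = i then ?N ys zs else 0) [0..<k] = 0"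
  proof
   fix i assume "i \<in> {..k} - {1..k}"
   then have "i = 0" by auto
   then show "shuf ?w (%ys zs. if length ys = i then ?N ys zs else 0) [0..<k] = 0" by (intro shuf_eq_zero) simp
  qed
 qed auto
 also have "\<dots> = shuf ?w ?N [0..<k]" by (rule shuf_lengths) simp
 also have "\<dots> = Jac (map ?x [0..<k])"
 proof -
  have "nested (map ?x ys) (map ?x zs) = ?N ys zs" for ys zs by (cases ys) (simp_all add: nested_def comp_def)
  then show ?thesis unfolding Jac_def shuf_map by (simp only: wt_def sg_power fst_conv)
 qed
 also have "\<dots> = 0" by (rule Jac_zero) (use v in auto)
 finally show "(\<Sum>i=1..k. \<Sum>\<sigma>\<in>unshuffles i k. koszul_sign d \<sigma> k *\<^sub>R
   mbr (mbr (map (%k. v (\<sigma> k)) [0..<i]) # map (%k. v (\<sigma> k)) [i..<k])) = 0" .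
qed

section \<open>Values of the brackets on homogeneous entries\<close>

lemma mbr_forms: "om \<in> forms M k ==> mbr [(om, 0)] = (- ext_deriv M k om, 0)" by (simp add: mbr_single ext_deriv_d_form(1))

lemma mbr_multivectors:
 assumes "P \<in> multivector_fields M a" "Q \<in> multivector_fields M b"
 shows "mbr [(0, P), (0, Q)] = (0, (-1) ^ (a + 1) *\<^sub>R schouten M a b P Q)" unfolding schouten_bracket[OF assms] by (subst mbr_no_forms) auto

lemma mbr_mixed:
 assumes k: "k \<ge> 1" and H: "H \<in> forms M k" and P: "!!i. i < k ==> P i \<in> multivector_fields M (a i)"
 shows "mbr ((H, 0) # map (%i. (0, P i)) [0..<k]) =
  (0, (-1) ^ (\<Sum>i<k. a i * (k - Suc i)) *\<^sub>R sharp_wedge M (map P [0..<k]) H)"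
proof -
 let ?zs = "map (%i. (0 :: 'a form, P i)) [0..<k]"
 have "H \<in> FM" using H by (simp add: forms_hom)
 have "set ?zs <= FM \<times> MV" using P FM_0 by (auto simp: multivector_fields_hom)
 then have "mbr ((H, 0) # ?zs) = (0, twist H (map P [0..<k]))"
 proof -
  have "fst z = 0" if "z \<in> set ([] @ ?zs)" for z using that by auto
  from mbr_one_form[where pre="[]" and post="?zs" and om=H, OF this] \<open>H \<in> FM\<close> \<open>set ?zs <= FM \<times> MV\<close> k show ?thesis by (simp add: comp_def)
 qed
 then show ?thesis using twist_sharp_wedge[of H k P a] H P by (simp add: comp_def)
qed

text \<open>The entries are classified by the number of those with vanishing multivector part, which
  include all forms: two of them make every bracket 0, none leaves only b), and one leaves a) or
  c).\<close>

lemma mbr_vanish: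
 assumes ne: "zs ~= []" and pure: "\<forall>z\<in>set zs. pure M z" and nb: "\<not> (\<exists>ys. mset ys = mset zs & bracket_input M ys)"
 shows "mbr zs = 0"
proof -
 have S: "z \<in> FM \<times> MV" if "pure M z" for z using that FM_0 MV_0 by (auto simp: pure_def forms_hom multivector_fields_hom)
 have zs: "set zs <= FM \<times> MV" using pure S by blast
 have mv: "fst z = 0 & (\<exists>a. snd z \<in> multivector_fields M a)" if "z \<in> set zs" "snd z ~= 0" for z
  using bspec[OF pure that(1)] that(2) unfolding pure_def by (elim disjE exE bexE conjE) (simp, auto)
 consider "length (filter (%z. snd z = 0) zs) \<ge> 2" | "length (filter (%z. snd z = 0) zs) = 0" | "length (filter (%z. snd z = 0) zs) = 1"
  by linarith
 then show ?thesis
 proof cases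
  case 1
  then show ?thesis by (rule mbr_two_forms[OF zs])
 next
  case 2
  then have nz: "snd z ~= 0" if "z \<in> set zs" for z using that by (simp add: filter_empty_conv)
  have "br zs = 0"
  proof (cases "length zs = 2")
   case True
   then obtain x y where xy: "zs = [x, y]" by (auto simp: length_Suc_conv numeral_2_eq_2)
   obtain P Q where P: "x = (0, P)" "y = (0, Q)" using mv[of x] mv[of y] nz xy by (metis list.set_intros prod.collapse)
   obtain a b where "P \<in> multivector_fields M a" "Q \<in> multivector_fields M b" using mv[of x] mv[of y] nz[of x] nz[of y] xy P by auto
   then have "bracket_input M zs" unfolding bracket_input_def xy P by blast
   then show ?thesis using nb by blast
  qed (simp add: br_def)
  moreover have "fst z = 0" if "z \<in> set zs" for z using mv[OF that nz[OF that]] by (rule conjunct1)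
  note mbr_no_forms[OF this ne]
  ultimately show ?thesis by (simp add: zero_prod_def)
 next
  case 3
  then obtain f where "filter (%z. snd z = 0) zs = [f]" by (auto simp: length_Suc_conv)
  then obtain pre post where z: "zs = pre @ f # post" "snd f = 0" "\<forall>z\<in>set pre. snd z ~= 0" "\<forall>z\<in>set post. snd z ~= 0"
   unfolding filter_eq_Cons_iff by (auto simp: filter_empty_conv dest!: sym[of "[]"])
  define om where "om = fst f"
  have f: "f = (om, 0)" using z(2) by (simp add: om_def prod_eq_iff)
  have nz: "snd z ~= 0" "z \<in> set zs" if "z \<in> set (pre @ post)" for z using that z by auto
  have nf: "fst z = 0" if "z \<in> set (pre @ post)" for z using mv[OF nz(2)[OF that] nz(1)[OF that]] by (rule conjunct1)
  have wF: "om \<in> FM" using zs z(1) f by auto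
  have s: "set (pre @ post) <= FM \<times> MV" using zs z(1) by auto
  consider "om = 0" | k where "k \<ge> 1" "om \<in> forms M k" using pure z(1) f by (auto simp: pure_def)
  then show ?thesis
  proof cases
   case 1
   then show ?thesis using mbr_zero_mem[OF zs] z(1) f by (simp add: zero_prod_def)
  next
   case (2 k)
   have "mbr [(om, 0)] = 0" if "pre @ post = []"
   proof -
    have "bracket_input M zs" unfolding bracket_input_def using 2 z(1) f that by auto
    then show ?thesis using nb by blast
   qed
   moreover have "twist om (map (par ^^ Suc (length (pre @ post))) (map snd pre) @ map snd post) = 0" (is "twist om ?Ps = 0")
   proof (cases "length (pre @ post) = k")
    case False
    then show ?thesis using 2(2) by (intro twist_length[of "int k"]) (auto simp: forms_hom)
   next
    case True
    \<comment> \<open>If all multivectors had degree at least 1, moving the form to the front would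
      give an input of type c). So one of them is a function, and this makes the contraction
      vanish.\<close>
    have "\<exists>z\<in>set (pre @ post). hdeg 0 (snd z)"
    proof (rule ccontr)
     assume n: "\<not> ?thesis"
     have "\<exists>a. 1 \<le> a & snd z \<in> multivector_fields M a" if z': "z \<in> set (pre @ post)" for z
     proof -
      obtain a where a: "snd z \<in> multivector_fields M a" using mv[OF nz(2)[OF z'] nz(1)[OF z']] by blast
      have "a ~= 0"
      proof
       assume "a = 0"
       then have "hdeg 0 (snd z)" using a by (simp add: multivector_fields_hom)
       then show False using n z' by blast
      qed
      then have "1 \<le> a" by simp
      then show ?thesis using a by blast
     qed
     then have "\<forall>i<k. \<exists>a. 1 \<le> a & snd ((pre @ post) ! i) \<in> multivector_fields M a" using True nth_mem by metis
     then obtain a where a: "\<forall>i<k. 1 \<le> a i & snd ((pre @ post) ! i) \<in> multivector_fields M (a i)" by metis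
     define Q where "Q i = snd ((pre @ post) ! i)" for i
     have e: "pre @ post = map (%i. (0, Q i)) [0..<k]"
     proof (rule nth_equalityI)
      fix i assume i: "i < length (pre @ post)"
      have "fst ((pre @ post) ! i) = 0" by (rule nf[OF nth_mem[OF i]])
      then show "(pre @ post) ! i = map (%i. (0, Q i)) [0..<k] ! i" using i True by (simp add: prod_eq_iff Q_def del: nth_append)
     qed (use True in simp)
     have "bracket_input M ((om, 0) # pre @ post)" unfolding bracket_input_def e
      using 2 a unfolding Q_def[symmetric] by (intro disjI2 exI[of _ k] conjI bexI[of _ om] exI[of _ a] exI[of _ Q] refl)
     moreover have "mset ((om, 0) # pre @ post) = mset zs" using z(1) f by simp
     ultimately show False using nb by blast
    qed
    then obtain z where z': "z \<in> set (pre @ post)" "hdeg 0 (snd z)" by blast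
    have "\<exists>P\<in>set ?Ps. hdeg 0 P"
    proof (cases "z \<in> set pre")
     case True
     have "hdeg 0 ((par ^^ Suc (length (pre @ post))) (snd z))" unfolding par_funpow_hom[OF z'(2)] by (rule hdeg_linear(2)[OF z'(2)])
     then show ?thesis using True by (auto simp del: funpow.simps)
    next
     case False
     then show ?thesis using z' by auto
    qed
    moreover have "set ?Ps <= MV"
    proof
     fix P assume "P \<in> set ?Ps"
     then consider z where "z \<in> set pre" "P = (par ^^ Suc (length (pre @ post))) (snd z)" | z where "z \<in> set post" "P = snd z"
      by (auto simp del: funpow.simps)
     then show "P \<in> MV"
     proof cases
      case (1 z)
      then have "snd z \<in> MV" using s by auto
      then show ?thesis unfolding 1(2) by (rule par_funpow_MV)
     next
      case (2 z)
      then show ?thesis using s by auto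
     qed
    qed
    ultimately show ?thesis using twist_hom_zero[OF wF] by blast
   qed
   ultimately show ?thesis
    using mbr_one_form[of pre post, OF nf _ wF s] z(1) f by (cases "pre @ post = []") (auto simp: zero_prod_def simp del: funpow.simps)
  qed
 qed
qed

section \<open>Maurer-Cartan elements\<close>

lemma fsum_replicate:
 "t P = P ==> fsum t G (replicate k (H, P)) = real k *\<^sub>R (G H (replicate (k - 1) P) :: 'c::real_vector)"
proof (induction k arbitrary: G)
 case (Suc k)
 have "fsum t (%om Ps. G om (P # Ps)) (replicate k (H, P)) = real k *\<^sub>R G H (P # replicate (k - 1) P)" by (rule Suc.IH[OF Suc.prems])
 moreover have "real k *\<^sub>R G H (P # replicate (k - 1) P) = real k *\<^sub>R G H (replicate k P)" by (cases k) simp_all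
 ultimately show ?case using Suc.prems by (simp add: scaleR_add_left)
qed simp

text \<open>Since \<pi> has even degree, \<open>par\<close> fixes it and all positions of the form
  contribute equally. A 3-form needs three copies of \<pi>, so beyond the unary and the binary
  bracket only the one with four entries remains.\<close>

lemma maurer_cartan_mbr:
 "{\<alpha>. maurer_cartan (Lspace M) mbr \<alpha>} =
  {(H, \<pi>). H \<in> forms M 3 & \<pi> \<in> multivector_fields M 2 & ext_deriv M 3 H = 0 & twisted_poisson M H \<pi>}"
proof (rule Set.set_eqI)
 fix \<alpha> :: "'a form \<times> 'a mvf"
 obtain H \<pi> where \<alpha>: "\<alpha> = (H, \<pi>)" by force
 have L: "\<alpha> \<in> Lspace M 0 \<longleftrightarrow> H \<in> forms M 3 & \<pi> \<in> multivector_fields M 2" by (simp add: \<alpha> Lspace_def)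
 have "maurer_cartan (Lspace M) mbr \<alpha> \<longleftrightarrow> ext_deriv M 3 H = 0 & twisted_poisson M H \<pi>"
  if H: "H \<in> forms M 3" and \<pi>: "\<pi> \<in> multivector_fields M 2"
 proof -
  let ?B = "bracket \<pi> \<pi>" and ?T = "twist H [\<pi>, \<pi>, \<pi>]"
  have h: "H \<in> FM" "hdeg 3 H" "\<pi> \<in> MV" "hdeg 2 \<pi>" using H \<pi> by (simp_all add: forms_hom multivector_fields_hom)
  have par: "(par ^^ j) \<pi> = \<pi>" for j using par_funpow_hom[OF h(4), of j] by (simp add: sg_def)
  have fs: "fsum (par ^^ j) twist (replicate k \<alpha>) = real k *\<^sub>R twist H (replicate (k - 1) \<pi>)" for j k
   unfolding \<alpha> by (rule fsum_replicate[where t="par ^^ j"]) (rule par)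
  have m1: "mbr (replicate 1 \<alpha>) = (- d_form H, 0)" by (simp add: \<alpha> mbr_single)
  have m2: "mbr (replicate 2 \<alpha>) = (0, ?B)"
  proof -
   have "twist H (replicate (2 - 1) \<pi>) = 0" by (rule twist_length[OF h(2)]) simp
   then show ?thesis using fs[of 2 2] by (simp add: mbr_many numeral_2_eq_2 \<alpha> br_def del: funpow.simps fsum.simps)
  qed
  \<comment> \<open>The form may come from any of the four entries; with 1 / 4! this leaves the
    coefficient 1 / 6.\<close>
  have m4: "mbr (replicate 4 \<alpha>) = (0, 4 *\<^sub>R ?T)" using fs[of 4 4] by (simp add: mbr_many br_def numeral_3_eq_3 del: funpow.simps)
  have mk: "mbr (replicate k \<alpha>) = 0" if "1 \<le> k" "k ~: {1, 2, 4}" for k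
  proof -
   have "twist H (replicate (k - 1) \<pi>) = 0" by (rule twist_length[OF h(2)]) (use that in auto)
   then show ?thesis using that fs[of k k] by (simp add: mbr_many br_def zero_prod_def)
  qed
  let ?I = "{k. 1 \<le> k & mbr (replicate k \<alpha>) ~= 0}"
  have I: "?I <= {1, 2, 4}" using mk by blast
  have "(\<Sum>k\<in>?I. (1 / fact k) *\<^sub>R mbr (replicate k \<alpha>)) = (\<Sum>k\<in>{1, 2, 4}. (1 / fact k) *\<^sub>R mbr (replicate k \<alpha>))"
   by (rule sum.mono_neutral_left[OF _ I]) auto
  also have "\<dots> = (- d_form H, (1 / 2) *\<^sub>R ?B + (1 / 6) *\<^sub>R ?T)"
   using m1 m2 m4 by (simp add: fact_numeral zero_prod_def[symmetric] del: replicate.simps plus_fun_apply)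
  finally have sum: "(\<Sum>k\<in>?I. (1 / fact k) *\<^sub>R mbr (replicate k \<alpha>)) = (- d_form H, (1 / 2) *\<^sub>R ?B + (1 / 6) *\<^sub>R ?T)" .
  have "?T = sharp_wedge M [\<pi>, \<pi>, \<pi>] H"
  proof -
   \<comment> \<open>The sign exponent of c) for three bivectors is 2 (2 + 1 + 0), which is even, so
     no sign appears.\<close>
   have "(\<Sum>i<3. 2 * (3 - Suc i)) = (6 :: nat)" by (simp add: numeral_3_eq_3)
   then show ?thesis using twist_sharp_wedge[OF H, of "%_. \<pi>" "%_. 2"] \<pi> by (simp add: numeral_3_eq_3)
  qed
  moreover have "schouten M 2 2 \<pi> \<pi> = - ?B" using schouten_bracket[OF \<pi> \<pi>] by (simp add: minus_equation_iff[of _ "bracket \<pi> \<pi>"])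
  ultimately have "twisted_poisson M H \<pi> \<longleftrightarrow> - ?B = (1 / 3) *\<^sub>R ?T"
   using \<pi> by (simp add: twisted_poisson_def wedge3_tilde_def)
  also have "\<dots> \<longleftrightarrow> (1 / 2) *\<^sub>R ?B + (1 / 6) *\<^sub>R ?T = 0"
  proof -
   have "(1 / 2) *\<^sub>R ?B + (1 / 6) *\<^sub>R ?T = - (1 / 2) *\<^sub>R (- ?B - (1 / 3) *\<^sub>R ?T)" by (simp add: scaleR_diff_right del: plus_fun_apply minus_apply uminus_apply)
   then show ?thesis by (metis (no_types, lifting) eq_iff_diff_eq_0 scaleR_eq_0_iff divide_eq_0_iff neg_equal_0_iff_equal one_neq_zero zero_neq_numeral)
  qed
  finally show ?thesis unfolding maurer_cartan_def sum ext_deriv_d_form(1)[OF H] using finite_subset[OF I] L H \<pi> by (auto simp: zero_prod_def)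
 qed
 then show "\<alpha> \<in> {\<alpha>. maurer_cartan (Lspace M) mbr \<alpha>} \<longleftrightarrow> \<alpha> \<in> {(H, \<pi>). H \<in> forms M 3 & \<pi> \<in> multivector_fields M 2 &
   ext_deriv M 3 H = 0 & twisted_poisson M H \<pi>}" using L by (auto simp: \<alpha> maurer_cartan_def)
qed

end

theorem corollary2p9:
  fixes M :: "'a mfd"
  assumes "smooth_manifold M"
  shows "\<exists>m. Linf1_algebra (Lspace M) m \<and>
    (\<forall>k\<ge>1. \<forall>\<omega> \<in> forms M k. m [(\<omega>, 0)] = (- ext_deriv M k \<omega>, 0)) \<and>
    (\<forall>a\<^sub>1 a\<^sub>2. \<forall>\<pi>\<^sub>1 \<in> multivector_fields M a\<^sub>1. \<forall>\<pi>\<^sub>2 \<in> multivector_fields M a\<^sub>2.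
       m [(0, \<pi>\<^sub>1), (0, \<pi>\<^sub>2)] = (0, (-1) ^ (a\<^sub>1 + 1) *\<^sub>R schouten M a\<^sub>1 a\<^sub>2 \<pi>\<^sub>1 \<pi>\<^sub>2)) \<and>
    (\<forall>n\<ge>1. \<forall>H \<in> forms M n. \<forall>a \<pi>.
       (\<forall>i<n. 1 \<le> a i \<and> \<pi> i \<in> multivector_fields M (a i)) \<longrightarrow>
       m ((H, 0) # map (\<lambda>i. (0, \<pi> i)) [0..<n]) =
         (0, (-1) ^ (\<Sum>i<n. a i * (n - Suc i)) *\<^sub>R sharp_wedge M (map \<pi> [0..<n]) H)) \<and>
    (\<forall>zs. zs \<noteq> [] \<and> (\<forall>z \<in> set zs. pure M z) \<and>
       \<not> (\<exists>ys. mset ys = mset zs \<and> bracket_input M ys) \<longrightarrow> m zs = 0) \<and>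
    {\<alpha>. maurer_cartan (Lspace M) m \<alpha>} =
      {(H, \<pi>). H \<in> forms M 3 \<and> \<pi> \<in> multivector_fields M 2 \<and>
               ext_deriv M 3 H = 0 \<and> twisted_poisson M H \<pi>}"
proof -
  interpret smooth_mfd M by (rule smooth_mfd.intro) (rule assms)
  show ?thesis
  proof (intro exI[of _ mbr] conjI allI impI ballI)
    show "mbr ((H, 0) # map (\<lambda>i. (0, \<pi> i)) [0..<n]) =
        (0, (-1) ^ (\<Sum>i<n. a i * (n - Suc i)) *\<^sub>R sharp_wedge M (map \<pi> [0..<n]) H)"
      if "1 \<le> n" "H \<in> forms M n" "\<forall>i<n. 1 \<le> a i \<and> \<pi> i \<in> multivector_fields M (a i)" for n H a \<pi>
      using that by (intro mbr_mixed) auto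
    show "mbr zs = 0" if "zs \<noteq> [] \<and> (\<forall>z \<in> set zs. pure M z) \<and> \<not> (\<exists>ys. mset ys = mset zs \<and> bracket_input M ys)" for zs
      using that mbr_vanish by blast
  qed (rule Linf1_mbr mbr_forms mbr_multivectors maurer_cartan_mbr; assumption)+
qed

end
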